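(* Let $c_0\in\mathbb C$ be an arbitrary constant. On the unknowns $f_n,u,\sigma_n$ of the super tau-cover of the KdV hierarchy define flows $\partial/\partial s_m$, $m\ge-1$, by \[\frac{\partial f_n}{\partial s_{-1}}=\frac{t_0}{\varepsilon}\delta_{n,0}+f_{n-1}+\sum_{k\ge0}t_{k+1}\frac{\partial f_n}{\partial t_k}+\sum_{k\ge0}(k+1+c_0)\tau_{k+1}\frac{\partial f_n}{\partial\tau_k}\qquad(f_{-1}:=0),\] and for $m\ge0$ \[\begin{aligned}\frac{\partial f_n}{\partial s_m}=&\frac{\varepsilon^2}2\sum_{k+l=m-1}\frac{\Gamma(k+\frac32)\Gamma(l+\frac32)}{\Gamma(\frac12)\Gamma(\frac12)}\frac{\partial^2f_n}{\partial t_k\partial t_l}+\varepsilon\sum_{k+l=m-1}\frac{\Gamma(k+\frac32)\Gamma(l+\frac32)}{\Gamma(\frac12)\Gamma(\frac12)}\frac{\partial f_n}{\partial t_k}f_l\\&+\frac{\Gamma(n+m+\frac32)}{\Gamma(n+\frac12)}f_{n+m}+\sum_{k\ge0}\frac{\Gamma(k+m+\frac32)}{\Gamma(k+\frac12)}t_k\frac{\partial f_n}{\partial t_{k+m}}+\sum_{k\ge0}(k+c_0)\tau_k\frac{\partial f_n}{\partial\tau_{k+m}},\end{aligned}\] together with \[\frac{\partial u}{\partial s_m}=\varepsilon\frac{\partial}{\partial t_0}\frac{\partial f_0}{\partial s_m},\qquad \frac{\partial\sigma_n}{\partial s_m}=\varepsilon\frac{\partial}{\partial\tau_n}\frac{\partial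 f_0}{\partial s_m}.\] Then the flows of the super tau-cover of the KdV hierarchy and the flows $\partial/\partial s_m$ satisfy, for all $m,n\ge-1$ and $k\ge0$, \[\Big[\frac{\partial}{\partial t_k},\frac{\partial}{\partial s_m}\Big]=0,\qquad \Big[\frac{\partial}{\partial\tau_k},\frac{\partial}{\partial s_m}\Big]=0,\qquad \Big[\frac{\partial}{\partial s_n},\frac{\partial}{\partial s_m}\Big]=(m-n)\frac{\partial}{\partial s_{n+m}}.\]
   Context: Here $\varepsilon$ is the (nonzero) dispersion parameter. Prime denotes $\partial_x$, and $t_0$ is identified with $x$. Let $\mathcal P_0=\partial_x$, $\mathcal P_1=u\partial_x+\frac12u'+\frac{\varepsilon^2}8\partial_x^3$. Differential polynomials $R_n$ in $u$ are defined by $R_0=1$, $(n+\frac12)\mathcal P_0R_{n+1}=\mathcal P_1R_n$, with the integration constant of $R_n$ ($n\ge1$) equal to zero. $\Omega_{n,k}$ are the differential polynomials in $u$ with vanishing constant term such that $\Omega_{n,k}'=\partial R_{n+1}/\partial t_k$, where $\partial u/\partial t_k=R_{k+1}'$. The super variables $\sigma_k$ ($k\ge0$) are odd variables (they and their $x$-derivatives anticommute with each other and commute with $u$ and its $x$-derivatives) satisfying $\mathcal P_0\sigma_{k+1}=\mathcal P_1\sigma_k$, i.e. $\sigma_{k+1}'=u\sigma_k'+\frac12u'\sigma_k+\frac{\varepsilon^2}8\sigma_k'''$; the ring of differential polynomials in $u$ and the $\sigma_k$ has no nonzero odd constants. $\Phi_k^n$ are the differential polynomials (in $u$ and the $\sigma$'s)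 with $(\Phi_k^n)'=\partial R_{k+1}/\partial\tau_n$, where $\partial u/\partial\tau_n=\sigma_n'$. The super tau-cover of the KdV hierarchy, for the unknowns $u$, $\sigma_k$ and the one-point functions $f_k$ (even, $k\ge0$), consists of the even flows $\partial/\partial t_n$ and odd flows $\partial/\partial\tau_n$ ($n\ge0$) \[\frac{\partial u}{\partial t_n}=R_{n+1}',\quad \frac{\partial u}{\partial\tau_n}=\sigma_n',\quad \frac{\partial\sigma_k}{\partial t_n}=\frac12\sum_{i=0}^n\frac{\Gamma(n+\frac12-i)}{\Gamma(n+\frac32)}\big(R_{n-i}\sigma_{k+i}'-R_{n-i}'\sigma_{k+i}\big),\] \[\frac{\partial\sigma_k}{\partial\tau_n}=-\frac{\partial\sigma_n}{\partial\tau_k}=\frac12\sum_{i=0}^{n-k-1}\sigma_{i+k}\sigma_{n-i-1}'\quad(k\le n),\qquad \frac{\partial f_k}{\partial t_n}=\Omega_{k,n},\quad \frac{\partial f_k}{\partial\tau_n}=\Phi_k^n.\] The times $t_k$ are even and the times $\tau_k$ are odd. Sums over $k+l=m-1$ are over $k,l\ge0$; an empty sum is $0$.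
   Formalization: One-point functions are normalised by ε∂f_k/∂t_n=Ω_{k,n}, ε∂f_k/∂τ_n=Φ_k^n (as printed, the claim fails unless ε=1); the flow ∂/∂s_{-1} is covered only for c_0=0, since for c_0≠0 it contradicts σ_1'=P_1σ_0; for m≥0, c_0 is arbitrary. *)

theory Defs
  imports "HOL-Analysis.Gamma_Function" "HOL-Library.Multiset" "HOL-Library.FSet"
begin

section \<open>The superalgebra\<close>

text \<open>
  Free generators.  Even: \<open>T k\<close> is the time $t_k$, \<open>U j\<close> the jet $u^{(j)}$, \<open>F k\<close> the one-point
  function $f_k$.  Odd: \<open>Tau k\<close> is the time $\tau_k$, \<open>Th j\<close> the jet $\sigma_0^{(j)}$, \<open>Sig k\<close> the
  super variable $\sigma_{k+1}$.  The relations $\sigma_{k+1}' = \mathcal P_1\sigma_k$ express every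
  derivative of $\sigma_{k+1}$ through the remaining generators, so the differential polynomials in
  $u$ and the $\sigma_k$ subject to these relations are the polynomials in \<open>U\<close>, \<open>Th\<close>, \<open>Sig\<close>; the
  relations themselves become the values of the derivation $\partial_x$ on \<open>Sig k\<close>
  (see \<open>super_tau_cover\<close>).
\<close>

datatype evar = T nat | U nat | F nat
datatype ovar = Tau nat | Th nat | Sig nat

type_synonym mono = "evar multiset \<times> ovar fset"

text \<open>An auxiliary total order on the odd generators, used to fix the signs of odd monomials.\<close>

fun pos :: "ovar \<Rightarrow> nat" where
  "pos (Tau k) = 3 * k"
| "pos (Th k) = 3 * k + 1"
| "pos (Sig k) = 3 * k + 2"

definition inversions :: "ovar fset \<Rightarrow> ovar fset \<Rightarrow> nat" where
  "inversions A B = card {(a, b). a |\<in>| A \<and> b |\<in>| B \<and> pos b < pos a}"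

definition sgn_odd :: "ovar fset \<Rightarrow> ovar fset \<Rightarrow> complex" where
  "sgn_odd A B = (-1) ^ inversions A B"

fun is_T :: "evar \<Rightarrow> bool" where "is_T (T _) = True" | "is_T _ = False"
fun is_Tau :: "ovar \<Rightarrow> bool" where "is_Tau (Tau _) = True" | "is_Tau _ = False"

definition time_part :: "mono \<Rightarrow> mono" where
  "time_part M = (filter_mset is_T (fst M), ffilter is_Tau (snd M))"

text \<open>
  Since the flows contain sums such as $\sum_k t_{k+1}\,\partial f_n/\partial t_k$, the algebra consists
  of formal power series in the times $t_k,\tau_k$ whose coefficients are polynomials in the
  remaining generators.
\<close>

typedef salg = "{a :: mono \<Rightarrow> complex. \<forall>Q. finite {M. a M \<noteq> 0 \<and> time_part M = Q}}"
  morphisms coeff Salg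
  by (rule exI[of _ "\<lambda>_. 0"]) simp

lemma salg_eqI: "(\<And>M. coeff a M = coeff b M) \<Longrightarrow> a = b"
  by (metis coeff_inject ext)

lemma finite_coeff: "finite {M. coeff a M \<noteq> 0 \<and> time_part M = Q}"
  using coeff[of a] by blast

definition splits :: "mono \<Rightarrow> (mono \<times> mono) set" where
  "splits M = {(A, B). fst A + fst B = fst M \<and> snd A |\<inter>| snd B = {||} \<and> snd A |\<union>| snd B = snd M}"

definition mul_coeff :: "(mono \<Rightarrow> complex) \<Rightarrow> (mono \<Rightarrow> complex) \<Rightarrow> mono \<Rightarrow> complex" where
  "mul_coeff a b M = (\<Sum>(A, B)\<in>splits M. sgn_odd (snd A) (snd B) * a A * b B)"

lemma finite_sub_mset: "finite {A. A \<subseteq># (M :: 'a multiset)}"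
proof (induction M)
  case empty
  then show ?case by simp
next
  case (add x M)
  have "{A. A \<subseteq># add_mset x M} \<subseteq> {A. A \<subseteq># M} \<union> add_mset x ` {A. A \<subseteq># M}"
  proof
    fix A assume A: "A \<in> {A. A \<subseteq># add_mset x M}"
    show "A \<in> {A. A \<subseteq># M} \<union> add_mset x ` {A. A \<subseteq># M}"
    proof (cases "x \<in># A")
      case True
      then obtain B where "A = add_mset x B" by (metis mset_add)
      then show ?thesis using A by auto
    next
      case False
      then have "A \<subseteq># M" using A
        by (metis mem_Collect_eq subset_mset.inf.absorb_iff2 inter_add_left1 subset_mset.inf_commute)
      then show ?thesis by auto
    qed
  qed
  then show ?case using add.IH by (metis finite_UnI finite_imageI finite_subset)
qed

lemma finite_splits: "finite (splits M)"
proof -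
  let ?X = "{A. A \<subseteq># fst M} \<times> {B. B |\<subseteq>| snd M}"
  have fO: "finite {B. B |\<subseteq>| snd M}"
    by (rule finite_subset[of _ "fset (fPow (snd M))"]) auto
  have "splits M \<subseteq> ?X \<times> ?X"
  proof
    fix p assume "p \<in> splits M"
    then obtain A B where p: "p = (A, B)" "fst M = fst A + fst B" "snd M = snd A |\<union>| snd B"
      unfolding splits_def by auto
    have "A \<in> ?X" "B \<in> ?X" unfolding mem_Times_iff p by simp_all
    then show "p \<in> ?X \<times> ?X" using p(1) by simp
  qed
  then show ?thesis
    by (rule finite_subset) (intro finite_cartesian_product finite_sub_mset fO)
qed

lemma time_part_splits:
  assumes "(A, B) \<in> splits M"
  shows "(time_part A, time_part B) \<in> splits (time_part M)"
  using assms unfolding splits_def time_part_def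
  by (auto simp flip: filter_union_mset)

lemma splits_unique: "(A, B) \<in> splits M \<Longrightarrow> M = (fst A + fst B, snd A |\<union>| snd B)"
  by (auto simp: splits_def prod_eq_iff)

lemma mul_coeff_closed:
  "mul_coeff (coeff a) (coeff b) \<in> {a. \<forall>Q. finite {M. a M \<noteq> 0 \<and> time_part M = Q}}"
proof (rule CollectI, rule allI)
  fix Q
  let ?f = "\<lambda>(A, B). (fst A + fst B, snd A |\<union>| snd B)"
  let ?X = "\<Union>(P, P')\<in>splits Q. {A. coeff a A \<noteq> 0 \<and> time_part A = P} \<times> {B. coeff b B \<noteq> 0 \<and> time_part B = P'}"
  have "{M. mul_coeff (coeff a) (coeff b) M \<noteq> 0 \<and> time_part M = Q} \<subseteq> ?f ` ?X"
  proof
    fix M assume M: "M \<in> {M. mul_coeff (coeff a) (coeff b) M \<noteq> 0 \<and> time_part M = Q}"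
    then obtain p where p: "p \<in> splits M"
      "(case p of (A, B) \<Rightarrow> sgn_odd (snd A) (snd B) * coeff a A * coeff b B) \<noteq> 0"
      unfolding mul_coeff_def by (auto elim: sum.not_neutral_contains_not_neutral)
    obtain A B where AB: "p = (A, B)" by (cases p)
    have 1: "coeff a A \<noteq> 0" "coeff b B \<noteq> 0" using p(2) AB by auto
    have 2: "(time_part A, time_part B) \<in> splits Q" using time_part_splits[of A B M] p(1) AB M by simp
    have "(A, B) \<in> ?X" using 1 2 by blast
    moreover have "M = ?f (A, B)" using splits_unique p(1) AB by auto
    ultimately show "M \<in> ?f ` ?X" by blast
  qed
  moreover have "finite ?X"
    by (intro finite_UN_I finite_splits) (auto intro!: finite_cartesian_product finite_coeff)
  ultimately show "finite {M. mul_coeff (coeff a) (coeff b) M \<noteq> 0 \<and> time_part M = Q}"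
    by (meson finite_imageI finite_subset)
qed

lemma inversions_finite: "finite {(a, b). a |\<in>| A \<and> b |\<in>| B \<and> pos b < pos a}"
  by (rule finite_subset[of _ "fset A \<times> fset B"]) auto

lemma inversions_union_left:
  assumes "A |\<inter>| B = {||}"
  shows "inversions (A |\<union>| B) D = inversions A D + inversions B D"
proof -
  have d: "x |\<in>| A \<Longrightarrow> x |\<in>| B \<Longrightarrow> False" for x using assms by auto
  show ?thesis
    unfolding inversions_def
    by (subst card_Un_disjoint[symmetric]) (auto intro!: inversions_finite arg_cong[of _ _ card] dest: d)
qed

lemma inversions_union_right:
  assumes "A |\<inter>| B = {||}"
  shows "inversions D (A |\<union>| B) = inversions D A + inversions D B"
proof -
  have d: "x |\<in>| A \<Longrightarrow> x |\<in>| B \<Longrightarrow> False" for x using assms by auto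
  show ?thesis
    unfolding inversions_def
    by (subst card_Un_disjoint[symmetric]) (auto intro!: inversions_finite arg_cong[of _ _ card] dest: d)
qed

lemma mul_coeff_assoc: "mul_coeff (mul_coeff a b) c M = mul_coeff a (mul_coeff b c) M"
proof -
  let ?m = "\<lambda>A B. (fst A + fst B, snd A |\<union>| snd B) :: mono"
  have "mul_coeff (mul_coeff a b) c M =
    (\<Sum>(P, D)\<in>splits M. \<Sum>(A, B)\<in>splits P.
       sgn_odd (snd P) (snd D) * sgn_odd (snd A) (snd B) * a A * b B * c D)"
    unfolding mul_coeff_def
    by (simp add: sum_distrib_left sum_distrib_right mult.assoc case_prod_unfold)
  also have "\<dots> = (\<Sum>((P, D), (A, B))\<in>(SIGMA x:splits M. splits (fst x)).
       sgn_odd (snd P) (snd D) * sgn_odd (snd A) (snd B) * a A * b B * c D)"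
    by (subst sum.Sigma[symmetric]) (auto simp: finite_splits case_prod_unfold)
  also have "\<dots> = (\<Sum>((A, P), (B, D))\<in>(SIGMA x:splits M. splits (snd x)).
       sgn_odd (snd A) (snd P) * sgn_odd (snd B) (snd D) * a A * b B * c D)"
  proof (rule sum.reindex_bij_witness[where
        i = "\<lambda>((A, P), (B, D)). ((?m A B, D), (A, B))" and
        j = "\<lambda>((P, D), (A, B)). ((A, ?m B D), (B, D))"], goal_cases)
    case (5 x)
    then obtain P D A B where x: "x = ((P, D), (A, B))" "(P, D) \<in> splits M" "(A, B) \<in> splits P"
      by auto
    from x(2,3) have e: "snd P = snd A |\<union>| snd B" "snd A |\<inter>| snd B = {||}" "snd B |\<inter>| snd D = {||}"
      by (auto simp: splits_def)
    show ?case
      by (simp add: x(1) e sgn_odd_def inversions_union_left inversions_union_right power_add)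
  next
    case (1 x) then show ?case by (clarsimp simp: splits_def)
  next
    case (2 x) then show ?case
      by (clarsimp simp: splits_def add.assoc sup_assoc inf_sup_distrib1 inf_sup_distrib2)
  next
    case (3 x) then show ?case by (clarsimp simp: splits_def)
  next
    case (4 x) then show ?case
      by (clarsimp simp: splits_def add.assoc sup_assoc inf_sup_distrib1 inf_sup_distrib2)
  qed
  also have "\<dots> = (\<Sum>(A, P)\<in>splits M. \<Sum>(B, D)\<in>splits P.
       sgn_odd (snd A) (snd P) * sgn_odd (snd B) (snd D) * a A * b B * c D)"
    by (subst sum.Sigma[symmetric]) (auto simp: finite_splits case_prod_unfold)
  also have "\<dots> = mul_coeff a (mul_coeff b c) M"
    unfolding mul_coeff_def
    by (simp add: sum_distrib_left sum_distrib_right mult_ac case_prod_unfold)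
  finally show ?thesis .
qed

definition unit_mono :: mono where "unit_mono = ({#}, {||})"

lemma sgn_odd_empty [simp]: "sgn_odd {||} A = 1" "sgn_odd A {||} = 1"
  by (simp_all add: sgn_odd_def inversions_def)

lemma splits_unit: "(unit_mono, M) \<in> splits M" "(M, unit_mono) \<in> splits M"
  "(unit_mono, B) \<in> splits M \<Longrightarrow> B = M" "(A, unit_mono) \<in> splits M \<Longrightarrow> A = M"
  by (auto simp: splits_def unit_mono_def prod_eq_iff)

lemma single_closed: "(\<lambda>M. if M = N then c else 0) \<in> {a. \<forall>Q. finite {M. a M \<noteq> (0::complex) \<and> time_part M = Q}}"
  by (auto intro: finite_subset[of _ "{N}"])

instantiation salg :: ring_1
begin

definition "0 = Salg (\<lambda>M. 0)"
definition "1 = Salg (\<lambda>M. if M = unit_mono then 1 else 0)"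
definition "a + b = Salg (\<lambda>M. coeff a M + coeff b M)"
definition "- a = Salg (\<lambda>M. - coeff a M)"
definition "a - b = Salg (\<lambda>M. coeff a M - coeff b M)"
definition "a * b = Salg (mul_coeff (coeff a) (coeff b))"

lemma coeff_zero: "coeff 0 = (\<lambda>M. 0)"
  unfolding zero_salg_def by (rule Salg_inverse) simp

lemma coeff_one: "coeff 1 = (\<lambda>M. if M = unit_mono then 1 else 0)"
  unfolding one_salg_def by (rule Salg_inverse[OF single_closed])

lemma coeff_add: "coeff (a + b) = (\<lambda>M. coeff a M + coeff b M)"
  unfolding plus_salg_def
  by (rule Salg_inverse)
    (auto intro!: finite_subset[OF _ finite_UnI[OF finite_coeff[of a] finite_coeff[of b]]])

lemma coeff_uminus: "coeff (- a) = (\<lambda>M. - coeff a M)"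
  unfolding uminus_salg_def
  by (rule Salg_inverse) (auto intro!: finite_subset[OF _ finite_coeff[of a]])

lemma coeff_diff: "coeff (a - b) = (\<lambda>M. coeff a M - coeff b M)"
  unfolding minus_salg_def
  by (rule Salg_inverse)
    (auto intro!: finite_subset[OF _ finite_UnI[OF finite_coeff[of a] finite_coeff[of b]]])

lemma coeff_mult: "coeff (a * b) = mul_coeff (coeff a) (coeff b)"
  unfolding times_salg_def by (rule Salg_inverse[OF mul_coeff_closed])

instance
proof
  fix a b c :: salg
  show "a + b + c = a + (b + c)" "a + b = b + a" "0 + a = a" "- a + a = 0" "a - b = a + - b"
    by (rule salg_eqI; simp add: coeff_add coeff_zero coeff_uminus coeff_diff)+
  show "a * b * c = a * (b * c)"
    by (rule salg_eqI) (simp add: coeff_mult mul_coeff_assoc)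
  show "(a + b) * c = a * c + b * c" "a * (b + c) = a * b + a * c"
    by (rule salg_eqI; simp add: coeff_mult coeff_add mul_coeff_def sum.distrib[symmetric]
        algebra_simps case_prod_unfold)+
  show "1 * a = a"
  proof (rule salg_eqI)
    fix M
    have "coeff (1 * a) M = (\<Sum>p\<in>{(unit_mono, M)}. sgn_odd (snd (fst p)) (snd (snd p)) *
        coeff 1 (fst p) * coeff a (snd p))"
      unfolding coeff_mult mul_coeff_def case_prod_unfold
      by (rule sum.mono_neutral_right[OF finite_splits])
        (auto simp: coeff_one splits_unit split: if_splits dest: splits_unit(3))
    then show "coeff (1 * a) M = coeff a M" by (simp add: coeff_one unit_mono_def)
  qed
  show "a * 1 = a"
  proof (rule salg_eqI)
    fix M
    have "coeff (a * 1) M = (\<Sum>p\<in>{(M, unit_mono)}. sgn_odd (snd (fst p)) (snd (snd p)) *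
        coeff a (fst p) * coeff 1 (snd p))"
      unfolding coeff_mult mul_coeff_def case_prod_unfold
      by (rule sum.mono_neutral_right[OF finite_splits])
        (auto simp: coeff_one splits_unit split: if_splits dest: splits_unit(4))
    then show "coeff (a * 1) M = coeff a M" by (simp add: coeff_one unit_mono_def)
  qed
  show "(0::salg) \<noteq> 1"
    by (metis coeff_one coeff_zero zero_neq_one)
qed

end

definition const :: "complex \<Rightarrow> salg" where
  "const c = Salg (\<lambda>M. if M = unit_mono then c else 0)"

definition even_gen :: "evar \<Rightarrow> salg" where
  "even_gen x = Salg (\<lambda>M. if M = ({#x#}, {||}) then 1 else 0)"

definition odd_gen :: "ovar \<Rightarrow> salg" where
  "odd_gen x = Salg (\<lambda>M. if M = ({#}, {|x|}) then 1 else 0)"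

abbreviation time :: "nat \<Rightarrow> salg" where "time k \<equiv> even_gen (T k)"
abbreviation tau :: "nat \<Rightarrow> salg" where "tau k \<equiv> odd_gen (Tau k)"
abbreviation ufield :: salg where "ufield \<equiv> even_gen (U 0)"
abbreviation fone :: "nat \<Rightarrow> salg" where "fone k \<equiv> even_gen (F k)"

fun sigma :: "nat \<Rightarrow> salg" where
  "sigma 0 = odd_gen (Th 0)"
| "sigma (Suc k) = odd_gen (Sig k)"

text \<open>The parity automorphism: the identity on even elements, minus the identity on odd ones.\<close>

definition par :: "salg \<Rightarrow> salg" where
  "par a = Salg (\<lambda>M. (-1) ^ fcard (snd M) * coeff a M)"

text \<open>
  Coefficientwise sum of a locally finite family: each coefficient receives finitely many nonzero
  contributions, and the sum lies in the carrier.  Both hold below, where the \<open>k\<close>-th summand is a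
  multiple of a time variable with index \<open>k\<close> or \<open>k + 1\<close>.
\<close>

definition lsum :: "(nat \<Rightarrow> salg) \<Rightarrow> salg" where
  "lsum g = Salg (\<lambda>M. \<Sum>k | coeff (g k) M \<noteq> 0. coeff (g k) M)"

definition u_poly :: "salg \<Rightarrow> bool" where
  "u_poly a \<longleftrightarrow> (\<forall>M. coeff a M \<noteq> 0 \<longrightarrow> set_mset (fst M) \<subseteq> range U \<and> snd M = {||})"

definition diff_poly :: "salg \<Rightarrow> bool" where
  "diff_poly a \<longleftrightarrow>
     (\<forall>M. coeff a M \<noteq> 0 \<longrightarrow> set_mset (fst M) \<subseteq> range U \<and> fset (snd M) \<subseteq> range Th \<union> range Sig)"

section \<open>Derivations\<close>

text \<open>
  Continuity for the formal power series topology in the times; it makes a derivation commute with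
  locally finite sums, hence determined by its values on the generators.
\<close>

definition time_continuous :: "(salg \<Rightarrow> salg) \<Rightarrow> bool" where
  "time_continuous D \<longleftrightarrow>
     (\<forall>M. \<exists>Q. finite Q \<and> (\<forall>a. (\<forall>N. time_part N \<in> Q \<longrightarrow> coeff a N = 0) \<longrightarrow> coeff (D a) M = 0))"

definition even_derivation :: "(salg \<Rightarrow> salg) \<Rightarrow> bool" where
  "even_derivation D \<longleftrightarrow>
     (\<forall>a b. D (a + b) = D a + D b) \<and> (\<forall>c a. D (const c * a) = const c * D a) \<and>
     (\<forall>a b. D (a * b) = D a * b + a * D b) \<and> (\<forall>a. D (par a) = par (D a)) \<and> time_continuous D"

definition odd_derivation :: "(salg \<Rightarrow> salg) \<Rightarrow> bool" where
  "odd_derivation D \<longleftrightarrow>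
     (\<forall>a b. D (a + b) = D a + D b) \<and> (\<forall>c a. D (const c * a) = const c * D a) \<and>
     (\<forall>a b. D (a * b) = D a * b + par a * D b) \<and> (\<forall>a. D (par a) = - par (D a)) \<and> time_continuous D"

definition commutator :: "(salg \<Rightarrow> salg) \<Rightarrow> (salg \<Rightarrow> salg) \<Rightarrow> salg \<Rightarrow> salg" where
  "commutator D E a = D (E a) - E (D a)"

section \<open>The super tau-cover of the KdV hierarchy\<close>

definition P1 :: "complex \<Rightarrow> (salg \<Rightarrow> salg) \<Rightarrow> salg \<Rightarrow> salg" where
  "P1 eps dx a = ufield * dx a + const (1/2) * dx ufield * a + const (eps\<^sup>2 / 8) * dx (dx (dx a))"

definition sigma_t :: "(nat \<Rightarrow> salg) \<Rightarrow> (salg \<Rightarrow> salg) \<Rightarrow> nat \<Rightarrow> nat \<Rightarrow> salg" where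
  "sigma_t R dx n k = const (1/2) *
     (\<Sum>i\<le>n. const (Gamma (of_nat (n - i) + 1/2) / Gamma (of_nat n + 3/2)) *
       (R (n - i) * dx (sigma (k + i)) - dx (R (n - i)) * sigma (k + i)))"

definition sigma_tau :: "(salg \<Rightarrow> salg) \<Rightarrow> nat \<Rightarrow> nat \<Rightarrow> salg" where
  "sigma_tau dx n k = const (1/2) * (\<Sum>i<n - k. sigma (i + k) * dx (sigma (n - i - 1)))"

text \<open>
  Since $t_0$ is identified with $x$, the derivation \<open>dt 0\<close> plays the role of $\partial_x$, and all
  flows are extended from the unknowns $u$, $\sigma_k$ to their $x$-derivatives by commuting with it.
  The one-point functions are normalised as $f_k = \varepsilon\,\partial\log\tau/\partial t_k$, i.e.
  $\varepsilon\,\partial f_k/\partial t_n = \Omega_{k,n}$ and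
  $\varepsilon\,\partial f_k/\partial\tau_n = \Phi_k^n$; in particular
  $u = \varepsilon\,\partial f_0/\partial t_0$ and $\sigma_n = \varepsilon\,\partial f_0/\partial\tau_n$,
  in agreement with the factors of $\varepsilon$ in the flows $\partial/\partial s_m$.
\<close>

definition super_tau_cover ::
  "complex \<Rightarrow> (nat \<Rightarrow> salg) \<Rightarrow> (nat \<Rightarrow> nat \<Rightarrow> salg) \<Rightarrow> (nat \<Rightarrow> nat \<Rightarrow> salg) \<Rightarrow>
   (nat \<Rightarrow> salg \<Rightarrow> salg) \<Rightarrow> (nat \<Rightarrow> salg \<Rightarrow> salg) \<Rightarrow> bool" where
  "super_tau_cover eps R Om Ph dt dtau \<longleftrightarrow> (let dx = dt 0 in
     (\<forall>n. even_derivation (dt n)) \<and> (\<forall>n. odd_derivation (dtau n)) \<and>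
     (\<forall>n k. dt n (time k) = (if n = k then 1 else 0)) \<and> (\<forall>n k. dt n (tau k) = 0) \<and>
     (\<forall>n k. dtau n (time k) = 0) \<and> (\<forall>n k. dtau n (tau k) = (if n = k then 1 else 0)) \<and>
     (\<forall>j. dx (even_gen (U j)) = even_gen (U (Suc j))) \<and>
     (\<forall>j. dx (odd_gen (Th j)) = odd_gen (Th (Suc j))) \<and>
     (\<forall>k. dx (sigma (Suc k)) = P1 eps dx (sigma k)) \<and>
     R 0 = 1 \<and> (\<forall>n. const (of_nat n + 1/2) * dx (R (Suc n)) = P1 eps dx (R n)) \<and>
     (\<forall>n. u_poly (R n)) \<and> (\<forall>n\<ge>1. coeff (R n) unit_mono = 0) \<and>
     (\<forall>n k. u_poly (Om n k) \<and> coeff (Om n k) unit_mono = 0 \<and> dx (Om n k) = dt k (R (Suc n))) \<and>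
     (\<forall>k n. diff_poly (Ph k n) \<and> par (Ph k n) = - Ph k n \<and> dx (Ph k n) = dtau n (R (Suc k))) \<and>
     (\<forall>n j. dt n ((dx ^^ j) ufield) = (dx ^^ j) (dx (R (Suc n)))) \<and>
     (\<forall>n j. dtau n ((dx ^^ j) ufield) = (dx ^^ j) (dx (sigma n))) \<and>
     (\<forall>n k j. dt n ((dx ^^ j) (sigma k)) = (dx ^^ j) (sigma_t R dx n k)) \<and>
     (\<forall>n k j. k \<le> n \<longrightarrow> dtau n ((dx ^^ j) (sigma k)) = (dx ^^ j) (sigma_tau dx n k)
                     \<and> dtau k ((dx ^^ j) (sigma n)) = - (dx ^^ j) (sigma_tau dx n k)) \<and>
     (\<forall>n k. const eps * dt n (fone k) = Om k n) \<and>
     (\<forall>n k. const eps * dtau n (fone k) = Ph k n))"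

section \<open>The flows $\partial/\partial s_m$\<close>

definition f_s ::
  "complex \<Rightarrow> complex \<Rightarrow> (nat \<Rightarrow> salg \<Rightarrow> salg) \<Rightarrow> (nat \<Rightarrow> salg \<Rightarrow> salg) \<Rightarrow> nat \<Rightarrow> nat \<Rightarrow> salg" where
  "f_s eps c0 dt dtau m n =
     const (eps\<^sup>2 / 2) * (\<Sum>(k, l) | k + l + 1 = m.
       const (Gamma (of_nat k + 3/2) * Gamma (of_nat l + 3/2) / (Gamma (1/2) * Gamma (1/2))) *
         dt k (dt l (fone n))) +
     const eps * (\<Sum>(k, l) | k + l + 1 = m.
       const (Gamma (of_nat k + 3/2) * Gamma (of_nat l + 3/2) / (Gamma (1/2) * Gamma (1/2))) *
         dt k (fone n) * fone l) +
     const (Gamma (of_nat (n + m) + 3/2) / Gamma (of_nat n + 1/2)) * fone (n + m) +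
     lsum (\<lambda>k. const (Gamma (of_nat (k + m) + 3/2) / Gamma (of_nat k + 1/2)) *
       time k * dt (k + m) (fone n)) +
     lsum (\<lambda>k. const (of_nat k + c0) * tau k * dtau (k + m) (fone n))"

definition f_s_minus1 ::
  "complex \<Rightarrow> complex \<Rightarrow> (nat \<Rightarrow> salg \<Rightarrow> salg) \<Rightarrow> (nat \<Rightarrow> salg \<Rightarrow> salg) \<Rightarrow> nat \<Rightarrow> salg" where
  "f_s_minus1 eps c0 dt dtau n =
     (if n = 0 then const (1 / eps) * time 0 else fone (n - 1)) +
     lsum (\<lambda>k. time (k + 1) * dt k (fone n)) +
     lsum (\<lambda>k. const (of_nat k + 1 + c0) * tau (k + 1) * dtau k (fone n))"

text \<open>
  \<open>S\<close> is the flow $\partial/\partial s_m$ ($m \ge -1$): a derivation that does not act on the times,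
  has the prescribed values on $f_n$, $u$, $\sigma_n$ and is extended to the $x$-derivatives of $u$
  and $\sigma_n$ by commuting with $\partial_x$.  Because of the relations among the $\sigma_n$, the
  existence of such a derivation is not automatic: for $m = -1$, applying it to
  $\sigma_1' = \mathcal P_1\sigma_0$ at vanishing times gives
  $(1 + c_0)\sigma_0' = \sigma_0'$, which forces $c_0 = 0$.
\<close>

definition s_flow ::
  "complex \<Rightarrow> complex \<Rightarrow> (nat \<Rightarrow> salg \<Rightarrow> salg) \<Rightarrow> (nat \<Rightarrow> salg \<Rightarrow> salg) \<Rightarrow> int \<Rightarrow>
   (salg \<Rightarrow> salg) \<Rightarrow> bool" where
  "s_flow eps c0 dt dtau m S \<longleftrightarrow> (let dx = dt 0 in
     even_derivation S \<and> (\<forall>k. S (time k) = 0) \<and> (\<forall>k. S (tau k) = 0) \<and>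
     (\<forall>n. S (fone n) = (if m = -1 then f_s_minus1 eps c0 dt dtau n else f_s eps c0 dt dtau (nat m) n)) \<and>
     (\<forall>j. S ((dx ^^ j) ufield) = (dx ^^ j) (const eps * dx (S (fone 0)))) \<and>
     (\<forall>n j. S ((dx ^^ j) (sigma n)) = (dx ^^ j) (const eps * dtau n (S (fone 0)))))"

end

theory Submission
  imports Defs "HOL-Computational_Algebra.Formal_Power_Series"
begin

text \<open>
  Normalise the one-point functions to $g_{k+1} = \varepsilon\frac{\Gamma(k+3/2)}{\Gamma(1/2)}f_k$ and
  the even flows to $d_{k+1} = \frac{\Gamma(k+3/2)}{\Gamma(1/2)}\partial/\partial t_k$, with
  $g_0 = d_0 = 0$, and let $M = m + 1$.  Up to an inhomogeneous term, $\partial/\partial s_m$ then acts on the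
  $g_l$ by $L_M = \frac{\varepsilon^2}2\sum d_kd_l + \sum g_ld_k + E_M$ ($k + l = M$), where $E_M$ is the
  derivation with the explicit time dependence.  The function $\rho_M = \varepsilon\,\partial f_0/\partial s_m$
  satisfies $\rho_{M+1}' = \mathcal P_1\rho_M$ like the $R_n$ and the $\sigma_n$, except for the
  term $c_0\tau_0\sigma_0'$ if $M = 0$.  A quadratic identity for the generating function of the $R_n$ turns
  such a recursion into $\partial R_n/\partial s_m \sim d_n\rho_M$ without any integration; hence the flow
  respects the relations between the $\sigma_n$ and commutes with $\partial_x$.  Its commutators with the
  other flows, evaluated on $g_l$ and $\sigma_n$, are differential polynomials killed by $\partial_x$, that is
  constants, and these vanish for parity reasons or by looking at the terms linear in $u$.  The Virasoro
  relations reduce to the commutators of the operators $L_M$.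
\<close>

subsection \<open>Monomials, constants and polynomials\<close>

text \<open>The obstacle is integration. On the whole algebra \<open>dx\<close> kills far more than
  constants, for instance \<open>time 1\<close> and every \<open>tau k\<close>, so an identity
  containing the f_k or explicit times cannot be proved by comparing x-derivatives. Such comparisons
  are confined to differential polynomials. There the kernel of \<open>dx\<close> consists of
  constants, but this needs proof, since sigma_{k+1} is adjoined as a formal primitive of P_1
  sigma_k; the Galilean symmetry excludes a second primitive in the remaining generators. Elsewhere
  the quadratic identity r r = 1 + X H(r, r) takes over: its linearisation determines the variation
  of r coefficient by coefficient, because r starts with 1 and the right-hand side carries a factor
  X. The Gamma factors absorb n + 1/2, so that the R_n, the sigma_n and the rho_M obey one
  recursion. The exceptional terms sit at index 0: r_0 = 1 although d_0 = 0, which is the origin of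
  t_0 / eps in s_{-1}, and sigma_0 has no predecessor, which is the origin of the condition on
  c_0.\<close>

definition mon :: "mono \<Rightarrow> salg" where
  "mon N = Salg (\<lambda>M. if M = N then 1 else 0)"

lemma coeff_mon: "coeff (mon N) M = (if M = N then 1 else 0)"
  unfolding mon_def using Salg_inverse[OF single_closed] by simp

lemma coeff_const: "coeff (const c) M = (if M = unit_mono then c else 0)"
  unfolding const_def using Salg_inverse[OF single_closed] by simp

lemma even_gen_mon: "even_gen x = mon ({#x#}, {||})"
  by (simp add: even_gen_def mon_def)

lemma odd_gen_mon: "odd_gen y = mon ({#}, {|y|})"
  by (simp add: odd_gen_def mon_def)

lemma mon_unit: "mon unit_mono = 1"
  by (rule salg_eqI) (simp add: coeff_mon coeff_one)

lemma const_0 [simp]: "const 0 = 0"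
  by (rule salg_eqI) (simp add: coeff_const coeff_zero)

lemma const_1 [simp]: "const 1 = 1"
  by (rule salg_eqI) (simp add: coeff_const coeff_one)

lemma coeff_const_mult: "coeff (const c * a) M = c * coeff a M"
proof -
  have "coeff (const c * a) M = (\<Sum>p\<in>{(unit_mono, M)}. sgn_odd (snd (fst p)) (snd (snd p)) *
      coeff (const c) (fst p) * coeff a (snd p))"
    unfolding coeff_mult mul_coeff_def case_prod_unfold
    by (rule sum.mono_neutral_right[OF finite_splits])
      (auto simp: coeff_const splits_unit split: if_splits dest: splits_unit(3))
  then show ?thesis by (simp add: coeff_const unit_mono_def)
qed

lemma coeff_mult_const: "coeff (a * const c) M = c * coeff a M"
proof -
  have "coeff (a * const c) M = (\<Sum>p\<in>{(M, unit_mono)}. sgn_odd (snd (fst p)) (snd (snd p)) *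
      coeff a (fst p) * coeff (const c) (snd p))"
    unfolding coeff_mult mul_coeff_def case_prod_unfold
    by (rule sum.mono_neutral_right[OF finite_splits])
      (auto simp: coeff_const splits_unit split: if_splits dest: splits_unit(4))
  then show ?thesis by (simp add: coeff_const unit_mono_def)
qed

lemma const_commute: "a * const c = const c * a"
  by (rule salg_eqI) (simp add: coeff_const_mult coeff_mult_const)

lemma const_mult: "const (c * d) = const c * const d"
  by (rule salg_eqI) (simp add: coeff_const_mult coeff_const)

lemma const_add: "const (c + d) = const c + const d"
  by (rule salg_eqI) (simp add: coeff_add coeff_const)

lemma const_diff: "const (c - d) = const c - const d"
  by (rule salg_eqI) (simp add: coeff_diff coeff_const)

lemma const_uminus: "const (- c) = - const c"
  by (rule salg_eqI) (simp add: coeff_uminus coeff_const)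

lemma const_of_nat: "const (of_nat n) = of_nat n"
  by (induction n) (simp_all add: const_add)

lemma const_numeral: "const (numeral n) = numeral n"
  by (metis const_of_nat of_nat_numeral)

lemma const_mult_assoc: "const c * (const d * a) = const (c * d) * a"
  by (simp add: const_mult mult.assoc)

lemma const_cancel:
  assumes "c \<noteq> 0" "const c * a = const c * b"
  shows "a = b"
proof -
  have "const (inverse c) * (const c * a) = const (inverse c) * (const c * b)"
    using assms(2) by simp
  then show ?thesis using assms(1) by (simp add: const_mult_assoc)
qed

lemma two_cancel: "(2::salg) * a = 2 * b \<Longrightarrow> a = b"
  using const_cancel[of 2 a b] by (simp add: const_numeral)

lemma coeff_sum: "coeff (sum f A) M = (\<Sum>x\<in>A. coeff (f x) M)"
  by (induction A rule: infinite_finite_induct) (simp_all add: coeff_zero coeff_add)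

lemma mon_mult:
  "mon A * mon B = (if snd A |\<inter>| snd B = {||}
     then const (sgn_odd (snd A) (snd B)) * mon (fst A + fst B, snd A |\<union>| snd B) else 0)"
proof (rule salg_eqI)
  fix M
  have "coeff (mon A * mon B) M = (\<Sum>p\<in>splits M \<inter> {(A, B)}. sgn_odd (snd (fst p)) (snd (snd p)))"
    unfolding coeff_mult mul_coeff_def case_prod_unfold
    by (rule sum.mono_neutral_cong_right[OF finite_splits])
      (auto simp: coeff_mon split: if_splits)
  also have "\<dots> = (if (A, B) \<in> splits M then sgn_odd (snd A) (snd B) else 0)"
    by auto
  also have "\<dots> = coeff (if snd A |\<inter>| snd B = {||}
     then const (sgn_odd (snd A) (snd B)) * mon (fst A + fst B, snd A |\<union>| snd B) else 0) M"
    by (cases M) (auto simp: coeff_const_mult coeff_mon coeff_zero splits_def)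
  finally show "coeff (mon A * mon B) M = coeff (if snd A |\<inter>| snd B = {||}
     then const (sgn_odd (snd A) (snd B)) * mon (fst A + fst B, snd A |\<union>| snd B) else 0) M" .
qed

lemma mon_add_even: "mon (add_mset x A, B) = even_gen x * mon (A, B)"
  by (simp add: even_gen_mon mon_mult)

lemma sgn_odd_square [simp]: "sgn_odd A B * sgn_odd A B = 1"
  unfolding sgn_odd_def by (simp flip: power_mult_distrib)

lemma mon_insert_odd:
  assumes "y |\<notin>| B"
  shows "mon (A, finsert y B) = const (sgn_odd {|y|} B) * (odd_gen y * mon (A, B))"
  using assms by (simp add: odd_gen_mon mon_mult const_mult_assoc)

text \<open>Over finitely many time parts only finitely many monomials occur, so for finite
  \<open>Q\<close> this is a finite combination of monomials. After its subtraction nothing is left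
  of \<open>a\<close> over the time parts in \<open>Q\<close>.\<close>

definition trunc :: "mono set \<Rightarrow> salg \<Rightarrow> salg" where
  "trunc Q a = (\<Sum>N | coeff a N \<noteq> 0 \<and> time_part N \<in> Q. const (coeff a N) * mon N)"

lemma finite_supp_time:
  assumes "finite Q"
  shows "finite {N. coeff a N \<noteq> 0 \<and> time_part N \<in> Q}"
proof -
  have "{N. coeff a N \<noteq> 0 \<and> time_part N \<in> Q} = (\<Union>q\<in>Q. {N. coeff a N \<noteq> 0 \<and> time_part N = q})"
    by auto
  then show ?thesis using assms finite_coeff by simp
qed

lemma coeff_trunc:
  assumes "finite Q"
  shows "coeff (trunc Q a) M = (if time_part M \<in> Q then coeff a M else 0)"
proof -
  have "coeff (trunc Q a) M = (\<Sum>N | coeff a N \<noteq> 0 \<and> time_part N \<in> Q. if M = N then coeff a N else 0)"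
    unfolding trunc_def by (simp add: coeff_sum coeff_const_mult coeff_mon if_distrib cong: if_cong)
  also have "\<dots> = (if M \<in> {N. coeff a N \<noteq> 0 \<and> time_part N \<in> Q} then coeff a M else 0)"
    by (rule sum.delta'[OF finite_supp_time[OF assms]])
  finally show ?thesis by auto
qed

section \<open>Linear maps and continuity in the times\<close>

definition lin :: "(salg \<Rightarrow> salg) \<Rightarrow> bool" where
  "lin D \<longleftrightarrow> (\<forall>a b. D (a + b) = D a + D b) \<and> (\<forall>c a. D (const c * a) = const c * D a)"

lemma lin_add: "lin D \<Longrightarrow> D (a + b) = D a + D b"
  and lin_const_mult: "lin D \<Longrightarrow> D (const c * a) = const c * D a"
  by (auto simp: lin_def)

lemma lin_0: "lin D \<Longrightarrow> D 0 = 0"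
  using lin_const_mult[of D 0 0] by simp

lemma lin_uminus: "lin D \<Longrightarrow> D (- a) = - D a"
  using lin_const_mult[of D "-1" a] by (simp add: const_uminus)

lemma lin_diff: "lin D \<Longrightarrow> D (a - b) = D a - D b"
  using lin_add[of D a "- b"] lin_uminus[of D b] by simp

lemma lin_sum: "lin D \<Longrightarrow> D (sum f A) = (\<Sum>x\<in>A. D (f x))"
  by (induction A rule: infinite_finite_induct) (simp_all add: lin_0 lin_add)

lemma lin_numeral_mult: "lin D \<Longrightarrow> D (numeral n * a) = numeral n * D a"
  using lin_const_mult[of D "numeral n" a] by (simp add: const_numeral)

lemma lin_comp: "lin D \<Longrightarrow> lin E \<Longrightarrow> lin (\<lambda>a. D (E a))"
  by (simp add: lin_def)

text \<open>Each coefficient of \<open>D a\<close> depends only on the time parts in some finite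
  \<open>Q\<close>; over these, \<open>a\<close> agrees with the finite combination
  \<open>trunc Q a\<close>, which linearity handles.\<close>

lemma lin_zero_ext:
  assumes "lin D" "time_continuous D" "\<And>N. D (mon N) = 0"
  shows "D a = 0"
proof (rule salg_eqI)
  fix M
  obtain Q where Q: "finite Q" "\<And>b. (\<forall>N. time_part N \<in> Q \<longrightarrow> coeff b N = 0) \<Longrightarrow> coeff (D b) M = 0"
    using assms(2) unfolding time_continuous_def by blast
  have "D (trunc Q a) = 0"
    unfolding trunc_def using assms(1,3) by (simp add: lin_sum lin_const_mult)
  moreover have "coeff (D (a - trunc Q a)) M = 0"
    by (rule Q(2)) (simp add: coeff_diff coeff_trunc[OF Q(1)])
  ultimately show "coeff (D a) M = coeff 0 M"
    using lin_diff[OF assms(1), of a "trunc Q a"] by (simp add: coeff_zero)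
qed

text \<open>Continuity that is uniform over all monomials with the same time part; unlike
  \<open>time_continuous\<close> it is visibly stable under composition.\<close>

definition scont :: "(salg \<Rightarrow> salg) \<Rightarrow> bool" where
  "scont D \<longleftrightarrow> (\<forall>P. \<exists>Q. finite Q \<and> (\<forall>a. (\<forall>N. time_part N \<in> Q \<longrightarrow> coeff a N = 0) \<longrightarrow>
     (\<forall>M. time_part M = P \<longrightarrow> coeff (D a) M = 0)))"

lemma scontD:
  assumes "scont D"
  obtains Q where "finite Q"
    "\<And>a M. (\<And>N. time_part N \<in> Q \<Longrightarrow> coeff a N = 0) \<Longrightarrow> time_part M = P \<Longrightarrow> coeff (D a) M = 0"
  using assms unfolding scont_def by metis

lemma scont_tc: "scont D \<Longrightarrow> time_continuous D"
  unfolding scont_def time_continuous_def by metis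

text \<open>The outer map constrains finitely many time parts, but each of them carries infinitely
  many monomials. The uniformity of the inner continuity keeps the resulting set of time parts
  finite.\<close>

lemma scont_comp_tc:
  assumes "time_continuous D" "scont E"
  shows "time_continuous (\<lambda>a. D (E a))"
  unfolding time_continuous_def
proof
  fix M
  obtain Q where Q: "finite Q" "\<And>b. (\<And>N. time_part N \<in> Q \<Longrightarrow> coeff b N = 0) \<Longrightarrow> coeff (D b) M = 0"
    using assms(1) unfolding time_continuous_def by metis
  obtain F where F: "\<And>P. finite (F P)"
    "\<And>P a M. (\<And>N. time_part N \<in> F P \<Longrightarrow> coeff a N = 0) \<Longrightarrow> time_part M = P \<Longrightarrow> coeff (E a) M = 0"
    using assms(2) unfolding scont_def by metis
  show "\<exists>Q. finite Q \<and> (\<forall>a. (\<forall>N. time_part N \<in> Q \<longrightarrow> coeff a N = 0) \<longrightarrow> coeff (D (E a)) M = 0)"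
  proof (intro exI[of _ "\<Union>(F ` Q)"] conjI allI impI)
    show "finite (\<Union>(F ` Q))" using Q(1) F(1) by blast
    fix a assume a: "\<forall>N. time_part N \<in> \<Union>(F ` Q) \<longrightarrow> coeff a N = 0"
    show "coeff (D (E a)) M = 0"
      by (rule Q(2)) (use a F(2) in blast)
  qed
qed

lemma scont_comp:
  assumes "scont D" "scont E"
  shows "scont (\<lambda>a. D (E a))"
  unfolding scont_def
proof
  fix P
  obtain Q where Q: "finite Q" "\<And>b M. (\<And>N. time_part N \<in> Q \<Longrightarrow> coeff b N = 0) \<Longrightarrow>
      time_part M = P \<Longrightarrow> coeff (D b) M = 0"
    using scontD[OF assms(1), of P] by metis
  obtain F where F: "\<And>P. finite (F P)"
    "\<And>P a M. (\<And>N. time_part N \<in> F P \<Longrightarrow> coeff a N = 0) \<Longrightarrow> time_part M = P \<Longrightarrow> coeff (E a) M = 0"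
    using assms(2) unfolding scont_def by metis
  show "\<exists>Q. finite Q \<and> (\<forall>a. (\<forall>N. time_part N \<in> Q \<longrightarrow> coeff a N = 0) \<longrightarrow>
      (\<forall>M. time_part M = P \<longrightarrow> coeff (D (E a)) M = 0))"
  proof (intro exI[of _ "\<Union>(F ` Q)"] conjI allI impI)
    show "finite (\<Union>(F ` Q))" using Q(1) F(1) by blast
    fix a M assume a: "\<forall>N. time_part N \<in> \<Union>(F ` Q) \<longrightarrow> coeff a N = 0" "time_part M = P"
    show "coeff (D (E a)) M = 0"
      by (rule Q(2)) (use a F(2) in blast)+
  qed
qed

lemma scont_add:
  assumes "scont D" "scont E"
  shows "scont (\<lambda>a. D a + E a)"
  unfolding scont_def
proof
  fix P
  obtain Q where Q: "finite Q" "\<And>b M. (\<And>N. time_part N \<in> Q \<Longrightarrow> coeff b N = 0) \<Longrightarrow>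
      time_part M = P \<Longrightarrow> coeff (D b) M = 0"
    using scontD[OF assms(1), of P] by metis
  obtain Q' where Q': "finite Q'" "\<And>b M. (\<And>N. time_part N \<in> Q' \<Longrightarrow> coeff b N = 0) \<Longrightarrow>
      time_part M = P \<Longrightarrow> coeff (E b) M = 0"
    using scontD[OF assms(2), of P] by metis
  show "\<exists>Q. finite Q \<and> (\<forall>a. (\<forall>N. time_part N \<in> Q \<longrightarrow> coeff a N = 0) \<longrightarrow>
      (\<forall>M. time_part M = P \<longrightarrow> coeff (D a + E a) M = 0))"
    by (intro exI[of _ "Q \<union> Q'"] conjI) (use Q Q' in \<open>auto simp: coeff_add\<close>)
qed

lemma scont_zero: "scont (\<lambda>a. 0)"
  unfolding scont_def by (auto simp: coeff_zero)

lemma finite_time_splits: "finite {A. \<exists>B. (A, B) \<in> splits P}" "finite {B. \<exists>A. (A, B) \<in> splits P}"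
proof -
  have "{A. \<exists>B. (A, B) \<in> splits P} = fst ` splits P" "{B. \<exists>A. (A, B) \<in> splits P} = snd ` splits P"
    by force+
  then show "finite {A. \<exists>B. (A, B) \<in> splits P}" "finite {B. \<exists>A. (A, B) \<in> splits P}"
    using finite_splits by simp_all
qed

lemma coeff_mult_zeroI:
  assumes "\<And>A B. (A, B) \<in> splits M \<Longrightarrow> coeff a A = 0 \<or> coeff b B = 0"
  shows "coeff (a * b) M = 0"
  unfolding coeff_mult mul_coeff_def using assms by (intro sum.neutral) auto

lemma scont_mult_left: "scont (\<lambda>b. a * b)"
  unfolding scont_def
proof
  fix P
  show "\<exists>Q. finite Q \<and> (\<forall>b. (\<forall>N. time_part N \<in> Q \<longrightarrow> coeff b N = 0) \<longrightarrow>
      (\<forall>M. time_part M = P \<longrightarrow> coeff (a * b) M = 0))"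
    by (rule exI[of _ "{B. \<exists>A. (A, B) \<in> splits P}"])
      (use finite_time_splits time_part_splits in \<open>blast intro: coeff_mult_zeroI\<close>)
qed

lemma scont_mult_right: "scont (\<lambda>b. b * a)"
  unfolding scont_def
proof
  fix P
  show "\<exists>Q. finite Q \<and> (\<forall>b. (\<forall>N. time_part N \<in> Q \<longrightarrow> coeff b N = 0) \<longrightarrow>
      (\<forall>M. time_part M = P \<longrightarrow> coeff (b * a) M = 0))"
    by (rule exI[of _ "{A. \<exists>B. (A, B) \<in> splits P}"])
      (use finite_time_splits time_part_splits in \<open>blast intro: coeff_mult_zeroI\<close>)
qed

lemma scont_uminus: "scont D \<Longrightarrow> scont (\<lambda>a. - D a)"
  using scont_comp[OF scont_mult_left[of "-1"], of D] by simp

lemma scont_diff: "scont D \<Longrightarrow> scont E \<Longrightarrow> scont (\<lambda>a. D a - E a)"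
  using scont_add[OF _ scont_uminus, of D E] by simp

subsection \<open>Parity\<close>

lemma coeff_par: "coeff (par a) M = (-1) ^ fcard (snd M) * coeff a M"
proof -
  have "(\<lambda>M. (-1) ^ fcard (snd M) * coeff a M) \<in> {a. \<forall>Q. finite {M. a M \<noteq> 0 \<and> time_part M = Q}}"
    using finite_coeff by (auto intro: finite_subset[OF _ finite_coeff[of a]])
  then show ?thesis unfolding par_def by (simp add: Salg_inverse)
qed

lemma par_par [simp]: "par (par a) = a"
  by (rule salg_eqI) (simp add: coeff_par flip: power_mult_distrib mult.assoc)

lemma scont_par: "scont par"
  unfolding scont_def
proof
  fix P
  show "\<exists>Q. finite Q \<and> (\<forall>a. (\<forall>N. time_part N \<in> Q \<longrightarrow> coeff a N = 0) \<longrightarrow>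
      (\<forall>M. time_part M = P \<longrightarrow> coeff (par a) M = 0))"
    by (intro exI[of _ "{P}"]) (auto simp: coeff_par)
qed

lemma lin_par: "lin par"
  by (auto simp: lin_def coeff_par coeff_add coeff_const_mult algebra_simps intro!: salg_eqI)

lemma fcard_union_disjoint: "A |\<inter>| B = {||} \<Longrightarrow> fcard (A |\<union>| B) = fcard A + fcard B"
  by (metis fcard_funion_finter fcard_fempty add.right_neutral)

lemma par_mult: "par (a * b) = par a * par b"
proof (rule salg_eqI)
  fix M
  show "coeff (par (a * b)) M = coeff (par a * par b) M"
    unfolding coeff_par coeff_mult mul_coeff_def sum_distrib_left
  proof (rule sum.cong, goal_cases)
    case (2 p)
    then have "fcard (snd M) = fcard (snd (fst p)) + fcard (snd (snd p))"
      by (auto simp: splits_def fcard_union_disjoint[symmetric])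
    then show ?case by (simp add: case_prod_unfold power_add mult_ac)
  qed simp
qed

lemma par_const [simp]: "par (const c) = const c"
  by (rule salg_eqI) (simp add: coeff_par coeff_const unit_mono_def fcard.rep_eq)

lemma par_one [simp]: "par 1 = 1"
  using par_const[of 1] by simp

lemma par_even_gen [simp]: "par (even_gen x) = even_gen x"
  by (rule salg_eqI) (simp add: coeff_par coeff_mon even_gen_mon fcard.rep_eq)

lemma par_odd_gen [simp]: "par (odd_gen x) = - odd_gen x"
  by (rule salg_eqI) (simp add: coeff_par coeff_mon odd_gen_mon coeff_uminus fcard.rep_eq)

lemma pos_inj: "pos a = pos b \<Longrightarrow> a = b"
  by (cases a; cases b) (simp; presburger)+

lemma inversions_swap:
  assumes "A |\<inter>| B = {||}"
  shows "inversions A B + inversions B A = fcard A * fcard B"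
proof -
  let ?f = "\<lambda>(a, b). (b, a)"
  have "inversions B A = card (?f ` {(a, b). a |\<in>| B \<and> b |\<in>| A \<and> pos b < pos a})"
    unfolding inversions_def by (subst card_image) (auto simp: inj_on_def)
  also have "?f ` {(a, b). a |\<in>| B \<and> b |\<in>| A \<and> pos b < pos a}
      = {(a, b). a |\<in>| A \<and> b |\<in>| B \<and> pos a < pos b}" by auto
  finally have "inversions A B + inversions B A
      = card ({(a, b). a |\<in>| A \<and> b |\<in>| B \<and> pos b < pos a} \<union> {(a, b). a |\<in>| A \<and> b |\<in>| B \<and> pos a < pos b})"
    unfolding inversions_def
    by (subst card_Un_disjoint)
      (auto intro: finite_subset[of _ "fset A \<times> fset B"])
  also have "{(a, b). a |\<in>| A \<and> b |\<in>| B \<and> pos b < pos a} \<union> {(a, b). a |\<in>| A \<and> b |\<in>| B \<and> pos a < pos b}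
      = fset A \<times> fset B"
  proof -
    have "pos a \<noteq> pos b" if "a |\<in>| A" "b |\<in>| B" for a b
      using that assms pos_inj by blast
    then show ?thesis by force
  qed
  finally show ?thesis by (simp add: card_cartesian_product fcard.rep_eq)
qed

lemma sgn_odd_swap:
  assumes "A |\<inter>| B = {||}"
  shows "sgn_odd B A = (-1) ^ (fcard A * fcard B) * sgn_odd A B"
proof -
  have "(-1) ^ (fcard A * fcard B) * sgn_odd A B = sgn_odd B A * (sgn_odd A B * sgn_odd A B)"
    unfolding inversions_swap[OF assms, symmetric] sgn_odd_def power_add by (simp only: mult_ac)
  then show ?thesis by simp
qed

text \<open>The Koszul rule at the level of coefficients: exchanging two factors costs one sign for
  every pair of odd generators taken from different factors. Centrality of even elements and
  anticommutation of odd ones are read off from it.\<close>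

lemma coeff_mult_swap:
  "coeff (b * a) M = (\<Sum>(A, B)\<in>splits M. (-1) ^ (fcard (snd A) * fcard (snd B)) *
     (sgn_odd (snd A) (snd B) * coeff a A * coeff b B))"
  unfolding coeff_mult mul_coeff_def
proof (rule sum.reindex_bij_witness[where i = "\<lambda>(A, B). (B, A)" and j = "\<lambda>(A, B). (B, A)"], goal_cases)
  case (5 p)
  obtain A B where p: "p = (A, B)" by (cases p)
  have "sgn_odd (snd A) (snd B) = (-1) ^ (fcard (snd B) * fcard (snd A)) * sgn_odd (snd B) (snd A)"
    by (rule sgn_odd_swap) (use 5 p in \<open>auto simp: splits_def\<close>)
  then show ?case unfolding p by (simp add: mult_ac)
qed (auto simp: splits_def inf_commute sup_commute add.commute)

definition cen :: "salg \<Rightarrow> bool" where "cen a \<longleftrightarrow> (\<forall>b. a * b = b * a)"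

lemma even_cen:
  assumes "par a = a"
  shows "cen a"
  unfolding cen_def
proof (intro allI salg_eqI)
  fix b M
  have e: "coeff a A = 0" if "odd (fcard (snd A))" for A
    using that arg_cong[OF assms, of "\<lambda>x. coeff x A"] by (simp add: coeff_par)
  show "coeff (a * b) M = coeff (b * a) M"
    unfolding coeff_mult_swap[of b a] unfolding coeff_mult mul_coeff_def
  proof (rule sum.cong, goal_cases)
    case (2 p)
    then show ?case using e[of "fst p"] by (cases "even (fcard (snd (fst p)))") (auto simp: case_prod_unfold)
  qed simp
qed

lemma odd_commute:
  assumes "par a = - a"
  shows "a * b = par b * a"
proof (rule salg_eqI)
  fix M
  have e: "coeff a A = 0" if "even (fcard (snd A))" for A
    using that arg_cong[OF assms, of "\<lambda>x. coeff x A"] by (simp add: coeff_par coeff_uminus)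
  show "coeff (a * b) M = coeff (par b * a) M"
    unfolding coeff_mult_swap[of "par b" a] unfolding coeff_mult mul_coeff_def
  proof (rule sum.cong, goal_cases)
    case (2 p)
    then show ?case using e[of "fst p"]
      by (cases "odd (fcard (snd (fst p)))")
        (auto simp: case_prod_unfold coeff_par minus_one_power_iff)
  qed simp
qed

lemma odd_anticommute: "par a = - a \<Longrightarrow> par b = - b \<Longrightarrow> a * b = - (b * a)"
  using odd_commute[of a b] by simp

lemma odd_square:
  assumes "par a = - a"
  shows "a * a = 0"
proof -
  have "2 * (a * a) = 2 * 0" using odd_anticommute[OF assms assms] by (metis mult_2 mult_zero_right add.right_inverse)
  then show ?thesis by (rule two_cancel)
qed

subsection \<open>Locally finite sums\<close>

declare split_paired_All [simp del] split_paired_Ex [simp del]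

text \<open>Summability adapted to the carrier: one finite index set has to serve all monomials with
  the same time part. This keeps the sum in the carrier and lets continuous linear maps act term by
  term.\<close>

definition ssum :: "(nat \<Rightarrow> salg) \<Rightarrow> bool" where
  "ssum g \<longleftrightarrow> (\<forall>P. finite {k. \<exists>M. time_part M = P \<and> coeff (g k) M \<noteq> 0})"

lemma ssum_finite:
  assumes "ssum g" "finite Q"
  shows "finite {k. \<exists>M. time_part M \<in> Q \<and> coeff (g k) M \<noteq> 0}"
proof -
  have "{k. \<exists>M. time_part M \<in> Q \<and> coeff (g k) M \<noteq> 0}
      = (\<Union>P\<in>Q. {k. \<exists>M. time_part M = P \<and> coeff (g k) M \<noteq> 0})" by blast
  then show ?thesis using assms by (simp add: ssum_def)
qed

lemma coeff_lsum_set: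
  assumes "ssum g" "finite K" "{k. \<exists>M. time_part M = P \<and> coeff (g k) M \<noteq> 0} \<subseteq> K" "time_part M = P"
  shows "coeff (lsum g) M = (\<Sum>k\<in>K. coeff (g k) M)"
proof -
  let ?f = "\<lambda>M. \<Sum>k | coeff (g k) M \<noteq> 0. coeff (g k) M"
  have "?f \<in> {a. \<forall>Q. finite {M. a M \<noteq> 0 \<and> time_part M = Q}}"
  proof (rule CollectI, rule allI)
    fix Q
    let ?K = "{k. \<exists>M. time_part M = Q \<and> coeff (g k) M \<noteq> 0}"
    have "{M. ?f M \<noteq> 0 \<and> time_part M = Q} \<subseteq> (\<Union>k\<in>?K. {M. coeff (g k) M \<noteq> 0 \<and> time_part M = Q})"
      by (auto elim!: sum.not_neutral_contains_not_neutral)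
    moreover have "finite ?K" using assms(1) by (simp add: ssum_def)
    ultimately show "finite {M. ?f M \<noteq> 0 \<and> time_part M = Q}"
      using finite_coeff by (meson finite_UN_I finite_subset)
  qed
  then have "coeff (lsum g) M = ?f M" unfolding lsum_def by (simp add: Salg_inverse)
  also have "\<dots> = (\<Sum>k\<in>K. coeff (g k) M)"
    by (rule sum.mono_neutral_left) (use assms in auto)
  finally show ?thesis .
qed

text \<open>A coefficient of \<open>D (lsum g)\<close> depends on finitely many time parts, and only
  finitely many summands reach these. The sum may thus be replaced by a finite one before
  \<open>D\<close> is applied.\<close>

lemma lsum_apply:
  assumes "lin D" "time_continuous D" "ssum g"
  shows "D (lsum g) = lsum (\<lambda>k. D (g k))"
proof -
  have "coeff (D (lsum g)) M = (\<Sum>k | coeff (D (g k)) M \<noteq> 0. coeff (D (g k)) M)" for M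
  proof -
    obtain Q where Q: "finite Q" "\<And>b. (\<And>N. time_part N \<in> Q \<Longrightarrow> coeff b N = 0) \<Longrightarrow> coeff (D b) M = 0"
      using assms(2) unfolding time_continuous_def by metis
    let ?K = "{k. \<exists>M. time_part M \<in> Q \<and> coeff (g k) M \<noteq> 0}"
    have fin: "finite ?K" by (rule ssum_finite[OF assms(3) Q(1)])
    have "coeff (D (lsum g - (\<Sum>k\<in>?K. g k))) M = 0"
    proof (rule Q(2))
      fix N assume N: "time_part N \<in> Q"
      have "{k. \<exists>M. time_part M = time_part N \<and> coeff (g k) M \<noteq> 0} \<subseteq> ?K"
        by (rule Collect_mono, rule impI, erule ex_forward) (use N in simp)
      from coeff_lsum_set[OF assms(3) fin this refl]
      show "coeff (lsum g - (\<Sum>k\<in>?K. g k)) N = 0"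
        by (simp add: coeff_diff coeff_sum)
    qed
    then have "coeff (D (lsum g)) M = (\<Sum>k\<in>?K. coeff (D (g k)) M)"
      using assms(1) by (simp add: lin_diff lin_sum coeff_diff coeff_sum)
    also have "\<dots> = (\<Sum>k | coeff (D (g k)) M \<noteq> 0. coeff (D (g k)) M)"
      by (rule sum.mono_neutral_right[OF fin]) (use Q(2) in auto)
    finally show ?thesis .
  qed
  then show ?thesis unfolding lsum_def by (metis (no_types, lifting) coeff_inverse ext)
qed

lemma ssum_add:
  assumes "ssum f" "ssum g"
  shows "ssum (\<lambda>k. f k + g k)"
  unfolding ssum_def
proof
  fix P
  have "{k. \<exists>M. time_part M = P \<and> coeff (f k + g k) M \<noteq> 0}
    \<subseteq> {k. \<exists>M. time_part M = P \<and> coeff (f k) M \<noteq> 0} \<union> {k. \<exists>M. time_part M = P \<and> coeff (g k) M \<noteq> 0}"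
    by (auto simp: coeff_add)
  then show "finite {k. \<exists>M. time_part M = P \<and> coeff (f k + g k) M \<noteq> 0}"
    using assms unfolding ssum_def by (meson finite_UnI finite_subset)
qed

lemma lsum_add:
  assumes "ssum f" "ssum g"
  shows "lsum (\<lambda>k. f k + g k) = lsum f + lsum g"
proof (rule salg_eqI)
  fix M
  let ?A = "\<lambda>f. {k. \<exists>N. time_part N = time_part M \<and> coeff (f k) N \<noteq> 0}"
  let ?K = "?A f \<union> ?A g \<union> ?A (\<lambda>k. f k + g k)"
  have fin: "finite ?K" using assms ssum_add[OF assms] by (simp add: ssum_def)
  show "coeff (lsum (\<lambda>k. f k + g k)) M = coeff (lsum f + lsum g) M"
    unfolding coeff_add coeff_lsum_set[OF assms(1) fin sup.coboundedI1[OF sup_ge1] refl]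
      coeff_lsum_set[OF assms(2) fin sup.coboundedI1[OF sup_ge2] refl]
      coeff_lsum_set[OF ssum_add[OF assms] fin sup_ge2 refl] by (rule sum.distrib)
qed

lemma lsum_zero: "lsum (\<lambda>k. 0) = 0"
  by (rule salg_eqI) (subst coeff_lsum_set[where K = "{}"], auto simp: ssum_def coeff_zero)

lemma ssum_Suc: "ssum g \<Longrightarrow> ssum (\<lambda>k. g (Suc k))"
proof -
  assume g: "ssum g"
  have "finite {k. \<exists>M. time_part M = P \<and> coeff (g (Suc k)) M \<noteq> 0}" for P
    using finite_vimageI[of "{k. \<exists>M. time_part M = P \<and> coeff (g k) M \<noteq> 0}" Suc] g
    by (simp add: vimage_def ssum_def)
  then show ?thesis by (simp add: ssum_def)
qed

lemma lsum_Suc: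
  assumes "ssum g"
  shows "lsum g = g 0 + lsum (\<lambda>k. g (Suc k))"
proof (rule salg_eqI)
  fix M
  let ?A = "\<lambda>f. {k. \<exists>N. time_part N = time_part M \<and> coeff (f k) N \<noteq> 0}"
  let ?K = "?A (\<lambda>k. g (Suc k))"
  have fin: "finite ?K" using ssum_Suc[OF assms] by (simp add: ssum_def)
  have sub: "?A g \<subseteq> insert 0 (Suc ` ?K)"
  proof
    fix k assume "k \<in> ?A g"
    then show "k \<in> insert 0 (Suc ` ?K)" by (cases k) auto
  qed
  have "coeff (lsum g) M = (\<Sum>k\<in>insert 0 (Suc ` ?K). coeff (g k) M)"
    by (rule coeff_lsum_set[OF assms _ sub]) (use fin in auto)
  also have "\<dots> = coeff (g 0) M + (\<Sum>k\<in>?K. coeff (g (Suc k)) M)"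
    using fin by (subst sum.insert) (auto simp: sum.reindex)
  also have "\<dots> = coeff (g 0 + lsum (\<lambda>k. g (Suc k))) M"
    using coeff_lsum_set[OF ssum_Suc[OF assms] fin, of "time_part M" M] by (simp add: coeff_add)
  finally show "coeff (lsum g) M = coeff (g 0 + lsum (\<lambda>k. g (Suc k))) M" .
qed

lemma lsum_shift:
  assumes "ssum g" "\<And>k. k < n \<Longrightarrow> g k = 0"
  shows "lsum g = lsum (\<lambda>k. g (k + n))"
  using assms
proof (induction n arbitrary: g)
  case (Suc n)
  have "lsum g = lsum (\<lambda>k. g (Suc k))" using lsum_Suc[OF Suc.prems(1)] Suc.prems(2)[of 0] by simp
  also have "\<dots> = lsum (\<lambda>k. g (Suc (k + n)))"
    by (rule Suc.IH) (use Suc.prems in \<open>auto intro: ssum_Suc\<close>)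
  finally show ?case by simp
qed simp

lemma lsum_single: "lsum (\<lambda>k. if k = n then x else 0) = x"
  by (rule salg_eqI) (subst coeff_lsum_set[where K = "{n}"], auto simp: ssum_def coeff_zero split: if_splits)

lemma ssum_single: "ssum (\<lambda>k. if k = n then x k else 0)"
  unfolding ssum_def
proof
  fix P
  show "finite {k. \<exists>M. time_part M = P \<and> coeff (if k = n then x k else 0) M \<noteq> 0}"
    by (rule finite_subset[of _ "{n}"]) (auto simp: coeff_zero)
qed

lemma lsum_delta: "lsum (\<lambda>k. if k = n then x k else 0) = x n"
proof -
  have "(\<lambda>k. if k = n then x k else 0) = (\<lambda>k. if k = n then x n else 0)" by auto
  then show ?thesis by (simp only: lsum_single)
qed

text \<open>The divisors of a monomial.\<close>

definition subs :: "mono \<Rightarrow> mono set" where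
  "subs P = {B. \<exists>A. (A, B) \<in> splits P}"

lemma finite_subs: "finite (subs P)"
  unfolding subs_def by (rule finite_time_splits)

lemma subs_iff: "B \<in> subs P \<longleftrightarrow> fst B \<subseteq># fst P \<and> snd B |\<subseteq>| snd P"
proof
  assume "fst B \<subseteq># fst P \<and> snd B |\<subseteq>| snd P"
  then have "((fst P - fst B, snd P |-| snd B), B) \<in> splits P"
    by (auto simp: splits_def)
  then show "B \<in> subs P" unfolding subs_def by blast
next
  assume "B \<in> subs P"
  then obtain A where "fst A + fst B = fst P" "snd A |\<union>| snd B = snd P"
    by (auto simp: subs_def splits_def)
  then show "fst B \<subseteq># fst P \<and> snd B |\<subseteq>| snd P"
    by (metis mset_subset_eq_add_right sup_ge2)
qed

lemma splits_subs: "(A, B) \<in> splits M \<Longrightarrow> A \<in> subs M \<and> B \<in> subs M"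
  unfolding subs_iff by (auto simp: splits_def) (metis mset_subset_eq_add_left mset_subset_eq_add_right)+

lemma time_part_subs: "A \<in> subs M \<Longrightarrow> time_part A \<in> subs (time_part M)"
  unfolding subs_def using time_part_splits by blast

lemma coeff_mult_nonzero:
  assumes "coeff (a * b) M \<noteq> 0"
  obtains A B where "(A, B) \<in> splits M" "coeff a A \<noteq> 0" "coeff b B \<noteq> 0"
  using coeff_mult_zeroI assms by blast

lemma coeff_time_mult_nonzero: "coeff (const c * time k * p) M \<noteq> 0 \<Longrightarrow> k \<in> T -` set_mset (fst (time_part M))"
proof -
  assume "coeff (const c * time k * p) M \<noteq> 0"
  then have "coeff (time k * p) M \<noteq> 0" by (simp add: coeff_const_mult mult.assoc)
  then obtain A B where "(A, B) \<in> splits M" "coeff (time k) A \<noteq> 0" by (rule coeff_mult_nonzero)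
  then have "T k \<in># fst M" by (auto simp: even_gen_mon coeff_mon splits_def split: if_splits)
    (metis union_iff union_single_eq_member)
  then show ?thesis by (auto simp: time_part_def)
qed

lemma coeff_tau_mult_nonzero: "coeff (const c * tau k * p) M \<noteq> 0 \<Longrightarrow> k \<in> Tau -` fset (snd (time_part M))"
proof -
  assume "coeff (const c * tau k * p) M \<noteq> 0"
  then have "coeff (tau k * p) M \<noteq> 0" by (simp add: coeff_const_mult mult.assoc)
  then obtain A B where "(A, B) \<in> splits M" "coeff (tau k) A \<noteq> 0" by (rule coeff_mult_nonzero)
  then have "Tau k |\<in>| snd M" by (auto simp: odd_gen_mon coeff_mon splits_def split: if_splits)
  then show ?thesis by (auto simp: time_part_def)
qed

lemma finite_time_vimage: "finite (T -` set_mset (fst P))" and finite_tau_vimage: "finite (Tau -` fset (snd P))"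
  by (auto intro!: finite_vimageI simp: inj_def)

lemma ssum_time: "ssum (\<lambda>k. const (c k) * time k * p k)"
  unfolding ssum_def
proof
  show "finite {k. \<exists>M. time_part M = P \<and> coeff (const (c k) * time k * p k) M \<noteq> 0}" for P
    by (rule finite_subset[OF _ finite_time_vimage[of P]]) (use coeff_time_mult_nonzero in blast)
qed

lemma ssum_tau: "ssum (\<lambda>k. const (c k) * tau k * p k)"
  unfolding ssum_def
proof
  show "finite {k. \<exists>M. time_part M = P \<and> coeff (const (c k) * tau k * p k) M \<noteq> 0}" for P
    by (rule finite_subset[OF _ finite_tau_vimage[of P]]) (use coeff_tau_mult_nonzero in blast)
qed

lemma time_continuous_lsum:
  assumes D: "\<And>k. time_continuous (D k)" and s: "\<And>a. ssum (\<lambda>k. D k a)"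
    and K: "\<And>P. finite (K P)" "\<And>a k M. coeff (D k a) M \<noteq> 0 \<Longrightarrow> k \<in> K (time_part M)"
  shows "time_continuous (\<lambda>a. lsum (\<lambda>k. D k a))"
  unfolding time_continuous_def
proof
  fix M
  have "\<forall>k. \<exists>Q. finite Q \<and> (\<forall>a. (\<forall>N. time_part N \<in> Q \<longrightarrow> coeff a N = 0) \<longrightarrow> coeff (D k a) M = 0)"
    using D unfolding time_continuous_def by blast
  then obtain Q where Q: "\<And>k. finite (Q k)" "\<And>k a. (\<And>N. time_part N \<in> Q k \<Longrightarrow> coeff a N = 0) \<Longrightarrow> coeff (D k a) M = 0"
    by metis
  have "coeff (lsum (\<lambda>k. D k a)) M = (\<Sum>k\<in>K (time_part M). coeff (D k a) M)" for a
    by (rule coeff_lsum_set[OF s K(1) _ refl]) (use K(2) in fastforce)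
  then show "\<exists>Q. finite Q \<and> (\<forall>a. (\<forall>N. time_part N \<in> Q \<longrightarrow> coeff a N = 0) \<longrightarrow> coeff (lsum (\<lambda>k. D k a)) M = 0)"
    using K(1) Q(1) by (intro exI[of _ "\<Union>k\<in>K (time_part M). Q k"]) (auto intro!: sum.neutral Q(2))
qed

lemma time_continuous_add: "time_continuous D \<Longrightarrow> time_continuous E \<Longrightarrow> time_continuous (\<lambda>a. D a + E a)"
  unfolding time_continuous_def
proof
  fix M
  assume D: "\<forall>M. \<exists>Q. finite Q \<and> (\<forall>a. (\<forall>N. time_part N \<in> Q \<longrightarrow> coeff a N = 0) \<longrightarrow> coeff (D a) M = 0)"
    and E: "\<forall>M. \<exists>Q. finite Q \<and> (\<forall>a. (\<forall>N. time_part N \<in> Q \<longrightarrow> coeff a N = 0) \<longrightarrow> coeff (E a) M = 0)"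
  obtain Q where "finite Q" "\<forall>a. (\<forall>N. time_part N \<in> Q \<longrightarrow> coeff a N = 0) \<longrightarrow> coeff (D a) M = 0" using D by blast
  moreover obtain Q' where "finite Q'" "\<forall>a. (\<forall>N. time_part N \<in> Q' \<longrightarrow> coeff a N = 0) \<longrightarrow> coeff (E a) M = 0" using E by blast
  ultimately show "\<exists>Q. finite Q \<and> (\<forall>a. (\<forall>N. time_part N \<in> Q \<longrightarrow> coeff a N = 0) \<longrightarrow> coeff (D a + E a) M = 0)"
    by (intro exI[of _ "Q \<union> Q'"]) (auto simp: coeff_add)
qed

lemma ssum_shifted: "ssum h \<Longrightarrow> ssum (\<lambda>k. if M \<le> Suc k then h (Suc k - M) else 0)"
  unfolding ssum_def
proof
  fix P
  assume "\<forall>P. finite {k. \<exists>X. time_part X = P \<and> coeff (h k) X \<noteq> 0}"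
  then have "finite {k. \<exists>X. time_part X = P \<and> coeff (h k) X \<noteq> 0}" by blast
  moreover have "{k. \<exists>X. time_part X = P \<and> coeff (if M \<le> Suc k then h (Suc k - M) else 0) X \<noteq> 0}
      \<subseteq> (\<lambda>j. j + M - 1) ` {k. \<exists>X. time_part X = P \<and> coeff (h k) X \<noteq> 0}"
  proof
    fix k assume "k \<in> {k. \<exists>X. time_part X = P \<and> coeff (if M \<le> Suc k then h (Suc k - M) else 0) X \<noteq> 0}"
    then have "M \<le> Suc k" "\<exists>X. time_part X = P \<and> coeff (h (Suc k - M)) X \<noteq> 0"
      by (auto simp: coeff_zero split: if_splits)
    then show "k \<in> (\<lambda>j. j + M - 1) ` {k. \<exists>X. time_part X = P \<and> coeff (h k) X \<noteq> 0}"
      by (intro image_eqI[of _ _ "Suc k - M"]) auto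
  qed
  ultimately show "finite {k. \<exists>X. time_part X = P \<and> coeff (if M \<le> Suc k then h (Suc k - M) else 0) X \<noteq> 0}"
    by (rule finite_surj)
qed

text \<open>This is the substitution j = k + 1 - M. For M = 0 it never reaches j = 0, so that term
  has to be subtracted; in \<open>EE_LL\<close> it becomes the exceptional t_0 term of the flow
  s_{-1}.\<close>

lemma lsum_shifted:
  assumes "ssum h"
  shows "lsum (\<lambda>k. if M \<le> Suc k then h (Suc k - M) else 0) = lsum h - (if M = 0 then h 0 else 0)"
proof (cases M)
  case 0
  then show ?thesis using lsum_Suc[OF assms] by simp
next
  case (Suc m)
  show ?thesis using lsum_shift[OF ssum_shifted[OF assms, of M], of m] by (simp add: Suc)
qed

subsection \<open>Derivations\<close>

text \<open>Even derivations are the case \<open>s = id\<close>, odd ones the case \<open>s = par\<close>.\<close>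

definition sder :: "(salg \<Rightarrow> salg) \<Rightarrow> (salg \<Rightarrow> salg) \<Rightarrow> bool" where
  "sder s D \<longleftrightarrow> lin D \<and> (\<forall>a b. D (a * b) = D a * b + s a * D b)"

lemma sder_lin: "sder s D \<Longrightarrow> lin D"
  and sder_mult: "sder s D \<Longrightarrow> D (a * b) = D a * b + s a * D b"
  by (simp_all add: sder_def)

lemma even_derivation_iff:
  "even_derivation D \<longleftrightarrow> sder id D \<and> (\<forall>a. D (par a) = par (D a)) \<and> time_continuous D"
  unfolding even_derivation_def sder_def lin_def by auto

lemma odd_derivation_iff:
  "odd_derivation D \<longleftrightarrow> sder par D \<and> (\<forall>a. D (par a) = - par (D a)) \<and> time_continuous D"
  unfolding odd_derivation_def sder_def lin_def by auto

lemma sder_one: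
  assumes "sder s D" "s 1 = 1"
  shows "D 1 = 0"
  using sder_mult[OF assms(1), of 1 1] assms(2) by simp

lemma sder_const:
  assumes "sder s D" "s 1 = 1"
  shows "D (const c) = 0"
  using lin_const_mult[OF sder_lin[OF assms(1)], of c 1] sder_one[OF assms] by simp

lemma sder_mon_zero:
  assumes "sder s D" "s 1 = 1" "\<And>x. x \<in># fst N \<Longrightarrow> D (even_gen x) = 0"
    "\<And>y. y |\<in>| snd N \<Longrightarrow> D (odd_gen y) = 0"
  shows "D (mon N) = 0"
proof -
  have 1: "D (mon ({#}, B)) = 0" if "\<And>y. y |\<in>| B \<Longrightarrow> D (odd_gen y) = 0" for B
    using that
  proof (induction B)
    case empty
    then show ?case using sder_one[OF assms(1,2)] mon_unit by (simp add: unit_mono_def)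
  next
    case (insert y B)
    then show ?case
      by (simp add: mon_insert_odd sder_mult[OF assms(1), of "odd_gen y"] lin_const_mult[OF sder_lin[OF assms(1)]])
  qed
  have "D (mon (A, B)) = 0" if "\<And>x. x \<in># A \<Longrightarrow> D (even_gen x) = 0" "\<And>y. y |\<in>| B \<Longrightarrow> D (odd_gen y) = 0" for A B
    using that(1)
  proof (induction A)
    case empty
    then show ?case using 1 that(2) by blast
  next
    case (add x A)
    then show ?case by (simp add: mon_add_even sder_mult[OF assms(1)])
  qed
  then show ?thesis using assms(3,4) by (cases N) auto
qed

lemma sder_zero_ext:
  assumes "sder s D" "s 1 = 1" "time_continuous D" "\<And>x. D (even_gen x) = 0" "\<And>y. D (odd_gen y) = 0"
  shows "D a = 0"
  using lin_zero_ext[OF sder_lin[OF assms(1)] assms(3)] sder_mon_zero[OF assms(1,2)] assms(4,5) by blast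

lemma sder_diff: "sder s D \<Longrightarrow> sder s E \<Longrightarrow> sder s (\<lambda>a. D a - E a)"
  by (auto simp: sder_def lin_def algebra_simps)

lemma const_left_commute: "a * (const c * b) = const c * (a * b)"
  by (metis const_commute mult.assoc)

lemma sder_const_mult: "sder s D \<Longrightarrow> sder s (\<lambda>a. const c * D a)"
proof -
  assume D: "sder s D"
  have "const c * (const d * D a) = const d * (const c * D a)" for d a
    by (rule const_left_commute)
  moreover have "s a * (const c * D b) = const c * (s a * D b)" for a b
    by (rule const_left_commute)
  ultimately show ?thesis
    using D unfolding sder_def lin_def by (metis distrib_left mult.assoc)
qed

lemma sder_commutator:
  assumes D: "sder s D" and E: "sder id E" and sE: "\<And>a. E (s a) = s (E a)"
  shows "sder s (\<lambda>a. D (E a) - E (D a))"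
proof -
  note a = lin_add[OF sder_lin[OF D]] lin_add[OF sder_lin[OF E]]
  note c = lin_const_mult[OF sder_lin[OF D]] lin_const_mult[OF sder_lin[OF E]]
  note m = sder_mult[OF D] sder_mult[OF E]
  have "lin (\<lambda>a. D (E a) - E (D a))" unfolding lin_def by (simp add: a c right_diff_distrib)
  then show ?thesis
    unfolding sder_def by (simp add: a m sE right_diff_distrib left_diff_distrib)
qed

lemma sder_anticommutator:
  assumes D: "sder par D" and E: "sder par E"
    and p: "\<And>a. D (par a) = - par (D a)" "\<And>a. E (par a) = - par (E a)"
  shows "sder id (\<lambda>a. D (E a) + E (D a))"
proof -
  note a = lin_add[OF sder_lin[OF D]] lin_add[OF sder_lin[OF E]]
  note c = lin_const_mult[OF sder_lin[OF D]] lin_const_mult[OF sder_lin[OF E]]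
  note m = sder_mult[OF D] sder_mult[OF E]
  have "lin (\<lambda>a. D (E a) + E (D a))" unfolding lin_def by (simp add: a c distrib_left)
  then show ?thesis
    unfolding sder_def by (simp add: a m p distrib_left distrib_right)
qed

text \<open>A derivation lowers the time part of a monomial by at most one generator on which it does not vanish.\<close>

lemma sder_scont:
  assumes D: "sder s D" "time_continuous D" and s: "s = id \<or> s = par"
    and J: "\<And>j. j \<ge> J \<Longrightarrow> D (time j) = 0" "\<And>j. j \<ge> J \<Longrightarrow> D (tau j) = 0"
  shows "scont D"
proof -
  \<comment> \<open>What one application of \<open>D\<close> may remove from a time part: nothing,
    or a single time with index below \<open>J\<close>. A pair is \<open>good\<close> if the first
    member divides the second after such a removal.\<close>
  define Rem :: "mono set" where "Rem = {({#}, {||})} \<union> (\<lambda>j. ({#T j#}, {||})) ` {..<J} \<union> (\<lambda>j. ({#}, {|Tau j|})) ` {..<J}"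
  define good :: "mono \<Rightarrow> mono \<Rightarrow> bool" where
    "good N M \<longleftrightarrow> (\<exists>X\<in>Rem. fst N - fst X \<subseteq># fst M \<and> snd N |-| snd X |\<subseteq>| snd M)" for N M
  note Dl = sder_lin[OF D(1)] and Dm = sder_mult[OF D(1)]
  have s1: "s 1 = 1" using s by auto
  have se: "s (even_gen x) = even_gen x" for x using s by auto
  have so: "s (odd_gen y) = odd_gen y \<or> s (odd_gen y) = - odd_gen y" for y using s by auto
  have R0: "({#}, {||}) \<in> Rem" by (simp add: Rem_def)
  have goodI: "good N M" if "N \<in> subs M" for N M
    unfolding good_def by (rule bexI[OF _ R0]) (use that in \<open>auto simp: subs_iff\<close>)
  have odd: "good (time_part ({#}, B)) (time_part M)" if "coeff (D (mon ({#}, B))) M \<noteq> 0" for B M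
    using that
  proof (induction B arbitrary: M)
    case empty
    then show ?case using sder_one[OF D(1) s1] mon_unit by (simp add: unit_mono_def coeff_zero)
  next
    case (insert y B)
    have "D (mon ({#}, finsert y B)) = const (sgn_odd {|y|} B) *
        (D (odd_gen y) * mon ({#}, B) + s (odd_gen y) * D (mon ({#}, B)))"
      using insert.hyps by (simp add: mon_insert_odd lin_const_mult[OF Dl] Dm[of "odd_gen y"])
    then have "coeff (D (odd_gen y) * mon ({#}, B)) M \<noteq> 0 \<or> coeff (odd_gen y * D (mon ({#}, B))) M \<noteq> 0"
      using insert.prems so[of y] by (auto simp: coeff_const_mult coeff_add coeff_uminus)
    then show ?case
    proof
      assume 1: "coeff (D (odd_gen y) * mon ({#}, B)) M \<noteq> 0"
      then have Dy: "D (odd_gen y) \<noteq> 0" by (auto simp: coeff_zero)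
      have B: "({#}, B) \<in> subs M"
        using 1 by (auto elim!: coeff_mult_nonzero simp: coeff_mon split: if_splits dest: splits_subs)
      show ?thesis
      proof (cases y)
        case (Tau j)
        then have "({#}, {|Tau j|}) \<in> Rem" using Dy J(2) by (auto simp: Rem_def not_less[symmetric])
        then show ?thesis using B Tau unfolding good_def
          by (intro bexI[of _ "({#}, {|Tau j|})"]) (auto simp: time_part_def subs_iff)
      next
        case (Th j)
        then have "time_part ({#}, finsert y B) = time_part ({#}, B)"
          by (auto simp: time_part_def fset_eq_iff)
        then show ?thesis using goodI[OF time_part_subs[OF B]] by simp
      next
        case (Sig j)
        then have "time_part ({#}, finsert y B) = time_part ({#}, B)"
          by (auto simp: time_part_def fset_eq_iff)
        then show ?thesis using goodI[OF time_part_subs[OF B]] by simp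
      qed
    next
      assume "coeff (odd_gen y * D (mon ({#}, B))) M \<noteq> 0"
      then obtain A C where AC: "(A, C) \<in> splits M" "coeff (odd_gen y) A \<noteq> 0" "coeff (D (mon ({#}, B))) C \<noteq> 0"
        by (rule coeff_mult_nonzero)
      then have A: "A = ({#}, {|y|})" by (auto simp: odd_gen_mon coeff_mon split: if_splits)
      obtain X where "X \<in> Rem" "fst (time_part ({#}, B)) - fst X \<subseteq># fst (time_part C)"
        "snd (time_part ({#}, B)) |-| snd X |\<subseteq>| snd (time_part C)"
        using insert.IH[OF AC(3)] unfolding good_def by blast
      moreover have "M = (fst C, finsert y (snd C))" using AC(1) A by (auto simp: splits_def prod_eq_iff)
      ultimately show ?thesis unfolding good_def
        by (intro bexI[of _ X]) (auto simp: time_part_def)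
    qed
  qed
  have good: "good (time_part (A, B)) (time_part M)" if "coeff (D (mon (A, B))) M \<noteq> 0" for A B M
    using that
  proof (induction A arbitrary: M)
    case empty
    then show ?case by (rule odd)
  next
    case (add x A)
    have "coeff (D (even_gen x) * mon (A, B)) M \<noteq> 0 \<or> coeff (even_gen x * D (mon (A, B))) M \<noteq> 0"
      using add.prems by (auto simp: mon_add_even Dm se coeff_add)
    then show ?case
    proof
      assume 1: "coeff (D (even_gen x) * mon (A, B)) M \<noteq> 0"
      then have Dy: "D (even_gen x) \<noteq> 0" by (auto simp: coeff_zero)
      have B: "(A, B) \<in> subs M"
        using 1 by (auto elim!: coeff_mult_nonzero simp: coeff_mon split: if_splits dest: splits_subs)
      note B' = time_part_subs[OF B]
      show ?thesis
      proof (cases x)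
        case (T j)
        then have "({#T j#}, {||}) \<in> Rem" using Dy J(1) by (auto simp: Rem_def not_less[symmetric])
        then show ?thesis using B' T unfolding good_def
          by (intro bexI[of _ "({#T j#}, {||})"]) (auto simp: time_part_def subs_iff)
      qed (use goodI[OF B'] in \<open>auto simp: time_part_def good_def\<close>)
    next
      assume "coeff (even_gen x * D (mon (A, B))) M \<noteq> 0"
      then obtain E C where AC: "(E, C) \<in> splits M" "coeff (even_gen x) E \<noteq> 0" "coeff (D (mon (A, B))) C \<noteq> 0"
        by (rule coeff_mult_nonzero)
      then have E: "E = ({#x#}, {||})" by (auto simp: even_gen_mon coeff_mon split: if_splits)
      have M: "M = (add_mset x (fst C), snd C)" using AC(1) E by (auto simp: splits_def prod_eq_iff)
      obtain X where X: "X \<in> Rem" "fst (time_part (A, B)) - fst X \<subseteq># fst (time_part C)"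
        "snd (time_part (A, B)) |-| snd X |\<subseteq>| snd (time_part C)"
        using add.IH[OF AC(3)] unfolding good_def by blast
      have "fst (time_part (add_mset x A, B)) - fst X \<subseteq># fst (time_part M)"
      proof (cases "is_T x")
        case True
        have "add_mset x (filter_mset is_T A) - fst X \<subseteq># add_mset x (filter_mset is_T A - fst X)"
          by (rule mset_subset_eqI) auto
        also have "\<dots> \<subseteq># add_mset x (filter_mset is_T (fst C))" using X(2) by (simp add: time_part_def)
        finally show ?thesis using True by (simp add: time_part_def M)
      qed (use X(2) in \<open>simp add: time_part_def M\<close>)
      then show ?thesis using X unfolding good_def
        by (intro bexI[of _ X]) (auto simp: time_part_def M)
    qed
  qed
  have fin: "finite {q. good q P}" for P
  proof (rule finite_subset)
    show "{q. good q P} \<subseteq> (\<Union>X\<in>Rem. subs (fst P + fst X, snd P |\<union>| snd X))"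
    proof
      fix q assume "q \<in> {q. good q P}"
      then obtain X where X: "X \<in> Rem" "fst q - fst X \<subseteq># fst P" "snd q |-| snd X |\<subseteq>| snd P"
        unfolding good_def by blast
      have "fst q \<subseteq># fst P + fst X" using X(2) by (simp add: subset_eq_diff_conv)
      moreover have "snd q |\<subseteq>| snd P |\<union>| snd X" using X(3) by auto
      ultimately show "q \<in> (\<Union>X\<in>Rem. subs (fst P + fst X, snd P |\<union>| snd X))"
        using X(1) by (auto simp: subs_iff)
    qed
    show "finite (\<Union>X\<in>Rem. subs (fst P + fst X, snd P |\<union>| snd X))"
      by (auto simp: Rem_def finite_subs)
  qed
  show ?thesis
    unfolding scont_def
  proof
    fix P
    show "\<exists>Q. finite Q \<and> (\<forall>a. (\<forall>N. time_part N \<in> Q \<longrightarrow> coeff a N = 0) \<longrightarrow>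
        (\<forall>M. time_part M = P \<longrightarrow> coeff (D a) M = 0))"
    proof (intro exI[of _ "{q. good q P}"] conjI allI impI fin)
      fix a M assume a: "\<forall>N. time_part N \<in> {q. good q P} \<longrightarrow> coeff a N = 0" "time_part M = P"
      \<comment> \<open>This \<open>Q\<close> depends on the monomial \<open>M\<close> and serves
        only to expand \<open>D a\<close> over finitely many monomials. The bound that is uniform in
        \<open>M\<close> comes from \<open>good\<close>.\<close>
      obtain Q where Q: "finite Q" "\<And>b. (\<forall>N. time_part N \<in> Q \<longrightarrow> coeff b N = 0) \<Longrightarrow> coeff (D b) M = 0"
        using D(2) unfolding time_continuous_def by blast
      have "coeff (D (a - trunc Q a)) M = 0"
        by (rule Q(2)) (simp add: coeff_diff coeff_trunc[OF Q(1)])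
      then have "coeff (D a) M = coeff (D (trunc Q a)) M"
        by (simp add: lin_diff[OF Dl] coeff_diff)
      also have "\<dots> = (\<Sum>N | coeff a N \<noteq> 0 \<and> time_part N \<in> Q. coeff a N * coeff (D (mon N)) M)"
        unfolding trunc_def by (simp add: lin_sum[OF Dl] lin_const_mult[OF Dl] coeff_sum coeff_const_mult)
      also have "\<dots> = 0"
      proof (rule sum.neutral, rule ballI)
        fix N assume N: "N \<in> {N. coeff a N \<noteq> 0 \<and> time_part N \<in> Q}"
        then have "\<not> good (time_part N) P" using a(1) by auto
        then have "coeff (D (mon N)) M = 0" using good[of "fst N" "snd N" M] a(2) by auto
        then show "coeff a N * coeff (D (mon N)) M = 0" by simp
      qed
      finally show "coeff (D a) M = 0" .
    qed
  qed
qed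

subsection \<open>Polynomial subalgebras\<close>

definition poly_on :: "evar set \<Rightarrow> ovar set \<Rightarrow> salg \<Rightarrow> bool" where
  "poly_on X Y a \<longleftrightarrow> (\<forall>M. coeff a M \<noteq> 0 \<longrightarrow> set_mset (fst M) \<subseteq> X \<and> fset (snd M) \<subseteq> Y)"

lemma u_poly_iff: "u_poly a \<longleftrightarrow> poly_on (range U) {} a"
  unfolding u_poly_def poly_on_def by (metis bot.extremum bot_fset.rep_eq fset_inject subset_empty)

lemma diff_poly_iff: "diff_poly a \<longleftrightarrow> poly_on (range U) (range Th \<union> range Sig) a"
  unfolding diff_poly_def poly_on_def by simp

lemma poly_on_0: "poly_on X Y 0"
  by (simp add: poly_on_def coeff_zero)

lemma poly_on_const: "poly_on X Y (const c)"
  by (simp add: poly_on_def coeff_const unit_mono_def)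

lemma poly_on_1: "poly_on X Y 1"
  using poly_on_const[of X Y 1] by simp

lemma poly_on_even: "x \<in> X \<Longrightarrow> poly_on X Y (even_gen x)"
  by (simp add: poly_on_def coeff_mon even_gen_mon)

lemma poly_on_odd: "y \<in> Y \<Longrightarrow> poly_on X Y (odd_gen y)"
  by (simp add: poly_on_def coeff_mon odd_gen_mon)

lemma poly_on_add: "poly_on X Y a \<Longrightarrow> poly_on X Y b \<Longrightarrow> poly_on X Y (a + b)"
  unfolding poly_on_def coeff_add by (metis add.right_neutral)

lemma poly_on_uminus: "poly_on X Y a \<Longrightarrow> poly_on X Y (- a)"
  by (simp add: poly_on_def coeff_uminus)

lemma poly_on_diff: "poly_on X Y a \<Longrightarrow> poly_on X Y b \<Longrightarrow> poly_on X Y (a - b)"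
  using poly_on_add[of X Y a "- b"] poly_on_uminus[of X Y b] by simp

lemma poly_on_mult:
  assumes "poly_on X Y a" "poly_on X Y b"
  shows "poly_on X Y (a * b)"
  unfolding poly_on_def
proof (intro allI impI)
  fix M assume "coeff (a * b) M \<noteq> 0"
  then obtain A B where AB: "(A, B) \<in> splits M" "coeff a A \<noteq> 0" "coeff b B \<noteq> 0" by (rule coeff_mult_nonzero)
  then have "set_mset (fst M) = set_mset (fst A) \<union> set_mset (fst B)" "fset (snd M) = fset (snd A) \<union> fset (snd B)"
    by (auto simp: splits_def simp flip: set_mset_union)
  then show "set_mset (fst M) \<subseteq> X \<and> fset (snd M) \<subseteq> Y"
    using AB assms unfolding poly_on_def by auto
qed

lemma poly_on_sum: "(\<And>x. x \<in> A \<Longrightarrow> poly_on X Y (f x)) \<Longrightarrow> poly_on X Y (sum f A)"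
  by (induction A rule: infinite_finite_induct) (auto simp: poly_on_0 poly_on_add)

lemma poly_on_mono: "poly_on X Y a \<Longrightarrow> X \<subseteq> X' \<Longrightarrow> Y \<subseteq> Y' \<Longrightarrow> poly_on X' Y' a"
  unfolding poly_on_def by blast

lemmas poly_on_intros = poly_on_0 poly_on_1 poly_on_const poly_on_add poly_on_uminus poly_on_diff
  poly_on_mult poly_on_sum

text \<open>Without times among the generators all monomials of \<open>a\<close> have trivial time
  part, so the carrier condition makes \<open>a\<close> an honest polynomial, and an induction over
  finite sums of monomials applies.\<close>

lemma poly_on_induct [consumes 3, case_names const even odd add mult]:
  assumes "poly_on X Y a" "\<And>x. x \<in> X \<Longrightarrow> \<not> is_T x" "\<And>y. y \<in> Y \<Longrightarrow> \<not> is_Tau y"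
    and c: "\<And>c. P (const c)" and e: "\<And>x. x \<in> X \<Longrightarrow> P (even_gen x)" and o: "\<And>y. y \<in> Y \<Longrightarrow> P (odd_gen y)"
    and a: "\<And>a b. poly_on X Y a \<Longrightarrow> poly_on X Y b \<Longrightarrow> P a \<Longrightarrow> P b \<Longrightarrow> P (a + b)"
    and m: "\<And>a b. poly_on X Y a \<Longrightarrow> poly_on X Y b \<Longrightarrow> P a \<Longrightarrow> P b \<Longrightarrow> P (a * b)"
  shows "P a"
proof -
  let ?P = "\<lambda>a. poly_on X Y a \<and> P a"
  have am: "?P a \<Longrightarrow> ?P b \<Longrightarrow> ?P (a + b)" "?P a \<Longrightarrow> ?P b \<Longrightarrow> ?P (a * b)" for a b
    using a m poly_on_add poly_on_mult by auto
  have 1: "?P (mon ({#}, B))" if "fset B \<subseteq> Y" for B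
    using that
  proof (induction B)
    case empty
    then show ?case using c[of 1] mon_unit poly_on_1 by (simp add: unit_mono_def)
  next
    case (insert y B)
    have "?P (const s * (odd_gen y * mon ({#}, B)))" for s
      by (intro am conjI poly_on_const c poly_on_odd o insert.IH) (use insert.prems in auto)
    then show ?case using insert.hyps mon_insert_odd by auto
  qed
  have 2: "?P (mon (A, B))" if "set_mset A \<subseteq> X" "fset B \<subseteq> Y" for A B
    using that(1)
  proof (induction A)
    case (add x A)
    have "?P (even_gen x * mon (A, B))"
      by (intro am conjI poly_on_even e add.IH) (use add.prems in auto)
    then show ?case by (simp add: mon_add_even)
  qed (use 1 that(2) in auto)
  have tp: "time_part N = unit_mono" if "coeff a N \<noteq> 0" for N
  proof -
    have "set_mset (fst N) \<subseteq> X" "fset (snd N) \<subseteq> Y" using that assms(1) unfolding poly_on_def by auto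
    then show ?thesis
      using assms(2,3) unfolding time_part_def unit_mono_def
      by (auto simp: fset_eq_iff count_eq_zero_iff intro!: multiset_eqI)
  qed
  have "a = trunc {unit_mono} a"
    by (rule salg_eqI) (use tp in \<open>auto simp: coeff_trunc\<close>)
  moreover have "?P (trunc {unit_mono} a)"
    unfolding trunc_def
  proof -
    have sP: "(\<And>N. N \<in> A \<Longrightarrow> ?P (f N)) \<Longrightarrow> ?P (sum f A)" for f :: "mono \<Rightarrow> salg" and A
      by (induction A rule: infinite_finite_induct) (use c[of 0] poly_on_0 am(1) in auto)
    show "?P (\<Sum>N | coeff a N \<noteq> 0 \<and> time_part N \<in> {unit_mono}. const (coeff a N) * mon N)"
    proof (rule sP, rule am(2))
      fix N assume "N \<in> {N. coeff a N \<noteq> 0 \<and> time_part N \<in> {unit_mono}}"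
      then show "?P (mon N)" using 2[of "fst N" "snd N"] assms(1) unfolding poly_on_def by auto
    qed (simp add: poly_on_const c)
  qed
  ultimately show ?thesis by simp
qed

lemma u_poly_induct [consumes 1, case_names const U add mult]:
  assumes "u_poly a" "\<And>c. P (const c)" "\<And>j. P (even_gen (U j))"
    "\<And>a b. u_poly a \<Longrightarrow> u_poly b \<Longrightarrow> P a \<Longrightarrow> P b \<Longrightarrow> P (a + b)"
    "\<And>a b. u_poly a \<Longrightarrow> u_poly b \<Longrightarrow> P a \<Longrightarrow> P b \<Longrightarrow> P (a * b)"
  shows "P a"
  using assms(1)[unfolded u_poly_iff]
  by (rule poly_on_induct) (use assms(2-) u_poly_iff in auto)

lemma diff_poly_induct [consumes 1, case_names const U Th Sig add mult]:
  assumes "diff_poly a" "\<And>c. P (const c)" "\<And>j. P (even_gen (U j))"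
    "\<And>j. P (odd_gen (Th j))" "\<And>j. P (odd_gen (Sig j))"
    "\<And>a b. diff_poly a \<Longrightarrow> diff_poly b \<Longrightarrow> P a \<Longrightarrow> P b \<Longrightarrow> P (a + b)"
    "\<And>a b. diff_poly a \<Longrightarrow> diff_poly b \<Longrightarrow> P a \<Longrightarrow> P b \<Longrightarrow> P (a * b)"
  shows "P a"
  using assms(1)[unfolded diff_poly_iff]
  by (rule poly_on_induct) (use assms(2-) diff_poly_iff in auto)

lemma u_poly_closed:
  "u_poly 0" "u_poly 1" "u_poly (const c)" "u_poly (even_gen (U j))"
  "u_poly a \<Longrightarrow> u_poly b \<Longrightarrow> u_poly (a + b)" "u_poly a \<Longrightarrow> u_poly (- a)"
  "u_poly a \<Longrightarrow> u_poly b \<Longrightarrow> u_poly (a - b)" "u_poly a \<Longrightarrow> u_poly b \<Longrightarrow> u_poly (a * b)"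
  "(\<And>x. x \<in> A \<Longrightarrow> u_poly (f x)) \<Longrightarrow> u_poly (sum f A)"
  unfolding u_poly_iff by (auto intro: poly_on_intros poly_on_even)

lemma diff_poly_closed:
  "diff_poly 0" "diff_poly 1" "diff_poly (const c)" "diff_poly (even_gen (U j))"
  "diff_poly (odd_gen (Th j))" "diff_poly (odd_gen (Sig j))"
  "diff_poly a \<Longrightarrow> diff_poly b \<Longrightarrow> diff_poly (a + b)" "diff_poly a \<Longrightarrow> diff_poly (- a)"
  "diff_poly a \<Longrightarrow> diff_poly b \<Longrightarrow> diff_poly (a - b)" "diff_poly a \<Longrightarrow> diff_poly b \<Longrightarrow> diff_poly (a * b)"
  "(\<And>x. x \<in> A \<Longrightarrow> diff_poly (f x)) \<Longrightarrow> diff_poly (sum f A)"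
  unfolding diff_poly_iff by (auto intro: poly_on_intros poly_on_even poly_on_odd)

lemma u_diff_poly: "u_poly a \<Longrightarrow> diff_poly a"
  unfolding u_poly_iff diff_poly_iff by (rule poly_on_mono) auto

lemma diff_poly_sigma: "diff_poly (sigma k)"
  by (cases k) (auto intro: diff_poly_closed)

lemma par_sigma: "par (sigma k) = - sigma k"
  by (cases k) auto

lemma par_u_poly: "u_poly a \<Longrightarrow> par a = a"
  by (rule salg_eqI) (auto simp: coeff_par u_poly_def fcard.rep_eq)

lemma u_poly_cen: "u_poly a \<Longrightarrow> cen a"
  by (rule even_cen[OF par_u_poly])

lemma sder_diff_poly_zero:
  assumes "sder s D" "s 1 = 1" "diff_poly a" "\<And>j. D (even_gen (U j)) = 0"
    "\<And>j. D (odd_gen (Th j)) = 0" "\<And>j. D (odd_gen (Sig j)) = 0"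
  shows "D a = 0"
  using assms(3)
  by (induction rule: diff_poly_induct)
    (use assms in \<open>auto simp: sder_const lin_add[OF sder_lin] sder_mult\<close>)

lemma sder_u_poly_zero:
  assumes "sder s D" "s 1 = 1" "u_poly a" "\<And>j. D (even_gen (U j)) = 0"
  shows "D a = 0"
  using assms(3)
  by (induction rule: u_poly_induct)
    (use assms in \<open>auto simp: sder_const lin_add[OF sder_lin] sder_mult\<close>)

text \<open>The augmentation. It is a ring homomorphism to the complex numbers, because the unit
  monomial splits only trivially, and it fixes the constants that comparison of x-derivatives leaves
  open.\<close>

definition aug :: "salg \<Rightarrow> complex" where "aug a = coeff a unit_mono"

lemma aug_mult: "aug (a * b) = aug a * aug b"
proof -
  have "splits unit_mono = {(unit_mono, unit_mono)}"
    by (auto simp: splits_def unit_mono_def prod_eq_iff)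
  then show ?thesis
    by (simp add: aug_def coeff_mult mul_coeff_def unit_mono_def)
qed

lemma aug_simps [simp]:
  "aug 0 = 0" "aug 1 = 1" "aug (const c) = c" "aug (a + b) = aug a + aug b" "aug (a - b) = aug a - aug b"
  "aug (- a) = - aug a" "aug (even_gen x) = 0" "aug (odd_gen y) = 0" "aug (a * b) = aug a * aug b"
  by (simp_all add: aug_def coeff_zero coeff_one coeff_const coeff_add coeff_diff coeff_uminus
      even_gen_mon odd_gen_mon coeff_mon aug_mult[unfolded aug_def]) (auto simp add: unit_mono_def fset_eq_iff)

lemma aug_sum: "aug (sum f A) = (\<Sum>x\<in>A. aug (f x))"
  by (induction A rule: infinite_finite_induct) auto

lemma aug_odd:
  assumes "par a = - a"
  shows "aug a = 0"
proof -
  have "aug a = - aug a"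
    using arg_cong[OF assms, of "\<lambda>x. coeff x unit_mono"]
    by (simp add: aug_def coeff_par coeff_uminus unit_mono_def fcard.rep_eq)
  then have "2 * aug a = 0" by (metis add.right_inverse mult_2)
  then show ?thesis by simp
qed

lemma aug_sder_diff_poly:
  assumes "sder s D" "s = id \<or> s = par" "diff_poly a" "\<And>j. aug (D (even_gen (U j))) = 0"
    "\<And>j. aug (D (odd_gen (Th j))) = 0" "\<And>j. aug (D (odd_gen (Sig j))) = 0"
  shows "aug (D a) = 0"
proof -
  have "s 1 = 1" using assms(2) by auto
  with assms(3) show ?thesis
    by (induction rule: diff_poly_induct)
      (use assms in \<open>auto simp: sder_const lin_add[OF sder_lin] sder_mult\<close>)
qed

subsection \<open>Partial derivatives and derivations with prescribed values\<close>

definition pde :: "evar \<Rightarrow> salg \<Rightarrow> salg" where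
  "pde x a = Salg (\<lambda>M. of_nat (Suc (count (fst M) x)) * coeff a (add_mset x (fst M), snd M))"

text \<open>The left derivative: the sign accounts for moving \<open>y\<close> to the front of the
  monomial before it is removed.\<close>

definition pdo :: "ovar \<Rightarrow> salg \<Rightarrow> salg" where
  "pdo y a = Salg (\<lambda>M. if y |\<in>| snd M then 0 else sgn_odd {|y|} (snd M) * coeff a (fst M, finsert y (snd M)))"

lemma time_part_add:
  "time_part (add_mset x (fst M), snd M)
     \<in> {time_part (add_mset x (fst (time_part M)), snd (time_part M)), time_part M}"
  by (cases "is_T x") (simp_all add: time_part_def multiset_eq_iff fset_eq_iff)

lemma time_part_finsert:
  "time_part (fst M, finsert y (snd M))
     \<in> {time_part (fst (time_part M), finsert y (snd (time_part M))), time_part M}"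
  by (cases "is_Tau y") (auto simp: time_part_def multiset_eq_iff fset_eq_iff)

lemma coeff_pde: "coeff (pde x a) M = of_nat (Suc (count (fst M) x)) * coeff a (add_mset x (fst M), snd M)"
proof -
  let ?f = "\<lambda>M. of_nat (Suc (count (fst M) x)) * coeff a (add_mset x (fst M), snd M)"
  have "finite {M. ?f M \<noteq> 0 \<and> time_part M = Q}" for Q
  proof (rule finite_subset)
    let ?g = "\<lambda>M :: mono. (add_mset x (fst M), snd M)"
    let ?Q = "{time_part (?g Q), Q}"
    show "{M. ?f M \<noteq> 0 \<and> time_part M = Q} \<subseteq> ?g -` {N. coeff a N \<noteq> 0 \<and> time_part N \<in> ?Q}"
      using time_part_add[of x] by auto
    show "finite (?g -` {N. coeff a N \<noteq> 0 \<and> time_part N \<in> ?Q})"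
      by (rule finite_vimageI[OF finite_supp_time]) (auto simp: inj_def prod_eq_iff)
  qed
  then show ?thesis unfolding pde_def by (simp add: Salg_inverse)
qed

lemma coeff_pdo:
  "coeff (pdo y a) M = (if y |\<in>| snd M then 0 else sgn_odd {|y|} (snd M) * coeff a (fst M, finsert y (snd M)))"
proof -
  let ?f = "\<lambda>M. if y |\<in>| snd M then 0 else sgn_odd {|y|} (snd M) * coeff a (fst M, finsert y (snd M))"
  have "finite {M. ?f M \<noteq> 0 \<and> time_part M = Q}" for Q
  proof (rule finite_subset)
    let ?g = "\<lambda>M :: mono. (fst M, snd M |-| {|y|})"
    let ?Q = "{time_part (fst Q, finsert y (snd Q)), Q}"
    show "{M. ?f M \<noteq> 0 \<and> time_part M = Q} \<subseteq> ?g ` {N. coeff a N \<noteq> 0 \<and> time_part N \<in> ?Q}"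
    proof
      fix M assume M: "M \<in> {M. ?f M \<noteq> 0 \<and> time_part M = Q}"
      have "M = ?g (fst M, finsert y (snd M))" using M by (auto simp: prod_eq_iff split: if_splits)
      moreover have "time_part (fst M, finsert y (snd M)) \<in> ?Q"
        using M time_part_finsert[of M y] by auto
      ultimately show "M \<in> ?g ` {N. coeff a N \<noteq> 0 \<and> time_part N \<in> ?Q}"
        using M by (intro image_eqI[of _ _ "(fst M, finsert y (snd M))"]) (auto split: if_splits)
    qed
    show "finite (?g ` {N. coeff a N \<noteq> 0 \<and> time_part N \<in> ?Q})"
      by (rule finite_imageI[OF finite_supp_time]) auto
  qed
  then show ?thesis unfolding pdo_def by (simp add: Salg_inverse)
qed

lemma lin_pde: "lin (pde x)"
  unfolding lin_def by (auto intro!: salg_eqI simp: coeff_pde coeff_add coeff_const_mult algebra_simps)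

lemma lin_pdo: "lin (pdo y)"
  unfolding lin_def by (auto intro!: salg_eqI simp: coeff_pdo coeff_add coeff_const_mult algebra_simps)

lemma pde_par: "pde x (par a) = par (pde x a)"
  by (rule salg_eqI) (simp add: coeff_pde coeff_par)

lemma pdo_par: "pdo y (par a) = - par (pdo y a)"
  by (rule salg_eqI) (auto simp: coeff_pdo coeff_par coeff_uminus fcard.rep_eq)

lemma scont_pde: "scont (pde x)"
  unfolding scont_def
proof
  fix P
  show "\<exists>Q. finite Q \<and> (\<forall>a. (\<forall>N. time_part N \<in> Q \<longrightarrow> coeff a N = 0) \<longrightarrow>
      (\<forall>M. time_part M = P \<longrightarrow> coeff (pde x a) M = 0))"
    by (rule exI[of _ "{time_part (add_mset x (fst P), snd P), P}"])
      (use time_part_add in \<open>auto simp: coeff_pde\<close>)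
qed

lemma scont_pdo: "scont (pdo y)"
  unfolding scont_def
proof
  fix P
  show "\<exists>Q. finite Q \<and> (\<forall>a. (\<forall>N. time_part N \<in> Q \<longrightarrow> coeff a N = 0) \<longrightarrow>
      (\<forall>M. time_part M = P \<longrightarrow> coeff (pdo y a) M = 0))"
    by (rule exI[of _ "{time_part (fst P, finsert y (snd P)), P}"])
      (use time_part_finsert in \<open>auto simp: coeff_pdo\<close>)
qed

text \<open>The defect of the product rule is linear and continuous in each argument, so it is
  enough that it vanishes on monomials; the two arguments are extended one after the other.\<close>

lemma leibniz_ext:
  assumes "lin D" "scont D" "lin s" "scont s"
    "\<And>M N. D (mon M * mon N) = D (mon M) * mon N + s (mon M) * D (mon N)"
  shows "sder s D"
proof -
  note lc = lin_add[OF assms(1)] lin_const_mult[OF assms(1)] lin_add[OF assms(3)] lin_const_mult[OF assms(3)]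
  have 1: "D (mon M * b) = D (mon M) * b + s (mon M) * D b" for M b
  proof -
    have "D (mon M * b) - D (mon M) * b - s (mon M) * D b = 0"
    proof (rule lin_zero_ext[where D = "\<lambda>b. D (mon M * b) - D (mon M) * b - s (mon M) * D b"])
      show "lin (\<lambda>b. D (mon M * b) - D (mon M) * b - s (mon M) * D b)"
        unfolding lin_def by (simp add: lc distrib_left distrib_right const_left_commute right_diff_distrib)
      show "time_continuous (\<lambda>b. D (mon M * b) - D (mon M) * b - s (mon M) * D b)"
        by (intro scont_tc scont_diff scont_comp[OF assms(2)] scont_comp[OF scont_mult_left assms(2)] scont_mult_left)
    qed (simp add: assms(5))
    then show ?thesis by (simp add: algebra_simps)
  qed
  have "D (a * b) - D a * b - s a * D b = 0" for a b
  proof (rule lin_zero_ext[where D = "\<lambda>a. D (a * b) - D a * b - s a * D b"])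
    show "lin (\<lambda>a. D (a * b) - D a * b - s a * D b)"
      unfolding lin_def by (simp add: lc distrib_left distrib_right mult.assoc right_diff_distrib)
    show "time_continuous (\<lambda>a. D (a * b) - D a * b - s a * D b)"
      by (intro scont_tc scont_diff scont_comp[OF assms(2)] scont_comp[OF scont_mult_right assms(2)]
          scont_comp[OF scont_mult_right assms(4)] scont_mult_right)
  qed (simp add: 1)
  then show ?thesis using assms(1) unfolding sder_def by (simp add: algebra_simps)
qed

lemma pde_mon: "pde x (mon (A, B)) = of_nat (count A x) * mon (A - {#x#}, B)"
proof (rule salg_eqI)
  fix M
  show "coeff (pde x (mon (A, B))) M = coeff (of_nat (count A x) * mon (A - {#x#}, B)) M"
    unfolding const_of_nat[symmetric] coeff_const_mult coeff_pde coeff_mon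
    by (cases M) (auto simp: not_in_iff dest: arg_cong[of _ _ "\<lambda>A. A - {#x#}"], metis insert_DiffM not_in_iff)
qed

lemma sder_pde: "sder id (pde x)"
proof (rule leibniz_ext[OF lin_pde scont_pde])
  show "lin id" "scont id" by (auto simp: lin_def scont_def)
  fix M N :: Defs.mono
  obtain A B C D where M: "M = (A, B)" and N: "N = (C, D)" by (cases M; cases N)
  have 1: "of_nat (count A x) * mon (A + C - {#x#}, B |\<union>| D) = of_nat (count A x) * mon (A - {#x#} + C, B |\<union>| D)"
  proof (cases "x \<in># A")
    case True
    then have "A + C - {#x#} = A - {#x#} + C"
      using diff_union_single_conv[of x A C] by (simp only: add.commute)
    then show ?thesis by simp
  next
    case False
    then have "count A x = 0" by (simp only: not_in_iff)
    then show ?thesis by simp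
  qed
  have 2: "of_nat (count C x) * mon (A + C - {#x#}, B |\<union>| D) = of_nat (count C x) * mon (A + (C - {#x#}), B |\<union>| D)"
  proof (cases "x \<in># C")
    case True
    then show ?thesis by (simp only: diff_union_single_conv)
  next
    case False
    then have "count C x = 0" by (simp only: not_in_iff)
    then show ?thesis by simp
  qed
  have c: "const c * (of_nat n * a) = of_nat n * (const c * a)" for c n a
    by (metis const_left_commute const_of_nat)
  have c': "a * (of_nat n * b) = of_nat n * (a * b)" for n and a b :: salg
    by (metis const_left_commute const_of_nat)
  show "pde x (mon M * mon N) = pde x (mon M) * mon N + id (mon M) * pde x (mon N)"
    unfolding M N
    by (simp add: mon_mult pde_mon lin_const_mult[OF lin_pde] lin_0[OF lin_pde] mult.assoc c c'
        distrib_left distrib_right 1 2)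
qed

lemma pdo_mon_free: "y |\<notin>| B \<Longrightarrow> pdo y (mon (A, B)) = 0"
  by (rule salg_eqI) (auto simp: coeff_pdo coeff_mon coeff_zero)

lemma pdo_mult_mon_free: "y |\<notin>| B \<Longrightarrow> pdo y (odd_gen y * mon (A, B)) = mon (A, B)"
proof (rule salg_eqI)
  fix M :: Defs.mono
  assume y: "y |\<notin>| B"
  have "odd_gen y * mon (A, B) = const (sgn_odd {|y|} B) * mon (A, finsert y B)"
    using y by (simp add: mon_insert_odd const_mult_assoc)
  moreover have "finsert y (snd M) = finsert y B \<longleftrightarrow> snd M = B" if "y |\<notin>| snd M"
    using y that by (metis finsert_ident)
  ultimately show "coeff (pdo y (odd_gen y * mon (A, B))) M = coeff (mon (A, B)) M"
    using y by (cases M) (auto simp: coeff_pdo coeff_const_mult coeff_mon)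
qed

lemma pdo_free_product:
  assumes "y |\<notin>| snd M" "y |\<notin>| snd N"
  shows "pdo y (mon M * mon N) = 0" "pdo y (odd_gen y * (mon M * mon N)) = mon M * mon N"
  using assms
  by (simp_all add: mon_mult lin_const_mult[OF lin_pdo] lin_0[OF lin_pdo] pdo_mon_free
      const_left_commute[of "odd_gen y"] pdo_mult_mon_free)

lemma mon_odd_decomp:
  assumes "y |\<in>| snd M"
  obtains c N where "y |\<notin>| snd N" "mon M = const c * (odd_gen y * mon N)"
proof -
  let ?N = "(fst M, snd M |-| {|y|})"
  have "M = (fst M, finsert y (snd M |-| {|y|}))"
    using assms by (metis finsert_fminus prod.collapse)
  then have "mon M = const (sgn_odd {|y|} (snd M |-| {|y|})) * (odd_gen y * mon ?N)"
    using mon_insert_odd[of y "snd M |-| {|y|}" "fst M"] by simp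
  then show ?thesis using that[of ?N] by simp
qed

lemma par_mon: "par (mon M) = const ((-1) ^ fcard (snd M)) * mon M"
  by (rule salg_eqI) (simp add: coeff_par coeff_mon coeff_const_mult)

lemma sder_pdo: "sder par (pdo y)"
proof (rule leibniz_ext[OF lin_pdo scont_pdo lin_par scont_par])
  fix M N
  note lc = lin_const_mult[OF lin_pdo] lin_const_mult[OF lin_par]
  have oc: "a * odd_gen y = odd_gen y * par a" for a
    using odd_commute[of "odd_gen y" "par a"] by simp
  have oc2: "a * (odd_gen y * b) = odd_gen y * (par a * b)" for a b
    using oc by (metis mult.assoc)
  have yy: "odd_gen y * (odd_gen y * a) = 0" for a
    using odd_square[of "odd_gen y"] by (simp flip: mult.assoc)
  have M0: "y |\<notin>| snd M \<Longrightarrow> pdo y (mon M) = 0" for M using pdo_mon_free[of y "snd M" "fst M"] by simp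
  have M1: "y |\<notin>| snd M \<Longrightarrow> pdo y (odd_gen y * mon M) = mon M" for M
    using pdo_mult_mon_free[of y "snd M" "fst M"] by simp
  consider "y |\<notin>| snd M" "y |\<notin>| snd N" | c M' where "y |\<notin>| snd M'" "mon M = const c * (odd_gen y * mon M')" "y |\<notin>| snd N"
    | c N' where "y |\<notin>| snd N'" "mon N = const c * (odd_gen y * mon N')" "y |\<notin>| snd M"
    | c d M' N' where "y |\<notin>| snd M'" "mon M = const c * (odd_gen y * mon M')" "y |\<notin>| snd N'" "mon N = const d * (odd_gen y * mon N')"
    using mon_odd_decomp by metis
  then show "pdo y (mon M * mon N) = pdo y (mon M) * mon N + par (mon M) * pdo y (mon N)"
  proof cases
    case 1
    then show ?thesis by (simp add: pdo_free_product M0)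
  next
    case 2
    then show ?thesis
      by (simp add: mult.assoc lc pdo_free_product M0 M1)
  next
    case 3
    have "pdo y (odd_gen y * (par (mon M) * mon N')) = par (mon M) * mon N'"
      using 3 by (simp add: par_mon mult.assoc const_left_commute[of "odd_gen y"] lc pdo_free_product)
    then show ?thesis
      using 3 by (simp add: mult.assoc lc const_left_commute[of "mon M"] const_left_commute[of "par (mon M)"]
          oc2[of "mon M"] M0 M1)
  next
    case 4
    show ?thesis
      unfolding 4(2,4)
      using 4(1,3) by (simp add: mult.assoc lc par_mult oc2[of "mon M'"] yy M1 lin_0[OF lin_pdo]
          const_left_commute[of "odd_gen y"] const_left_commute[of "mon M'"] const_left_commute[of "par (mon M')"])
  qed
qed

lemma pde_even_gen: "pde x (even_gen z) = (if x = z then 1 else 0)"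
  using mon_unit by (auto simp: even_gen_mon pde_mon unit_mono_def)

lemma pde_odd_gen: "pde x (odd_gen z) = 0"
  by (simp add: odd_gen_mon pde_mon)

lemma pdo_even_gen: "pdo y (even_gen z) = 0"
  by (simp add: even_gen_mon pdo_mon_free)

lemma pdo_odd_gen: "pdo y (odd_gen z) = (if y = z then 1 else 0)"
  using mon_unit pdo_mult_mon_free[of y "{||}" "{#}"] pdo_mon_free[of y "{|z|}" "{#}"]
  by (auto simp: unit_mono_def odd_gen_mon)

text \<open>A nonconstant monomial of \<open>a\<close> survives differentiation by any generator it
  contains: the multiplicity is nonzero in characteristic 0, and distinct monomials stay
  distinct.\<close>

lemma diff_poly_const_iff:
  assumes "diff_poly a" "\<And>j. pde (U j) a = 0" "\<And>j. pdo (Th j) a = 0" "\<And>j. pdo (Sig j) a = 0"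
  shows "a = const (aug a)"
proof (rule salg_eqI)
  fix M
  show "coeff a M = coeff (const (aug a)) M"
  proof (cases "coeff a M = 0")
    case True
    then show ?thesis by (auto simp: coeff_const aug_def)
  next
    case False
    then have M: "set_mset (fst M) \<subseteq> range U" "fset (snd M) \<subseteq> range Th \<union> range Sig"
      using assms(1) unfolding diff_poly_def by blast+
    have "fst M = {#}"
    proof (rule ccontr)
      assume "fst M \<noteq> {#}"
      then obtain x A where A: "fst M = add_mset x A" by (metis multiset_cases)
      then obtain j where "x = U j" using M(1) by auto
      then have "coeff (pde (U j) a) (A, snd M) = of_nat (Suc (count A x)) * coeff a M"
        using A by (simp add: coeff_pde prod_eq_iff) (metis prod.collapse)
      then show False using False assms(2)[of j] by (simp add: coeff_zero del: of_nat_Suc)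
    qed
    moreover have "snd M = {||}"
    proof (rule ccontr)
      assume "snd M \<noteq> {||}"
      then obtain y where y: "y |\<in>| snd M" by auto
      have "coeff (pdo y a) (fst M, snd M |-| {|y|}) = sgn_odd {|y|} (snd M |-| {|y|}) * coeff a M"
        using y by (simp add: coeff_pdo finsert_absorb)
      moreover have "pdo y a = 0" using y M(2) assms(3,4) by auto
      ultimately show False using False sgn_odd_square by (metis coeff_zero mult_eq_0_iff zero_neq_one)
    qed
    ultimately have "M = unit_mono" by (simp add: unit_mono_def prod_eq_iff)
    then show ?thesis by (simp add: coeff_const aug_def)
  qed
qed

lemma lin_mult_left: "lin (\<lambda>b. a * b)"
  unfolding lin_def using const_left_commute distrib_left by blast

lemma lin_mult_right: "lin (\<lambda>b. b * a)"
  unfolding lin_def using mult.assoc distrib_right by blast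

lemma ssum_subs:
  assumes "ssum g" "\<And>k M. coeff (h k) M \<noteq> 0 \<Longrightarrow> \<exists>N. N \<in> subs M \<and> coeff (g k) N \<noteq> 0"
  shows "ssum h"
  unfolding ssum_def
proof
  fix P
  have "{k. \<exists>M. time_part M = P \<and> coeff (h k) M \<noteq> 0} \<subseteq> {k. \<exists>M. time_part M \<in> subs P \<and> coeff (g k) M \<noteq> 0}"
  proof (intro Collect_mono impI)
    fix k assume "\<exists>M. time_part M = P \<and> coeff (h k) M \<noteq> 0"
    then obtain M where M: "time_part M = P" "coeff (h k) M \<noteq> 0" by blast
    then obtain N where "N \<in> subs M" "coeff (g k) N \<noteq> 0" using assms(2) by blast
    then show "\<exists>M. time_part M \<in> subs P \<and> coeff (g k) M \<noteq> 0" using M(1) time_part_subs by blast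
  qed
  then show "finite {k. \<exists>M. time_part M = P \<and> coeff (h k) M \<noteq> 0}"
    using ssum_finite[OF assms(1) finite_subs] finite_subset by blast
qed

lemma ssum_mult_right: "ssum g \<Longrightarrow> ssum (\<lambda>k. g k * b)"
  by (erule ssum_subs) (blast elim: coeff_mult_nonzero dest: splits_subs)

lemma ssum_mult_left: "ssum g \<Longrightarrow> ssum (\<lambda>k. b * g k)"
  by (erule ssum_subs) (blast elim: coeff_mult_nonzero dest: splits_subs)

lemma ssum_pd:
  assumes "\<And>k M. coeff (pd k a) M \<noteq> 0 \<Longrightarrow> \<exists>N. time_part N = time_part M \<and> coeff a N \<noteq> 0 \<and> k \<in> I N"
    and "\<And>N. finite (I N)"
  shows "ssum (\<lambda>k. v k * pd k a)"
  unfolding ssum_def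
proof
  fix P
  have "{k. \<exists>M. time_part M = P \<and> coeff (v k * pd k a) M \<noteq> 0}
      \<subseteq> (\<Union>N\<in>{N. coeff a N \<noteq> 0 \<and> time_part N \<in> subs P}. I N)"
  proof
    fix k assume "k \<in> {k. \<exists>M. time_part M = P \<and> coeff (v k * pd k a) M \<noteq> 0}"
    then obtain M where M: "time_part M = P" "coeff (v k * pd k a) M \<noteq> 0" by blast
    then obtain A B where "(A, B) \<in> splits M" "coeff (pd k a) B \<noteq> 0" by (blast elim: coeff_mult_nonzero)
    then show "k \<in> (\<Union>N\<in>{N. coeff a N \<noteq> 0 \<and> time_part N \<in> subs P}. I N)"
      using assms(1)[of k B] M(1) splits_subs time_part_subs by fastforce
  qed
  then show "finite {k. \<exists>M. time_part M = P \<and> coeff (v k * pd k a) M \<noteq> 0}"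
    using finite_supp_time[OF finite_subs] assms(2) by (meson finite_UN_I finite_subset)
qed

text \<open>The hypothesis on \<open>pd\<close> holds for partial derivatives by generators other
  than times: they leave the time part alone, and the index must occur in a monomial of
  \<open>a\<close>. Hence the sum over all jets is locally finite and continuous.\<close>

lemma even_derivation_lsum_pd:
  assumes nz: "\<And>k a M. coeff (pd k a) M \<noteq> 0 \<Longrightarrow> \<exists>N. time_part N = time_part M \<and> coeff a N \<noteq> 0 \<and> k \<in> I N"
    and I: "\<And>N. finite (I N)"
    and der: "\<And>k. sder id (\<lambda>a. v k * pd k a)" and p: "\<And>k a. v k * pd k (par a) = par (v k * pd k a)"
  shows "even_derivation (\<lambda>a. lsum (\<lambda>k. v k * pd k a))"
proof -
  have ss: "ssum (\<lambda>k. v k * pd k a)" for a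
    by (rule ssum_pd[where I = I]) (fact nz, fact I)
  have ap: "D (lsum (\<lambda>k. v k * pd k a)) = lsum (\<lambda>k. D (v k * pd k a))" if "lin D" "scont D" for D a
    by (rule lsum_apply[OF that(1) scont_tc[OF that(2)] ss])
  have "scont (\<lambda>a. lsum (\<lambda>k. v k * pd k a))"
    unfolding scont_def
  proof
    fix P
    have "coeff (lsum (\<lambda>k. v k * pd k a)) M = 0"
      if a: "\<And>N. time_part N \<in> subs P \<Longrightarrow> coeff a N = 0" "time_part M = P" for a M
    proof -
      have "coeff (v k * pd k a) N = 0" if "time_part N = P" for k N
      proof (rule coeff_mult_zeroI, rule disjI2, rule ccontr)
        fix A B assume "(A, B) \<in> splits N" "coeff (pd k a) B \<noteq> 0"
        then show False using nz[of k a B] a(1) that splits_subs time_part_subs by metis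
      qed
      then show ?thesis by (subst coeff_lsum_set[OF ss, where K = "{}" and P = P]) (use a(2) in auto)
    qed
    then show "\<exists>Q. finite Q \<and> (\<forall>a. (\<forall>N. time_part N \<in> Q \<longrightarrow> coeff a N = 0) \<longrightarrow>
        (\<forall>M. time_part M = P \<longrightarrow> coeff (lsum (\<lambda>k. v k * pd k a)) M = 0))"
      by (intro exI[of _ "subs P"] conjI finite_subs) simp
  qed
  moreover have "sder id (\<lambda>a. lsum (\<lambda>k. v k * pd k a))"
    unfolding sder_def
  proof (intro conjI allI)
    show "lin (\<lambda>a. lsum (\<lambda>k. v k * pd k a))"
      unfolding lin_def
    proof (intro conjI allI)
      fix a b c
      show "lsum (\<lambda>k. v k * pd k (a + b)) = lsum (\<lambda>k. v k * pd k a) + lsum (\<lambda>k. v k * pd k b)"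
        by (simp only: lin_add[OF sder_lin[OF der]]) (rule lsum_add[OF ss ss])
      show "lsum (\<lambda>k. v k * pd k (const c * a)) = const c * lsum (\<lambda>k. v k * pd k a)"
      proof -
        have "v k * pd k (const c * a) = const c * (v k * pd k a)" for k
          using lin_const_mult[OF sder_lin[OF der]] by blast
        then show ?thesis by (simp only: ap[OF lin_mult_left scont_mult_left])
      qed
    qed
    fix a b
    have 1: "lsum (\<lambda>k. v k * pd k a) * b = lsum (\<lambda>k. v k * pd k a * b)"
      by (rule ap[OF lin_mult_right scont_mult_right])
    have 2: "a * lsum (\<lambda>k. v k * pd k b) = lsum (\<lambda>k. a * (v k * pd k b))"
      by (rule ap[OF lin_mult_left scont_mult_left])
    show "lsum (\<lambda>k. v k * pd k (a * b)) = lsum (\<lambda>k. v k * pd k a) * b + id a * lsum (\<lambda>k. v k * pd k b)"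
      unfolding 1 2 id_apply using sder_mult[OF der] lsum_add[OF ssum_mult_right[OF ss] ssum_mult_left[OF ss]]
      by (simp only: id_apply)
  qed
  moreover have "lsum (\<lambda>k. v k * pd k (par a)) = par (lsum (\<lambda>k. v k * pd k a))" for a
    unfolding p by (rule ap[symmetric, OF lin_par scont_par])
  ultimately show ?thesis by (simp add: even_derivation_iff scont_tc)
qed

lemma sder_mult_pde: "par v = v \<Longrightarrow> sder id (\<lambda>a. v * pde x a)"
proof -
  assume v: "par v = v"
  then have c: "a * v = v * a" for a using even_cen unfolding cen_def by metis
  show ?thesis
    using sder_mult[OF sder_pde] lin_add[OF lin_pde] lin_const_mult[OF lin_pde]
    unfolding sder_def lin_def
    by (simp add: distrib_left const_left_commute[of v] mult.assoc) (metis c mult.assoc)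
qed

lemma sder_mult_pdo: "par v = - v \<Longrightarrow> sder id (\<lambda>a. v * pdo y a)"
proof -
  assume v: "par v = - v"
  have c: "v * (par a * b) = a * (v * b)" for a b
    using odd_commute[OF v, of "par a"] by (metis mult.assoc par_par)
  show ?thesis
    using sder_mult[OF sder_pdo] lin_add[OF lin_pdo] lin_const_mult[OF lin_pdo]
    unfolding sder_def lin_def
    by (simp add: distrib_left const_left_commute[of v] mult.assoc c)
qed

text \<open>The vector field with values \<open>v\<close> and \<open>w\<close> on the generators
  other than the times, which it annihilates. Both the Galilean symmetry and the Virasoro flows are
  constructed in this way.\<close>

definition derv :: "(evar \<Rightarrow> salg) \<Rightarrow> (ovar \<Rightarrow> salg) \<Rightarrow> salg \<Rightarrow> salg" where
  "derv v w a = lsum (\<lambda>k. v (U k) * pde (U k) a) + lsum (\<lambda>k. v (F k) * pde (F k) a) +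
     lsum (\<lambda>k. w (Th k) * pdo (Th k) a) + lsum (\<lambda>k. w (Sig k) * pdo (Sig k) a)"

lemma even_derivation_add:
  "even_derivation D \<Longrightarrow> even_derivation E \<Longrightarrow> even_derivation (\<lambda>a. D a + E a)"
  unfolding even_derivation_def
proof (elim conjE, intro conjI)
  assume D: "time_continuous D" "time_continuous E"
  show "time_continuous (\<lambda>a. D a + E a)"
    unfolding time_continuous_def
  proof
    fix M
    obtain Q where Q: "finite Q" "\<forall>b. (\<forall>N. time_part N \<in> Q \<longrightarrow> coeff b N = 0) \<longrightarrow> coeff (D b) M = 0"
      using D(1) unfolding time_continuous_def by blast
    obtain Q' where Q': "finite Q'" "\<forall>b. (\<forall>N. time_part N \<in> Q' \<longrightarrow> coeff b N = 0) \<longrightarrow> coeff (E b) M = 0"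
      using D(2) unfolding time_continuous_def by blast
    show "\<exists>Q. finite Q \<and> (\<forall>a. (\<forall>N. time_part N \<in> Q \<longrightarrow> coeff a N = 0) \<longrightarrow> coeff (D a + E a) M = 0)"
      by (intro exI[of _ "Q \<union> Q'"]) (use Q Q' in \<open>auto simp: coeff_add\<close>)
  qed
qed (simp_all add: distrib_left distrib_right lin_add[OF lin_par])

lemma pde_nonzero:
  assumes "coeff (pde x a) M \<noteq> 0" "\<not> is_T x"
  shows "\<exists>N. time_part N = time_part M \<and> coeff a N \<noteq> 0 \<and> x \<in># fst N"
  using assms by (intro exI[of _ "(add_mset x (fst M), snd M)"]) (auto simp: coeff_pde time_part_def)

lemma pdo_nonzero:
  assumes "coeff (pdo y a) M \<noteq> 0" "\<not> is_Tau y"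
  shows "\<exists>N. time_part N = time_part M \<and> coeff a N \<noteq> 0 \<and> y |\<in>| snd N"
  using assms by (intro exI[of _ "(fst M, finsert y (snd M))"])
    (auto simp: coeff_pdo time_part_def fset_eq_iff split: if_splits)

theorem even_derivation_derv:
  assumes "\<And>x. par (v x) = v x" "\<And>y. par (w y) = - w y"
  shows "even_derivation (derv v w)"
proof -
  have vpar: "v x * pde x (par a) = par (v x * pde x a)" for x a
    by (simp add: assms pde_par par_mult)
  have wpar: "w x * pdo x (par a) = par (w x * pdo x a)" for x a
    by (simp add: assms pdo_par par_mult)
  have "even_derivation (\<lambda>a. lsum (\<lambda>k. v (U k) * pde (U k) a))"
    by (rule even_derivation_lsum_pd[where I = "\<lambda>N. U -` set_mset (fst N)"])
      (use pde_nonzero in \<open>auto intro!: finite_vimageI sder_mult_pde vpar assms simp: inj_def\<close>)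
  moreover have "even_derivation (\<lambda>a. lsum (\<lambda>k. v (F k) * pde (F k) a))"
    by (rule even_derivation_lsum_pd[where I = "\<lambda>N. F -` set_mset (fst N)"])
      (use pde_nonzero in \<open>auto intro!: finite_vimageI sder_mult_pde vpar assms simp: inj_def\<close>)
  moreover have "even_derivation (\<lambda>a. lsum (\<lambda>k. w (Th k) * pdo (Th k) a))"
    by (rule even_derivation_lsum_pd[where I = "\<lambda>N. Th -` fset (snd N)"])
      (use pdo_nonzero in \<open>auto intro!: finite_vimageI sder_mult_pdo wpar assms simp: inj_def\<close>)
  moreover have "even_derivation (\<lambda>a. lsum (\<lambda>k. w (Sig k) * pdo (Sig k) a))"
    by (rule even_derivation_lsum_pd[where I = "\<lambda>N. Sig -` fset (snd N)"])
      (use pdo_nonzero in \<open>auto intro!: finite_vimageI sder_mult_pdo wpar assms simp: inj_def\<close>)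
  ultimately show ?thesis
    using even_derivation_add unfolding derv_def[abs_def] by blast
qed

lemma derv_gen:
  "derv v w (even_gen (T k)) = 0" "derv v w (odd_gen (Tau k)) = 0"
  "derv v w (even_gen (U k)) = v (U k)" "derv v w (even_gen (F k)) = v (F k)"
  "derv v w (odd_gen (Th k)) = w (Th k)" "derv v w (odd_gen (Sig k)) = w (Sig k)"
  by (simp_all add: derv_def pde_even_gen pde_odd_gen pdo_even_gen pdo_odd_gen lsum_zero if_distrib
      lsum_delta cong: if_cong)

subsection \<open>Iterated derivations\<close>

text \<open>The elements of a subalgebra all of whose \<open>dx\<close>-derivatives stay in it again form a
  subalgebra, which is closed under \<open>dx\<close>.\<close>

definition subalg :: "(salg \<Rightarrow> bool) \<Rightarrow> bool" where
  "subalg V \<longleftrightarrow> (\<forall>c. V (const c)) \<and> (\<forall>a b. V a \<longrightarrow> V b \<longrightarrow> V (a + b) \<and> V (a * b))"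

definition jets :: "(salg \<Rightarrow> salg) \<Rightarrow> (salg \<Rightarrow> bool) \<Rightarrow> salg \<Rightarrow> bool" where
  "jets dx V a \<longleftrightarrow> (\<forall>i. V ((dx ^^ i) a))"

lemma subalg_ker: "sder s C \<Longrightarrow> s 1 = 1 \<Longrightarrow> subalg (\<lambda>a. C a = 0)"
  by (simp add: subalg_def sder_const lin_add[OF sder_lin] sder_mult)

lemma lin_funpow: "lin dx \<Longrightarrow> lin (dx ^^ i)"
  by (induction i) (auto simp: lin_def)

lemma jets_dx: "jets dx V a \<Longrightarrow> jets dx V (dx a)"
  unfolding jets_def by (metis funpow_simps_right(2) o_apply)

lemma jets_0: "jets dx V a \<Longrightarrow> V a"
  unfolding jets_def by (metis funpow_0)

lemma jetsI: "V a \<Longrightarrow> jets dx V (dx a) \<Longrightarrow> jets dx V a"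
  unfolding jets_def
proof
  fix i assume "V a" "\<forall>i. V ((dx ^^ i) (dx a))"
  then show "V ((dx ^^ i) a)" by (cases i) (simp_all add: funpow_swap1)
qed

lemma jets_add: "lin dx \<Longrightarrow> subalg V \<Longrightarrow> jets dx V a \<Longrightarrow> jets dx V b \<Longrightarrow> jets dx V (a + b)"
  using lin_add[OF lin_funpow] by (simp add: jets_def subalg_def)

lemma jets_const: "sder id dx \<Longrightarrow> subalg V \<Longrightarrow> jets dx V (const c)"
proof -
  assume dx: "sder id dx" and V: "subalg V"
  have "(dx ^^ i) 0 = 0" for i using lin_0[OF lin_funpow[OF sder_lin[OF dx]]] .
  then have "(dx ^^ i) (const c) = (if i = 0 then const c else const 0)" for i
    using sder_const[OF dx, of c] by (cases i) (simp_all add: funpow_swap1)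
  moreover have "V (const c)" "V (const 0)" using V unfolding subalg_def by blast+
  ultimately show ?thesis unfolding jets_def by simp
qed

lemma jets_mult:
  assumes dx: "sder id dx" and V: "subalg V" and a: "jets dx V a" and b: "jets dx V b"
  shows "jets dx V (a * b)"
proof -
  have "V ((dx ^^ i) (a * b))" for i
    using a b
  proof (induction i arbitrary: a b)
    case 0
    then have "V a" "V b" by (auto dest: jets_0)
    then show ?case using V by (simp add: subalg_def)
  next
    case (Suc i)
    have "(dx ^^ Suc i) (a * b) = (dx ^^ i) (dx a * b) + (dx ^^ i) (a * dx b)"
      by (simp add: funpow_swap1 sder_mult[OF dx] lin_add[OF lin_funpow[OF sder_lin[OF dx]]])
    then show ?case
      using Suc.IH[of "dx a" b] Suc.IH[of a "dx b"] Suc.prems jets_dx V by (auto simp: subalg_def)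
  qed
  then show ?thesis by (simp add: jets_def)
qed

lemma jets_P1:
  assumes "sder id dx" "subalg V" "jets dx V ufield" "jets dx V a"
  shows "jets dx V (P1 eps dx a)"
  unfolding P1_def
  using assms sder_lin[OF assms(1)]
  by (intro jets_add jets_mult jets_const jets_dx)

section \<open>Stability of the polynomial subalgebras\<close>

lemma poly_on_pde: "poly_on X Y a \<Longrightarrow> poly_on X Y (pde x a)"
  unfolding poly_on_def
proof (intro allI impI)
  fix M assume "\<forall>M. coeff a M \<noteq> 0 \<longrightarrow> set_mset (fst M) \<subseteq> X \<and> fset (snd M) \<subseteq> Y" "coeff (pde x a) M \<noteq> 0"
  then show "set_mset (fst M) \<subseteq> X \<and> fset (snd M) \<subseteq> Y"
    using spec[of "\<lambda>M. coeff a M \<noteq> 0 \<longrightarrow> set_mset (fst M) \<subseteq> X \<and> fset (snd M) \<subseteq> Y" "(add_mset x (fst M), snd M)"]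
    by (auto simp: coeff_pde)
qed

lemma poly_on_pdo: "poly_on X Y a \<Longrightarrow> poly_on X Y (pdo y a)"
  unfolding poly_on_def
proof (intro allI impI)
  fix M assume "\<forall>M. coeff a M \<noteq> 0 \<longrightarrow> set_mset (fst M) \<subseteq> X \<and> fset (snd M) \<subseteq> Y" "coeff (pdo y a) M \<noteq> 0"
  then show "set_mset (fst M) \<subseteq> X \<and> fset (snd M) \<subseteq> Y"
    using spec[of "\<lambda>M. coeff a M \<noteq> 0 \<longrightarrow> set_mset (fst M) \<subseteq> X \<and> fset (snd M) \<subseteq> Y" "(fst M, finsert y (snd M))"]
    by (auto simp: coeff_pdo split: if_splits)
qed

lemma poly_on_par: "poly_on X Y a \<Longrightarrow> poly_on X Y (par a)"
  unfolding poly_on_def by (simp add: coeff_par)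

lemma poly_on_sder:
  assumes "poly_on X Y a" "\<And>x. x \<in> X \<Longrightarrow> \<not> is_T x" "\<And>y. y \<in> Y \<Longrightarrow> \<not> is_Tau y"
    "sder s D" "s = id \<or> s = par" "\<And>x. x \<in> X \<Longrightarrow> poly_on X Y (D (even_gen x))"
    "\<And>y. y \<in> Y \<Longrightarrow> poly_on X Y (D (odd_gen y))"
  shows "poly_on X Y (D a)"
proof -
  have s: "s 1 = 1" "\<And>b. poly_on X Y b \<Longrightarrow> poly_on X Y (s b)" using assms(5) poly_on_par by auto
  show ?thesis
    by (rule poly_on_induct[OF assms(1,2,3), where P = "\<lambda>a. poly_on X Y (D a)"])
      (use assms(4,6,7) s in \<open>auto simp: sder_const lin_add[OF sder_lin] sder_mult intro!: poly_on_intros\<close>)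
qed

lemma u_poly_sder:
  assumes "u_poly a" "sder id D" "\<And>j. u_poly (D (even_gen (U j)))"
  shows "u_poly (D a)"
  unfolding u_poly_iff
  by (rule poly_on_sder[OF assms(1)[unfolded u_poly_iff] _ _ assms(2)])
    (use assms(3)[unfolded u_poly_iff] in auto)

lemma diff_poly_sder:
  assumes "diff_poly a" "sder s D" "s = id \<or> s = par" "\<And>j. diff_poly (D (even_gen (U j)))"
    "\<And>j. diff_poly (D (odd_gen (Th j)))" "\<And>j. diff_poly (D (odd_gen (Sig j)))"
  shows "diff_poly (D a)"
  unfolding diff_poly_iff
  by (rule poly_on_sder[OF assms(1)[unfolded diff_poly_iff] _ _ assms(2,3)])
    (use assms(4-)[unfolded diff_poly_iff] in auto)

lemma pde_eventually_0: "diff_poly a \<Longrightarrow> \<exists>N. \<forall>j\<ge>N. pde (U j) a = 0"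
proof (induction rule: diff_poly_induct)
  case (U j)
  then show ?case by (intro exI[of _ "Suc j"]) (simp add: pde_even_gen)
next
  case (add a b)
  then obtain N N' where "\<forall>j\<ge>N. pde (U j) a = 0" "\<forall>j\<ge>N'. pde (U j) b = 0" by blast
  then show ?case by (intro exI[of _ "max N N'"]) (simp add: lin_add[OF lin_pde])
next
  case (mult a b)
  then obtain N N' where "\<forall>j\<ge>N. pde (U j) a = 0" "\<forall>j\<ge>N'. pde (U j) b = 0" by blast
  then show ?case by (intro exI[of _ "max N N'"]) (simp add: sder_mult[OF sder_pde])
qed (auto simp: pde_odd_gen sder_const[OF sder_pde])

lemma pdo_eventually_0: "diff_poly a \<Longrightarrow> \<exists>N. \<forall>j\<ge>N. pdo (Th j) a = 0"
proof (induction rule: diff_poly_induct)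
  case (Th j)
  then show ?case by (intro exI[of _ "Suc j"]) (simp add: pdo_odd_gen)
next
  case (add a b)
  then obtain N N' where "\<forall>j\<ge>N. pdo (Th j) a = 0" "\<forall>j\<ge>N'. pdo (Th j) b = 0" by blast
  then show ?case by (intro exI[of _ "max N N'"]) (simp add: lin_add[OF lin_pdo])
next
  case (mult a b)
  then obtain N N' where "\<forall>j\<ge>N. pdo (Th j) a = 0" "\<forall>j\<ge>N'. pdo (Th j) b = 0" by blast
  then show ?case by (intro exI[of _ "max N N'"]) (simp add: sder_mult[OF sder_pdo])
qed (auto simp: pdo_even_gen pdo_odd_gen sder_const[OF sder_pdo])

lemma sder_even_mult:
  assumes "par v = v" "sder s D"
  shows "sder s (\<lambda>a. v * D a)"
proof -
  have c: "a * (v * b) = v * (a * b)" for a b using even_cen[OF assms(1)] by (metis cen_def mult.assoc)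
  have "const d * (v * b) = v * (const d * b)" "s a * (v * b) = v * (s a * b)" for a b d by (rule c)+
  then have "lin (\<lambda>a. v * D a)" "v * D (a * b) = v * D a * b + s a * (v * D b)" for a b
    using lin_add[OF sder_lin[OF assms(2)]] lin_const_mult[OF sder_lin[OF assms(2)]]
    unfolding lin_def sder_mult[OF assms(2)] by (simp_all add: distrib_left mult.assoc)
  then show ?thesis unfolding sder_def by blast
qed

lemma pdo_anticommute: "pdo y (pdo z a) = - pdo z (pdo y a)"
proof -
  have "pdo y (pdo z a) + pdo z (pdo y a) = 0"
    by (rule sder_zero_ext[OF sder_anticommutator[OF sder_pdo sder_pdo pdo_par pdo_par]])
      (simp_all add: pdo_even_gen pdo_odd_gen lin_0[OF lin_pdo] sder_one[OF sder_pdo] if_distrib[of "pdo _"]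
        scont_tc[OF scont_add[OF scont_comp[OF scont_pdo scont_pdo] scont_comp[OF scont_pdo scont_pdo]]])
  then show ?thesis by (simp add: add_eq_0_iff2)
qed

subsection \<open>The flows of the super tau-cover\<close>

locale tau_cover =
  fixes eps c0 :: complex and R :: "nat \<Rightarrow> salg" and Om Ph :: "nat \<Rightarrow> nat \<Rightarrow> salg"
    and dt dtau :: "nat \<Rightarrow> salg \<Rightarrow> salg"
  assumes eps: "eps \<noteq> 0" and cover: "super_tau_cover eps R Om Ph dt dtau"
begin

abbreviation dx :: "salg \<Rightarrow> salg" where "dx \<equiv> dt 0"
abbreviation PP :: "salg \<Rightarrow> salg" where "PP \<equiv> P1 eps dx"

lemma
  shows dt_even: "even_derivation (dt n)" and dtau_odd: "odd_derivation (dtau n)"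
    and dt_time: "dt n (time k) = (if n = k then 1 else 0)" and dt_tau: "dt n (tau k) = 0"
    and dtau_time: "dtau n (time k) = 0" and dtau_tau: "dtau n (tau k) = (if n = k then 1 else 0)"
    and dx_U: "dx (even_gen (U j)) = even_gen (U (Suc j))"
    and dx_Th: "dx (odd_gen (Th j)) = odd_gen (Th (Suc j))"
    and dx_sigma: "dx (sigma (Suc k)) = PP (sigma k)"
    and R_0: "R 0 = 1" and R_Suc: "const (of_nat n + 1/2) * dx (R (Suc n)) = PP (R n)"
    and R_poly: "u_poly (R n)" and R_aug: "n \<ge> 1 \<Longrightarrow> aug (R n) = 0"
    and Om_poly: "u_poly (Om n k)" and Om_aug: "aug (Om n k) = 0" and dx_Om: "dx (Om n k) = dt k (R (Suc n))"
    and Ph_poly: "diff_poly (Ph k n)" and Ph_par: "par (Ph k n) = - Ph k n"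
    and dx_Ph: "dx (Ph k n) = dtau n (R (Suc k))"
    and dt_jet_u: "dt n ((dx ^^ j) ufield) = (dx ^^ j) (dx (R (Suc n)))"
    and dtau_jet_u: "dtau n ((dx ^^ j) ufield) = (dx ^^ j) (dx (sigma n))"
    and dt_jet_sigma: "dt n ((dx ^^ j) (sigma k)) = (dx ^^ j) (sigma_t R dx n k)"
    and dtau_jet_sigma: "k \<le> n \<Longrightarrow> dtau n ((dx ^^ j) (sigma k)) = (dx ^^ j) (sigma_tau dx n k)"
    and dtau_jet_sigma': "k \<le> n \<Longrightarrow> dtau k ((dx ^^ j) (sigma n)) = - (dx ^^ j) (sigma_tau dx n k)"
    and dt_fone: "const eps * dt n (fone k) = Om k n"
    and dtau_fone: "const eps * dtau n (fone k) = Ph k n"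
  using cover unfolding super_tau_cover_def Let_def aug_def by auto

lemma sder_dt: "sder id (dt n)" and par_dt: "dt n (par a) = par (dt n a)" and tc_dt: "time_continuous (dt n)"
  using dt_even[of n] by (auto simp: even_derivation_iff)

lemma sder_dtau: "sder par (dtau n)" and par_dtau: "dtau n (par a) = - par (dtau n a)"
  and tc_dtau: "time_continuous (dtau n)"
  using dtau_odd[of n] by (auto simp: odd_derivation_iff)

lemmas lin_dt = sder_lin[OF sder_dt] and lin_dtau = sder_lin[OF sder_dtau]

lemma scont_dt: "scont (dt n)"
  by (rule sder_scont[OF sder_dt tc_dt, where J = "Suc n"]) (auto simp: dt_time dt_tau)

lemma scont_dtau: "scont (dtau n)"
  by (rule sder_scont[OF sder_dtau tc_dtau, where J = "Suc n"]) (auto simp: dtau_time dtau_tau)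

lemma dx_pow_u: "(dx ^^ j) ufield = even_gen (U j)"
  by (induction j) (auto simp: dx_U)

lemma dx_pow_sigma0: "(dx ^^ j) (sigma 0) = odd_gen (Th j)"
  by (induction j) (auto simp: dx_Th)

lemma dx_Sig: "dx (odd_gen (Sig k)) = PP (sigma k)"
  using dx_sigma[of k] by simp

text \<open>Since sigma_{k+1}' = P_1 sigma_k, differentiation pushes sigma_{k+1} down to the jets of
  sigma_k. Thus the jets of sigma_k need only the \<open>U\<close>, the \<open>Th\<close> and the
  \<open>Sig j\<close> with j < k, which is what makes inductions on k possible.\<close>

lemma jets_sigma:
  assumes "subalg V" "\<And>j. V (even_gen (U j))" "\<And>j. V (odd_gen (Th j))" "\<And>j. j < k \<Longrightarrow> V (odd_gen (Sig j))"
  shows "jets dx V (sigma k)"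
  using assms(4)
proof (induction k)
  case 0
  then show ?case unfolding jets_def dx_pow_sigma0 using assms(3) by blast
next
  case (Suc k)
  have "jets dx V ufield" unfolding jets_def dx_pow_u using assms(2) by blast
  then have "jets dx V (PP (sigma k))"
    by (intro jets_P1[OF sder_dt assms(1)] Suc.IH) (use Suc.prems in auto)
  with dx_sigma[of k] have "jets dx V (dx (sigma (Suc k)))" by simp
  moreover have "V (sigma (Suc k))" using Suc.prems by simp
  ultimately show ?case by (rule jetsI[rotated])
qed

lemma u_poly_dx: "u_poly a \<Longrightarrow> u_poly (dx a)"
  by (rule u_poly_sder[OF _ sder_dt]) (auto simp: dx_U u_poly_closed)

lemma jets_diff_poly_sigma: "jets dx diff_poly (sigma k)"
  by (rule jets_sigma) (auto simp: subalg_def intro: diff_poly_closed)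

lemma diff_poly_dx: "diff_poly a \<Longrightarrow> diff_poly (dx a)"
proof (rule diff_poly_sder[OF _ sder_dt])
  show "diff_poly (dx (odd_gen (Sig j)))" for j
    using jets_0[OF jets_dx[OF jets_diff_poly_sigma[of "Suc j"]]] by (simp only: sigma.simps)
qed (simp_all add: dx_U dx_Th diff_poly_closed)

subsection \<open>The kernel of $\partial_x$ on differential polynomials\<close>

text \<open>The infinitesimal Galilean symmetry.  It commutes with \<open>dx\<close>, which rules out elements of the
  kernel that contain some \<open>Sig k\<close>.\<close>

definition gal :: "salg \<Rightarrow> salg" where
  "gal = derv (\<lambda>x. if x = U 0 then 1 else 0) (\<lambda>y. case y of Sig k \<Rightarrow> const (of_nat k + 1) * sigma k | _ \<Rightarrow> 0)"

lemma even_derivation_gal: "even_derivation gal"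
  unfolding gal_def
  by (rule even_derivation_derv) (auto simp: lin_0[OF lin_par] lin_const_mult[OF lin_par] par_sigma split: ovar.split)

lemma sder_gal: "sder id gal" and par_gal: "gal (par a) = par (gal a)"
  using even_derivation_gal by (auto simp: even_derivation_iff)

lemma gal_gen:
  "gal (even_gen (U j)) = (if j = 0 then 1 else 0)" "gal (odd_gen (Th j)) = 0"
  "gal (odd_gen (Sig k)) = const (of_nat k + 1) * sigma k"
  by (simp_all add: gal_def derv_gen)

lemma gal_dx:
  assumes "diff_poly a"
  shows "gal (dx a) = dx (gal a)"
proof -
  let ?C = "\<lambda>a. gal (dx a) - dx (gal a)"
  have C: "sder id ?C" by (rule sder_commutator[OF sder_gal sder_dt]) simp
  note l = lin_0[OF lin_dt] sder_one[OF sder_dt] lin_const_mult[OF lin_dt] lin_0[OF sder_lin[OF sder_gal]]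
  have U: "?C (even_gen (U j)) = 0" for j by (simp add: dx_U gal_gen l)
  have Th: "?C (odd_gen (Th j)) = 0" for j by (simp add: dx_Th gal_gen l)
  have V: "subalg (\<lambda>a. ?C a = 0)" by (rule subalg_ker[OF C]) simp
  have Sig: "?C (odd_gen (Sig k)) = 0" for k
  proof (induction k rule: less_induct)
    case (less k)
    have "jets dx (\<lambda>a. ?C a = 0) (sigma k)" using jets_sigma[OF V] U Th less by blast
    then have j: "?C ((dx ^^ i) (sigma k)) = 0" for i unfolding jets_def by blast
    have g: "gal (dx (sigma k)) = dx (gal (sigma k))" "gal (dx (dx (dx (sigma k)))) = dx (dx (dx (gal (sigma k))))"
      using j[of 0] j[of 1] j[of 2] by (simp_all add: numeral_2_eq_2)
    have "gal (dx ufield) = 0" by (simp add: dx_U gal_gen)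
    \<comment> \<open>The value 1 on u contributes one copy of sigma_k', and k sigma_{k-1}
      contributes k more through P_1 sigma_{k-1} = sigma_k'. This is the origin of the factor k + 1
      in \<open>gal\<close>.\<close>
    then have "gal (PP (sigma k)) = dx (sigma k) + PP (gal (sigma k))"
      unfolding P1_def by (simp add: lin_add[OF sder_lin[OF sder_gal]] sder_mult[OF sder_gal]
          sder_const[OF sder_gal] g gal_gen algebra_simps)
    also have "PP (gal (sigma k)) = const (of_nat k) * dx (sigma k)"
    proof (cases k)
      case 0
      then show ?thesis by (simp add: P1_def l gal_gen)
    next
      case (Suc n)
      have "PP (const c * a) = const c * PP a" for c a
        unfolding P1_def lin_const_mult[OF lin_dt] distrib_left
        by (simp add: mult.assoc const_left_commute[of _ c])
      then show ?thesis using dx_sigma[of n] by (simp add: Suc gal_gen add.commute)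
    qed
    finally show ?case
      by (simp add: dx_Sig gal_gen lin_const_mult[OF lin_dt]) (simp add: const_add distrib_right)
  qed
  show ?thesis using sder_diff_poly_zero[OF C _ assms U Th Sig] by simp
qed

definition low :: "nat \<Rightarrow> salg \<Rightarrow> bool" where
  "low K = poly_on (range U) (range Th \<union> Sig ` {..<K})"

lemma low_diff_poly: "low K a \<Longrightarrow> diff_poly a"
  unfolding low_def diff_poly_iff by (rule poly_on_mono) auto

lemma diff_poly_low: "diff_poly a \<Longrightarrow> \<exists>K. low K a"
proof (induction rule: diff_poly_induct)
  case (add a b)
  then obtain K L where "low K a" "low L b" by blast
  then have "low (max K L) a" "low (max K L) b" unfolding low_def by (auto elim: poly_on_mono)
  then show ?case unfolding low_def by (blast intro: poly_on_intros)
next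
  case (mult a b)
  then obtain K L where "low K a" "low L b" by blast
  then have "low (max K L) a" "low (max K L) b" unfolding low_def by (auto elim: poly_on_mono)
  then show ?case unfolding low_def by (blast intro: poly_on_intros)
next
  case (Sig j)
  show ?case unfolding low_def by (intro exI[of _ "Suc j"] poly_on_odd) auto
qed (auto simp: low_def intro: poly_on_const poly_on_even poly_on_odd)

lemma low_induct_zero:
  assumes "low K a" "sder s D" "s 1 = 1" "\<And>j. D (even_gen (U j)) = 0" "\<And>j. D (odd_gen (Th j)) = 0"
    "\<And>j. j < K \<Longrightarrow> D (odd_gen (Sig j)) = 0"
  shows "D a = 0"
  by (rule poly_on_induct[OF assms(1)[unfolded low_def], where P = "\<lambda>a. D a = 0"])
    (use assms(2-) in \<open>auto simp: sder_const lin_add[OF sder_lin] sder_mult\<close>)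

lemma low_Suc:
  assumes "low (Suc K) a" "pdo (Sig K) a = 0"
  shows "low K a"
  unfolding low_def poly_on_def
proof (intro allI impI conjI)
  fix M assume M: "coeff a M \<noteq> 0"
  then have "set_mset (fst M) \<subseteq> range U" and s: "fset (snd M) \<subseteq> range Th \<union> Sig ` {..<Suc K}"
    using assms(1) unfolding low_def poly_on_def by blast+
  then show "set_mset (fst M) \<subseteq> range U" by simp
  have "Sig K |\<notin>| snd M"
  proof
    assume y: "Sig K |\<in>| snd M"
    have "coeff (pdo (Sig K) a) (fst M, snd M |-| {|Sig K|}) = sgn_odd {|Sig K|} (snd M |-| {|Sig K|}) * coeff a M"
      using y by (simp add: coeff_pdo finsert_absorb)
    then show False using M assms(2) sgn_odd_square by (metis coeff_zero mult_eq_0_iff zero_neq_one)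
  qed
  then show "fset (snd M) \<subseteq> range Th \<union> Sig ` {..<K}"
    using s unfolding lessThan_Suc by blast
qed

text \<open>In the jet variables the commutator of d/du^(j+1) with \<open>dx\<close> is d/du^(j),
  and likewise for sigma_0. So on the kernel of \<open>dx\<close> vanishing of the partial
  derivative of order j + 1 passes down to order j, starting from the high orders that do not
  occur.\<close>

lemma low_0_kernel:
  assumes "low 0 a" "dx a = 0"
  shows "a = const (aug a)"
proof -
  have d: "diff_poly a" by (rule low_diff_poly[OF assms(1)])
  have down: "(\<forall>j. P (Suc j) \<longrightarrow> P j) \<Longrightarrow> \<exists>N. \<forall>j\<ge>N. P j \<Longrightarrow> P j" for P :: "nat \<Rightarrow> bool" and j
    by (metis inc_induct nat_le_linear)
  have "pde (U j) a = 0" for j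
  proof (rule down)
    show "\<forall>j. pde (U (Suc j)) a = 0 \<longrightarrow> pde (U j) a = 0"
    proof (intro allI impI)
      fix j assume j: "pde (U (Suc j)) a = 0"
      have "pde (U (Suc j)) (dx a) - dx (pde (U (Suc j)) a) - pde (U j) a = 0"
        by (rule low_induct_zero[OF assms(1)
              sder_diff[OF sder_commutator[OF sder_pde sder_dt] sder_pde]])
          (auto simp: dx_U dx_Th pde_even_gen pde_odd_gen lin_0[OF lin_dt] sder_one[OF sder_dt])
      then show "pde (U j) a = 0" using j assms(2) by (simp add: lin_0[OF lin_pde] lin_0[OF lin_dt])
    qed
  qed (rule pde_eventually_0[OF d])
  moreover have "pdo (Th j) a = 0" for j
  proof (rule down)
    show "\<forall>j. pdo (Th (Suc j)) a = 0 \<longrightarrow> pdo (Th j) a = 0"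
    proof (intro allI impI)
      fix j assume j: "pdo (Th (Suc j)) a = 0"
      have "pdo (Th (Suc j)) (dx a) - dx (pdo (Th (Suc j)) a) - pdo (Th j) a = 0"
        by (rule low_induct_zero[OF assms(1)
              sder_diff[OF sder_commutator[OF sder_pdo sder_dt] sder_pdo]])
          (auto simp: dx_U dx_Th pdo_even_gen pdo_odd_gen lin_0[OF lin_dt] sder_one[OF sder_dt] par_dt)
      then show "pdo (Th j) a = 0" using j assms(2) by (simp add: lin_0[OF lin_pdo] lin_0[OF lin_dt])
    qed
  qed (rule pdo_eventually_0[OF d])
  moreover have "pdo (Sig j) a = 0" for j
    by (rule low_induct_zero[OF assms(1) sder_pdo]) (auto simp: pdo_even_gen pdo_odd_gen)
  ultimately show ?thesis by (intro diff_poly_const_iff d)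
qed

lemma pdo_jet_sigma:
  assumes "\<And>j. y \<noteq> Th j" "\<And>j. j < k \<Longrightarrow> y \<noteq> Sig j"
  shows "pdo y ((dx ^^ i) (sigma k)) = 0"
proof -
  have "jets dx (\<lambda>a. pdo y a = 0) (sigma k)"
    by (rule jets_sigma[OF subalg_ker[OF sder_pdo]]) (use assms in \<open>auto simp: pdo_even_gen pdo_odd_gen\<close>)
  then show ?thesis by (simp add: jets_def)
qed

definition sgen :: "nat \<Rightarrow> ovar" where
  "sgen k = (case k of 0 \<Rightarrow> Th 0 | Suc j \<Rightarrow> Sig j)"

lemma sigma_sgen: "sigma k = odd_gen (sgen k)"
  by (cases k) (simp_all add: sgen_def)

lemma pdo_P1:
  assumes "pdo y (dx a) = 0" "pdo y (dx (dx (dx a))) = 0"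
  shows "pdo y (PP a) = const (1/2) * even_gen (U 1) * pdo y a"
  unfolding P1_def using assms
  by (simp add: lin_add[OF lin_pdo] sder_mult[OF sder_pdo] sder_const[OF sder_pdo] pdo_even_gen dx_U mult.assoc)

text \<open>Derivatives lower the index: sigma_k' = P_1 sigma_{k-1} contains only generators
  strictly below sigma_k, apart from jets of u and sigma_0 of positive order.\<close>

lemma pdo_sgen_jet: "i > 0 \<Longrightarrow> k \<le> K \<Longrightarrow> pdo (sgen K) ((dx ^^ i) (sigma k)) = 0"
proof (cases "K = 0")
  case True
  assume "i > 0" "k \<le> K"
  then show ?thesis using True by (simp add: dx_pow_sigma0[simplified] pdo_odd_gen sgen_def)
next
  case False
  assume i: "i > 0" and k: "k \<le> K"
  obtain j where j: "i = Suc j" using i by (cases i) auto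
  obtain L where L: "K = Suc L" using False by (cases K) auto
  show ?thesis
  proof (cases k)
    case 0
    then show ?thesis by (simp add: dx_pow_sigma0[simplified] pdo_odd_gen sgen_def L)
  next
    case (Suc n)
    have "jets dx (\<lambda>a. pdo (Sig L) a = 0) (sigma n)"
      unfolding jets_def by (intro allI pdo_jet_sigma) (use Suc L k in auto)
    moreover have "jets dx (\<lambda>a. pdo (Sig L) a = 0) ufield"
      by (simp add: jets_def dx_pow_u pdo_even_gen)
    ultimately have "jets dx (\<lambda>a. pdo (Sig L) a = 0) (PP (sigma n))"
      by (intro jets_P1[OF sder_dt subalg_ker[OF sder_pdo]]) auto
    then show ?thesis using dx_sigma[of n] by (simp add: jets_def j Suc L sgen_def funpow_swap1)
  qed
qed

text \<open>Induction on the highest \<open>Sig\<close> that occurs. If \<open>Sig K\<close> is the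
  highest, its partial derivative b lies in the kernel and is a constant c. The partial derivative e
  by sigma_K satisfies e' = - c u' / 2, so e + c u / 2 is constant and \<open>gal e\<close> = - c /
  2. On the other hand \<open>gal a\<close> is a constant by induction, and commuting
  \<open>gal\<close> with the partial derivative gives \<open>gal e\<close> = - (K + 1) c. Hence (2
  K + 1) c = 0, and \<open>Sig K\<close> does not occur.\<close>

theorem dx_kernel:
  assumes "diff_poly a" "dx a = 0"
  shows "a = const (aug a)"
proof -
  obtain K where "low K a" using diff_poly_low[OF assms(1)] by blast
  then show ?thesis using assms(2)
  proof (induction K arbitrary: a)
    case 0
    then show ?case by (rule low_0_kernel)
  next
    case (Suc K)
    note low = Suc.prems(1) and dxa = Suc.prems(2)
    note l0 = lin_0[OF lin_dt] lin_0[OF lin_pdo] lin_0[OF sder_lin[OF sder_gal]]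
    note lc = sder_const[OF sder_dt] sder_const[OF sder_pdo] sder_const[OF sder_gal]
      sder_one[OF sder_dt] sder_one[OF sder_pdo] sder_one[OF sder_gal]
    have pd: "pdo (sgen L) (PP (sigma k)) = (if k = L then const (1/2) * even_gen (U 1) else 0)" if "k \<le> L" for k L
    proof -
      have "pdo (sgen L) ((dx ^^ 1) (sigma k)) = 0" "pdo (sgen L) ((dx ^^ 3) (sigma k)) = 0"
        by (rule pdo_sgen_jet[OF _ that], simp)+
      then have "pdo (sgen L) (PP (sigma k)) = const (1/2) * even_gen (U 1) * pdo (sgen L) (sigma k)"
        by (intro pdo_P1) (simp_all add: numeral_3_eq_3)
      moreover have "sgen L = sgen k \<longleftrightarrow> k = L" by (auto simp: sgen_def split: nat.splits)
      ultimately show ?thesis by (simp add: sigma_sgen pdo_odd_gen)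
    qed
    define b where "b = pdo (Sig K) a"
    define c where "c = aug b"
    define e where "e = pdo (sgen K) a"
    have b_low: "low K b"
    proof (rule low_Suc)
      show "low (Suc K) b" using low unfolding b_def low_def by (rule poly_on_pdo)
      have "2 * pdo (Sig K) b = 2 * 0" unfolding b_def mult_2 using pdo_anticommute[of "Sig K" "Sig K" a] by (metis add.right_inverse add_0)
      then show "pdo (Sig K) b = 0" by (rule two_cancel)
    qed
    have "pdo (Sig K) (dx a) - dx (pdo (Sig K) a) = 0"
    proof (rule low_induct_zero[OF low sder_commutator[OF sder_pdo sder_dt]])
      fix j assume j: "j < Suc K"
      have "pdo (sgen (Suc K)) (PP (sigma j)) = 0" using pd[of j "Suc K"] j by simp
      then show "pdo (Sig K) (dx (odd_gen (Sig j))) - dx (pdo (Sig K) (odd_gen (Sig j))) = 0"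
        by (simp add: dx_Sig sgen_def pdo_odd_gen l0 lc)
    qed (auto simp: dx_U dx_Th pdo_even_gen pdo_odd_gen l0 lc par_dt)
    then have "dx b = 0" using dxa by (simp add: b_def l0)
    then have bc: "b = const c" unfolding c_def by (intro Suc.IH b_low)
    have sK: "pdo (Sig K) (sigma j) = 0" if "j < Suc K" for j
      using pdo_jet_sigma[of "Sig K" j 0] that by simp
    have "pdo (Sig K) (gal a) - gal (pdo (Sig K) a) = 0"
      by (rule low_induct_zero[OF low sder_commutator[OF sder_pdo sder_gal]])
        (auto simp: gal_gen pdo_even_gen pdo_odd_gen l0 lc par_gal lin_const_mult[OF lin_pdo] sK)
    then have g1: "pdo (Sig K) (gal a) = 0" using bc by (simp add: b_def lc)
    have "low (Suc K) (gal a)"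
      unfolding low_def
    proof (rule poly_on_sder[OF low[unfolded low_def] _ _ sder_gal])
      fix y assume "y \<in> range Th \<union> Sig ` {..<Suc K}"
      then show "poly_on (range U) (range Th \<union> Sig ` {..<Suc K}) (gal (odd_gen y))"
        by (auto simp: gal_gen sigma_sgen sgen_def split: nat.split intro!: poly_on_intros poly_on_odd)
    qed (auto simp: gal_gen intro: poly_on_intros)
    then have "low K (gal a)" using g1 by (rule low_Suc)
    moreover have "dx (gal a) = 0" using gal_dx[OF low_diff_poly[OF low]] dxa by (simp add: l0)
    ultimately have "gal a = const (aug (gal a))" by (rule Suc.IH)
    then have pg: "pdo (sgen K) (gal a) = 0" by (metis lc(2) par_one)
    have sg: "sgen K = sgen j \<longleftrightarrow> j = K" for j by (auto simp: sgen_def split: nat.splits)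
    have ee: "pdo (sgen K) (gal a) - gal (pdo (sgen K) a) - const (of_nat K + 1) * pdo (Sig K) a = 0"
      by (rule low_induct_zero[OF low sder_diff[OF sder_commutator[OF sder_pdo sder_gal] sder_const_mult[OF sder_pdo]]])
        (auto simp: gal_gen pdo_even_gen pdo_odd_gen l0 lc par_gal lin_const_mult[OF lin_pdo] sigma_sgen sg)
    have "- gal e - const ((of_nat K + 1) * c) = 0"
      using ee[folded e_def b_def] unfolding bc pg const_mult by simp
    then have "- gal e = const ((of_nat K + 1) * c)" by (rule iffD2[OF eq_iff_diff_eq_0])
    then have ge: "gal e = const (- (of_nat K + 1) * c)"
      by (metis add.inverse_inverse const_uminus mult_minus_left)
    have ed: "pdo (sgen K) (dx a) - dx (pdo (sgen K) a) - const (1/2) * even_gen (U 1) * pdo (Sig K) a = 0"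
    proof (rule low_induct_zero[OF low sder_diff[OF sder_commutator[OF sder_pdo sder_dt] sder_even_mult[OF _ sder_pdo]]])
      show "pdo (sgen K) (dx (odd_gen (Sig j))) - dx (pdo (sgen K) (odd_gen (Sig j))) -
          const (1/2) * even_gen (U 1) * pdo (Sig K) (odd_gen (Sig j)) = 0" if "j < Suc K" for j
        using that by (simp add: dx_Sig pd pdo_odd_gen l0 lc)
    qed (auto simp: dx_U dx_Th pdo_even_gen pdo_odd_gen l0 lc par_dt par_mult sgen_def split: nat.split)
    have "0 - dx e - const (1/2) * even_gen (U 1) * const c = 0"
      using ed[folded e_def b_def] unfolding bc dxa l0 .
    then have dxe: "dx e + const (1/2) * even_gen (U 1) * const c = 0"
      by (metis diff_0 diff_diff_eq neg_equal_0_iff_equal)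
    define h where "h = e + const (c / 2) * ufield"
    have "low (Suc K) h" using low unfolding h_def e_def low_def
      by (intro poly_on_intros poly_on_pdo poly_on_even) auto
    moreover have "pdo (Sig K) h = 0"
    proof -
      have "pdo (Sig K) e = 0" unfolding e_def pdo_anticommute[of "Sig K"] using bc by (simp add: b_def lc)
      then show ?thesis by (simp add: h_def lin_add[OF lin_pdo] lin_const_mult[OF lin_pdo] pdo_even_gen)
    qed
    ultimately have "low K h" by (rule low_Suc)
    moreover have "dx h = 0"
    proof -
      have "dx h = dx e + const (c / 2) * even_gen (U 1)"
        by (simp add: h_def lin_add[OF lin_dt] lin_const_mult[OF lin_dt] dx_U)
      also have "const (c / 2) * even_gen (U 1) = const (1/2) * even_gen (U 1) * const c"
        by (simp add: const_commute[of _ c] const_mult_assoc)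
      finally show ?thesis using dxe by simp
    qed
    ultimately have "h = const (aug h)" by (rule Suc.IH)
    then have "gal h = 0" by (metis lc(3) id_apply)
    then have "const (- (of_nat K + 1) * c + c / 2) = 0"
      using ge by (simp add: h_def lin_add[OF sder_lin[OF sder_gal]] lin_const_mult[OF sder_lin[OF sder_gal]] gal_gen const_add)
    then have "- (of_nat K + 1) * c + c / 2 = 0" by (metis aug_simps(1,3))
    moreover have "(of_nat (2 * K + 1) :: complex) * c = - 2 * (- (of_nat K + 1) * c + c / 2)"
      by (simp add: algebra_simps)
    ultimately have "(of_nat (2 * K + 1) :: complex) * c = 0" by simp
    then have "c = 0" unfolding mult_eq_0_iff of_nat_eq_0_iff by simp
    then have "pdo (Sig K) a = 0" using bc by (simp add: b_def)
    with low have "low K a" by (rule low_Suc)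
    then show ?case using dxa by (rule Suc.IH)
  qed
qed

lemma u_poly_kernel: "u_poly a \<Longrightarrow> dx a = 0 \<Longrightarrow> aug a = 0 \<Longrightarrow> a = 0"
  using dx_kernel[OF u_diff_poly] by (metis const_0)

lemma diff_poly_kernel: "diff_poly a \<Longrightarrow> dx a = 0 \<Longrightarrow> aug a = 0 \<Longrightarrow> a = 0"
  using dx_kernel by (metis const_0)

end

subsection \<open>Identities in differential rings\<close>

definition central :: "'a::ring_1 \<Rightarrow> bool" where "central a \<longleftrightarrow> (\<forall>b. a * b = b * a)"

lemma central_swap: "central a \<or> central b \<Longrightarrow> a * b = b * a"
  by (auto simp: central_def)

lemma central_swap2: "central a \<or> central b \<Longrightarrow> a * (b * c) = b * (a * c)"
  by (metis central_def mult.assoc)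

lemma central_numeral: "central (numeral n :: 'a::ring_1)"
  by (metis central_def mult_of_nat_commute of_nat_numeral)

lemma central_mult: "central a \<Longrightarrow> central b \<Longrightarrow> central (a * b)"
  by (metis central_def mult.assoc)

lemma central_0: "central 0" and central_1: "central 1"
  and central_add: "central a \<Longrightarrow> central b \<Longrightarrow> central (a + b)"
  and central_uminus: "central a \<Longrightarrow> central (- a)"
  and central_diff: "central a \<Longrightarrow> central b \<Longrightarrow> central (a - b)"
  by (simp_all add: central_def algebra_simps)

lemmas central_closed = central_numeral central_mult central_0 central_1 central_add central_uminus central_diff

text \<open>Interpreted twice, for the superalgebra and for power series over it. Centrality is
  required of u and k only, since the other elements may be odd; each identity states which of its
  arguments must be central.\<close>

locale dring =
  fixes D :: "'a::ring_1 \<Rightarrow> 'a" and u k :: 'a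
  assumes D_add: "D (a + b) = D a + D b" and D_mult: "D (a * b) = D a * b + a * D b"
    and cu: "central u" and ck: "central k" and Dk: "D k = 0"
begin

lemma D_0: "D 0 = 0" using D_add[of 0 0] by simp
lemma D_1: "D 1 = 0" using D_mult[of 1 1] by simp
lemma D_uminus: "D (- a) = - D a" using D_add[of a "- a"] D_0 by (metis add.right_inverse add_eq_0_iff)
lemma D_diff: "D (a - b) = D a - D b" using D_add[of a "- b"] D_uminus by simp
lemma D_numeral: "D (numeral n) = 0"
proof -
  have "D (of_nat n) = 0" for n by (induction n) (simp_all add: D_0 D_1 D_add)
  then show ?thesis by (metis of_nat_numeral)
qed

lemma central_D:
  assumes "central a"
  shows "central (D a)"
  unfolding central_def
proof
  fix b
  have "D a * b + a * D b = D b * a + b * D a"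
    using assms D_mult[of a b] D_mult[of b a] by (simp add: central_def)
  moreover have "a * D b = D b * a" using assms by (simp add: central_def)
  ultimately show "D a * b = b * D a" by (metis add.commute add_right_cancel)
qed

text \<open>The bracket of vector fields on the line, that is, the Wronskian.\<close>

definition br :: "'a \<Rightarrow> 'a \<Rightarrow> 'a" where "br a b = a * D b - D a * b"
text \<open>Twice the operator P_1, which keeps fractions out of the identities.\<close>

definition Q :: "'a \<Rightarrow> 'a" where "Q a = 2 * u * D a + D u * a + 2 * k * D (D (D a))"
text \<open>The polarised first integral of the third-order equation Q a = 0; on the diagonal it is
  u a^2 + k (2 a a'' - a'^2) for central a.\<close>

definition H :: "'a \<Rightarrow> 'a \<Rightarrow> 'a" where "H a b = u * a * b + k * (a * D (D b) - D a * D b + D (D a) * b)"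

lemmas D_simps = D_add D_mult D_diff D_0 D_1 D_uminus D_numeral Dk
lemmas cD = central_D central_D[OF central_D] central_D[OF central_D[OF central_D]]
  central_D[OF central_D[OF central_D[OF central_D]]]
text \<open>A normal form for differential polynomials: products are expanded, central factors are
  sorted and doubling becomes addition. The identities below then reduce to a comparison of
  sums.\<close>

lemmas norm = distrib_left distrib_right left_diff_distrib right_diff_distrib mult.assoc
  central_swap central_swap2 cu ck cD central_closed mult_2 mult_2_right

text \<open>Skew-adjointness of \<open>Q\<close> with an explicit primitive, which stands in for
  integration in the sequel.\<close>

lemma D_H: "central a \<Longrightarrow> 2 * D (H a b) = a * Q b + Q a * b"
  unfolding H_def Q_def by (simp add: D_simps norm)

lemma br_Q: "central a \<Longrightarrow> a * D (Q b) - D (Q a) * b - Q (br a b) = 2 * (Q a * D b - D a * Q b)"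
  unfolding br_def Q_def by (simp add: D_simps norm)

text \<open>The computation behind \<open>flow_resolvent\<close>: it shows that the bracket of the
  resolvent with a solution of the recursion solves the linearised quadratic identity.\<close>

lemma H_br: "central a \<Longrightarrow> 2 * H (br a b) a = a * a * Q b - a * Q a * b"
  unfolding br_def Q_def H_def by (simp add: D_simps norm)

text \<open>The Jacobi identity for vector fields on the line, with the third argument allowed to be
  odd.\<close>

lemma br_jacobi: "central a \<Longrightarrow> central c \<Longrightarrow> br a (br c b) - br c (br a b) = br (br a c) b"
  unfolding br_def by (simp add: D_simps norm)

lemma H_br_br: "central a \<Longrightarrow> H a a * b - a * H a b = - (k * br a (br a b))"
  unfolding br_def H_def by (simp add: D_simps norm)

end

subsection \<open>Power series over differential rings\<close>

abbreviation cof :: "'a::zero fps \<Rightarrow> nat \<Rightarrow> 'a" (infixl "\<odot>" 75) where "f \<odot> n \<equiv> fps_nth f n"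

definition lft :: "(salg \<Rightarrow> salg) \<Rightarrow> salg fps \<Rightarrow> salg fps" where
  "lft D f = Abs_fps (\<lambda>n. D (f \<odot> n))"

lemma lft_nth [simp]: "lft D f \<odot> n = D (f \<odot> n)"
  by (simp add: lft_def)

lemma central_fps: "(\<And>n. central (f \<odot> n)) \<Longrightarrow> central f"
  unfolding central_def
proof (intro allI fps_ext)
  fix g n assume c: "\<And>n. \<forall>b. f \<odot> n * b = b * f \<odot> n"
  have "(f * g) \<odot> n = (\<Sum>i=0..n. f \<odot> i * g \<odot> (n - i))" by (simp add: fps_mult_nth)
  also have "\<dots> = (\<Sum>i=0..n. g \<odot> (n - i) * f \<odot> i)" using c by simp
  also have "\<dots> = (\<Sum>i=0..n. g \<odot> i * f \<odot> (n - i))"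
    by (rule sum.reindex_bij_witness[where i = "\<lambda>i. n - i" and j = "\<lambda>i. n - i"]) auto
  finally show "(f * g) \<odot> n = (g * f) \<odot> n" by (simp add: fps_mult_nth)
qed

lemma central_X: "central (fps_X :: 'a::ring_1 fps)"
  unfolding central_def by (simp add: fps_mult_fps_X_commute)

lemma cen_central: "cen a \<longleftrightarrow> central a"
  by (simp add: cen_def central_def)

lemma central_fps_const: "central a \<Longrightarrow> central (fps_const a)"
  by (rule central_fps) (simp add: central_def)

lemma lft_mult:
  assumes "lin D" "\<And>i j. D (f \<odot> i * g \<odot> j) = D (f \<odot> i) * g \<odot> j + f \<odot> i * D (g \<odot> j)"
  shows "lft D (f * g) = lft D f * g + f * lft D g"
  by (rule fps_ext) (simp add: fps_mult_nth lin_sum[OF assms(1)] assms(2) sum.distrib)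

lemma lft_add: "lin D \<Longrightarrow> lft D (f + g) = lft D f + lft D g"
  and lft_diff: "lin D \<Longrightarrow> lft D (f - g) = lft D f - lft D g"
  by (rule fps_ext; simp add: lin_add lin_diff)+

lemma lft_X_mult: "lin D \<Longrightarrow> lft D (fps_X * f) = fps_X * lft D f"
  by (rule fps_ext) (simp add: lin_0)

lemma lft_numeral_mult: "lin D \<Longrightarrow> lft D (numeral n * f) = numeral n * lft D f"
  by (rule fps_ext) (simp add: lin_numeral_mult numeral_fps_const)

text \<open>The Euler operator X d/dX.\<close>

definition eul :: "salg fps \<Rightarrow> salg fps" where
  "eul f = Abs_fps (\<lambda>n. of_nat n * f \<odot> n)"

lemma eul_nth [simp]: "eul f \<odot> n = of_nat n * f \<odot> n"
  by (simp add: eul_def)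

lemma eul_mult: "eul (f * g) = eul f * g + f * eul g"
proof (rule fps_ext)
  fix n
  have "eul (f * g) \<odot> n = (\<Sum>i=0..n. of_nat n * (f \<odot> i * g \<odot> (n - i)))"
    by (simp add: fps_mult_nth sum_distrib_left)
  also have "\<dots> = (\<Sum>i=0..n. of_nat i * f \<odot> i * g \<odot> (n - i) + f \<odot> i * (of_nat (n - i) * g \<odot> (n - i)))"
  proof (rule sum.cong)
    fix i assume "i \<in> {0..n}"
    then have "of_nat n = (of_nat i + of_nat (n - i) :: salg)" by (simp flip: of_nat_add)
    then show "of_nat n * (f \<odot> i * g \<odot> (n - i)) = of_nat i * f \<odot> i * g \<odot> (n - i) + f \<odot> i * (of_nat (n - i) * g \<odot> (n - i))"
      by (simp add: distrib_right mult.assoc) (metis mult.assoc mult_of_nat_commute)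
  qed simp
  finally show "eul (f * g) \<odot> n = (eul f * g + f * eul g) \<odot> n" by (simp add: fps_mult_nth sum.distrib)
qed

lemma eul_diff: "eul (f - g) = eul f - eul g"
  by (rule fps_ext) (simp add: right_diff_distrib)

lemma eul_X_mult: "eul (fps_X * f) = fps_X * f + fps_X * eul f"
proof -
  have "eul fps_X = fps_X" by (rule fps_ext) (simp add: fps_X_def)
  then show ?thesis by (simp add: eul_mult)
qed

lemma of_nat_salg_left_commute: "a * (of_nat n * b) = of_nat n * (a * (b :: salg))"
  by (metis const_left_commute const_of_nat)

lemma lin_of_nat_mult: "lin D \<Longrightarrow> D (of_nat n * a) = of_nat n * D a"
  using lin_const_mult[of D "of_nat n" a] by (simp add: const_of_nat)

lemma lft_eul: "lin D \<Longrightarrow> lft D (eul f) = eul (lft D f)"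
  by (rule fps_ext) (simp add: lin_of_nat_mult)

subsection \<open>Normalised flows and the resolvent\<close>

lemma half_not_nonpos: "of_nat n + 1/2 \<notin> (\<int>\<^sub>\<le>\<^sub>0 :: complex set)"
proof
  assume "of_nat n + 1/2 \<in> (\<int>\<^sub>\<le>\<^sub>0 :: complex set)"
  then obtain i :: int where "of_nat n + 1/2 = (of_int i :: complex)" "i \<le> 0" by (auto elim: nonpos_Ints_cases)
  then have "Re (of_nat n + 1/2) = Re (of_int i)" by (simp only:)
  then have "real n + 1/2 = real_of_int i" by simp
  moreover have "real_of_int i \<le> 0" using \<open>i \<le> 0\<close> by simp
  ultimately show False by linarith
qed

text \<open>The Pochhammer symbol (1/2)_n.\<close>

definition cf :: "nat \<Rightarrow> complex" where "cf n = Gamma (of_nat n + 1/2) / Gamma (1/2)"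

lemma Gamma_half_nz: "Gamma (of_nat n + 1/2 :: complex) \<noteq> 0"
  using half_not_nonpos by (simp add: Gamma_eq_zero_iff)

lemma cf_nz [simp]: "cf n \<noteq> 0"
  using Gamma_half_nz[of n] Gamma_half_nz[of 0] by (simp add: cf_def)

lemma cf_0 [simp]: "cf 0 = 1"
  using Gamma_half_nz[of 0] by (simp add: cf_def)

lemma cf_Suc: "cf (Suc n) = (of_nat n + 1/2) * cf n"
proof -
  have "Gamma (of_nat (Suc n) + 1/2 :: complex) = (of_nat n + 1/2) * Gamma (of_nat n + 1/2)"
    using Gamma_plus1[OF half_not_nonpos[of n]] by (simp add: add_ac)
  then show ?thesis by (simp add: cf_def)
qed

lemma Gamma_cf: "Gamma (of_nat n + 1/2) = cf n * Gamma (1/2)"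
  using Gamma_half_nz[of 0] by (simp add: cf_def)

lemma Gamma_cf_Suc: "Gamma (of_nat n + 3/2) = cf (Suc n) * Gamma (1/2)"
  using Gamma_cf[of "Suc n"] by (simp add: add_ac)

lemma subalg_uminus: "subalg V \<Longrightarrow> V a \<Longrightarrow> V (- a)"
proof -
  assume "subalg V" "V a"
  then have "V (const (-1) * a)" unfolding subalg_def by blast
  then show ?thesis by (simp add: const_uminus)
qed

lemma subalg_diff: "subalg V \<Longrightarrow> V a \<Longrightarrow> V b \<Longrightarrow> V (a - b)"
  using subalg_uminus[of V b] unfolding subalg_def by (metis diff_conv_add_uminus)

lemma subalg_sum: "subalg V \<Longrightarrow> (\<And>x. x \<in> A \<Longrightarrow> V (f x)) \<Longrightarrow> V (sum f A)"
  by (induction A rule: infinite_finite_induct) (auto simp: subalg_def simp flip: const_0)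

definition allc :: "(salg \<Rightarrow> bool) \<Rightarrow> salg fps \<Rightarrow> bool" where
  "allc V f \<longleftrightarrow> (\<forall>n. V (f \<odot> n))"

lemma allc_mult: "subalg V \<Longrightarrow> allc V f \<Longrightarrow> allc V g \<Longrightarrow> allc V (f * g)"
  unfolding allc_def fps_mult_nth
proof (rule allI, rule subalg_sum)
  fix n i assume "subalg V" "\<forall>n. V (f \<odot> n)" "\<forall>n. V (g \<odot> n)"
  then show "V (f \<odot> i * g \<odot> (n - i))" unfolding subalg_def by blast
qed

lemma allc_add: "subalg V \<Longrightarrow> allc V f \<Longrightarrow> allc V g \<Longrightarrow> allc V (f + g)"
  unfolding allc_def fps_add_nth subalg_def by blast

lemma allc_diff: "subalg V \<Longrightarrow> allc V f \<Longrightarrow> allc V g \<Longrightarrow> allc V (f - g)"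
  unfolding allc_def fps_sub_nth by (rule allI, rule subalg_diff) blast+

lemma subalg_0: "subalg V \<Longrightarrow> V 0" and subalg_1: "subalg V \<Longrightarrow> V 1"
  unfolding subalg_def by (metis const_0, metis const_1)

lemma allc_const: "subalg V \<Longrightarrow> V a \<Longrightarrow> allc V (fps_const a)"
  using subalg_0 by (auto simp: allc_def fps_const_def)

lemma allc_X: "subalg V \<Longrightarrow> allc V fps_X"
  using subalg_0 subalg_1 by (auto simp: allc_def fps_X_def)

lemma allc_1: "subalg V \<Longrightarrow> allc V 1"
  using allc_const[of V 1] subalg_1[of V] by simp

lemma allc_numeral: "subalg V \<Longrightarrow> allc V (numeral n)"
proof -
  assume V: "subalg V"
  then have "V (const (numeral n))" unfolding subalg_def by blast
  then show ?thesis using allc_const[OF V, of "numeral n"] by (simp add: const_numeral numeral_fps_const)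
qed

lemma subalg_u_poly: "subalg u_poly" and subalg_diff_poly: "subalg diff_poly"
  by (auto simp: subalg_def intro: u_poly_closed diff_poly_closed)

definition afps :: "salg fps \<Rightarrow> complex fps" where "afps f = Abs_fps (\<lambda>n. aug (f \<odot> n))"

lemma afps_nth: "afps f \<odot> n = aug (f \<odot> n)"
  by (simp add: afps_def)

lemma afps_mult: "afps (f * g) = afps f * afps g"
  by (rule fps_ext) (simp add: afps_def fps_mult_nth aug_sum)

lemma afps_simps: "afps (f + g) = afps f + afps g" "afps (f - g) = afps f - afps g"
  "afps (fps_const a) = fps_const (aug a)" "afps fps_X = fps_X" "afps 1 = 1"
  by (rule fps_ext; simp add: afps_def fps_X_def)+

lemma fps_mult_left_zero:
  fixes f g :: "salg fps"
  shows "(\<And>j. j \<le> m \<Longrightarrow> f \<odot> j = 0) \<Longrightarrow> (f * g) \<odot> m = 0"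
  unfolding fps_mult_nth by (auto intro: sum.neutral)

context tau_cover
begin

abbreviation kap :: salg where "kap \<equiv> const (eps\<^sup>2 / 8)"

lemma central_u_poly: "u_poly a \<Longrightarrow> central a"
  using u_poly_cen cen_central by blast

lemma central_const: "central (const c)"
  by (rule central_u_poly) (rule u_poly_closed)

sublocale ds: dring dx ufield kap
  by unfold_locales
    (auto simp: lin_add[OF lin_dt] sder_mult[OF sder_dt] sder_const[OF sder_dt] central_const
      intro: central_u_poly u_poly_closed)

sublocale df: dring "lft dx" "fps_const ufield" "fps_const kap"
  by unfold_locales
    (auto simp: lft_add[OF lin_dt] lft_mult[OF lin_dt] sder_mult[OF sder_dt] sder_const[OF sder_dt]
      lin_0[OF lin_dt]
      intro!: central_fps_const central_const central_u_poly u_poly_closed fps_ext lft_mult[OF lin_dt])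

lemma PP_Q: "2 * PP a = ds.Q a"
proof -
  have "const 2 * (const (1/2) * b) = b" for b by (simp add: const_mult_assoc)
  then have h: "2 * (const (1/2) * b) = b" for b by (simp add: const_numeral)
  show ?thesis by (simp add: P1_def ds.Q_def distrib_left mult.assoc h)
qed

lemma Q_nth: "df.Q f \<odot> n = ds.Q (f \<odot> n)"
proof -
  have c: "(2 * fps_const a * f) \<odot> n = 2 * a * f \<odot> n" for a and f :: "salg fps"
    by (simp add: numeral_fps_const)
  have "lft dx (fps_const ufield) = fps_const (dx ufield)"
    by (rule fps_ext) (simp add: lin_0[OF lin_dt])
  then show ?thesis by (simp add: df.Q_def ds.Q_def c)
qed

lemma lin_PP: "lin PP"
  unfolding lin_def P1_def lin_add[OF lin_dt] lin_const_mult[OF lin_dt]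
    const_left_commute[of "ufield"] const_left_commute[of "const (1/2) * dx ufield"]
    const_left_commute[of "const (eps\<^sup>2 / 8)"] distrib_left
  by (simp add: add_ac)

text \<open>The factor (1/2)_n turns (n + 1/2) R_{n+1}' = P_1 R_n into r_{n+1}' = P_1 r_n, the
  recursion of the sigma_n. In the same normalisation \<open>d n\<close> sends u to r_n', and the
  derivative of \<open>g n\<close> is r_n for n > 0.\<close>

definition r :: "nat \<Rightarrow> salg" where "r n = const (cf n) * R n"
definition d :: "nat \<Rightarrow> salg \<Rightarrow> salg" where "d n a = (case n of 0 \<Rightarrow> 0 | Suc k \<Rightarrow> const (cf n) * dt k a)"
definition g :: "nat \<Rightarrow> salg" where "g n = (case n of 0 \<Rightarrow> 0 | Suc k \<Rightarrow> const (eps * cf n) * fone k)"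

lemma d_0: "d 0 a = 0" and d_Suc: "d (Suc n) a = const (cf (Suc n)) * dt n a"
  by (simp_all add: d_def)

lemma g_0: "g 0 = 0" and g_Suc: "g (Suc n) = const (eps * cf (Suc n)) * fone n"
  by (simp_all add: g_def)

lemma two_d1: "2 * d 1 a = dx a"
proof -
  have "2 * d 1 a = const 2 * (const (1/2) * dx a)" by (simp add: d_def cf_Suc const_numeral)
  then show ?thesis by (simp add: const_mult_assoc)
qed

lemma r_0: "r 0 = 1"
  by (simp add: r_def R_0)

lemma r_rec: "dx (r (Suc n)) = PP (r n)"
proof -
  have "dx (r (Suc n)) = const (cf n * (of_nat n + 1/2)) * dx (R (Suc n))"
    by (simp only: r_def cf_Suc lin_const_mult[OF lin_dt] mult.commute)
  also have "\<dots> = const (cf n) * PP (R n)"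
    unfolding R_Suc[symmetric] by (rule const_mult_assoc[symmetric])
  finally show ?thesis by (simp only: r_def lin_const_mult[OF lin_PP])
qed

lemma u_poly_r: "u_poly (r n)"
  by (simp add: r_def u_poly_closed R_poly)

lemma central_r: "central (r n)"
  by (rule central_u_poly[OF u_poly_r])

lemma par_r: "par (r n) = r n"
  by (rule par_u_poly[OF u_poly_r])

lemma aug_r: "aug (r n) = (if n = 0 then 1 else 0)"
  using R_aug[of n] by (simp add: r_def R_0)

lemma sder_d: "sder id (d n)"
proof (cases n)
  case 0
  then show ?thesis by (simp add: sder_def lin_def d_0)
next
  case (Suc k)
  then show ?thesis using sder_const_mult[OF sder_dt] by (simp add: d_Suc[abs_def])
qed

lemmas lin_d = sder_lin[OF sder_d]

lemma par_d: "d n (par a) = par (d n a)"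
  by (cases n) (simp_all add: d_0 d_Suc par_dt lin_0[OF lin_par] lin_const_mult[OF lin_par])

lemma scont_d: "scont (d n)"
  by (cases n) (simp_all add: d_0[abs_def] d_Suc[abs_def] scont_zero scont_comp[OF scont_mult_left scont_dt])

lemma aug_dx: "diff_poly a \<Longrightarrow> aug (dx a) = 0"
  by (rule aug_sder_diff_poly[OF sder_dt])
    (auto simp: dx_U aug_odd par_dt[symmetric] lin_uminus[OF lin_dt])

lemma diff_poly_pow_dx: "diff_poly a \<Longrightarrow> diff_poly ((dx ^^ j) a)"
  by (induction j) (auto intro: diff_poly_dx)

lemma u_poly_pow_dx: "u_poly a \<Longrightarrow> u_poly ((dx ^^ j) a)"
  by (induction j) (auto intro: u_poly_dx)

lemma aug_pow_dx: "diff_poly a \<Longrightarrow> aug a = 0 \<Longrightarrow> aug ((dx ^^ j) a) = 0"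
  by (cases j) (auto intro!: aug_dx diff_poly_pow_dx)

lemma dt_U: "dt n (even_gen (U j)) = (dx ^^ j) (dx (R (Suc n)))"
  using dt_jet_u[of n j] by (simp only: dx_pow_u)

lemma dtau_U: "dtau n (even_gen (U j)) = (dx ^^ j) (dx (sigma n))"
  using dtau_jet_u[of n j] by (simp only: dx_pow_u)

lemma u_poly_dt: "u_poly a \<Longrightarrow> u_poly (dt n a)"
  by (rule u_poly_sder[OF _ sder_dt])
    (assumption, simp only: dt_U u_poly_pow_dx u_poly_dx R_poly)

lemma diff_poly_sigma_t: "diff_poly (sigma_t R dx n k)"
  unfolding sigma_t_def
  by (intro diff_poly_closed diff_poly_dx diff_poly_sigma u_diff_poly[OF R_poly])

lemma diff_poly_sigma_tau: "diff_poly (sigma_tau dx n k)"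
  unfolding sigma_tau_def
  by (intro diff_poly_closed diff_poly_dx diff_poly_sigma)

lemma diff_poly_dt: "diff_poly a \<Longrightarrow> diff_poly (dt n a)"
proof (rule diff_poly_sder[OF _ sder_dt])
  have s: "diff_poly (dt n ((dx ^^ j) (sigma k)))" for j k
    unfolding dt_jet_sigma by (intro diff_poly_pow_dx diff_poly_sigma_t)
  show "diff_poly (dt n (odd_gen (Th j)))" for j using s[of j 0] by (simp only: dx_pow_sigma0)
  show "diff_poly (dt n (odd_gen (Sig j)))" for j using s[of 0 "Suc j"] by simp
  show "diff_poly (dt n (even_gen (U j)))" for j
    unfolding dt_U by (intro diff_poly_pow_dx diff_poly_dx u_diff_poly[OF R_poly])
qed auto

lemma aug_dt: "diff_poly a \<Longrightarrow> aug (dt n a) = 0"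
proof (rule aug_sder_diff_poly[OF sder_dt])
  show "aug (dt n (even_gen (U j))) = 0" for j
    unfolding dt_U
    by (intro aug_pow_dx diff_poly_dx aug_dx u_diff_poly[OF R_poly])
qed (auto simp: aug_odd par_dt[symmetric] lin_uminus[OF lin_dt])

lemma dtau_sigma_jet:
  "\<exists>n' k'. dtau n ((dx ^^ j) (sigma k)) = (dx ^^ j) (sigma_tau dx n' k') \<or>
     dtau n ((dx ^^ j) (sigma k)) = - (dx ^^ j) (sigma_tau dx n' k')"
  using dtau_jet_sigma[of k n j] dtau_jet_sigma'[of n k j] by (metis nat_le_linear)

lemma diff_poly_dtau_sigma: "diff_poly (dtau n ((dx ^^ j) (sigma k)))"
  using dtau_sigma_jet[of n j k] diff_poly_pow_dx[OF diff_poly_sigma_tau] by (metis diff_poly_closed(8))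

lemma diff_poly_dtau: "diff_poly a \<Longrightarrow> diff_poly (dtau n a)"
proof (rule diff_poly_sder[OF _ sder_dtau])
  show "diff_poly (dtau n (odd_gen (Th j)))" for j
    using diff_poly_dtau_sigma[of n j 0] by (simp only: dx_pow_sigma0)
  show "diff_poly (dtau n (odd_gen (Sig j)))" for j using diff_poly_dtau_sigma[of n 0 "Suc j"] by simp
  show "diff_poly (dtau n (even_gen (U j)))" for j
    unfolding dtau_U by (intro diff_poly_pow_dx diff_poly_dx diff_poly_sigma)
qed auto

lemma aug_sigma: "aug (sigma k) = 0"
  by (rule aug_odd[OF par_sigma])

lemma aug_dtau: "diff_poly a \<Longrightarrow> aug (dtau n a) = 0"
proof (rule aug_sder_diff_poly[OF sder_dtau])
  have "aug ((dx ^^ j) (sigma_tau dx n k)) = 0" for j n k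
    by (intro aug_pow_dx diff_poly_sigma_tau) (simp add: sigma_tau_def aug_sum aug_sigma)
  then have s: "aug (dtau n ((dx ^^ j) (sigma k))) = 0" for j k
    using dtau_sigma_jet[of n j k] by auto
  show "aug (dtau n (odd_gen (Th j))) = 0" for j using s[of j 0] by (simp only: dx_pow_sigma0)
  show "aug (dtau n (odd_gen (Sig j))) = 0" for j using s[of 0 "Suc j"] by simp
  show "aug (dtau n (even_gen (U j))) = 0" for j
    by (rule aug_odd) (metis add.inverse_inverse par_dtau par_even_gen)
qed auto

lemma fone_eq: "fone k = const (1 / (eps * cf (Suc k))) * g (Suc k)"
  using eps by (simp add: g_Suc const_mult_assoc)

text \<open>Commutation with \<open>dx\<close> carries vanishing from u and sigma_0 to all their
  jets. This reduces identities between flows to the times, the f_k, u and the sigma_k.\<close>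

lemma der_ext:
  assumes D: "sder s D" "s = id \<or> s = par" "time_continuous D" "\<And>a. D (dx a) = dx (D a)"
    and "\<And>k. D (time k) = 0" "\<And>k. D (tau k) = 0" "\<And>k. D (fone k) = 0" "D ufield = 0" "\<And>k. D (sigma k) = 0"
  shows "D a = 0"
proof (rule sder_zero_ext[OF D(1) _ D(3)])
  have j: "D ((dx ^^ i) a) = (dx ^^ i) (D a)" for i a
    by (induction i) (simp_all add: D(4))
  have z: "(dx ^^ i) 0 = 0" for i by (rule lin_0[OF lin_funpow[OF lin_dt]])
  show "D (even_gen x) = 0" for x
    using assms(5,7,8) j[of _ ufield] by (cases x) (auto simp: dx_pow_u z)
  show "D (odd_gen y) = 0" for y
    using assms(6) assms(9)[of 0] assms(9)[of "Suc _"] j[of _ "sigma 0"]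
    by (cases y) (auto simp: dx_pow_sigma0[simplified] z)
  show "s 1 = 1" using D(2) by auto
qed

lemma Om_0: "Om k 0 = R (Suc k)"
proof -
  have "Om k 0 - R (Suc k) = 0"
    by (rule u_poly_kernel)
      (simp_all add: u_poly_closed Om_poly R_poly lin_diff[OF lin_dt] dx_Om Om_aug R_aug)
  then show ?thesis by simp
qed

text \<open>The jets of u and of sigma_0 are all generators and have to be checked one by one; the
  later sigma_k are generators themselves, so their first derivative is enough.\<close>

lemma commute_dx:
  assumes D: "sder s D" "s = id \<or> s = par" "scont D" "\<And>a. dx (s a) = s (dx a)"
    and t: "\<And>k. dx (D (time k)) = 0" "\<And>k. dx (D (tau k)) = 0"
    and f: "\<And>k. D (dx (fone k)) = dx (D (fone k))"
    and u: "\<And>j. D ((dx ^^ j) ufield) = (dx ^^ j) (D ufield)"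
    and th: "\<And>j. D ((dx ^^ j) (sigma 0)) = (dx ^^ j) (D (sigma 0))"
    and sg: "\<And>k. D (dx (sigma k)) = dx (D (sigma k))"
  shows "D (dx a) = dx (D a)"
proof -
  have s1: "s 1 = 1" using D(2) by auto
  note D0 = lin_0[OF sder_lin[OF D(1)]] sder_one[OF D(1) s1]
  have "D (dx a) - dx (D a) = 0"
  proof (rule sder_zero_ext[OF sder_commutator[OF D(1) sder_dt D(4)] s1])
    show "time_continuous (\<lambda>a. D (dx a) - dx (D a))"
      by (rule scont_tc[OF scont_diff[OF scont_comp[OF D(3) scont_dt] scont_comp[OF scont_dt D(3)]]])
    have "D (dx (even_gen (U j))) = dx (D (even_gen (U j)))" for j
      using u[of j] u[of "Suc j"] unfolding funpow.simps o_apply by (simp only: dx_pow_u)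
    then show "D (dx (even_gen x)) - dx (D (even_gen x)) = 0" for x
      by (cases x) (auto simp: f t dt_time D0)
    have "D (dx (odd_gen (Th j))) = dx (D (odd_gen (Th j)))" for j
      using th[of j] th[of "Suc j"] unfolding funpow.simps o_apply by (simp only: dx_pow_sigma0)
    then show "D (dx (odd_gen y)) - dx (D (odd_gen y)) = 0" for y
      using sg[of "Suc _"] by (cases y) (auto simp: t dt_tau D0)
  qed
  then show ?thesis by simp
qed

lemma dt_dx: "dt n (dx a) = dx (dt n a)"
proof (rule commute_dx[OF sder_dt _ scont_dt])
  fix k
  have "const eps * dt n (dx (fone k)) = const eps * dx (dt n (fone k))"
    using dt_fone[of 0 k] dt_fone[of n k]
    by (simp add: lin_const_mult[OF lin_dt, symmetric] Om_0 dx_Om)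
  then show "dt n (dx (fone k)) = dx (dt n (fone k))" using eps const_cancel by blast
  show "dt n ((dx ^^ j) ufield) = (dx ^^ j) (dt n ufield)" for j
    using dt_jet_u[of n j] dt_jet_u[of n 0] by simp
  show "dt n ((dx ^^ j) (sigma 0)) = (dx ^^ j) (dt n (sigma 0))" for j
    using dt_jet_sigma[of n j 0] dt_jet_sigma[of n 0 0] by simp
  show "dt n (dx (sigma k)) = dx (dt n (sigma k))"
    using dt_jet_sigma[of n 1 k] dt_jet_sigma[of n 0 k] by simp
qed (auto simp: dt_time dt_tau lin_0[OF lin_dt] sder_one[OF sder_dt])

lemma dtau_dx: "dtau n (dx a) = dx (dtau n a)"
proof (rule commute_dx[OF sder_dtau _ scont_dtau])
  fix k
  have "const eps * dtau n (dx (fone k)) = const eps * dx (dtau n (fone k))"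
    using dt_fone[of 0 k] dtau_fone[of n k]
    by (simp add: lin_const_mult[OF lin_dt, symmetric] lin_const_mult[OF lin_dtau, symmetric] Om_0 dx_Ph)
  then show "dtau n (dx (fone k)) = dx (dtau n (fone k))" using eps const_cancel by blast
  show "dtau n ((dx ^^ j) ufield) = (dx ^^ j) (dtau n ufield)" for j
    using dtau_jet_u[of n j] dtau_jet_u[of n 0] by simp
  have s: "dtau n ((dx ^^ j) (sigma k)) = (dx ^^ j) (dtau n (sigma k))" for j k
  proof (cases "k \<le> n")
    case True
    then show ?thesis using dtau_jet_sigma[of k n j] dtau_jet_sigma[of k n 0] by simp
  next
    case False
    then show ?thesis using dtau_jet_sigma'[of n k j] dtau_jet_sigma'[of n k 0]
      by (simp add: lin_uminus[OF lin_funpow[OF lin_dt]])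
  qed
  show "dtau n ((dx ^^ j) (sigma 0)) = (dx ^^ j) (dtau n (sigma 0))" for j by (rule s)
  show "dtau n (dx (sigma k)) = dx (dtau n (sigma k))" using s[of 1 k] by simp
qed (auto simp: dtau_time dtau_tau lin_0[OF lin_dt] sder_one[OF sder_dt] par_dt)

lemma d_dx: "d n (dx a) = dx (d n a)"
  by (cases n) (simp_all add: d_0 d_Suc dt_dx lin_0[OF lin_dt] lin_const_mult[OF lin_dt])

lemma d_u: "d n ufield = dx (r n)"
  using dt_jet_u[of _ 0]
  by (cases n) (simp_all add: d_0 d_Suc r_def R_0 sder_const[OF sder_dt] sder_one[OF sder_dt] lin_const_mult[OF lin_dt])

lemma dtau_u: "dtau n ufield = dx (sigma n)"
  using dtau_jet_u[of n 0] by simp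

lemma dx_g: "dx (g n) = (if n = 0 then 0 else r n)"
proof (cases n)
  case (Suc k)
  have "dx (g n) = const (cf (Suc k)) * (const eps * dx (fone k))"
    by (simp add: Suc g_Suc lin_const_mult[OF lin_dt] const_mult_assoc mult.commute)
  then show ?thesis using dt_fone[of 0 k] by (simp add: Suc Om_0 r_def)
qed (simp add: g_0 lin_0[OF lin_dt])

end

declare sigma.simps [simp del]

context tau_cover
begin

text \<open>The resolvent: the generating function of the r_n in the variable X, which solves the
  third-order equation \<open>lft_dx_rF\<close>.\<close>

definition rF :: "salg fps" where "rF = Abs_fps r"

lemma rF_nth [simp]: "rF \<odot> n = r n"
  by (simp add: rF_def)

lemma central_rF: "central rF"
  by (rule central_fps) (simp add: central_r)

lemma allc_rF: "allc u_poly rF"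
  by (simp add: allc_def u_poly_r)

lemma numeral_nth: "(numeral m * f) \<odot> n = numeral m * (f \<odot> n :: salg)"
  by (simp add: numeral_fps_const)

lemma lft_dx_rF: "2 * lft dx rF = fps_X * df.Q rF"
proof (rule fps_ext)
  fix n
  show "(2 * lft dx rF) \<odot> n = (fps_X * df.Q rF) \<odot> n"
    by (cases n) (simp_all add: numeral_nth r_0 sder_one[OF sder_dt] r_rec PP_Q Q_nth)
qed

lemma lft_dx_X0: "lft dx fps_X = 0"
  by (rule fps_ext) (simp add: fps_X_def lin_0[OF lin_dt] sder_one[OF sder_dt])

lemmas fnorm = df.D_simps df.norm central_rF central_X lft_dx_X0

lemma u_polyF: "allc u_poly f \<Longrightarrow> allc u_poly (lft dx f)"
  by (simp add: allc_def u_poly_dx)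

lemma allc_H: "allc u_poly f \<Longrightarrow> allc u_poly h \<Longrightarrow> allc u_poly (df.H f h)"
  unfolding df.H_def
  by (intro allc_add allc_diff allc_mult allc_const u_polyF subalg_u_poly u_poly_closed)

lemma afps_rF: "afps rF = 1"
  by (rule fps_ext) (simp add: afps_nth aug_r)

lemma afps_dx: "allc diff_poly f \<Longrightarrow> afps (lft dx f) = 0"
  by (rule fps_ext) (simp add: afps_nth allc_def aug_dx)

text \<open>By the third-order equation and \<open>D_H\<close> both sides have the same derivative.
  Their difference is a polynomial in the jets of u without constant term, hence zero.\<close>

lemma resolvent_square: "rF * rF = 1 + fps_X * df.H rF rF"
proof -
  define E where "E = rF * rF - 1 - fps_X * df.H rF rF"
  have "2 * lft dx (rF * rF) = rF * (2 * lft dx rF) + (2 * lft dx rF) * rF"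
    by (simp add: fnorm)
  also have "\<dots> = fps_X * (rF * df.Q rF + df.Q rF * rF)"
    unfolding lft_dx_rF by (simp add: fnorm)
  also have "\<dots> = 2 * lft dx (fps_X * df.H rF rF)"
    unfolding df.D_H[OF central_rF, symmetric] by (simp add: fnorm)
  finally have "2 * lft dx E = 0"
    unfolding E_def df.D_diff df.D_1 right_diff_distrib by simp
  then have "(2 * lft dx E) \<odot> n = 0" for n by (simp only: fps_zero_nth)
  then have "2 * dx (E \<odot> n) = 2 * 0" for n unfolding numeral_nth lft_nth by simp
  then have 1: "dx (E \<odot> n) = 0" for n by (rule two_cancel)
  have "allc u_poly E"
    unfolding E_def by (intro allc_diff allc_mult allc_X allc_1 allc_rF allc_H subalg_u_poly)
  then have 2: "u_poly (E \<odot> n)" for n by (simp add: allc_def)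
  have "allc diff_poly rF" "allc diff_poly (lft dx rF)"
    using allc_rF u_polyF[OF allc_rF] by (auto simp: allc_def u_diff_poly)
  then have "afps E = 0"
    by (simp add: E_def afps_simps afps_mult afps_rF df.H_def afps_dx)
  then have 3: "aug (E \<odot> n) = 0" for n by (simp flip: afps_nth)
  have "E \<odot> n = 0" for n by (rule u_poly_kernel[OF 2 1 3])
  then have "E = 0" by (simp add: fps_eq_iff)
  then show ?thesis by (simp add: E_def algebra_simps)
qed

text \<open>The product rule and commutation with \<open>dx\<close> are required only on polynomials
  in the jets of u. So odd flows qualify, and so do flows whose commutation with \<open>dx\<close>
  is still to be proved elsewhere; the b_i need not be differential polynomials.\<close>

definition flowlike :: "(salg \<Rightarrow> salg) \<Rightarrow> (nat \<Rightarrow> salg) \<Rightarrow> bool" where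
  "flowlike \<delta> b \<longleftrightarrow> lin \<delta> \<and> (\<forall>x y. u_poly x \<longrightarrow> u_poly y \<longrightarrow> \<delta> (x * y) = \<delta> x * y + x * \<delta> y) \<and>
     (\<forall>x. u_poly x \<longrightarrow> \<delta> (dx x) = dx (\<delta> x)) \<and> \<delta> ufield = dx (b 0) \<and> (\<forall>i. dx (b (Suc i)) = PP (b i))"

lemma lft_dx_seq:
  assumes "\<And>i. dx (b (Suc i)) = PP (b i)"
  shows "2 * lft dx (Abs_fps b) = 2 * fps_const (dx (b 0)) + fps_X * df.Q (Abs_fps b)"
proof (rule fps_ext)
  fix n
  show "(2 * lft dx (Abs_fps b)) \<odot> n = (2 * fps_const (dx (b 0)) + fps_X * df.Q (Abs_fps b)) \<odot> n"
    unfolding fps_add_nth numeral_nth lft_nth by (cases n) (simp_all add: assms PP_Q Q_nth)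
qed

lemma H_X: "df.H (fps_X * f) h = fps_X * df.H f h"
  unfolding df.H_def by (simp add: fnorm)

text \<open>The resolvent starts with 1 and the right-hand side is divisible by X, so the lowest
  coefficient of Z vanishes, then the next, and so on.\<close>

lemma resolvent_unique:
  assumes "2 * (rF * Z) = fps_X * (2 * df.H Z rF)"
  shows "Z = 0"
proof -
  have "Z \<odot> n = 0" for n
  proof (induction n rule: less_induct)
    case (less n)
    have "(rF * Z) \<odot> n = (\<Sum>i=0..n. r i * Z \<odot> (n - i))" by (simp add: fps_mult_nth)
    also have "\<dots> = r 0 * Z \<odot> n + (\<Sum>i=Suc 0..n. r i * Z \<odot> (n - i))"
      by (simp add: sum.atLeast_Suc_atMost)
    also have "(\<Sum>i=Suc 0..n. r i * Z \<odot> (n - i)) = 0"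
      by (rule sum.neutral) (use less in auto)
    finally have "(2 * (rF * Z)) \<odot> n = 2 * Z \<odot> n" by (simp add: numeral_nth r_0)
    moreover have "(fps_X * (2 * df.H Z rF)) \<odot> n = 0"
    proof (cases n)
      case (Suc m)
      have z: "j \<le> m \<Longrightarrow> Z \<odot> j = 0" for j using less Suc by simp
      have "(Z * f) \<odot> m = 0" "(lft dx Z * f) \<odot> m = 0" "(lft dx (lft dx Z) * f) \<odot> m = 0" for f
        by (rule fps_mult_left_zero; simp add: z lin_0[OF lin_dt])+
      then have "df.H Z rF \<odot> m = 0" by (simp add: df.H_def mult.assoc)
      then show ?thesis by (simp add: Suc numeral_nth)
    qed simp
    ultimately have "2 * Z \<odot> n = 2 * 0" using assms by simp
    then show ?case by (rule two_cancel)
  qed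
  then show ?thesis by (simp add: fps_eq_iff)
qed

text \<open>The quadratic identity determines the action of a flow \<open>\<delta>\<close> on the resolvent from
  \<open>\<delta> u = b\<^sub>0'\<close> without integration, so that also nonlocal flows are covered.\<close>

theorem flow_resolvent:
  assumes "flowlike \<delta> b"
  shows "2 * lft \<delta> rF = fps_X * df.br rF (Abs_fps b)"
proof -
  define B where "B = Abs_fps b"
  define B0 where "B0 = fps_const (dx (b 0))"
  define y where "y = lft \<delta> rF"
  define Y where "Y = fps_X * df.br rF B"
  have lin: "lin \<delta>" and mult: "u_poly x \<Longrightarrow> u_poly z \<Longrightarrow> \<delta> (x * z) = \<delta> x * z + x * \<delta> z"
    and comm: "u_poly x \<Longrightarrow> \<delta> (dx x) = dx (\<delta> x)" and u: "\<delta> ufield = dx (b 0)"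
    and b: "\<And>i. dx (b (Suc i)) = PP (b i)" for x z
    using assms unfolding flowlike_def by blast+
  have c: "\<delta> (const c) = 0" for c
  proof -
    have "\<delta> 1 = 0" using mult[OF u_poly_closed(2) u_poly_closed(2)] by simp
    then show ?thesis using lin_const_mult[OF lin, of c 1] by simp
  qed
  have m: "allc u_poly f \<Longrightarrow> allc u_poly h \<Longrightarrow> lft \<delta> (f * h) = lft \<delta> f * h + f * lft \<delta> h" for f h
    by (rule lft_mult[OF lin]) (simp add: allc_def mult)
  have cm: "allc u_poly f \<Longrightarrow> lft \<delta> (lft dx f) = lft dx (lft \<delta> f)" for f
    by (rule fps_ext) (simp add: allc_def comm)
  note R = allc_rF u_polyF[OF allc_rF] u_polyF[OF u_polyF[OF allc_rF]]
  have au: "allc u_poly (fps_const ufield)" "allc u_poly (fps_const kap)"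
    by (intro allc_const subalg_u_poly u_poly_closed)+
  have cst: "lft \<delta> (fps_const ufield) = B0" "lft \<delta> (fps_const kap) = 0" "lft \<delta> 1 = 0"
    using u c[of 1] by (auto intro!: fps_ext simp: c B0_def lin_0[OF lin])
  have pl: "allc u_poly f \<Longrightarrow> allc u_poly h \<Longrightarrow> allc u_poly (f * h)" for f h
    by (rule allc_mult[OF subalg_u_poly])
  have pa: "allc u_poly f \<Longrightarrow> allc u_poly h \<Longrightarrow> allc u_poly (f + h)" for f h
    by (rule allc_add[OF subalg_u_poly])
  have pd: "allc u_poly f \<Longrightarrow> allc u_poly h \<Longrightarrow> allc u_poly (f - h)" for f h
    by (rule allc_diff[OF subalg_u_poly])
  have "lft \<delta> (rF * rF) = fps_X * lft \<delta> (df.H rF rF)"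
    by (subst resolvent_square) (simp add: lft_add[OF lin] lft_X_mult[OF lin] cst)
  moreover have "lft \<delta> (rF * rF) = y * rF + rF * y"
    unfolding y_def by (rule m[OF allc_rF allc_rF])
  moreover have "lft \<delta> (df.H rF rF) = B0 * rF * rF + fps_const ufield * (y * rF + rF * y) +
      fps_const kap * (y * lft dx (lft dx rF) + rF * lft dx (lft dx y)
        - (lft dx y * lft dx rF + lft dx rF * lft dx y) + lft dx (lft dx y) * rF + lft dx (lft dx rF) * y)"
    unfolding df.H_def y_def
    by (simp add: m R au pl pa pd cm lft_add[OF lin] lft_diff[OF lin] cst) (simp add: algebra_simps)
  ultimately have "y * rF + rF * y = fps_X * (B0 * rF * rF + fps_const ufield * (y * rF + rF * y) +
      fps_const kap * (y * lft dx (lft dx rF) + rF * lft dx (lft dx y)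
        - (lft dx y * lft dx rF + lft dx rF * lft dx y) + lft dx (lft dx y) * rF + lft dx (lft dx rF) * y))"
    by (simp only:)
  moreover have "2 * (rF * y) = y * rF + rF * y" by (simp add: fnorm)
  \<comment> \<open>The quadratic identity differentiated along the flow: a linear equation for y
    whose source is the variation of u.\<close>
  ultimately have E1: "2 * (rF * y) = fps_X * (B0 * rF * rF + 2 * df.H y rF)"
    unfolding df.H_def by (simp add: fnorm)
  have rB: "2 * lft dx B = 2 * B0 + fps_X * df.Q B"
    unfolding B_def B0_def by (rule lft_dx_seq) (rule b)
  \<comment> \<open>The candidate Y satisfies the equation of y with twice the source, so 2 y - Y
    satisfies the homogeneous equation.\<close>
  have "2 * (rF * Y) = fps_X * (rF * rF * (2 * lft dx B) - rF * (2 * lft dx rF) * B)"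
    unfolding Y_def df.br_def by (simp add: fnorm)
  also have "\<dots> = fps_X * (2 * B0 * rF * rF) + fps_X * (fps_X * (rF * rF * df.Q B - rF * df.Q rF * B))"
    unfolding rB lft_dx_rF by (simp add: fnorm)
  also have "\<dots> = fps_X * (2 * B0 * rF * rF + 2 * df.H Y rF)"
    unfolding df.H_br[OF central_rF, symmetric] Y_def H_X by (simp add: fnorm)
  finally have E2: "2 * (rF * Y) = fps_X * (2 * B0 * rF * rF + 2 * df.H Y rF)" .
  have "2 * (rF * (2 * y - Y)) = 2 * (2 * (rF * y)) - 2 * (rF * Y)" by (simp add: fnorm)
  also have "\<dots> = fps_X * (2 * df.H (2 * y - Y) rF)"
    unfolding E1 E2 df.H_def by (simp add: fnorm)
  finally have "2 * y - Y = 0" by (rule resolvent_unique)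
  then show ?thesis by (simp add: y_def Y_def B_def)
qed

lemma X_br_nth: "(fps_X * df.br rF (Abs_fps b)) \<odot> n = (\<Sum>i<n. ds.br (r (n - 1 - i)) (b i))"
proof (cases n)
  case (Suc m)
  have "df.br rF (Abs_fps b) \<odot> m = (\<Sum>i=0..m. r i * dx (b (m - i)) - dx (r i) * b (m - i))"
    by (simp add: df.br_def fps_mult_nth sum_subtractf)
  also have "\<dots> = (\<Sum>i<n. ds.br (r (n - 1 - i)) (b i))"
    unfolding Suc ds.br_def
    by (rule sum.reindex_bij_witness[where i = "\<lambda>i. m - i" and j = "\<lambda>i. m - i"]) auto
  finally show ?thesis by (simp add: Suc)
qed simp

lemma flow_resolvent_nth:
  assumes "flowlike \<delta> b"
  shows "2 * \<delta> (r n) = (\<Sum>i<n. ds.br (r (n - 1 - i)) (b i))"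
  using arg_cong[OF flow_resolvent[OF assms], of "\<lambda>f. f \<odot> n"] unfolding X_br_nth
  by (simp add: numeral_nth)

lemma flowlike_d: "flowlike (d n) (\<lambda>i. r (n + i))"
  unfolding flowlike_def using lin_d sder_mult[OF sder_d] d_dx d_u r_rec by simp

lemma flowlike_dtau: "flowlike (dtau n) (\<lambda>i. sigma (n + i))"
  unfolding flowlike_def using lin_dtau sder_mult[OF sder_dtau] dtau_dx dtau_u dx_sigma par_u_poly by simp

text \<open>The prescribed flow of sigma_k is the sum of brackets that \<open>flow_resolvent\<close>
  yields for the tau_k-flow of r_n: the factor (1/2)_n cancels against the Gamma quotients and
  leaves exactly the normalisation of the r_{n-1-i}.\<close>

lemma d_sigma: "d n (sigma k) = dtau k (r n)"
proof (rule two_cancel)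
  have "2 * dtau k (r n) = (\<Sum>i<n. ds.br (r (n - 1 - i)) (sigma (k + i)))"
    by (rule flow_resolvent_nth[OF flowlike_dtau])
  also have "\<dots> = 2 * d n (sigma k)"
  proof (cases n)
    case (Suc m)
    have g: "cf n * (Gamma (of_nat (m - i) + 1/2) / Gamma (of_nat m + 3/2)) = cf (m - i)" for i
      using Gamma_half_nz[of 0] by (simp add: Gamma_cf Gamma_cf_Suc Suc)
    have "2 * d n (sigma k) = const 2 * (const (cf n) * (const (1/2) *
        (\<Sum>i\<le>m. const (Gamma (of_nat (m - i) + 1/2) / Gamma (of_nat m + 3/2)) *
          (R (m - i) * dx (sigma (k + i)) - dx (R (m - i)) * sigma (k + i)))))"
      using dt_jet_sigma[of m 0 k] by (simp add: Suc d_Suc sigma_t_def const_numeral)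
    also have "\<dots> = const (cf n) * (\<Sum>i\<le>m. const (Gamma (of_nat (m - i) + 1/2) / Gamma (of_nat m + 3/2)) *
          (R (m - i) * dx (sigma (k + i)) - dx (R (m - i)) * sigma (k + i)))"
      unfolding const_mult_assoc by simp
    also have "\<dots> = (\<Sum>i\<le>m. ds.br (r (m - i)) (sigma (k + i)))"
      unfolding sum_distrib_left const_mult_assoc g ds.br_def r_def lin_const_mult[OF lin_dt]
      by (simp add: right_diff_distrib mult.assoc)
    finally show ?thesis by (simp add: Suc lessThan_Suc_atMost)
  qed (simp add: d_0)
  finally show "2 * d n (sigma k) = 2 * dtau k (r n)" ..
qed

text \<open>The sums of brackets for the two sides differ in a single term. This moves an index from
  the differential polynomial to the flow, and symmetry follows by iteration.\<close>

lemma d_r_Suc: "2 * d j (r (Suc k)) = 2 * d (Suc j) (r k) + ds.br (r k) (r j)"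
  unfolding flow_resolvent_nth[OF flowlike_d] by (subst sum.lessThan_Suc_shift) simp

lemma dtau_r_Suc: "2 * dtau j (r (Suc k)) = 2 * dtau (Suc j) (r k) + ds.br (r k) (sigma j)"
  unfolding flow_resolvent_nth[OF flowlike_dtau] by (subst sum.lessThan_Suc_shift) simp

lemma br_swap: "central a \<Longrightarrow> ds.br a b = - ds.br b a"
  unfolding ds.br_def by (simp add: ds.norm)

lemma d_r_sym: "d j (r k) = d k (r j)"
proof (induction j arbitrary: k)
  case 0
  show ?case by (simp add: d_0 r_0 sder_one[OF sder_d])
next
  case (Suc j)
  have "2 * d (Suc j) (r k) = 2 * d j (r (Suc k)) - ds.br (r k) (r j)" using d_r_Suc[of j k] by simp
  also have "\<dots> = 2 * d (Suc k) (r j) + ds.br (r j) (r k)"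
    using Suc[of "Suc k"] br_swap[OF central_r, of k "r j"] by simp
  also have "\<dots> = 2 * d k (r (Suc j))" using d_r_Suc[of k j] by simp
  finally show ?case by (rule two_cancel)
qed

subsection \<open>Commutativity of the flows\<close>

lemma dtau_sigma_swap: "dtau n (sigma k) = - dtau k (sigma n)"
  using dtau_jet_sigma[of _ _ 0] dtau_jet_sigma'[of _ _ 0]
  by (cases "k \<le> n") (metis add.inverse_inverse funpow_0 nat_le_linear)+

lemma dtau_dtau_u_poly:
  assumes "u_poly a"
  shows "dtau n (dtau k a) + dtau k (dtau n a) = 0"
proof (rule sder_u_poly_zero[OF _ _ assms])
  show "sder id (\<lambda>a. dtau n (dtau k a) + dtau k (dtau n a))"
    by (rule sder_anticommutator[OF sder_dtau sder_dtau]) (rule par_dtau)+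
  have "dtau n (sigma k) + dtau k (sigma n) = 0" using dtau_sigma_swap[of n k] by simp
  moreover have "dtau n ((dx ^^ j) a) = (dx ^^ j) (dtau n a)" for n j a
    by (induction j) (simp_all add: dtau_dx)
  ultimately have "dtau n (dtau k ((dx ^^ j) ufield)) + dtau k (dtau n ((dx ^^ j) ufield)) = (dx ^^ Suc j) 0" for j
    by (simp add: dtau_u dtau_dx funpow_swap1 flip: lin_add[OF lin_funpow[OF lin_dt]] lin_add[OF lin_dt])
  then show "dtau n (dtau k (even_gen (U j))) + dtau k (dtau n (even_gen (U j))) = 0" for j
    using lin_0[OF lin_funpow[OF lin_dt]] unfolding dx_pow_u by metis
qed simp

text \<open>An operator that commutes with \<open>dx\<close> and kills u is compatible with the
  recursion: the derivative of C sigma_{k+1} is P_1 applied to C sigma_k. Integration is legitimate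
  because C sigma_{k+1} is a differential polynomial without constant term.\<close>

lemma C_sigma_kernel:
  assumes C: "sder s C" "s = id \<or> s = par" "\<And>a. C (dx a) = dx (C a)" "C ufield = 0"
    and p: "diff_poly (C (sigma (Suc k)))" "aug (C (sigma (Suc k))) = 0" and k: "C (sigma k) = 0"
  shows "C (sigma (Suc k)) = 0"
proof (rule diff_poly_kernel[OF p(1) _ p(2)])
  have "s 1 = 1" using C(2) by auto
  then have c: "C (const c) = 0" for c by (rule sder_const[OF C(1)])
  have "dx (C (sigma (Suc k))) = C (PP (sigma k))" by (simp add: C(3)[symmetric] dx_sigma)
  also have "\<dots> = 0"
    unfolding P1_def by (simp add: lin_add[OF sder_lin[OF C(1)]] sder_mult[OF C(1)] C(3) C(4) c k lin_0[OF lin_dt])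
  finally show "dx (C (sigma (Suc k))) = 0" .
qed

text \<open>As the t-flow of sigma_k is the tau_k-flow of a polynomial in u, where the odd flows
  anticommute, the commutator of tau_n with t_j on sigma_k is antisymmetric in n and k. It vanishes
  for n = k = 0, then for n = 0 by the recursion in k, for k = 0 by antisymmetry, and in general by
  the recursion again.\<close>

lemma dtau_dt_sigma: "dtau n (dt j (sigma k)) = dt j (dtau n (sigma k))"
proof -
  let ?C = "\<lambda>n a. dtau n (dt j a) - dt j (dtau n a)"
  have C: "sder par (?C n)" for n by (rule sder_commutator[OF sder_dtau sder_dt]) (rule par_dt)
  have Cdx: "?C n (dx a) = dx (?C n a)" for n a by (simp add: dt_dx dtau_dx lin_diff[OF lin_dt])
  have dp: "diff_poly (?C n (sigma k))" "aug (?C n (sigma k)) = 0" for n k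
    by (simp_all add: diff_poly_closed diff_poly_dt diff_poly_dtau diff_poly_sigma aug_dt aug_dtau)
  have dts: "const (cf (Suc j)) * dt j (sigma k) = dtau k (r (Suc j))" for k
    using d_sigma[of "Suc j" k] by (simp add: d_Suc)
  have Cu: "?C n ufield = 0" for n
  proof -
    have "const (cf (Suc j)) * dtau n (dt j ufield) = dtau n (d (Suc j) ufield)"
      by (simp add: d_Suc lin_const_mult[OF lin_dtau])
    also have "\<dots> = dx (dtau n (r (Suc j)))" by (simp add: d_u dtau_dx)
    also have "\<dots> = const (cf (Suc j)) * dt j (dtau n ufield)"
      by (simp add: dtau_u dt_dx dts[symmetric] lin_const_mult[OF lin_dt])
    finally show ?thesis using const_cancel[OF cf_nz] by auto
  qed
  have anti: "?C n (sigma k) + ?C k (sigma n) = 0" for n k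
  proof (rule const_cancel[OF cf_nz[of "Suc j"]])
    have "const (cf (Suc j)) * (?C n (sigma k) + ?C k (sigma n)) =
      dtau n (dtau k (r (Suc j))) + dtau k (dtau n (r (Suc j)))
      - const (cf (Suc j)) * dt j (dtau n (sigma k) + dtau k (sigma n))"
      by (simp add: dts[symmetric] lin_const_mult[OF lin_dtau] lin_add[OF lin_dt] distrib_left right_diff_distrib)
    then show "const (cf (Suc j)) * (?C n (sigma k) + ?C k (sigma n)) = const (cf (Suc j)) * 0"
      using dtau_dtau_u_poly[OF u_poly_r] dtau_sigma_swap[of n k] by (simp add: lin_0[OF lin_dt])
  qed
  have ind: "?C n (sigma k) = 0" if "?C n (sigma 0) = 0" for n k
    by (induction k) (use that C_sigma_kernel[OF C _ Cdx Cu dp] in auto)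
  have "2 * ?C 0 (sigma 0) = 2 * 0" using anti[of 0 0] by (simp only: mult_2 mult_zero_right)
  then have "?C 0 (sigma 0) = 0" by (rule two_cancel)
  then have "?C 0 (sigma k) = 0" for k by (rule ind)
  then have "?C n (sigma 0) = 0" for n using anti[of 0 n] by (metis add_0)
  then have "?C n (sigma k) = 0" by (rule ind)
  then show ?thesis by simp
qed

lemma Ph_aug: "aug (Ph k n) = 0"
  by (rule aug_odd[OF Ph_par])

text \<open>On f_k the commutator is, up to eps, a difference of flows of \<Omega> and \<Phi>. This
  is a differential polynomial without constant term whose derivative is the commutator on R_{k+1},
  where it is already known to vanish. The other pairs of flows are treated alike.\<close>

theorem dtau_dt: "dtau n (dt j a) = dt j (dtau n a)"
proof -
  let ?C = "\<lambda>a. dtau n (dt j a) - dt j (dtau n a)"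
  have C: "sder par ?C" by (rule sder_commutator[OF sder_dtau sder_dt]) (rule par_dt)
  have Cdx: "?C (dx a) = dx (?C a)" for a by (simp add: dt_dx dtau_dx lin_diff[OF lin_dt])
  have Cu: "?C ufield = 0"
  proof -
    have "const (cf (Suc j)) * dtau n (dt j ufield) = dtau n (d (Suc j) ufield)"
      by (simp add: d_Suc lin_const_mult[OF lin_dtau])
    also have "\<dots> = dx (dtau n (r (Suc j)))" by (simp add: d_u dtau_dx)
    also have "\<dots> = dx (d (Suc j) (sigma n))" by (simp add: d_sigma)
    also have "\<dots> = const (cf (Suc j)) * dt j (dtau n ufield)"
      by (simp add: dtau_u dt_dx d_Suc lin_const_mult[OF lin_dt])
    finally show ?thesis using const_cancel[OF cf_nz] by auto
  qed
  have CU: "?C (even_gen (U i)) = 0" for i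
  proof -
    have "?C ((dx ^^ i) ufield) = (dx ^^ i) (?C ufield)" by (induction i) (simp_all add: Cdx)
    then show ?thesis unfolding Cu dx_pow_u lin_0[OF lin_funpow[OF lin_dt]] .
  qed
  have Cf: "?C (fone k) = 0" for k
  proof (rule const_cancel[OF eps])
    have "const eps * ?C (fone k) = dtau n (Om k j) - dt j (Ph k n)"
      by (simp add: right_diff_distrib dt_fone[symmetric] dtau_fone[symmetric]
          lin_const_mult[OF lin_dtau] lin_const_mult[OF lin_dt])
    moreover have "dtau n (Om k j) - dt j (Ph k n) = 0"
    proof (rule diff_poly_kernel)
      have "dx (dtau n (Om k j) - dt j (Ph k n)) = ?C (R (Suc k))"
        by (simp add: lin_diff[OF lin_dt] dtau_dx[symmetric] dt_dx[symmetric] dx_Om dx_Ph)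
      also have "\<dots> = 0" by (rule sder_u_poly_zero[OF C _ R_poly]) (simp_all add: CU)
      finally show "dx (dtau n (Om k j) - dt j (Ph k n)) = 0" .
    qed (simp_all add: diff_poly_closed diff_poly_dt diff_poly_dtau u_diff_poly[OF Om_poly] Ph_poly aug_dt aug_dtau)
    ultimately show "const eps * ?C (fone k) = const eps * 0" by simp
  qed
  have "?C a = 0"
    by (rule der_ext[OF C _ _ Cdx _ _ Cf Cu])
      (auto simp: dtau_dt_sigma dt_time dt_tau dtau_time dtau_tau lin_0[OF lin_dt] lin_0[OF lin_dtau]
        sder_one[OF sder_dt] sder_one[OF sder_dtau]
        intro: scont_tc[OF scont_diff[OF scont_comp[OF scont_dtau scont_dt] scont_comp[OF scont_dt scont_dtau]]])
  then show ?thesis by simp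
qed

lemma dtau_d: "dtau n (d j a) = d j (dtau n a)"
  by (cases j) (simp_all add: d_0 d_Suc dtau_dt lin_0[OF lin_dtau] lin_const_mult[OF lin_dtau])

lemma dt_dt_gen:
  assumes "d (Suc j) (d (Suc n) a) = d (Suc n) (d (Suc j) a)"
  shows "dt j (dt n a) = dt n (dt j a)"
proof -
  have "const (cf (Suc j) * cf (Suc n)) * dt j (dt n a) = const (cf (Suc j) * cf (Suc n)) * dt n (dt j a)"
    using assms by (simp add: d_Suc lin_const_mult[OF lin_dt] const_mult_assoc mult.commute)
  then show ?thesis by (rule const_cancel[rotated]) simp
qed

theorem dt_dt: "dt j (dt n a) = dt n (dt j a)"
proof -
  let ?C = "\<lambda>a. dt j (dt n a) - dt n (dt j a)"
  have C: "sder id ?C" by (rule sder_commutator[OF sder_dt sder_dt]) simp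
  have Cdx: "?C (dx a) = dx (?C a)" for a by (simp add: dt_dx lin_diff[OF lin_dt])
  have "dt j (dt n ufield) = dt n (dt j ufield)"
    by (rule dt_dt_gen) (simp add: d_u d_dx d_r_sym[of "Suc j"])
  then have Cu: "?C ufield = 0" by simp
  have CU: "?C (even_gen (U i)) = 0" for i
  proof -
    have "?C ((dx ^^ i) ufield) = (dx ^^ i) (?C ufield)" by (induction i) (simp_all add: Cdx)
    then show ?thesis unfolding Cu dx_pow_u lin_0[OF lin_funpow[OF lin_dt]] .
  qed
  have "dt j (dt n (sigma k)) = dt n (dt j (sigma k))" for k
    by (rule dt_dt_gen) (simp add: d_sigma dtau_d[symmetric] d_r_sym[of "Suc j"])
  then have Cs: "?C (sigma k) = 0" for k by simp
  have Cf: "?C (fone k) = 0" for k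
  proof (rule const_cancel[OF eps])
    have "const eps * ?C (fone k) = dt j (Om k n) - dt n (Om k j)"
      by (simp add: right_diff_distrib dt_fone[symmetric] lin_const_mult[OF lin_dt])
    moreover have "dt j (Om k n) - dt n (Om k j) = 0"
    proof (rule diff_poly_kernel)
      have "dx (dt j (Om k n) - dt n (Om k j)) = ?C (R (Suc k))"
        by (simp add: lin_diff[OF lin_dt] dt_dx[symmetric] dx_Om)
      also have "\<dots> = 0" by (rule sder_u_poly_zero[OF C _ R_poly]) (simp_all add: CU)
      finally show "dx (dt j (Om k n) - dt n (Om k j)) = 0" .
    qed (simp_all add: diff_poly_closed diff_poly_dt u_diff_poly[OF Om_poly] aug_dt)
    ultimately show "const eps * ?C (fone k) = const eps * 0" by simp
  qed
  have "?C a = 0"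
    by (rule der_ext[OF C _ _ Cdx _ _ Cf Cu Cs])
      (auto simp: dt_time dt_tau lin_0[OF lin_dt] sder_one[OF sder_dt]
        intro: scont_tc[OF scont_diff[OF scont_comp[OF scont_dt scont_dt] scont_comp[OF scont_dt scont_dt]]])
  then show ?thesis by simp
qed

lemma d_d: "d j (d n a) = d n (d j a)"
  by (cases j; cases n) (simp_all add: d_0 d_Suc dt_dt lin_0[OF lin_dt] lin_const_mult[OF lin_dt]
      const_mult_assoc mult.commute)

theorem dtau_dtau: "dtau j (dtau n a) = - dtau n (dtau j a)"
proof -
  let ?C = "\<lambda>j n a. dtau j (dtau n a) + dtau n (dtau j a)"
  have C: "sder id (?C j n)" for j n by (rule sder_anticommutator[OF sder_dtau sder_dtau]) (rule par_dtau)+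
  have Cdx: "?C j n (dx a) = dx (?C j n a)" for j n a by (simp add: dtau_dx lin_add[OF lin_dt])
  have Cu: "?C j n a = 0" if "u_poly a" for j n a using dtau_dtau_u_poly[OF that] .
  have dp: "diff_poly (?C j n (sigma k))" "aug (?C j n (sigma k)) = 0" for j n k
    by (simp_all add: diff_poly_closed diff_poly_dtau diff_poly_sigma aug_dtau)
  have ind: "?C j n (sigma k) = 0" if "?C j n (sigma 0) = 0" for j n k
    by (induction k) (use that C_sigma_kernel[OF C _ Cdx Cu[OF u_poly_closed(4)] dp] in auto)
  \<comment> \<open>The antisymmetry of the odd flows of the sigma's, differentiated once more. From
    this cyclic identity the vanishing for (0, 0) spreads to (0, n) and then to (j, n), with the
    recursion in k in between.\<close>
  have cyc: "?C j n (sigma k) + ?C n k (sigma j) + ?C k j (sigma n) = 0" for j n k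
  proof -
    have "?C j n (sigma k) + ?C n k (sigma j) + ?C k j (sigma n) =
        dtau j (dtau n (sigma k) + dtau k (sigma n)) + dtau n (dtau j (sigma k) + dtau k (sigma j))
        + dtau k (dtau n (sigma j) + dtau j (sigma n))"
      by (simp add: lin_add[OF lin_dtau] add_ac)
    moreover have "dtau n (sigma k) + dtau k (sigma n) = 0" for n k using dtau_sigma_swap[of n k] by simp
    ultimately show ?thesis by (simp add: lin_0[OF lin_dtau])
  qed
  have "dtau 0 (sigma 0) = 0"
    using dtau_jet_sigma[of 0 0 0] by (simp add: sigma_tau_def)
  then have "?C 0 0 (sigma 0) = 0" by (simp only: lin_0[OF lin_dtau] add_0)
  then have c00: "?C 0 0 (sigma k) = 0" for k by (rule ind)
  have "2 * ?C 0 n (sigma 0) = 2 * 0" for n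
    using cyc[of 0 n 0] c00[of n] by (simp add: mult_2 add_ac)
  then have c0n: "?C 0 n (sigma 0) = 0" for n by (rule two_cancel)
  then have c0: "?C 0 n (sigma k) = 0" for n k by (rule ind)
  have "?C j n (sigma 0) = 0" for j n
    using cyc[of j n 0] c0[of j n] c0[of n j] by (simp add: add_ac)
  then have Cs: "?C j n (sigma k) = 0" for j n k by (rule ind)
  have Cf: "?C j n (fone k) = 0" for k
  proof (rule const_cancel[OF eps])
    have "const eps * ?C j n (fone k) = dtau j (Ph k n) + dtau n (Ph k j)"
      by (simp add: distrib_left dtau_fone[symmetric] lin_const_mult[OF lin_dtau])
    moreover have "dtau j (Ph k n) + dtau n (Ph k j) = 0"
    proof (rule diff_poly_kernel)
      have "dx (dtau j (Ph k n) + dtau n (Ph k j)) = ?C j n (R (Suc k))"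
        by (simp add: lin_add[OF lin_dt] dtau_dx[symmetric] dx_Ph)
      then show "dx (dtau j (Ph k n) + dtau n (Ph k j)) = 0" using Cu[OF R_poly] by simp
    qed (simp_all add: diff_poly_closed diff_poly_dtau Ph_poly aug_dtau)
    ultimately show "const eps * ?C j n (fone k) = const eps * 0" by simp
  qed
  have "?C j n a = 0"
    by (rule der_ext[OF C _ _ Cdx _ _ Cf Cu[OF u_poly_closed(4)] Cs])
      (auto simp: dtau_time dtau_tau lin_0[OF lin_dtau] sder_one[OF sder_dtau]
        intro: scont_tc[OF scont_add[OF scont_comp[OF scont_dtau scont_dtau] scont_comp[OF scont_dtau scont_dtau]]])
  then show ?thesis by (simp add: eq_neg_iff_add_eq_0)
qed

end

declare fps_const_add [simp del] fps_const_mult [simp del]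

context tau_cover
begin

subsection \<open>Local identities for the Virasoro flows\<close>

definition gF :: "salg fps" where "gF = Abs_fps g"
text \<open>Since 2 d_j g_1 = r_j for j > 0, this is twice the second-order part of L_M applied to
  g_1, without its coefficient.\<close>

definition J :: "nat \<Rightarrow> salg" where "J M = (\<Sum>k\<le>M. d k (r (M - k)))"
definition JF :: "salg fps" where "JF = Abs_fps J"
abbreviation K :: salg where "K \<equiv> const (eps\<^sup>2 / 2)"
text \<open>The part of rho_M without explicit times; it still contains the one-point
  functions.\<close>

definition rho_l :: "nat \<Rightarrow> salg" where "rho_l M = K * J M + (\<Sum>k\<le>M. r k * g (M - k))"
definition rho_lF :: "salg fps" where "rho_lF = fps_const K * JF + rF * gF"

lemma gF_nth [simp]: "gF \<odot> n = g n" and JF_nth [simp]: "JF \<odot> n = J n"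
  by (simp_all add: gF_def JF_def)

lemma rho_lF_nth: "rho_lF \<odot> n = rho_l n"
proof -
  have "(fps_const K * JF) \<odot> n = K * J n" by simp
  moreover have "(rF * gF) \<odot> n = (\<Sum>k\<le>n. r k * g (n - k))" by (simp add: fps_mult_nth atLeast0AtMost)
  ultimately show ?thesis by (simp only: rho_lF_def rho_l_def fps_add_nth)
qed

lemma par_g: "par (g n) = g n"
  by (cases n) (simp_all add: g_0 g_Suc lin_0[OF lin_par] lin_const_mult[OF lin_par])

lemma central_even: "par a = a \<Longrightarrow> central a"
  using even_cen cen_central by blast

lemma central_gF: "central gF"
  by (rule central_fps) (simp add: central_even par_g)

lemma u_poly_d: "u_poly a \<Longrightarrow> u_poly (d n a)"
  by (cases n) (simp_all add: d_0 d_Suc u_poly_closed u_poly_dt)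

lemma diff_poly_d: "diff_poly a \<Longrightarrow> diff_poly (d n a)"
  by (cases n) (simp_all add: d_0 d_Suc diff_poly_closed diff_poly_dt)

lemma u_poly_J: "u_poly (J M)"
  unfolding J_def by (intro u_poly_closed u_poly_d u_poly_r)

lemma central_JF: "central JF"
  by (rule central_fps) (simp add: central_u_poly u_poly_J)

lemma central_eul: "central f \<Longrightarrow> (\<And>n. central (f \<odot> n)) \<Longrightarrow> central (eul f)"
proof (rule central_fps)
  fix n assume "\<And>n. central (f \<odot> n)"
  moreover have "central (of_nat n :: salg)" using central_const[of "of_nat n"] by (simp add: const_of_nat)
  ultimately show "central (eul f \<odot> n)" by (simp add: central_mult)
qed

lemma central_eul_rF: "central (eul rF)"
  by (rule central_eul[OF central_rF]) (simp add: central_r)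

lemma lft_dx_const: "lft dx (fps_const (const c)) = 0"
  by (rule fps_ext) (simp add: sder_const[OF sder_dt] lin_0[OF lin_dt])

lemmas fnorm2 = fnorm lft_dx_const central_gF central_JF central_eul_rF central_fps_const[OF central_const]

lemma sum_triangle: "(\<Sum>k\<le>M. \<Sum>i<M - k. f (k + i)) = (\<Sum>q<M. of_nat (Suc q) * (f q :: salg))"
proof -
  have "(\<Sum>k\<le>M. \<Sum>i<M - k. f (k + i)) = (\<Sum>(k, i)\<in>(SIGMA k:{..M}. {..<M - k}). f (k + i))"
    by (simp add: sum.Sigma)
  also have "\<dots> = (\<Sum>(q, k)\<in>(SIGMA q:{..<M}. {..q}). f q)"
    by (rule sum.reindex_bij_witness[where i = "\<lambda>(q, k). (k, q - k)" and j = "\<lambda>(k, i). (k + i, k)"]) auto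
  also have "\<dots> = (\<Sum>q<M. \<Sum>k\<le>q. f q)"
    by (rule sum.Sigma[symmetric]) auto
  also have "\<dots> = (\<Sum>q<M. of_nat (Suc q) * f q)" by simp
  finally show ?thesis .
qed

text \<open>The bracket formula for the d_k r_{M-k} makes the left side a double sum of brackets
  that depend only on q = k + i; there are q + 1 pairs for each q. The weight q gives the Euler
  operator, and the weight 1 gives the bracket of the resolvent with itself, which is zero.\<close>

lemma two_JF: "2 * JF = fps_X * df.br rF (eul rF)"
proof (rule fps_ext)
  fix M
  let ?f = "\<lambda>q. ds.br (r (M - 1 - q)) (r q)"
  have "2 * J M = (\<Sum>k\<le>M. \<Sum>i<M - k. ?f (k + i))"
    unfolding J_def sum_distrib_left flow_resolvent_nth[OF flowlike_d]
    by (intro sum.cong refl) (simp add: add.commute diff_diff_add)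
  also have "\<dots> = (\<Sum>q<M. of_nat q * ?f q) + (\<Sum>q<M. ?f q)"
    using sum_triangle[of ?f M] by (simp add: distrib_right sum.distrib add.commute)
  also have "(\<Sum>q<M. ?f q) = (fps_X * df.br rF rF) \<odot> M" using X_br_nth[of r M] by (simp add: rF_def)
  also have "df.br rF rF = 0" unfolding df.br_def by (simp add: fnorm)
  also have "(\<Sum>q<M. of_nat q * ?f q) = (\<Sum>q<M. ds.br (r (M - 1 - q)) (of_nat q * r q))"
    unfolding ds.br_def lin_of_nat_mult[OF lin_dt] by (simp add: of_nat_salg_left_commute right_diff_distrib)
  also have "\<dots> = (fps_X * df.br rF (eul rF)) \<odot> M"
    unfolding eul_def by (subst X_br_nth) simp
  finally show "(2 * JF) \<odot> M = (fps_X * df.br rF (eul rF)) \<odot> M" by (simp add: numeral_nth)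
qed

lemma eul_Q: "eul (df.Q f) = df.Q (eul f)"
  by (rule fps_ext) (simp add: Q_nth ds.Q_def lin_of_nat_mult[OF lin_dt] of_nat_salg_left_commute distrib_left)

lemma lft_dx_eul: "lft dx (eul f) = eul (lft dx f)"
  by (rule lft_eul[OF lin_dt])

lemma eul_numeral: "eul (numeral n * f) = numeral n * eul f"
  by (rule fps_ext) (simp add: numeral_nth, metis const_numeral const_left_commute const_of_nat)

lemma dx_eul_rF: "2 * lft dx (eul rF) = fps_X * df.Q rF + fps_X * df.Q (eul rF)"
  unfolding lft_dx_eul eul_numeral[symmetric] lft_dx_rF eul_X_mult eul_Q ..

text \<open>The Euler operator does not commute with multiplication by X, so \<open>eul rF\<close>
  obeys the third-order equation only with a source. \<open>br_Q\<close> transports the equation to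
  the bracket, and the sources give the quadratic terms.\<close>

lemma JF_rec: "2 * lft dx JF = fps_X * df.Q JF + fps_X * (rF * lft dx (lft dx rF) + 2 * (lft dx rF * lft dx rF))"
proof -
  let ?b = "df.br rF (eul rF)"
  have "2 * lft dx ?b = rF * lft dx (2 * lft dx (eul rF)) - lft dx (2 * lft dx rF) * eul rF"
    unfolding df.br_def by (simp add: fnorm2)
  also have "\<dots> = fps_X * (rF * lft dx (df.Q rF) + (rF * lft dx (df.Q (eul rF)) - lft dx (df.Q rF) * eul rF))"
    unfolding dx_eul_rF lft_dx_rF by (simp add: fnorm2)
  also have "rF * lft dx (df.Q (eul rF)) - lft dx (df.Q rF) * eul rF
      = df.Q ?b + 2 * (df.Q rF * lft dx (eul rF) - lft dx rF * df.Q (eul rF))"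
    unfolding df.br_Q[OF central_rF, symmetric] by simp
  also have "fps_X * (rF * lft dx (df.Q rF) + (df.Q ?b + 2 * (df.Q rF * lft dx (eul rF) - lft dx rF * df.Q (eul rF))))
      = fps_X * df.Q ?b + rF * lft dx (fps_X * df.Q rF) +
        2 * ((fps_X * df.Q rF) * lft dx (eul rF) - lft dx rF * (fps_X * df.Q (eul rF)))"
    by (simp add: fnorm2)
  also have "fps_X * df.Q (eul rF) = 2 * lft dx (eul rF) - 2 * lft dx rF"
    unfolding dx_eul_rF lft_dx_rF by simp
  also have "rF * lft dx (fps_X * df.Q rF) = 2 * (rF * lft dx (lft dx rF))"
    unfolding lft_dx_rF[symmetric] by (simp add: fnorm2)
  also have "(fps_X * df.Q rF) * lft dx (eul rF) - lft dx rF * (2 * lft dx (eul rF) - 2 * lft dx rF)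
      = 2 * (lft dx rF * lft dx rF)"
    unfolding lft_dx_rF[symmetric] by (simp add: fnorm2)
  finally have b: "2 * lft dx ?b = fps_X * df.Q ?b + 2 * (rF * lft dx (lft dx rF)) + 2 * (2 * (lft dx rF * lft dx rF))" .
  have QX: "df.Q (fps_X * f) = fps_X * df.Q f" "df.Q (2 * f) = 2 * df.Q f" for f
    unfolding df.Q_def by (simp_all add: fnorm2)
  have "2 * (2 * lft dx JF) = fps_X * (2 * lft dx ?b)"
    using arg_cong[OF two_JF, of "\<lambda>f. 2 * lft dx f"] by (simp add: lft_numeral_mult[OF lin_dt] lft_X_mult[OF lin_dt]) (simp add: fnorm2)
  also have "\<dots> = fps_X * df.Q (fps_X * ?b) + 2 * (fps_X * (rF * lft dx (lft dx rF) + 2 * (lft dx rF * lft dx rF)))"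
    unfolding b QX by (simp add: fnorm2)
  also have "\<dots> = 2 * (fps_X * df.Q JF + fps_X * (rF * lft dx (lft dx rF) + 2 * (lft dx rF * lft dx rF)))"
    unfolding two_JF[symmetric] QX by (simp add: fnorm2)
  finally have "const 2 * ((2 * lft dx JF) \<odot> n) = const 2 * ((fps_X * df.Q JF + fps_X * (rF * lft dx (lft dx rF) + 2 * (lft dx rF * lft dx rF))) \<odot> n)" for n
    by (metis numeral_nth const_numeral)
  then show ?thesis by (intro fps_ext) (rule const_cancel[of 2], simp, blast)
qed

lemma fps_two_cancel: "2 * f = 2 * h \<Longrightarrow> f = (h :: salg fps)"
  by (rule fps_ext) (metis numeral_nth two_cancel)

lemma lft_dx_gF: "lft dx gF = rF - 1"
  by (rule fps_ext) (simp add: dx_g r_0)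

lemma K_kap: "fps_const K = 4 * fps_const kap"
proof -
  have "4 * fps_const kap = fps_const (4 * kap)" by (simp add: numeral_fps_const fps_const_mult)
  also have "4 * kap = K" using const_mult[of 4 "eps\<^sup>2 / 8"] by (simp add: const_numeral)
  finally show ?thesis ..
qed

lemma numeral_4_eq:
  fixes x :: "'a::ring_1"
  shows "3 * x = x + x + x" "4 * x = x + x + x + x" "6 * x = x + x + x + x + x + x"
proof -
  have n: "(3::'a) = 1 + 1 + 1" "(4::'a) = 1 + 1 + 1 + 1" "(6::'a) = 1 + 1 + 1 + 1 + 1 + 1" by simp_all
  show "3 * x = x + x + x" "4 * x = x + x + x + x" "6 * x = x + x + x + x + x + x"
    unfolding n by (simp_all only: distrib_left distrib_right mult_1_left mult_1_right)
qed

text \<open>The derivative of \<open>gF\<close> is rF - 1, which produces terms quadratic in the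
  resolvent. Together with those of \<open>JF_rec\<close> they become linear by the quadratic
  identity; the linear remainder is what the explicit times compensate in
  \<open>rho_Suc\<close>.\<close>

lemma rho_l_rec:
  "2 * lft dx rho_lF = fps_X * df.Q rho_lF +
     fps_X * (2 * fps_const ufield * rF + 6 * fps_const kap * lft dx (lft dx rF)) - 2 * rF + 2"
proof -
  let ?k = "fps_const kap" and ?u = "fps_const ufield"
  have k1: "4 * ?k * (2 * lft dx JF) = 4 * ?k * (fps_X * df.Q JF + fps_X * (rF * lft dx (lft dx rF) + 2 * (lft dx rF * lft dx rF)))"
    unfolding JF_rec ..
  have "2 * lft dx rho_lF = 4 * ?k * (2 * lft dx JF) + (2 * lft dx rF) * gF + 2 * (rF * rF) - 2 * rF"
    unfolding rho_lF_def K_kap by (simp add: fnorm2 lft_dx_gF numeral_4_eq)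
  moreover have "fps_X * df.Q rho_lF = fps_X * (4 * ?k * df.Q JF) + (fps_X * df.Q rF) * gF +
      fps_X * (2 * ?u * rF * rF - 2 * ?u * rF + 2 * ?k * (4 * (rF * lft dx (lft dx rF)) - 3 * lft dx (lft dx rF)
        + 3 * (lft dx rF * lft dx rF)))"
    unfolding rho_lF_def K_kap df.Q_def by (simp add: fnorm2 lft_dx_gF numeral_4_eq)
  moreover have "2 * (rF * rF) = 2 + fps_X * (2 * ?u * rF * rF + 2 * ?k * (2 * (rF * lft dx (lft dx rF)) - lft dx rF * lft dx rF))"
    by (subst resolvent_square) (simp add: df.H_def fnorm2)
  ultimately show ?thesis unfolding k1 lft_dx_rF by (simp add: fnorm2 numeral_4_eq)
qed

text \<open>A pair of consecutive flows of one of the two families.\<close>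

definition consec :: "(salg \<Rightarrow> salg) \<Rightarrow> (salg \<Rightarrow> salg) \<Rightarrow> (nat \<Rightarrow> salg) \<Rightarrow> bool" where
  "consec \<delta> \<delta>' b \<longleftrightarrow> flowlike \<delta> b \<and> flowlike \<delta>' (\<lambda>i. b (Suc i)) \<and>
     (\<forall>i. diff_poly (b i) \<and> aug (b i) = 0) \<and>
     (\<forall>D\<in>{\<delta>, \<delta>'}. (\<forall>n. diff_poly (D (g n)) \<and> aug (D (g n)) = 0 \<and> dx (D (g n)) = D (dx (g n))) \<and>
        (\<forall>x y. par x = x \<longrightarrow> D (x * y) = D x * y + x * D y))"

lemma eps_g_flow:
  "const eps * dt n (fone k) = Om k n \<Longrightarrow> dt n (g (Suc k)) = const (cf (Suc k)) * Om k n"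
  "dtau n (g (Suc k)) = const (cf (Suc k)) * Ph k n"
  using dtau_fone[of n k]
  by (auto simp: g_Suc lin_const_mult[OF lin_dt] lin_const_mult[OF lin_dtau] const_mult mult.assoc
      mult.commute[of eps])

text \<open>Up to numerical factors these are \<Omega> and \<Phi>: the g_n are not differential
  polynomials, but their flows are.\<close>

lemma flow_g: "u_poly (d n (g m))" "aug (d n (g m)) = 0" "diff_poly (dtau n (g m))" "aug (dtau n (g m)) = 0"
proof -
  have "dt n (g (Suc k)) = const (cf (Suc k)) * Om k n" for n k by (rule eps_g_flow(1)[OF dt_fone])
  then show "u_poly (d n (g m))" "aug (d n (g m)) = 0"
    by (cases n; cases m; simp add: d_0 d_Suc g_0 lin_0[OF lin_dt] u_poly_closed Om_poly Om_aug)+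
  show "diff_poly (dtau n (g m))" "aug (dtau n (g m)) = 0"
    by (cases m; simp add: g_0 lin_0[OF lin_dtau] eps_g_flow(2) diff_poly_closed Ph_poly Ph_aug)+
qed

lemma consec_d: "n > 0 \<Longrightarrow> consec (d n) (d (Suc n)) (\<lambda>i. r (n + i))"
  unfolding consec_def using flowlike_d[of n] flowlike_d[of "Suc n"] flow_g(1,2)
  by (auto simp: u_diff_poly u_poly_r aug_r d_dx sder_mult[OF sder_d])

lemma consec_dtau: "consec (dtau n) (dtau (Suc n)) (\<lambda>i. sigma (n + i))"
  unfolding consec_def using flowlike_dtau[of n] flowlike_dtau[of "Suc n"] flow_g(3,4)
  by (auto simp: diff_poly_sigma aug_sigma dtau_dx sder_mult[OF sder_dtau])

lemma afps_0I: "(\<And>n. aug (f \<odot> n) = 0) \<Longrightarrow> afps f = 0"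
  by (rule fps_ext) (simp add: afps_nth)

text \<open>The flows of the g_n are known only through their derivatives, the flows of the r_n. In
  the combination of two consecutive flows the bracket sums telescope to the bracket with b_0 alone,
  and \<open>D_H\<close> supplies an explicit primitive.\<close>

lemma Phi_rel:
  assumes "consec \<delta> \<delta>' b"
  shows "2 * lft \<delta> gF - 2 * (fps_X * lft \<delta>' gF)
     = 2 * (fps_X * (rF * Abs_fps b - fps_X * df.H rF (Abs_fps b))) - fps_X * (rF * fps_const (b 0))"
proof -
  define B where "B = Abs_fps b"
  define B' where "B' = Abs_fps (\<lambda>i. b (Suc i))"
  define b0 where "b0 = fps_const (b 0)"
  define P where "P = lft \<delta> gF"
  define P' where "P' = lft \<delta>' gF"
  have fl: "flowlike \<delta> b" "flowlike \<delta>' (\<lambda>i. b (Suc i))" and b: "\<And>i. dx (b (Suc i)) = PP (b i)"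
    using assms unfolding consec_def flowlike_def by blast+
  have bp: "diff_poly (b i)" "aug (b i) = 0" for i using assms by (auto simp: consec_def)
  have Dg: "diff_poly (\<delta> (g n))" "aug (\<delta> (g n)) = 0" "dx (\<delta> (g n)) = \<delta> (dx (g n))"
    "diff_poly (\<delta>' (g n))" "aug (\<delta>' (g n)) = 0" "dx (\<delta>' (g n)) = \<delta>' (dx (g n))" for n
    using assms by (auto simp: consec_def)
  have one: "D (r 0) = 0" "D 0 = 0" if "flowlike D c" for D c
    using flow_resolvent_nth[OF that, of 0] two_cancel[of "D (r 0)" 0] lin_0[of D] that
    by (auto simp: flowlike_def)
  have DP: "lft dx P = lft \<delta> rF" "lft dx P' = lft \<delta>' rF"
    using Dg(3,6) one[OF fl(1)] one[OF fl(2)] by (auto intro!: fps_ext simp: P_def P'_def dx_g)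
  have BB: "B = b0 + fps_X * B'"
  proof (rule fps_ext)
    fix n show "B \<odot> n = (b0 + fps_X * B') \<odot> n" by (cases n) (simp_all add: B_def b0_def B'_def)
  qed
  have dB: "2 * lft dx B = 2 * lft dx b0 + fps_X * df.Q B"
  proof -
    have "lft dx b0 = fps_const (dx (b 0))" unfolding b0_def by (rule fps_ext) (simp add: lin_0[OF lin_dt])
    then show ?thesis unfolding B_def using lft_dx_seq[of b] b by simp
  qed
  define E where "E = 2 * P - 2 * (fps_X * P') - (2 * (fps_X * (rF * B - fps_X * df.H rF B)) - fps_X * (rF * b0))"
  have "lft dx (2 * P - 2 * (fps_X * P')) = 2 * lft \<delta> rF - fps_X * (2 * lft \<delta>' rF)"
    by (simp add: fnorm2 DP)
  also have "\<dots> = fps_X * (df.br rF B - fps_X * df.br rF B')"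
    unfolding flow_resolvent[OF fl(1)] flow_resolvent[OF fl(2)] B_def B'_def by (simp add: fnorm2)
  also have "\<dots> = fps_X * df.br rF b0"
    unfolding BB df.br_def by (simp add: fnorm2)
  finally have 1: "lft dx (2 * P - 2 * (fps_X * P')) = fps_X * df.br rF b0" .
  have "lft dx (2 * (fps_X * (rF * B - fps_X * df.H rF B)) - fps_X * (rF * b0)) =
      fps_X * ((2 * lft dx rF) * B + rF * (2 * lft dx B)) - fps_X * (fps_X * (2 * lft dx (df.H rF B)))
      - fps_X * (lft dx rF * b0 + rF * lft dx b0)"
    by (simp add: fnorm2)
  also have "\<dots> = fps_X * df.br rF b0"
    unfolding df.D_H[OF central_rF] dB lft_dx_rF df.br_def by (simp add: fnorm2)
  finally have 2: "lft dx (2 * (fps_X * (rF * B - fps_X * df.H rF B)) - fps_X * (rF * b0)) = fps_X * df.br rF b0" .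
  have "lft dx E = 0" unfolding E_def df.D_diff[of "2 * P - 2 * (fps_X * P')"] 1 2 by simp
  then have E1: "dx (E \<odot> n) = 0" for n by (metis lft_nth fps_zero_nth)
  note V = subalg_diff_poly
  have aB: "allc diff_poly B" "allc diff_poly P" "allc diff_poly P'" "allc diff_poly rF"
    "allc diff_poly b0" "allc diff_poly (fps_const ufield)" "allc diff_poly (fps_const kap)"
    using bp Dg u_diff_poly[OF u_poly_r]
    by (auto simp: allc_def B_def P_def P'_def b0_def fps_const_def diff_poly_closed)
  have lD: "allc diff_poly f \<Longrightarrow> allc diff_poly (lft dx f)" for f by (simp add: allc_def diff_poly_dx)
  have m: "allc diff_poly f \<Longrightarrow> allc diff_poly h \<Longrightarrow> allc diff_poly (f * h)"
    "allc diff_poly f \<Longrightarrow> allc diff_poly h \<Longrightarrow> allc diff_poly (f + h)"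
    "allc diff_poly f \<Longrightarrow> allc diff_poly h \<Longrightarrow> allc diff_poly (f - h)"
    "allc diff_poly fps_X" "allc diff_poly 2" for f h
    using allc_mult[OF V] allc_add[OF V] allc_diff[OF V] allc_X[OF V] allc_numeral[OF V] by blast+
  have "allc diff_poly E"
    unfolding E_def df.H_def by (intro m aB lD)
  then have E2: "diff_poly (E \<odot> n)" for n by (simp add: allc_def)
  have z: "afps B = 0" "afps P = 0" "afps P' = 0" "afps b0 = 0" "afps (lft dx B) = 0" "afps (lft dx (lft dx B)) = 0"
    using bp Dg by (auto intro!: afps_0I aug_dx diff_poly_dx simp: B_def P_def P'_def b0_def fps_const_def)
  have "afps E = 0" unfolding E_def df.H_def by (simp add: afps_simps afps_mult z)
  then have E3: "aug (E \<odot> n) = 0" for n by (simp flip: afps_nth)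
  have "E \<odot> n = 0" for n by (rule diff_poly_kernel[OF E2 E1 E3])
  then have "E = 0" by (simp add: fps_eq_iff)
  then show ?thesis unfolding E_def P_def P'_def B_def b0_def by simp
qed

text \<open>The counterpart of \<open>d_r_Suc\<close> for rho: one step in the flow index against
  one step in M, with a bracket as correction. The right-hand side is the remainder that the
  explicit times cancel.\<close>

lemma rho_l_consec:
  assumes "consec \<delta> \<delta>' b"
  shows "2 * (fps_X * lft \<delta>' rho_lF) - 2 * lft \<delta> rho_lF + fps_X * df.br rho_lF (fps_const (b 0))
     = fps_X * (rF * fps_const (b 0)) - 2 * (fps_X * Abs_fps b)"
proof -
  define B where "B = Abs_fps b"
  define B' where "B' = Abs_fps (\<lambda>i. b (Suc i))"
  define b0 where "b0 = fps_const (b 0)"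
  define P where "P = lft \<delta> gF"
  define P' where "P' = lft \<delta>' gF"
  define y where "y = lft \<delta> rF"
  define y' where "y' = lft \<delta>' rF"
  let ?t = "eul rF" and ?k = "fps_const kap"
  have fl: "flowlike \<delta> b" "flowlike \<delta>' (\<lambda>i. b (Suc i))"
    using assms unfolding consec_def by blast+
  have lin: "lin \<delta>" "lin \<delta>'" using fl by (auto simp: flowlike_def)
  have BB: "B = b0 + fps_X * B'"
  proof (rule fps_ext)
    fix n show "B \<odot> n = (b0 + fps_X * B') \<odot> n" by (cases n) (simp_all add: B_def b0_def B'_def)
  qed
  have y2: "2 * y = fps_X * df.br rF B" unfolding y_def B_def by (rule flow_resolvent[OF fl(1)])
  have "2 * (fps_X * y') = fps_X * (2 * y')" by (simp add: fnorm2)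
  also have "\<dots> = 2 * y - fps_X * df.br rF b0"
    unfolding y2 y'_def flow_resolvent[OF fl(2)] BB B'_def[symmetric] df.br_def by (simp add: fnorm2)
  finally have y'2: "2 * (fps_X * y') = 2 * y - fps_X * df.br rF b0" .
  have J: "2 * lft D JF = fps_X * (df.br (lft D rF) ?t + df.br rF (eul (lft D rF)))" if f: "flowlike D c" for D c
  proof -
    have lD: "lin D" and mD: "u_poly x \<Longrightarrow> u_poly z \<Longrightarrow> D (x * z) = D x * z + x * D z"
      and cD: "u_poly x \<Longrightarrow> D (dx x) = dx (D x)" for x z
      using f unfolding flowlike_def by blast+
    have au: "allc u_poly ?t" unfolding allc_def eul_nth
      using u_poly_closed(8)[OF u_poly_closed(3) u_poly_r] by (metis const_of_nat rF_nth)
    have m: "allc u_poly f \<Longrightarrow> allc u_poly h \<Longrightarrow> lft D (f * h) = lft D f * h + f * lft D h" for f h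
      by (rule lft_mult[OF lD]) (simp add: allc_def mD)
    have cm: "allc u_poly f \<Longrightarrow> lft D (lft dx f) = lft dx (lft D f)" for f
      by (rule fps_ext) (simp add: allc_def cD)
    have "2 * lft D JF = fps_X * lft D (df.br rF ?t)"
      unfolding lft_numeral_mult[OF lD, symmetric] two_JF lft_X_mult[OF lD] ..
    also have "lft D (df.br rF ?t) = df.br (lft D rF) ?t + df.br rF (eul (lft D rF))"
      unfolding df.br_def lft_diff[OF lD] m[OF allc_rF u_polyF[OF au]] m[OF u_polyF[OF allc_rF] au]
        cm[OF allc_rF] cm[OF au] lft_eul[OF lD] by simp
    finally show ?thesis .
  qed
  have brX: "df.br (fps_X * f) h = fps_X * df.br f h" "df.br f (fps_X * h) = fps_X * df.br f h"
    "df.br (f + f') h = df.br f h + df.br f' h" "df.br (f - f') h = df.br f h - df.br f' h"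
    "df.br f (h + f') = df.br f h + df.br f f'" "df.br f (h - f') = df.br f h - df.br f f'"
    "df.br (2 * f) h = 2 * df.br f h" "df.br f (2 * h) = 2 * df.br f h" for f f' h
    unfolding df.br_def by (simp_all add: fnorm2)
  have eb0: "eul (df.br rF b0) = df.br ?t b0"
  proof -
    have "eul b0 = 0" "eul (lft dx b0) = 0"
      by (auto intro!: fps_ext simp: b0_def lin_0[OF lin_dt])
    then show ?thesis unfolding df.br_def by (simp add: eul_diff eul_mult lft_dx_eul)
  qed
  have "2 * (fps_X * eul y') = eul (2 * (fps_X * y')) - 2 * (fps_X * y')"
    by (simp add: eul_numeral eul_X_mult distrib_left)
  also have "\<dots> = 2 * eul y - fps_X * df.br ?t b0 - 2 * y"
    unfolding y'2 eul_diff eul_numeral eul_X_mult eb0 by simp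
  finally have ey': "2 * (fps_X * eul y') = 2 * eul y - fps_X * df.br ?t b0 - 2 * y" .
  have "2 * (2 * (fps_X * lft \<delta>' JF)) = fps_X * (2 * (2 * lft \<delta>' JF))" by (simp add: fnorm2)
  also have "\<dots> = fps_X * (df.br (2 * (fps_X * y')) ?t + df.br rF (2 * (fps_X * eul y')))"
    unfolding J[OF fl(2)] y'_def[symmetric] brX by (simp add: fnorm2)
  also have "\<dots> = fps_X * (2 * (df.br y ?t + df.br rF (eul y))) - 2 * (fps_X * df.br rF y)
      - fps_X * (fps_X * (df.br (df.br rF b0) ?t + df.br rF (df.br ?t b0)))"
    unfolding y'2 ey' brX by (simp add: fnorm2)
  also have "df.br (df.br rF b0) ?t = - df.br ?t (df.br rF b0)"
    unfolding df.br_def[of _ ?t] df.br_def[of ?t] by (simp add: fnorm2)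
  \<comment> \<open>Here the Jacobi identity merges the two nested brackets into one with
    \<open>df.br rF ?t\<close>, which is \<open>JF\<close> up to the factor X / 2.\<close>
  also have "- df.br ?t (df.br rF b0) + df.br rF (df.br ?t b0) = df.br (df.br rF ?t) b0"
    unfolding df.br_jacobi[OF central_rF central_eul_rF, symmetric] by simp
  also have "fps_X * (fps_X * df.br (df.br rF ?t) b0) = 2 * (fps_X * df.br JF b0)"
  proof -
    have "fps_X * df.br (df.br rF ?t) b0 = 2 * df.br JF b0" unfolding brX[symmetric] two_JF ..
    then show ?thesis by (simp add: fnorm2)
  qed
  also have "fps_X * (2 * (df.br y ?t + df.br rF (eul y))) = 2 * (2 * lft \<delta> JF)"
    unfolding J[OF fl(1)] y_def by (simp add: fnorm2)
  finally have JL: "2 * (2 * (fps_X * lft \<delta>' JF)) = 2 * (2 * lft \<delta> JF) - 2 * (fps_X * df.br rF y) - 2 * (fps_X * df.br JF b0)" .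
  have Kc: "lft D (fps_const K * f) = fps_const K * lft D f" if "lin D" for D f
    by (rule fps_ext) (simp add: lin_const_mult[OF that])
  have rg: "lft \<delta> (rF * gF) = y * gF + rF * P" "lft \<delta>' (rF * gF) = y' * gF + rF * P'"
    unfolding y_def y'_def P_def P'_def
    using assms by (auto intro!: lft_mult lin simp: consec_def par_r)
  have KJ: "2 * (2 * (fps_X * (fps_const K * lft \<delta>' JF))) - 2 * (2 * (fps_const K * lft \<delta> JF)) + 2 * (fps_X * (fps_const K * df.br JF b0))
      = 4 * (fps_X * (fps_X * (df.H rF rF * B - rF * df.H rF B)))"
  proof -
    have "2 * (2 * (fps_X * (fps_const K * lft \<delta>' JF))) - 2 * (2 * (fps_const K * lft \<delta> JF)) + 2 * (fps_X * (fps_const K * df.br JF b0))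
      = fps_const K * (2 * (2 * (fps_X * lft \<delta>' JF)) - 2 * (2 * lft \<delta> JF) + 2 * (fps_X * df.br JF b0))"
      by (simp add: fnorm2)
    also have "\<dots> = - (fps_const K * (fps_X * df.br rF (2 * y)))"
      unfolding JL brX by (simp add: fnorm2)
    also have "\<dots> = 4 * (fps_X * (fps_X * (df.H rF rF * B - rF * df.H rF B)))"
      unfolding y2 brX df.H_br_br[OF central_rF] K_kap by (simp add: fnorm2 numeral_4_eq)
    finally show ?thesis .
  qed
  have Pr: "2 * P - 2 * (fps_X * P') = 2 * (fps_X * (rF * B - fps_X * df.H rF B)) - fps_X * (rF * b0)"
    unfolding P_def P'_def B_def b0_def by (rule Phi_rel[OF assms])
  have RG: "2 * (2 * (fps_X * (y' * gF + rF * P'))) - 2 * (2 * (y * gF + rF * P)) + 2 * (fps_X * df.br (rF * gF) b0)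
      = 4 * (fps_X * (fps_X * (rF * df.H rF B))) - 4 * (fps_X * (rF * rF * B)) + 2 * (fps_X * (rF * b0))"
  proof -
    have "2 * (2 * (fps_X * (y' * gF + rF * P'))) - 2 * (2 * (y * gF + rF * P)) + 2 * (fps_X * df.br (rF * gF) b0)
      = 2 * ((2 * (fps_X * y')) * gF - 2 * y * gF) - 2 * (rF * (2 * P - 2 * (fps_X * P'))) + 2 * (fps_X * (df.br rF b0 * gF))
        - 2 * (fps_X * (rF * (rF - 1) * b0))"
      unfolding df.br_def[of "rF * gF"] df.br_def[of rF b0] by (simp add: fnorm2 lft_dx_gF)
    also have "\<dots> = 4 * (fps_X * (fps_X * (rF * df.H rF B))) - 4 * (fps_X * (rF * rF * B)) + 2 * (fps_X * (rF * b0))"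
      unfolding y'2 Pr by (simp add: fnorm2 numeral_4_eq)
    finally show ?thesis .
  qed
  have "2 * (2 * (fps_X * lft \<delta>' rho_lF) - 2 * lft \<delta> rho_lF + fps_X * df.br rho_lF b0) =
      (2 * (2 * (fps_X * (fps_const K * lft \<delta>' JF))) - 2 * (2 * (fps_const K * lft \<delta> JF)) + 2 * (fps_X * (fps_const K * df.br JF b0)))
      + (2 * (2 * (fps_X * (y' * gF + rF * P'))) - 2 * (2 * (y * gF + rF * P)) + 2 * (fps_X * df.br (rF * gF) b0))"
    unfolding rho_lF_def lft_add[OF lin(1)] lft_add[OF lin(2)] Kc[OF lin(1)] Kc[OF lin(2)] rg df.br_def
    by (simp add: fnorm2)
  also have "\<dots> = 4 * (fps_X * ((fps_X * df.H rF rF - rF * rF) * B)) + 2 * (fps_X * (rF * b0))"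
    unfolding KJ RG by (simp add: fnorm2)
  \<comment> \<open>The terms from the second-order part and from the g's meet in the quadratic
    identity, which leaves a constant.\<close>
  also have "fps_X * df.H rF rF - rF * rF = - 1"
    unfolding resolvent_square by simp
  also have "4 * (fps_X * (- 1 * B)) + 2 * (fps_X * (rF * b0)) = 2 * (fps_X * (rF * b0) - 2 * (fps_X * B))"
    by (simp add: fnorm2 numeral_4_eq)
  finally show ?thesis unfolding b0_def B_def by (rule fps_two_cancel)
qed

subsection \<open>Time-dependent terms\<close>

text \<open>All sums over explicit times in the flows have this shape. The weight 1 / (1/2)_k is
  what remains of the Gamma quotient once t-derivatives are replaced by the normalised
  \<open>d\<close>.\<close>

definition LL :: "(nat \<Rightarrow> salg) \<Rightarrow> (nat \<Rightarrow> salg) \<Rightarrow> salg" where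
  "LL p q = lsum (\<lambda>k. const (1 / cf k) * time k * p k) + lsum (\<lambda>k. const (of_nat k + c0) * tau k * q k)"

lemma LL_add: "LL (\<lambda>k. p k + p' k) (\<lambda>k. q k + q' k) = LL p q + LL p' q'"
proof -
  have "lsum (\<lambda>k. const (1 / cf k) * time k * (p k + p' k)) =
      lsum (\<lambda>k. const (1 / cf k) * time k * p k) + lsum (\<lambda>k. const (1 / cf k) * time k * p' k)"
    unfolding distrib_left by (rule lsum_add[OF ssum_time ssum_time])
  moreover have "lsum (\<lambda>k. const (of_nat k + c0) * tau k * (q k + q' k)) =
      lsum (\<lambda>k. const (of_nat k + c0) * tau k * q k) + lsum (\<lambda>k. const (of_nat k + c0) * tau k * q' k)"
    unfolding distrib_left by (rule lsum_add[OF ssum_tau ssum_tau])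
  ultimately show ?thesis by (simp add: LL_def)
qed

lemma LL_apply:
  assumes "lin D" "time_continuous D"
  shows "D (LL p q) = lsum (\<lambda>k. D (const (1 / cf k) * time k * p k)) + lsum (\<lambda>k. D (const (of_nat k + c0) * tau k * q k))"
  unfolding LL_def lin_add[OF assms(1)] lsum_apply[OF assms ssum_time] lsum_apply[OF assms ssum_tau] ..

text \<open>Two maps are needed on the right because a parity-sensitive \<open>D\<close> changes by
  a sign when it passes an odd time.\<close>

lemma LL_module_hom:
  assumes "lin D" "time_continuous D"
    "\<And>k a. D (const (1 / cf k) * time k * a) = const (1 / cf k) * time k * D1 a"
    "\<And>k a. D (const (of_nat k + c0) * tau k * a) = const (of_nat k + c0) * tau k * D2 a"
  shows "D (LL p q) = LL (\<lambda>k. D1 (p k)) (\<lambda>k. D2 (q k))"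
  by (simp only: LL_apply[OF assms(1,2)] assms(3,4)) (simp only: LL_def)

lemma LL_central_mult:
  assumes "central c"
  shows "c * LL p q = LL (\<lambda>k. c * p k) (\<lambda>k. c * q k)"
proof (rule LL_module_hom[OF lin_mult_left scont_tc[OF scont_mult_left]])
  show "c * (const (1 / cf k) * time k * a) = const (1 / cf k) * time k * (c * a)" for k a
    using assms by (metis central_def mult.assoc)
  show "c * (const (of_nat k + c0) * tau k * a) = const (of_nat k + c0) * tau k * (c * a)" for k a
    using assms by (metis central_def mult.assoc)
qed

lemma LL_mult_right: "LL p q * c = LL (\<lambda>k. p k * c) (\<lambda>k. q k * c)"
  by (rule LL_module_hom[OF lin_mult_right scont_tc[OF scont_mult_right]]) (simp_all add: mult.assoc)

lemma LL_uminus: "- LL p q = LL (\<lambda>k. - p k) (\<lambda>k. - q k)"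
  using LL_central_mult[of "-1" p q] by (simp add: central_closed)

lemma LL_diff: "LL (\<lambda>k. p k - p' k) (\<lambda>k. q k - q' k) = LL p q - LL p' q'"
  using LL_add[of p "\<lambda>k. - p' k" q "\<lambda>k. - q' k"] by (simp add: LL_uminus)

lemma LL_par: "par (LL p q) = LL (\<lambda>k. par (p k)) (\<lambda>k. - par (q k))"
  by (rule LL_module_hom[OF lin_par scont_tc[OF scont_par]]) (simp_all add: par_mult)

lemma LL_even_derivation:
  assumes "sder id D" "time_continuous D" "\<And>k. D (time k) = 0" "\<And>k. D (tau k) = 0"
  shows "D (LL p q) = LL (\<lambda>k. D (p k)) (\<lambda>k. D (q k))"
  by (rule LL_module_hom[OF sder_lin[OF assms(1)] assms(2)])
    (simp_all add: sder_mult[OF assms(1)] sder_const[OF assms(1)] assms(3,4))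

lemma LL_dt: "dt n (LL p q) = LL (\<lambda>k. dt n (p k)) (\<lambda>k. dt n (q k)) + const (1 / cf n) * p n"
proof -
  have 1: "dt n (const (1 / cf k) * time k * a) = (if k = n then const (1 / cf k) * a else 0) + const (1 / cf k) * time k * dt n a" for k a
    by (simp add: sder_mult[OF sder_dt] sder_const[OF sder_dt] dt_time)
  have 2: "dt n (const (of_nat k + c0) * tau k * a) = const (of_nat k + c0) * tau k * dt n a" for k a
    by (simp add: sder_mult[OF sder_dt] sder_const[OF sder_dt] dt_tau)
  have "lsum (\<lambda>k. (if k = n then const (1 / cf k) * p k else 0) + const (1 / cf k) * time k * dt n (p k))
      = const (1 / cf n) * p n + lsum (\<lambda>k. const (1 / cf k) * time k * dt n (p k))"
    by (subst lsum_add[OF ssum_single ssum_time]) (simp only: lsum_delta)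
  then show ?thesis by (simp only: LL_apply[OF lin_dt tc_dt] 1 2) (simp only: LL_def add_ac)
qed

lemma LL_d: "d (Suc n) (LL p q) = LL (\<lambda>k. d (Suc n) (p k)) (\<lambda>k. d (Suc n) (q k)) + const (of_nat n + 1/2) * p n"
  unfolding d_Suc LL_dt distrib_left LL_central_mult[OF central_const] const_mult_assoc by (simp add: cf_Suc)

lemma LL_dx: "dx (LL p q) = LL (\<lambda>k. dx (p k)) (\<lambda>k. dx (q k)) + p 0"
  using LL_dt[of 0] by simp

lemma LL_dtau: "dtau n (LL p q) = LL (\<lambda>k. dtau n (p k)) (\<lambda>k. - dtau n (q k)) + const (of_nat n + c0) * q n"
proof -
  have 1: "dtau n (const (1 / cf k) * time k * a) = const (1 / cf k) * time k * dtau n a" for k a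
    by (simp add: sder_mult[OF sder_dtau] sder_const[OF sder_dtau] dtau_time par_mult)
  have 2: "dtau n (const (of_nat k + c0) * tau k * a) = (if k = n then const (of_nat k + c0) * a else 0) + const (of_nat k + c0) * tau k * (- dtau n a)" for k a
    by (simp add: sder_mult[OF sder_dtau] sder_const[OF sder_dtau] dtau_tau par_mult)
  have "lsum (\<lambda>k. (if k = n then const (of_nat k + c0) * q k else 0) + const (of_nat k + c0) * tau k * (- dtau n (q k)))
      = const (of_nat n + c0) * q n + lsum (\<lambda>k. const (of_nat k + c0) * tau k * (- dtau n (q k)))"
    by (subst lsum_add[OF ssum_single ssum_tau]) (simp only: lsum_delta)
  then show ?thesis by (simp only: LL_apply[OF lin_dtau tc_dtau] 1 2) (simp only: LL_def add_ac)
qed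

lemma LL_0: "(\<And>k. p k = 0) \<Longrightarrow> (\<And>k. const (of_nat k + c0) * q k = 0) \<Longrightarrow> LL p q = 0"
proof -
  assume "\<And>k. p k = 0" and q: "\<And>k. const (of_nat k + c0) * q k = 0"
  moreover have "const (of_nat k + c0) * tau k * q k = tau k * (const (of_nat k + c0) * q k)" for k
    by (metis const_commute mult.assoc)
  ultimately show ?thesis by (simp add: LL_def lsum_zero)
qed

lemma LL_delta: "LL (\<lambda>k. 0) (\<lambda>k. if k = 0 then q else 0) = const c0 * tau 0 * q"
  by (simp add: LL_def lsum_zero if_distrib lsum_delta cong: if_cong)

text \<open>Shifted by one like \<open>d\<close> and \<open>g\<close>, so that index k + M belongs
  to sigma_{k+m}. The value 0 at index 0 expresses that the sum for s_{-1} has no term with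
  tau_0.\<close>

definition s :: "nat \<Rightarrow> salg" where "s n = (case n of 0 \<Rightarrow> 0 | Suc k \<Rightarrow> sigma k)"
definition e :: "nat \<Rightarrow> salg \<Rightarrow> salg" where "e n a = (case n of 0 \<Rightarrow> 0 | Suc k \<Rightarrow> dtau k a)"

lemma s_simps [simp]: "s 0 = 0" "s (Suc n) = sigma n"
  and e_simps [simp]: "e 0 a = 0" "e (Suc n) a = dtau n a"
  by (simp_all add: s_def e_def)

lemma lin_e: "lin (e n)"
  by (cases n) (simp_all add: e_def[abs_def] lin_dtau lin_def[of "\<lambda>a. 0"])

definition Lam :: "nat \<Rightarrow> salg" where "Lam M = LL (\<lambda>k. r (k + M)) (\<lambda>k. s (k + M))"
definition rho :: "nat \<Rightarrow> salg" where "rho M = rho_l M + Lam M"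

lemma par_s: "par (s n) = - s n"
  by (cases n) (simp_all add: par_sigma lin_0[OF lin_par])

lemma par_Lam: "par (Lam M) = Lam M"
  by (simp add: Lam_def LL_par par_r par_s)

lemma par_sum: "par (sum f A) = (\<Sum>x\<in>A. par (f x))"
  by (rule lin_sum[OF lin_par])

lemma par_rho_l: "par (rho_l M) = rho_l M"
  by (simp add: rho_l_def lin_add[OF lin_par] par_mult par_sum par_r par_g par_u_poly[OF u_poly_J])

lemma par_rho: "par (rho M) = rho M"
  by (simp add: rho_def lin_add[OF lin_par] par_rho_l par_Lam)

text \<open>The sum behaves as if its coefficients were constant except that \<open>dx\<close>
  differentiates t_0. The product t_0 r_M contributes r_M to the first and 3 r_M'' to the third
  derivative, hence 2 u and 6 kappa.\<close>

lemma Q_Lam: "ds.Q (Lam M) = LL (\<lambda>k. ds.Q (r (k + M))) (\<lambda>k. ds.Q (s (k + M)))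
    + (2 * ufield * r M + 6 * kap * dx (dx (r M)))"
proof -
  have c: "central (2 * ufield)" "central (dx ufield)" "central (2 * kap)"
    by (intro central_closed central_const ds.cu ds.central_D)+
  have D: "dx (Lam M) = LL (\<lambda>k. dx (r (k + M))) (\<lambda>k. dx (s (k + M))) + r M"
    by (simp add: Lam_def LL_dx)
  have D3: "dx (dx (dx (Lam M))) = LL (\<lambda>k. dx (dx (dx (r (k + M))))) (\<lambda>k. dx (dx (dx (s (k + M))))) + 3 * dx (dx (r M))"
    unfolding D by (simp add: LL_dx lin_add[OF lin_dt] numeral_4_eq)
  show ?thesis
    unfolding ds.Q_def[of "Lam M"] unfolding D3 unfolding D unfolding Lam_def distrib_left LL_central_mult[OF c(1)] LL_central_mult[OF c(2)] LL_central_mult[OF c(3)] ds.Q_def LL_add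
    by (simp add: distrib_left distrib_right mult.assoc numeral_4_eq mult_2 add_ac)
qed

lemma rho_l_Suc: "2 * dx (rho_l (Suc M)) = ds.Q (rho_l M) + (2 * ufield * r M + 6 * kap * dx (dx (r M))) - 2 * r (Suc M)"
proof -
  have "(2 * lft dx rho_lF) \<odot> Suc M = (fps_X * df.Q rho_lF +
     fps_X * (2 * (fps_const ufield * rF) + 6 * (fps_const kap * lft dx (lft dx rF))) - 2 * rF + 2) \<odot> Suc M"
    unfolding rho_l_rec by (simp add: mult.assoc)
  moreover have "(2::salg fps) \<odot> Suc M = 0" by (simp add: numeral_fps_const)
  ultimately show ?thesis
    by (simp add: numeral_nth Q_nth rho_lF_nth mult.assoc)
qed

lemma s_rec: "dx (s (Suc n)) = PP (s n) + (if n = 0 then dx (sigma 0) else 0)"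
  by (cases n) (simp_all add: dx_sigma lin_0[OF lin_PP])

text \<open>The sources of \<open>rho_l_Suc\<close> and \<open>Q_Lam\<close> cancel. What remains
  comes from \<open>s_rec\<close>: the shifted sequence satisfies the recursion except between
  indices 0 and 1, a place met only for k = M = 0, where the weight is c_0.\<close>

lemma rho_Suc: "dx (rho (Suc M)) = PP (rho M) + (if M = 0 then const c0 * tau 0 * dx (sigma 0) else 0)"
proof (rule two_cancel)
  let ?q = "\<lambda>k. if k = 0 then if M = 0 then 2 * dx (sigma 0) else 0 else 0"
  have "2 * dx (Lam (Suc M)) = LL (\<lambda>k. 2 * dx (r (Suc (k + M)))) (\<lambda>k. 2 * dx (s (Suc (k + M)))) + 2 * r (Suc M)"
    by (simp add: Lam_def LL_dx distrib_left LL_central_mult[OF central_closed(1)])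
  also have "LL (\<lambda>k. 2 * dx (r (Suc (k + M)))) (\<lambda>k. 2 * dx (s (Suc (k + M)))) =
      LL (\<lambda>k. ds.Q (r (k + M)) + 0) (\<lambda>k. ds.Q (s (k + M)) + ?q k)"
  proof -
    have "2 * dx (s (Suc (k + M))) = ds.Q (s (k + M)) + ?q k" for k
      unfolding s_rec distrib_left PP_Q by simp
    moreover have "2 * dx (r (Suc (k + M))) = ds.Q (r (k + M)) + 0" for k
      unfolding r_rec PP_Q by simp
    ultimately show ?thesis by (simp only:)
  qed
  also have "\<dots> = LL (\<lambda>k. ds.Q (r (k + M))) (\<lambda>k. ds.Q (s (k + M))) + const c0 * tau 0 * (if M = 0 then 2 * dx (sigma 0) else 0)"
    unfolding LL_add LL_delta ..
  finally have L: "2 * dx (Lam (Suc M)) = ds.Q (Lam M) - (2 * ufield * r M + 6 * kap * dx (dx (r M))) + 2 * r (Suc M)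
      + const c0 * tau 0 * (if M = 0 then 2 * dx (sigma 0) else 0)"
    by (simp add: Q_Lam)
  have "2 * dx (rho (Suc M)) = ds.Q (rho_l M) + ds.Q (Lam M) + const c0 * tau 0 * (if M = 0 then 2 * dx (sigma 0) else 0)"
    unfolding rho_def lin_add[OF lin_dt] distrib_left rho_l_Suc L by simp
  also have "ds.Q (rho_l M) + ds.Q (Lam M) = 2 * PP (rho M)"
    unfolding PP_Q[symmetric] rho_def lin_add[OF lin_PP] by (simp add: distrib_left)
  also have "const c0 * tau 0 * (if M = 0 then 2 * dx (sigma 0) else 0) = 2 * (if M = 0 then const c0 * tau 0 * dx (sigma 0) else 0)"
    by (simp add: mult_2 distrib_left)
  finally show "2 * dx (rho (Suc M)) = 2 * (PP (rho M) + (if M = 0 then const c0 * tau 0 * dx (sigma 0) else 0))"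
    by (simp add: distrib_left)
qed

lemma br_fps_const_nth: "df.br f (fps_const b) \<odot> n = ds.br (f \<odot> n) b"
proof -
  have "lft dx (fps_const b) = fps_const (dx b)" by (rule fps_ext) (simp add: lin_0[OF lin_dt])
  then show ?thesis by (simp add: df.br_def ds.br_def)
qed

lemma rho_l_consec_nth:
  assumes "consec \<delta> \<delta>' b"
  shows "2 * \<delta>' (rho_l M) - 2 * \<delta> (rho_l (Suc M)) + ds.br (rho_l M) (b 0) = r M * b 0 - 2 * b M"
  using arg_cong[OF rho_l_consec[OF assms], of "\<lambda>f. f \<odot> Suc M"]
  by (simp add: numeral_nth rho_lF_nth br_fps_const_nth)

lemma sum_index_shift: "(\<Sum>i<Suc m. f i) = f 0 + (\<Sum>i<m. f (Suc i))" for f :: "nat \<Rightarrow> salg"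
  by (rule sum.lessThan_Suc_shift)

lemma dx_sigma_odd: "sigma k * dx (sigma n) = - (dx (sigma n) * sigma k)"
  by (rule odd_anticommute) (simp_all add: par_sigma par_dt[symmetric] lin_uminus[OF lin_dt])

text \<open>For j < n the sum on the left has two more terms, the first and the last, and these form
  the bracket. The remaining cases follow by antisymmetry.\<close>

lemma dtau_sigma_Suc: "2 * dtau (Suc n) (sigma j) = 2 * dtau n (sigma (Suc j)) + ds.br (sigma j) (sigma n)"
proof -
  have "const 2 * (const (1/2) * a) = a" for a by (simp add: const_mult_assoc)
  then have h: "2 * (const (1/2) * a) = a" for a by (simp add: const_numeral)
  have T: "2 * dtau n (sigma k) = (\<Sum>i<n - k. sigma (i + k) * dx (sigma (n - i - 1)))" if "k \<le> n" for n k
    using dtau_jet_sigma[OF that, of 0] by (simp add: sigma_tau_def h)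
  have brs: "ds.br (sigma j) (sigma n) = sigma j * dx (sigma n) + sigma n * dx (sigma j)" for j n
    unfolding ds.br_def dx_sigma_odd[of n j] by simp
  have less: "2 * dtau (Suc n) (sigma j) = 2 * dtau n (sigma (Suc j)) + ds.br (sigma j) (sigma n)" if jn: "j < n" for n j
  proof -
    obtain m where m: "n = Suc (j + m)" using less_imp_Suc_add[OF jn] by blast
    have "2 * dtau (Suc n) (sigma j) = (\<Sum>i<Suc (Suc m). sigma (i + j) * dx (sigma (n - i)))"
      by (subst T) (use m in auto)
    also have "\<dots> = sigma j * dx (sigma n) + (\<Sum>i<m. sigma (Suc i + j) * dx (sigma (n - Suc i))) + sigma n * dx (sigma j)"
      by (subst sum_index_shift) (simp add: m add_ac)
    also have "(\<Sum>i<m. sigma (Suc i + j) * dx (sigma (n - Suc i))) = 2 * dtau n (sigma (Suc j))"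
      by (subst T) (use m in auto)
    finally show ?thesis by (simp add: brs add_ac)
  qed
  consider "j < n" | "j = n" | "n < j" by linarith
  then show ?thesis
  proof cases
    case 1
    then show ?thesis by (rule less)
  next
    case 2
    have "2 * dtau (Suc n) (sigma n) = sigma n * dx (sigma n)" by (subst T) auto
    moreover have "2 * dtau n (sigma (Suc n)) = - (2 * dtau (Suc n) (sigma n))"
      using dtau_sigma_swap[of n "Suc n"] by simp
    ultimately show ?thesis using 2 by (simp add: brs)
  next
    case 3
    have "2 * dtau (Suc n) (sigma j) = - (2 * dtau j (sigma (Suc n)))" "2 * dtau n (sigma (Suc j)) = - (2 * dtau (Suc j) (sigma n))"
      using dtau_sigma_swap[of "Suc n" j] dtau_sigma_swap[of n "Suc j"] by simp_all
    then show ?thesis using less[OF 3] by (simp add: brs add_ac)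
  qed
qed

lemma d_sigma_Suc: "2 * d (Suc n) (sigma k) = 2 * d n (sigma (Suc k)) + ds.br (r n) (sigma k)"
  using dtau_r_Suc[of k n] by (simp add: d_sigma)

lemma const_sub_mult: "const a * x - const b * x = const (a - b) * x"
  by (simp add: const_diff left_diff_distrib)

lemma br_Lam: "ds.br (Lam M) b = LL (\<lambda>k. ds.br (r (k + M)) b) (\<lambda>k. ds.br (s (k + M)) b) - r M * b"
  unfolding ds.br_def Lam_def LL_dx distrib_right LL_mult_right LL_diff by simp

text \<open>The remainder of \<open>rho_l_consec\<close> is compensated by differentiating tau_n and
  tau_{n+1} in the explicit sum. The exceptional term at k = M = 0 is c_0 times the tau_n-flow of
  sigma_0, which is zero for n = 0; the case n = 0 is needed to show that c_0 = 0 is forced.\<close>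

lemma rho_dtau_Suc:
  assumes "c0 = 0 \<or> M > 0 \<or> n = 0"
  shows "2 * dtau (Suc n) (rho M) = 2 * dtau n (rho (Suc M)) - ds.br (rho M) (sigma n)"
proof -
  have t: "2 * dtau (Suc n) (r j) - 2 * dtau n (r (Suc j)) + ds.br (r j) (sigma n) = 0" for j
    by (simp add: dtau_r_Suc)
  have q: "2 * (- dtau (Suc n) (s (k + M))) - 2 * (- dtau n (s (Suc (k + M)))) + ds.br (s (k + M)) (sigma n) = (if k + M = 0 then 2 * dtau n (sigma 0) else 0)" for k
  proof (cases "k + M")
    case 0
    then show ?thesis by (simp add: lin_0[OF lin_dtau] ds.br_def lin_0[OF lin_dt])
  next
    case (Suc j)
    then show ?thesis using dtau_sigma_Suc[of n j] by simp
  qed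
  have "dtau 0 (sigma 0) = 0" using dtau_jet_sigma[of 0 0 0] by (simp add: sigma_tau_def)
  then have q0: "const (of_nat k + c0) * (if k + M = 0 then 2 * dtau n (sigma 0) else 0) = 0" for k
    using assms by auto
  have A: "dtau (Suc n) (Lam M) = LL (\<lambda>k. dtau (Suc n) (r (k + M))) (\<lambda>k. - dtau (Suc n) (s (k + M))) + const (of_nat n + 1 + c0) * s (Suc n + M)"
    unfolding Lam_def LL_dtau by (simp add: add_ac)
  have B: "dtau n (Lam (Suc M)) = LL (\<lambda>k. dtau n (r (Suc (k + M)))) (\<lambda>k. - dtau n (s (Suc (k + M)))) + const (of_nat n + c0) * s (Suc n + M)"
    unfolding Lam_def LL_dtau by (simp add: add_ac)
  have "2 * dtau (Suc n) (Lam M) - 2 * dtau n (Lam (Suc M)) + ds.br (Lam M) (sigma n) =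
     LL (\<lambda>k. 2 * dtau (Suc n) (r (k + M)) - 2 * dtau n (r (Suc (k + M))) + ds.br (r (k + M)) (sigma n))
        (\<lambda>k. 2 * (- dtau (Suc n) (s (k + M))) - 2 * (- dtau n (s (Suc (k + M)))) + ds.br (s (k + M)) (sigma n))
     + (2 * (const (of_nat n + 1 + c0) * sigma (n + M)) - 2 * (const (of_nat n + c0) * sigma (n + M))) - r M * sigma n"
    unfolding A B br_Lam LL_add LL_diff distrib_left LL_central_mult[OF central_closed(1)] by simp
  also have "LL (\<lambda>k. 2 * dtau (Suc n) (r (k + M)) - 2 * dtau n (r (Suc (k + M))) + ds.br (r (k + M)) (sigma n))
        (\<lambda>k. 2 * (- dtau (Suc n) (s (k + M))) - 2 * (- dtau n (s (Suc (k + M)))) + ds.br (s (k + M)) (sigma n)) = 0"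
    by (rule LL_0) (rule t, simp only: q q0)
  also have "2 * (const (of_nat n + 1 + c0) * sigma (n + M)) - 2 * (const (of_nat n + c0) * sigma (n + M)) = 2 * sigma (n + M)"
    by (simp only: right_diff_distrib[symmetric] const_sub_mult) simp
  finally have L: "2 * dtau (Suc n) (Lam M) - 2 * dtau n (Lam (Suc M)) + ds.br (Lam M) (sigma n) = 2 * sigma (n + M) - r M * sigma n"
    by simp
  have "2 * dtau (Suc n) (rho M) - 2 * dtau n (rho (Suc M)) + ds.br (rho M) (sigma n) =
      (2 * dtau (Suc n) (rho_l M) - 2 * dtau n (rho_l (Suc M)) + ds.br (rho_l M) (sigma n)) +
      (2 * dtau (Suc n) (Lam M) - 2 * dtau n (Lam (Suc M)) + ds.br (Lam M) (sigma n))"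
    unfolding rho_def lin_add[OF lin_dtau] ds.br_def lin_add[OF lin_dt] by (simp add: distrib_left distrib_right)
  also have "\<dots> = 0"
    using rho_l_consec_nth[OF consec_dtau[of n], of M] unfolding L by simp
  finally show ?thesis by (simp add: algebra_simps)
qed

lemma rho_d_Suc:
  assumes "c0 = 0 \<or> M > 0"
  shows "2 * d (Suc n) (rho M) = 2 * d n (rho (Suc M)) - ds.br (rho M) (r n)"
proof (cases n)
  case 0
  then show ?thesis using two_d1[of "rho M"] by (simp add: d_0 ds.br_def r_0 sder_one[OF sder_dt])
next
  case (Suc m)
  have t: "2 * d (Suc n) (r j) - 2 * d n (r (Suc j)) + ds.br (r j) (r n) = 0" for j
    using d_r_Suc[of n j] by simp
  have q: "2 * d (Suc n) (s (k + M)) - 2 * d n (s (Suc (k + M))) + ds.br (s (k + M)) (r n) = (if k + M = 0 then - 2 * d n (sigma 0) else 0)" for k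
  proof (cases "k + M")
    case 0
    then show ?thesis by (simp add: lin_0[OF lin_d] ds.br_def lin_0[OF lin_dt])
  next
    case (Suc j)
    then show ?thesis using d_sigma_Suc[of n j] br_swap[OF central_r, of n "sigma j"] by simp
  qed
  have q0: "const (of_nat k + c0) * (if k + M = 0 then - 2 * d n (sigma 0) else 0) = 0" for k
    using assms by auto
  have A: "d (Suc n) (Lam M) = LL (\<lambda>k. d (Suc n) (r (k + M))) (\<lambda>k. d (Suc n) (s (k + M))) + const (of_nat m + 1 + 1/2) * r (n + M)"
    unfolding Lam_def LL_d by (simp add: Suc add_ac)
  have B: "d n (Lam (Suc M)) = LL (\<lambda>k. d n (r (Suc (k + M)))) (\<lambda>k. d n (s (Suc (k + M)))) + const (of_nat m + 1/2) * r (n + M)"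
    unfolding Lam_def Suc LL_d by simp
  have "2 * d (Suc n) (Lam M) - 2 * d n (Lam (Suc M)) + ds.br (Lam M) (r n) =
     LL (\<lambda>k. 2 * d (Suc n) (r (k + M)) - 2 * d n (r (Suc (k + M))) + ds.br (r (k + M)) (r n))
        (\<lambda>k. 2 * d (Suc n) (s (k + M)) - 2 * d n (s (Suc (k + M))) + ds.br (s (k + M)) (r n))
     + (2 * (const (of_nat m + 1 + 1/2) * r (n + M)) - 2 * (const (of_nat m + 1/2) * r (n + M))) - r M * r n"
    unfolding A B br_Lam LL_add LL_diff distrib_left LL_central_mult[OF central_closed(1)] by simp
  also have "LL (\<lambda>k. 2 * d (Suc n) (r (k + M)) - 2 * d n (r (Suc (k + M))) + ds.br (r (k + M)) (r n))
        (\<lambda>k. 2 * d (Suc n) (s (k + M)) - 2 * d n (s (Suc (k + M))) + ds.br (s (k + M)) (r n)) = 0"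
    by (rule LL_0) (rule t, simp only: q q0)
  also have "2 * (const (of_nat m + 1 + 1/2) * r (n + M)) - 2 * (const (of_nat m + 1/2) * r (n + M)) = 2 * r (n + M)"
    by (simp only: right_diff_distrib[symmetric] const_sub_mult) simp
  finally have L: "2 * d (Suc n) (Lam M) - 2 * d n (Lam (Suc M)) + ds.br (Lam M) (r n) = 2 * r (n + M) - r M * r n"
    by simp
  have "2 * d (Suc n) (rho M) - 2 * d n (rho (Suc M)) + ds.br (rho M) (r n) =
      (2 * d (Suc n) (rho_l M) - 2 * d n (rho_l (Suc M)) + ds.br (rho_l M) (r n)) +
      (2 * d (Suc n) (Lam M) - 2 * d n (Lam (Suc M)) + ds.br (Lam M) (r n))"
    unfolding rho_def lin_add[OF lin_d] ds.br_def lin_add[OF lin_dt] by (simp add: distrib_left distrib_right)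
  also have "\<dots> = 0"
    using rho_l_consec_nth[OF consec_d[of n], of M] Suc unfolding L by simp
  finally show ?thesis by (simp add: algebra_simps)
qed

text \<open>Iterating the one-step relation yields the sum of brackets that
  \<open>flow_resolvent\<close> assigns to a flow with u-variation rho_M'. This is how the flow of
  r_n is found without integration.\<close>

lemma d_rho:
  assumes "c0 = 0 \<or> M > 0"
  shows "2 * d n (rho M) = (\<Sum>i<n. ds.br (r (n - 1 - i)) (rho (M + i)))"
  using assms
proof (induction n arbitrary: M)
  case 0
  then show ?case by (simp add: d_0)
next
  case (Suc n)
  have "2 * d (Suc n) (rho M) = 2 * d n (rho (Suc M)) + ds.br (r n) (rho M)"
    using rho_d_Suc[OF Suc.prems, of n] br_swap[OF central_r, of n "rho M"] by simp
  also have "2 * d n (rho (Suc M)) = (\<Sum>i<n. ds.br (r (n - 1 - i)) (rho (Suc M + i)))"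
    by (rule Suc.IH) simp
  finally show ?case by (subst sum_index_shift) (simp add: add.commute)
qed

subsection \<open>The Virasoro flows on the one-point functions\<close>

definition EE :: "nat \<Rightarrow> salg \<Rightarrow> salg" where
  "EE M a = LL (\<lambda>k. d (k + M) a) (\<lambda>k. e (k + M) a)"

text \<open>\<open>Sg M n\<close> is the prescribed value of the flow with index $m = M - 1$ on \<open>g n\<close>, for \<open>n \<ge> 1\<close>.\<close>

definition Sg :: "nat \<Rightarrow> nat \<Rightarrow> salg" where
  "Sg M n = K * (\<Sum>k\<le>M. d k (d (M - k) (g n))) + (\<Sum>k\<le>M. d k (g n) * g (M - k)) +
     const (of_nat n - 1/2) * g (n + M - 1) + EE M (g n) + (if n = 1 \<and> M = 0 then const (1/2) * time 0 else 0)"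

lemma dx_g_pos: "n > 0 \<Longrightarrow> dx (g n) = r n"
  by (simp add: dx_g)

lemma d_g_sym: "d j (g n) = d n (g j)"
proof (cases "j = 0 \<or> n = 0")
  case True
  then show ?thesis by (auto simp: d_0 g_0 lin_0[OF lin_d])
next
  case False
  have "d j (g n) - d n (g j) = 0"
    by (rule u_poly_kernel)
      (use False d_r_sym[of j n] in \<open>auto simp: u_poly_closed flow_g lin_diff[OF lin_dt] d_dx[symmetric] dx_g_pos\<close>)
  then show ?thesis by simp
qed

lemma two_d_r1: "2 * d j (r 1) = dx (r j)"
  unfolding d_r_sym[of j 1] by (rule two_d1)

lemma two_d_g1: "j > 0 \<Longrightarrow> 2 * d j (g 1) = r j"
proof -
  assume j: "j > 0"
  have "2 * d j (g 1) - r j = 0"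
  proof (rule u_poly_kernel)
    show "dx (2 * d j (g 1) - r j) = 0"
      using two_d_r1[of j] by (simp add: lin_diff[OF lin_dt] lin_numeral_mult[OF lin_dt] d_dx[symmetric] dx_g_pos)
    show "u_poly (2 * d j (g 1) - r j)"
      unfolding mult_2 by (intro u_poly_closed flow_g u_poly_r)
    show "aug (2 * d j (g 1) - r j) = 0" using j by (simp add: mult_2 flow_g aug_r)
  qed
  then show ?thesis by simp
qed

lemma two_dtau_g1: "2 * dtau n (g 1) = sigma n"
proof -
  have r1: "2 * dtau n (r 1) = dx (sigma n)" using d_sigma[of 1 n] two_d1[of "sigma n"] by simp
  have "2 * dtau n (g 1) - sigma n = 0"
  proof (rule diff_poly_kernel)
    show "dx (2 * dtau n (g 1) - sigma n) = 0"
      using r1 by (simp add: lin_diff[OF lin_dt] lin_numeral_mult[OF lin_dt] dtau_dx[symmetric] dx_g_pos)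
    show "diff_poly (2 * dtau n (g 1) - sigma n)"
      unfolding mult_2 by (intro diff_poly_closed flow_g diff_poly_sigma)
    show "aug (2 * dtau n (g 1) - sigma n) = 0" by (simp add: mult_2 flow_g aug_sigma)
  qed
  then show ?thesis by simp
qed

lemma LL_two: "2 * LL p q = LL (\<lambda>k. 2 * p k) (\<lambda>k. 2 * q k)"
  by (rule LL_central_mult[OF central_closed(1)])

lemma LL_time0: "LL (\<lambda>k. if k = 0 then a else 0) (\<lambda>k. 0) = time 0 * a"
  by (simp add: LL_def lsum_zero if_distrib lsum_delta cong: if_cong)

text \<open>As g_1 = eps f_0 / 2, twice its flow is rho. The relations 2 d_j g_1 = r_j hold for j >
  0 only; the inhomogeneous terms g_M / 2 and t_0 / 4 in effect restore r_0 = 1, with t_0 / 4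
  doubled by the coefficient already present in \<open>Sg\<close>.\<close>

lemma rho_Sg: "2 * Sg M 1 = rho M"
proof -
  have "(\<Sum>k\<le>M. 2 * d k (d (M - k) (g 1))) = J M"
    unfolding J_def
  proof (rule sum.cong)
    fix k assume "k \<in> {..M}"
    then show "2 * d k (d (M - k) (g 1)) = d k (r (M - k))"
      using two_d_g1[of "M - k"]
      by (cases "k = M") (simp_all add: d_0 r_0 sder_one[OF sder_d] lin_0[OF lin_d] lin_numeral_mult[OF lin_d, symmetric])
  qed simp
  then have 1: "2 * (K * (\<Sum>k\<le>M. d k (d (M - k) (g 1)))) = K * J M"
    by (metis const_numeral const_left_commute sum_distrib_left)
  have "(\<Sum>k\<le>M. 2 * (d k (g 1) * g (M - k))) + g M = (\<Sum>k\<le>M. r k * g (M - k))"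
  proof -
    have "(\<Sum>k\<le>M. r k * g (M - k)) = g M + (\<Sum>k\<in>{..M} - {0}. r k * g (M - k))"
      by (subst sum.remove[of _ 0]) (auto simp: r_0)
    moreover have "(\<Sum>k\<le>M. 2 * (d k (g 1) * g (M - k))) = (\<Sum>k\<in>{..M} - {0}. 2 * (d k (g 1) * g (M - k)))"
      by (subst sum.remove[of _ 0]) (auto simp: d_0)
    moreover have "\<dots> = (\<Sum>k\<in>{..M} - {0}. r k * g (M - k))"
      using two_d_g1[unfolded One_nat_def] by (intro sum.cong) (auto simp flip: mult.assoc)
    ultimately show ?thesis by simp
  qed
  then have 2: "2 * (\<Sum>k\<le>M. d k (g 1) * g (M - k)) + 2 * (const (of_nat 1 - 1/2) * g (1 + M - 1)) = (\<Sum>k\<le>M. r k * g (M - k))"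
    unfolding sum_distrib_left[symmetric] using const_mult_assoc[of 2 "1/2" "g M"] by (simp add: const_numeral)
  have "2 * EE M (g 1) + (if M = 0 then time 0 else 0) = Lam M"
  proof -
    have "r (k + M) = 2 * d (k + M) (g 1) + (if k = 0 then if M = 0 then 1 else 0 else 0)" for k
      using two_d_g1[of "k + M"] by (cases "k + M") (auto simp: d_0 r_0)
    moreover have "s (k + M) = 2 * e (k + M) (g 1) + 0" for k
      using two_dtau_g1 by (cases "k + M") simp_all
    ultimately have "Lam M = LL (\<lambda>k. 2 * d (k + M) (g 1) + (if k = 0 then if M = 0 then 1 else 0 else 0)) (\<lambda>k. 2 * e (k + M) (g 1) + 0)"
      unfolding Lam_def by (simp only:)
    also have "\<dots> = 2 * EE M (g 1) + time 0 * (if M = 0 then 1 else 0)"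
      unfolding LL_add LL_time0 EE_def LL_two ..
    finally show ?thesis by simp
  qed
  moreover have "2 * (if 1 = (1::nat) \<and> M = 0 then const (1/2) * time 0 else 0) = (if M = 0 then time 0 else 0)"
    using const_mult_assoc[of 2 "1/2" "time 0"] by (simp add: const_numeral)
  ultimately have "2 * EE M (g 1) + 2 * (if 1 = (1::nat) \<and> M = 0 then const (1/2) * time 0 else 0) = Lam M" by simp
  then show ?thesis
    unfolding Sg_def distrib_left 1 rho_def rho_l_def using 2 by (simp add: add.assoc)
qed

lemma e_dx: "e n (dx a) = dx (e n a)"
  by (cases n) (simp_all add: dtau_dx lin_0[OF lin_dt])

lemma dx_EE: "dx (EE M a) = EE M (dx a) + d M a"
  unfolding EE_def LL_dx by (simp add: d_dx e_dx)

lemma e_r: "e j (r n) = d n (s j)"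
  by (cases j) (simp_all add: d_sigma lin_0[OF lin_d])

text \<open>The compatibility condition for the flow on g_n: its value has the derivative that
  \<open>S_r\<close> assigns to r_n. It rests on the symmetry of d_j r_n in j and n.\<close>

lemma dx_Sg:
  assumes n: "n > 0"
  shows "dx (Sg M n) = d n (rho M)"
proof -
  have dg: "dx (d k (d j (g n))) = d n (d k (r j))" for k j
    using n by (simp add: d_dx[symmetric] dx_g_pos) (metis d_d d_r_sym)
  have 1: "dx (K * (\<Sum>k\<le>M. d k (d (M - k) (g n)))) = d n (K * J M)"
    by (simp add: J_def lin_const_mult[OF lin_dt] lin_const_mult[OF lin_d] lin_sum[OF lin_dt] lin_sum[OF lin_d] dg)
  have rev: "(\<Sum>k\<le>M. r k * d n (g (M - k))) = (\<Sum>k\<le>M. d k (g n) * r (M - k))"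
    by (rule sum.reindex_bij_witness[where i = "\<lambda>k. M - k" and j = "\<lambda>k. M - k"])
      (use central_r in \<open>auto simp: central_def d_g_sym[of _ n]\<close>)
  have "(\<Sum>k\<le>M. d k (g n) * dx (g (M - k))) + d M (g n) = (\<Sum>k\<le>M. d k (g n) * dx (g (M - k)) + (if k = M then d M (g n) else 0))"
    by (simp add: sum.distrib)
  also have "\<dots> = (\<Sum>k\<le>M. d k (g n) * r (M - k))"
    by (rule sum.cong) (auto simp: dx_g r_0)
  finally have 2: "dx (\<Sum>k\<le>M. d k (g n) * g (M - k)) + d M (g n) = d n (\<Sum>k\<le>M. r k * g (M - k))"
    using n d_r_sym[of _ n]
    by (simp add: lin_sum[OF lin_dt] lin_sum[OF lin_d] sder_mult[OF sder_dt] sder_mult[OF sder_d] sum.distrib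
        d_dx[symmetric] dx_g_pos rev add.assoc)
  obtain m where m: "n = Suc m" using n by (cases n) auto
  have "d n (Lam M) = LL (\<lambda>k. d (k + M) (r n)) (\<lambda>k. e (k + M) (r n)) + const (of_nat m + 1/2) * r (m + M)"
    unfolding Lam_def m LL_d e_r by (simp only: d_r_sym[of "Suc m"])
  moreover have "dx (EE M (g n)) = LL (\<lambda>k. d (k + M) (r n)) (\<lambda>k. e (k + M) (r n)) + d M (g n)"
    unfolding dx_EE by (simp add: EE_def dx_g_pos n)
  moreover have "dx (const (of_nat n - 1/2) * g (n + M - 1)) + dx (if n = 1 \<and> M = 0 then const (1/2) * time 0 else 0)
      = const (of_nat m + 1/2) * r (m + M)"
    by (auto simp: m lin_const_mult[OF lin_dt] dx_g dt_time r_0 lin_0[OF lin_dt] add.commute)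
  ultimately show ?thesis
    unfolding Sg_def rho_def rho_l_def lin_add[OF lin_dt] lin_add[OF lin_d] 1 2[symmetric] by (simp add: add_ac)
qed

lemma par_EE: "par (EE M a) = EE M (par a)"
proof -
  have "- par (e j a) = e j (par a)" for j by (cases j) (simp_all add: par_dtau lin_0[OF lin_par])
  then show ?thesis unfolding EE_def LL_par by (simp add: par_d)
qed

lemma par_Sg: "par (Sg M n) = Sg M n"
  by (simp add: Sg_def lin_add[OF lin_par] par_mult par_sum par_d[symmetric] par_g par_EE lin_0[OF lin_par])

lemma LL_mult_left: "a * LL p q = LL (\<lambda>k. a * p k) (\<lambda>k. par a * q k)"
proof (rule LL_module_hom[OF lin_mult_left scont_tc[OF scont_mult_left]])
  have "central (time k)" for k by (rule central_even) simp
  then show "a * (const (1 / cf k) * time k * x) = const (1 / cf k) * time k * (a * x)" for k x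
    using central_const by (metis central_def mult.assoc)
  have "a * tau k = tau k * par a" for k using odd_commute[of "tau k" "par a"] by simp
  then show "a * (const (of_nat k + c0) * tau k * x) = const (of_nat k + c0) * tau k * (par a * x)" for k x
    by (metis const_commute mult.assoc)
qed

lemma e_mult: "e n (a * b) = e n a * b + par a * e n b"
  by (cases n) (simp_all add: sder_mult[OF sder_dtau])

lemma sder_EE: "sder id (EE M)"
proof -
  have "EE M (a + b) = EE M a + EE M b" for a b
    unfolding EE_def lin_add[OF lin_d] lin_add[OF lin_e] by (rule LL_add)
  moreover have "EE M (const c * a) = const c * EE M a" for c a
    unfolding EE_def lin_const_mult[OF lin_d] lin_const_mult[OF lin_e] LL_central_mult[OF central_const] ..
  moreover have "EE M (a * b) = EE M a * b + a * EE M b" for a b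
    unfolding EE_def sder_mult[OF sder_d] e_mult LL_add LL_mult_right LL_mult_left by simp
  ultimately show ?thesis unfolding sder_def lin_def by simp
qed

lemma central_g: "central (g n)"
  by (rule central_even[OF par_g])

lemma diff_poly_s: "diff_poly (s n)"
  by (cases n) (simp_all add: diff_poly_closed diff_poly_sigma)

lemma diff_poly_e: "diff_poly a \<Longrightarrow> diff_poly (e n a)"
  by (cases n) (simp_all add: diff_poly_closed diff_poly_dtau)

lemma diff_poly_par: "diff_poly a \<Longrightarrow> diff_poly (par a)"
  unfolding diff_poly_iff by (rule poly_on_par)

lemma diff_poly_e_g: "diff_poly (e n (g k))"
  by (cases n) (simp_all add: diff_poly_closed flow_g)

lemma aug_e: "diff_poly a \<Longrightarrow> aug (e n a) = 0"
  by (cases n) (simp_all add: aug_dtau)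

lemma fone_zero: "lin D \<Longrightarrow> (\<And>n. n > 0 \<Longrightarrow> D (g n) = 0) \<Longrightarrow> D (fone k) = 0"
  by (simp add: fone_eq lin_const_mult)

text \<open>The predicate \<open>s_flow\<close> in the normalised variables with M = m + 1; the
  equivalence is \<open>s_flow_iff\<close>.\<close>

definition sfl :: "nat \<Rightarrow> (salg \<Rightarrow> salg) \<Rightarrow> bool" where
  "sfl M S \<longleftrightarrow> even_derivation S \<and> (\<forall>k. S (time k) = 0) \<and> (\<forall>k. S (tau k) = 0) \<and>
     (\<forall>n>0. S (g n) = Sg M n) \<and> (\<forall>j. S ((dx ^^ j) ufield) = (dx ^^ j) (dx (rho M))) \<and>
     (\<forall>n j. S ((dx ^^ j) (sigma n)) = (dx ^^ j) (dtau n (rho M)))"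

text \<open>The condition that removes the defect in \<open>rho_Suc\<close>.\<close>

abbreviation ok :: "nat \<Rightarrow> bool" where "ok M \<equiv> c0 = 0 \<or> M > 0"

lemma flowlike_rho:
  assumes "ok M" "lin S" "\<And>x y. u_poly x \<Longrightarrow> u_poly y \<Longrightarrow> S (x * y) = S x * y + x * S y"
    "\<And>x. u_poly x \<Longrightarrow> S (dx x) = dx (S x)" "S ufield = dx (rho M)"
  shows "flowlike S (\<lambda>i. rho (M + i))"
  unfolding flowlike_def using assms rho_Suc by auto

context
  fixes M S assumes S: "sfl M S"
begin

lemma sder_S: "sder id S" and par_S: "S (par a) = par (S a)" and tc_S: "time_continuous S"
  and S_time: "S (time k) = 0" and S_tau: "S (tau k) = 0" and S_g: "n > 0 \<Longrightarrow> S (g n) = Sg M n"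
  and S_jet_u: "S ((dx ^^ j) ufield) = (dx ^^ j) (dx (rho M))"
  and S_jet_sigma: "S ((dx ^^ j) (sigma n)) = (dx ^^ j) (dtau n (rho M))"
  using S by (auto simp: sfl_def even_derivation_iff)

lemmas lin_S = sder_lin[OF sder_S]

lemma S_u: "S ufield = dx (rho M)" using S_jet_u[of 0] by simp
lemma S_sigma: "S (sigma n) = dtau n (rho M)" using S_jet_sigma[of 0] by simp

lemma scont_S: "scont S"
  by (rule sder_scont[OF sder_S tc_S, where J = 0]) (auto simp: S_time S_tau)

lemma S_dx_u_poly: "u_poly a \<Longrightarrow> S (dx a) = dx (S a)"
proof -
  assume a: "u_poly a"
  have "S (dx a) - dx (S a) = 0"
  proof (rule sder_u_poly_zero[OF sder_commutator[OF sder_S sder_dt] _ a])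
    show "S (dx (even_gen (U j))) - dx (S (even_gen (U j))) = 0" for j
      using S_jet_u[of j] S_jet_u[of "Suc j"] unfolding funpow.simps o_apply dx_pow_u by simp
  qed simp_all
  then show ?thesis by simp
qed

text \<open>Both sides equal the same sum of brackets with the rho_{M+i}, by
  \<open>flow_resolvent\<close> for S and by \<open>d_rho\<close> for d_n.\<close>

lemma S_r: "ok M \<Longrightarrow> S (r n) = d n (rho M)"
proof (rule two_cancel)
  assume ok: "ok M"
  have "flowlike S (\<lambda>i. rho (M + i))"
    by (rule flowlike_rho[OF ok lin_S]) (simp_all add: sder_mult[OF sder_S] S_dx_u_poly S_u)
  then show "2 * S (r n) = 2 * d n (rho M)"
    unfolding d_rho[OF ok] by (rule flow_resolvent_nth)
qed

lemma S_dx: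
  assumes ok: "ok M"
  shows "S (dx a) = dx (S a)"
proof (rule commute_dx[OF sder_S _ scont_S])
  show "S (dx (fone k)) = dx (S (fone k))" for k
    by (simp add: fone_eq lin_const_mult[OF lin_S] lin_const_mult[OF lin_dt] dx_g_pos S_r[OF ok] S_g dx_Sg)
  show "S ((dx ^^ j) ufield) = (dx ^^ j) (S ufield)" for j by (simp only: S_jet_u S_u)
  show "S ((dx ^^ j) (sigma 0)) = (dx ^^ j) (S (sigma 0))" for j by (simp only: S_jet_sigma S_sigma)
  show "S (dx (sigma k)) = dx (S (sigma k))" for k using S_jet_sigma[of 1 k] by (simp add: S_sigma)
qed (auto simp: S_time S_tau lin_0[OF lin_dt])

subsection \<open>Symmetry of the flows\<close>

text \<open>The part of the flow that is left after removing the time-dependent and the nonlocal terms;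
  it preserves differential polynomials.\<close>

definition YY :: "salg \<Rightarrow> salg" where
  "YY a = S a - EE M a - (\<Sum>i\<le>M. d i a * g (M - i))"

lemma sder_YY: "sder id YY"
proof -
  have "lin (\<lambda>a. d i a * g (M - i))" "d i (a * b) * g (M - i) = d i a * g (M - i) * b + a * (d i b * g (M - i))" for i a b
  proof -
    show "lin (\<lambda>a. d i a * g (M - i))" by (rule lin_comp[OF lin_mult_right lin_d])
    show "d i (a * b) * g (M - i) = d i a * g (M - i) * b + a * (d i b * g (M - i))"
      using central_g by (simp add: sder_mult[OF sder_d] distrib_right mult.assoc central_def)
  qed
  then have "sder id (\<lambda>a. \<Sum>i\<le>M. d i a * g (M - i))"
    unfolding sder_def lin_def by (simp add: sum.distrib sum_distrib_left sum_distrib_right)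
  then show ?thesis unfolding YY_def[abs_def] by (intro sder_diff sder_S sder_EE)
qed

lemma par_YY: "YY (par a) = par (YY a)"
  by (simp add: YY_def par_S par_EE lin_diff[OF lin_par] par_sum par_mult par_d[symmetric] par_g)

text \<open>Two corrections appear: the g_{M-i} have derivatives r_{M-i}, except that g_0 has
  derivative 0, and \<open>dx\<close> hits t_0 in \<open>EE\<close>. The second one supplies
  precisely the missing term with r_0 = 1.\<close>

lemma YY_dx: "ok M \<Longrightarrow> YY (dx a) = dx (YY a) + (\<Sum>i\<le>M. d i a * r (M - i))"
proof -
  assume ok: "ok M"
  have "(\<Sum>i\<le>M. d i a * dx (g (M - i))) + d M a = (\<Sum>i\<le>M. d i a * dx (g (M - i)) + (if i = M then d M a else 0))"
    by (simp add: sum.distrib)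
  also have "\<dots> = (\<Sum>i\<le>M. d i a * r (M - i))"
    by (rule sum.cong) (auto simp: dx_g r_0)
  finally show ?thesis
    unfolding YY_def by (simp add: lin_diff[OF lin_dt] lin_add[OF lin_dt] lin_sum[OF lin_dt] S_dx[OF ok] dx_EE d_dx
        sder_mult[OF sder_dt] sum.distrib algebra_simps)
qed

lemma YY_u: "YY ufield = K * dx (J M) + (\<Sum>k\<le>M. r k * r (M - k))"
proof -
  have "(\<Sum>i\<le>M. r i * dx (g (M - i))) + r M = (\<Sum>i\<le>M. r i * dx (g (M - i)) + (if i = M then r M else 0))"
    by (simp add: sum.distrib)
  also have "\<dots> = (\<Sum>i\<le>M. r i * r (M - i))"
    by (rule sum.cong) (auto simp: dx_g r_0)
  finally have 1: "(\<Sum>i\<le>M. r i * dx (g (M - i))) + r M = (\<Sum>i\<le>M. r i * r (M - i))" .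
  have "e j ufield = dx (s j)" for j by (cases j) (simp_all add: dtau_u lin_0[OF lin_dt])
  then have "dx (Lam M) = EE M ufield + r M"
    by (simp add: Lam_def LL_dx EE_def d_u)
  then show ?thesis
    unfolding YY_def S_u rho_def rho_l_def 1[symmetric]
    by (simp add: lin_add[OF lin_dt] lin_sum[OF lin_dt] lin_const_mult[OF lin_dt] sder_mult[OF sder_dt] sder_const[OF sder_dt] d_u sum.distrib)
qed

lemma YY_sigma: "YY (sigma n) = K * dtau n (J M) + (\<Sum>k\<le>M. r k * dtau n (g (M - k))) + const (of_nat n + c0) * s (n + M)"
proof -
  have e: "e j (sigma n) = - dtau n (s j)" for j
    using dtau_sigma_swap[of _ n] by (cases j) (simp_all add: lin_0[OF lin_dtau])
  have "dtau n (Lam M) = EE M (sigma n) + const (of_nat n + c0) * s (n + M)"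
    by (simp add: Lam_def LL_dtau EE_def d_sigma e)
  then show ?thesis
    unfolding YY_def S_sigma rho_def rho_l_def
    by (simp add: lin_add[OF lin_dtau] lin_sum[OF lin_dtau] lin_const_mult[OF lin_dtau] sder_mult[OF sder_dtau] sder_const[OF sder_dtau] par_r d_sigma sum.distrib)
qed

lemma diff_poly_YY:
  assumes ok: "ok M" and a: "diff_poly a"
  shows "diff_poly (YY a)"
proof (rule diff_poly_sder[OF a sder_YY])
  have step: "diff_poly (YY ((dx ^^ j) b))" if "diff_poly b" "diff_poly (YY b)" for b j
  proof (induction j)
    case (Suc j)
    show ?case
      unfolding funpow.simps o_apply YY_dx[OF ok]
      by (intro diff_poly_closed diff_poly_dx Suc diff_poly_d diff_poly_pow_dx that u_diff_poly[OF u_poly_r])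
  qed (use that in simp)
  have u: "diff_poly (YY ufield)"
    unfolding YY_u by (intro diff_poly_closed diff_poly_dx u_diff_poly[OF u_poly_r] u_diff_poly[OF u_poly_J])
  have s: "diff_poly (YY (sigma n))" for n
    unfolding YY_sigma by (intro diff_poly_closed diff_poly_dtau diff_poly_s flow_g u_diff_poly[OF u_poly_r] u_diff_poly[OF u_poly_J])
  show "diff_poly (YY (even_gen (U j)))" for j using step[OF _ u, of j] unfolding dx_pow_u by (simp add: diff_poly_closed)
  show "diff_poly (YY (odd_gen (Th j)))" for j using step[OF diff_poly_sigma s, of j 0] unfolding dx_pow_sigma0 .
  show "diff_poly (YY (odd_gen (Sig j)))" for j using s[of "Suc j"] by (simp only: sigma.simps)
qed simp

text \<open>In the commutator the explicit times and the g's occur only after differentiation. Hence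
  for a differential polynomial \<open>a\<close> the right-hand side is one too, and
  \<open>dx_kernel\<close> becomes applicable.\<close>

lemma commutator_d:
  "d (Suc m) (S a) - S (d (Suc m) a) = d (Suc m) (YY a) - YY (d (Suc m) a) + const (of_nat m + 1/2) * d (m + M) a
     + (\<Sum>i\<le>M. d i a * d (Suc m) (g (M - i)))"
proof -
  have "e j (d (Suc m) a) = d (Suc m) (e j a)" for j by (cases j) (simp_all add: dtau_d lin_0[OF lin_d])
  then have "d (Suc m) (EE M a) = EE M (d (Suc m) a) + const (of_nat m + 1/2) * d (m + M) a"
    by (simp add: EE_def LL_d) (simp add: d_d[of "Suc m"])
  then show ?thesis
    by (simp add: YY_def lin_diff[OF lin_d] lin_add[OF lin_d] lin_sum[OF lin_d] sder_mult[OF sder_d] d_d[of "Suc m"] sum.distrib algebra_simps)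
qed

lemma commutator_dtau:
  "dtau m (S a) - S (dtau m a) = dtau m (YY a) - YY (dtau m a) + const (of_nat m + c0) * e (m + M) a
     + (\<Sum>i\<le>M. par (d i a) * dtau m (g (M - i)))"
proof -
  have "- dtau m (e j a) = e j (dtau m a)" for j
    using dtau_dtau[of _ m a] by (cases j) (simp_all add: lin_0[OF lin_dtau])
  then have "dtau m (EE M a) = EE M (dtau m a) + const (of_nat m + c0) * e (m + M) a"
    by (simp add: EE_def LL_dtau dtau_d)
  then show ?thesis
    by (simp add: YY_def lin_diff[OF lin_dtau] lin_add[OF lin_dtau] lin_sum[OF lin_dtau] sder_mult[OF sder_dtau] dtau_d sum.distrib algebra_simps)
qed

lemma YY_g: "n > 0 \<Longrightarrow> YY (g n) = K * (\<Sum>k\<le>M. d k (d (M - k) (g n))) + const (of_nat n - 1/2) * g (n + M - 1)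
    + (if n = 1 \<and> M = 0 then const (1/2) * time 0 else 0)"
  by (simp add: YY_def S_g Sg_def)

lemma dtau_S_u_poly:
  assumes "u_poly a"
  shows "dtau m (S a) - S (dtau m a) = 0"
proof (rule sder_u_poly_zero[OF sder_commutator[OF sder_dtau sder_S] _ assms])
  have "dtau n ((dx ^^ j) a) = (dx ^^ j) (dtau n a)" for n j a
    by (induction j) (simp_all add: dtau_dx)
  then have "dtau m (S ((dx ^^ j) ufield)) - S (dtau m ((dx ^^ j) ufield)) = 0" for j
    using S_jet_sigma[of "Suc j" m] by (simp add: S_jet_u dtau_u dtau_dx funpow_swap1)
  then show "dtau m (S (even_gen (U j))) - S (dtau m (even_gen (U j))) = 0" for j unfolding dx_pow_u .
qed (simp_all add: par_S)

text \<open>The bootstrap of \<open>dtau_dt_sigma\<close>: antisymmetry in m and n together with the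
  recursion. The constant terms vanish because sigma is odd and its odd flows are quadratic in the
  sigma's.\<close>

lemma dtau_S_sigma:
  assumes ok: "ok M"
  shows "dtau m (S (sigma n)) - S (dtau m (sigma n)) = 0"
proof -
  let ?C = "\<lambda>m a. dtau m (S a) - S (dtau m a)"
  have C: "sder par (?C m)" for m by (rule sder_commutator[OF sder_dtau sder_S]) (rule par_S)
  have Cdx: "?C m (dx a) = dx (?C m a)" for m a
    by (simp add: S_dx[OF ok] dtau_dx lin_diff[OF lin_dt])
  have Cu: "?C m ufield = 0" for m by (rule dtau_S_u_poly) (rule u_poly_closed)
  have dp: "diff_poly (?C m (sigma k))" for m k
    unfolding commutator_dtau
    by (intro diff_poly_closed diff_poly_dtau diff_poly_YY[OF ok] diff_poly_e diff_poly_par diff_poly_d diff_poly_sigma flow_g)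
  have ag: "aug (?C m (sigma k)) = 0" for m k
  proof -
    have odd: "aug (YY (sigma j)) = 0" for j
      by (rule aug_odd) (simp add: par_YY[symmetric] par_sigma lin_uminus[OF sder_lin[OF sder_YY]])
    have st: "aug (YY (sigma_tau dx n' k')) = 0" for n' k'
      unfolding sigma_tau_def
      by (simp add: lin_const_mult[OF sder_lin[OF sder_YY]] lin_sum[OF sder_lin[OF sder_YY]] sder_mult[OF sder_YY]
          aug_sum odd aug_sigma aug_dx diff_poly_sigma)
    have "aug (YY (dtau m (sigma k))) = 0"
      using dtau_sigma_jet[of m 0 k] st by (auto simp: lin_uminus[OF sder_lin[OF sder_YY]])
    then show ?thesis
      unfolding commutator_dtau
      by (simp add: aug_dtau diff_poly_YY[OF ok] diff_poly_sigma aug_e aug_sum flow_g)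
  qed
  have anti: "?C m (sigma n) + ?C n (sigma m) = 0" for m n
  proof -
    have "?C m (sigma n) + ?C n (sigma m) = (dtau m (dtau n (rho M)) + dtau n (dtau m (rho M))) - S (dtau m (sigma n) + dtau n (sigma m))"
      by (simp add: S_sigma lin_add[OF lin_S])
    then show ?thesis using dtau_sigma_swap[of m n] dtau_dtau[of m n] by (simp add: lin_0[OF lin_S])
  qed
  have ind: "?C m (sigma k) = 0" if "?C m (sigma 0) = 0" for m k
    by (induction k) (use that C_sigma_kernel[OF C _ Cdx Cu dp ag] in auto)
  have "2 * ?C 0 (sigma 0) = 2 * 0" using anti[of 0 0] by (simp only: mult_2 mult_zero_right)
  then have "?C 0 (sigma 0) = 0" by (rule two_cancel)
  then have "?C 0 (sigma k) = 0" for k by (rule ind)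
  then have "?C m (sigma 0) = 0" for m using anti[of 0 m] by (metis add_0)
  then show ?thesis by (rule ind)
qed

text \<open>On g_n the commutator is a differential polynomial in the kernel of \<open>dx\<close>,
  so a constant; being odd it is zero.\<close>

theorem dtau_S:
  assumes ok: "ok M"
  shows "dtau m (S a) = S (dtau m a)"
proof -
  let ?C = "\<lambda>a. dtau m (S a) - S (dtau m a)"
  have C: "sder par ?C" by (rule sder_commutator[OF sder_dtau sder_S]) (rule par_S)
  have Cdx: "?C (dx a) = dx (?C a)" for a
    by (simp add: S_dx[OF ok] dtau_dx lin_diff[OF lin_dt])
  have "?C (g n) = 0" if n: "n > 0" for n
  proof (rule diff_poly_kernel)
    show "diff_poly (?C (g n))"
      unfolding commutator_dtau YY_g[OF n] lin_add[OF lin_dtau]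
      by (intro diff_poly_closed diff_poly_YY[OF ok] diff_poly_e_g diff_poly_par flow_g u_diff_poly[OF flow_g(1)])
        (auto simp: lin_const_mult[OF lin_dtau] lin_sum[OF lin_dtau] dtau_time lin_0[OF lin_dtau]
          intro!: diff_poly_closed diff_poly_dtau diff_poly_d u_diff_poly[OF flow_g(1)] flow_g)
    show "dx (?C (g n)) = 0"
      unfolding Cdx[symmetric] dx_g_pos[OF n] by (rule dtau_S_u_poly[OF u_poly_r])
    have g: "par (dtau m (g n)) = - dtau m (g n)" "par (dtau m (S (g n))) = - dtau m (S (g n))"
      by (metis add.inverse_inverse par_dtau par_S par_g)+
    have "par (S (dtau m (g n))) = - S (dtau m (g n))"
      unfolding par_S[symmetric] g by (rule lin_uminus[OF lin_S])
    then show "aug (?C (g n)) = 0" by (intro aug_odd) (simp add: lin_diff[OF lin_par] g)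
  qed
  then have Cf: "?C (fone k) = 0" for k by (intro fone_zero[OF sder_lin[OF C]])
  have "?C a = 0"
    by (rule der_ext[OF C _ _ Cdx _ _ Cf dtau_S_u_poly[OF u_poly_closed(4)] dtau_S_sigma[OF ok]])
      (auto simp: S_time S_tau dtau_time dtau_tau lin_0[OF lin_dtau] lin_0[OF lin_S] sder_one[OF sder_S]
        intro: scont_tc[OF scont_diff[OF scont_comp[OF scont_dtau scont_S] scont_comp[OF scont_S scont_dtau]]])
  then show ?thesis by simp
qed

end

section \<open>Terms linear in u\<close>

lemma u_poly_pde: "u_poly a \<Longrightarrow> u_poly (pde x a)"
  unfolding u_poly_iff by (rule poly_on_pde)

lemma pde_U0_dx: "u_poly a \<Longrightarrow> pde (U 0) (dx a) = dx (pde (U 0) a)"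
proof -
  assume a: "u_poly a"
  have "pde (U 0) (dx a) - dx (pde (U 0) a) = 0"
    by (rule sder_u_poly_zero[OF sder_commutator[OF sder_pde sder_dt] _ a])
      (auto simp: dx_U pde_even_gen sder_one[OF sder_dt] lin_0[OF lin_dt])
  then show ?thesis by simp
qed

lemma pde_U1_dx: "u_poly a \<Longrightarrow> pde (U 1) (dx a) = dx (pde (U 1) a) + pde (U 0) a"
proof -
  assume a: "u_poly a"
  have "pde (U 1) (dx a) - dx (pde (U 1) a) - pde (U 0) a = 0"
    by (rule sder_u_poly_zero[OF sder_diff[OF sder_commutator[OF sder_pde sder_dt] sder_pde] _ a])
      (auto simp: dx_U pde_even_gen sder_one[OF sder_dt] lin_0[OF lin_dt])
  then show ?thesis by (simp add: algebra_simps)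
qed

lemma aug_pde_dx:
  assumes "u_poly a"
  shows "aug (pde (U 0) (dx a)) = 0" "aug (pde (U 1) (dx a)) = aug (pde (U 0) a)"
  using assms by (simp_all add: pde_U0_dx pde_U1_dx[unfolded One_nat_def] aug_dx u_diff_poly u_poly_pde)

text \<open>The coefficient of u in r_j is the coefficient of u' in r_j' = P_1 r_{j-1}. There only
  u' r_{j-1} / 2 contributes, through the constant term of r_{j-1}, which is nonzero for j = 1
  alone.\<close>

lemma aug_pde_r: "aug (pde (U 0) (r j)) = (if j = 1 then 1/2 else 0)"
proof (cases j)
  case 0
  then show ?thesis by (simp add: r_0 sder_one[OF sder_pde])
next
  case (Suc i)
  note p = u_poly_r u_poly_dx[OF u_poly_r] u_poly_dx[OF u_poly_dx[OF u_poly_r]]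
  have "aug (pde (U 0) (r j)) = aug (pde (U 1) (PP (r i)))"
    unfolding Suc r_rec[symmetric] by (rule aug_pde_dx(2)[OF u_poly_r, symmetric])
  also have "\<dots> = 1/2 * aug (r i)"
    unfolding P1_def
    by (simp add: lin_add[OF lin_pde] sder_mult[OF sder_pde] sder_const[OF sder_pde] dx_U pde_even_gen
        aug_pde_dx[unfolded One_nat_def] p aug_dx u_diff_poly)
  finally show ?thesis by (cases i) (simp_all add: Suc aug_r)
qed

text \<open>The coefficient of u is again read off one derivative higher, where the bracket formula
  is available; each bracket contributes through the constant term r_0 = 1 only.\<close>

lemma aug_pde_dg:
  assumes n: "n > 0"
  shows "aug (pde (U 0) (d (Suc m) (g n))) = (if m = 0 \<and> n = 1 then 1/4 else 0)"
proof -
  have "2 * aug (pde (U 0) (d (Suc m) (g n))) = 2 * aug (pde (U 1) (d (Suc m) (r n)))"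
    using aug_pde_dx(2)[OF flow_g(1), of "Suc m" n] by (simp add: d_dx[symmetric] dx_g_pos n)
  also have "\<dots> = aug (pde (U 1) (2 * d (Suc m) (r n)))"
    unfolding mult_2 lin_add[OF lin_pde] by simp
  also have "\<dots> = (\<Sum>i<n. aug (pde (U 1) (ds.br (r (n - 1 - i)) (r (Suc m + i)))))"
    unfolding flow_resolvent_nth[OF flowlike_d] by (simp add: lin_sum[OF lin_pde] aug_sum)
  also have "\<dots> = (\<Sum>i<n. if i = n - 1 then aug (pde (U 0) (r (Suc m + i))) else 0)"
  proof (rule sum.cong)
    fix i assume "i \<in> {..<n}"
    then show "aug (pde (U 1) (ds.br (r (n - 1 - i)) (r (Suc m + i)))) = (if i = n - 1 then aug (pde (U 0) (r (Suc m + i))) else 0)"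
      unfolding ds.br_def
      by (auto simp: lin_diff[OF lin_pde] sder_mult[OF sder_pde] aug_pde_dx[unfolded One_nat_def] u_poly_r aug_r
          aug_dx u_diff_poly)
  qed simp
  also have "\<dots> = aug (pde (U 0) (r (m + n)))" using n by (simp add: sum.delta)
  finally show ?thesis using n by (cases "m = 0 \<and> n = 1") (auto simp: aug_pde_r mult.commute)
qed

lemma aug_d: "diff_poly a \<Longrightarrow> aug (d n a) = 0"
  by (cases n) (simp_all add: d_0 d_Suc aug_dt)

lemma d_time0: "d i (time 0) = (if i = 1 then const (1/2) else 0)"
  by (cases i) (auto simp: d_0 d_Suc dt_time cf_Suc)

context
  fixes M S assumes S: "sfl M S"
begin

text \<open>For M = 0 the operator sends u to an element with constant term 1, so at the level of
  constant terms it acts like the shift of u. For M > 0 every product r_k r_{M-k} lacks a constant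
  term.\<close>

lemma aug_YY:
  assumes ok: "ok M" and a: "u_poly a"
  shows "aug (YY M S a) = (if M = 0 then aug (pde (U 0) a) else 0)"
  using a
proof (induction rule: u_poly_induct)
  case (const c)
  then show ?case by (simp add: sder_const[OF sder_YY[OF S]] sder_const[OF sder_pde])
next
  case (U j)
  show ?case
  proof (cases j)
    case 0
    have "aug (\<Sum>k\<le>M. r k * r (M - k)) = (\<Sum>k\<le>M. if k = 0 then if M = 0 then 1 else 0 else 0)"
      unfolding aug_sum by (rule sum.cong) (auto simp: aug_r)
    then show ?thesis
      by (simp add: 0 YY_u[OF S] aug_dx u_diff_poly u_poly_J pde_even_gen)
  next
    case (Suc i)
    then show ?thesis
      by (simp add: dx_U[symmetric] YY_dx[OF S ok] aug_dx diff_poly_YY[OF S ok] diff_poly_closed aug_sum aug_d)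
        (simp add: dx_U pde_even_gen)
  qed
next
  case (add a b)
  then show ?case by (simp add: lin_add[OF sder_lin[OF sder_YY[OF S]]] lin_add[OF lin_pde])
next
  case (mult a b)
  then show ?case by (simp add: sder_mult[OF sder_YY[OF S]] sder_mult[OF sder_pde])
qed

text \<open>Here the commutator on g_n is even and its constant needs a computation. For M = 0, d_1
  and g_1 the inhomogeneous term t_0 / 2 gives 1/4, and the term u / 4 of d_1 g_1 gives 1/4 with the
  opposite sign; in all other cases both contributions vanish.\<close>

theorem d_S:
  assumes ok: "ok M"
  shows "d m (S a) = S (d m a)"
proof (cases m)
  case 0
  then show ?thesis by (simp add: d_0 lin_0[OF lin_S[OF S]])
next
  case (Suc l)
  let ?C = "\<lambda>a. d m (S a) - S (d m a)"
  have C: "sder id ?C" by (rule sder_commutator[OF sder_d sder_S[OF S]]) simp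
  have Cdx: "?C (dx a) = dx (?C a)" for a
    by (simp add: S_dx[OF S ok] d_dx lin_diff[OF lin_dt])
  have Cu: "?C ufield = 0" by (simp add: S_u[OF S] d_u d_dx S_dx[OF S ok] S_r[OF S ok])
  have CU: "?C (even_gen (U i)) = 0" for i
  proof -
    have "?C ((dx ^^ i) ufield) = (dx ^^ i) (?C ufield)" by (induction i) (simp_all add: Cdx)
    then show ?thesis unfolding Cu dx_pow_u lin_0[OF lin_funpow[OF lin_dt]] .
  qed
  have Cs: "?C (sigma k) = 0" for k
    by (simp add: S_sigma[OF S] d_sigma dtau_d[symmetric] dtau_S[OF S ok, symmetric] S_r[OF S ok])
  have Cg: "?C (g n) = 0" if n: "n > 0" for n
  proof (rule diff_poly_kernel)
    show "diff_poly (?C (g n))"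
      unfolding Suc commutator_d[OF S] YY_g[OF S n] lin_add[OF lin_d]
      by (intro diff_poly_closed diff_poly_YY[OF S ok] flow_g u_diff_poly[OF flow_g(1)])
        (auto simp: lin_const_mult[OF lin_d] lin_sum[OF lin_d] d_time0 lin_0[OF lin_d]
          intro!: diff_poly_closed diff_poly_d u_diff_poly[OF flow_g(1)])
    show "dx (?C (g n)) = 0"
      unfolding Cdx[symmetric] dx_g_pos[OF n]
      by (rule sder_u_poly_zero[OF C _ u_poly_r]) (simp_all add: CU)
    have "aug (d m (YY M S (g n))) = (if l = 0 \<and> n = 1 \<and> M = 0 then 1/4 else 0)"
      unfolding YY_g[OF S n] Suc
      by (auto simp: lin_add[OF lin_d] lin_const_mult[OF lin_d] lin_sum[OF lin_d] aug_sum aug_d flow_g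
          diff_poly_d u_diff_poly[OF flow_g(1)] d_time0 lin_0[OF lin_d])
    moreover have "aug (YY M S (d m (g n))) = (if l = 0 \<and> n = 1 \<and> M = 0 then 1/4 else 0)"
      unfolding aug_YY[OF ok flow_g(1)] Suc aug_pde_dg[OF n] by simp
    ultimately show "aug (?C (g n)) = 0"
      unfolding Suc commutator_d[OF S] by (simp add: Suc flow_g aug_sum)
  qed
  then have Cf: "?C (fone k) = 0" for k by (intro fone_zero[OF sder_lin[OF C]])
  have tc: "time_continuous ?C"
    by (rule scont_tc[OF scont_diff[OF scont_comp[OF scont_d scont_S[OF S]] scont_comp[OF scont_S[OF S] scont_d]]])
  have "?C a = 0"
    by (rule der_ext[OF C _ tc Cdx _ _ Cf Cu Cs])
      (auto simp: S_time[OF S] S_tau[OF S] Suc d_Suc dt_time dt_tau lin_0[OF lin_dt] lin_0[OF lin_S[OF S]]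
        sder_const[OF sder_S[OF S]])
  then show ?thesis by simp
qed

lemma e_S: "ok M \<Longrightarrow> e m (S a) = S (e m a)"
  by (cases m) (simp_all add: dtau_S[OF S] lin_0[OF lin_S[OF S]])

lemma S_EE: "ok M \<Longrightarrow> S (EE N a) = EE N (S a)"
  unfolding EE_def
  by (simp add: LL_even_derivation[OF sder_S[OF S] tc_S[OF S] S_time[OF S] S_tau[OF S]] d_S e_S)

end

subsection \<open>The Virasoro commutation relations\<close>

definition Qop :: "nat \<Rightarrow> salg \<Rightarrow> salg" where "Qop M a = K * (\<Sum>k\<le>M. d k (d (M - k) a))"
definition Nop :: "nat \<Rightarrow> salg \<Rightarrow> salg" where "Nop M a = (\<Sum>k\<le>M. d k a * g (M - k))"
definition Lop :: "nat \<Rightarrow> salg \<Rightarrow> salg" where "Lop M a = Qop M a + Nop M a + EE M a"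
text \<open>The commutator of d_i with \<open>EE N\<close>, caused by differentiation of the
  explicit times (\<open>d_EE\<close>).\<close>

definition hh :: "nat \<Rightarrow> nat \<Rightarrow> salg \<Rightarrow> salg" where
  "hh i N a = (case i of 0 \<Rightarrow> 0 | Suc m \<Rightarrow> const (of_nat m + 1/2) * d (m + N) a)"
definition gg :: "nat \<Rightarrow> nat \<Rightarrow> salg" where
  "gg i N = (case i of 0 \<Rightarrow> 0 | Suc m \<Rightarrow> const (of_nat m + 1/2) * g (m + N))"
definition dl :: "nat \<Rightarrow> nat \<Rightarrow> salg" where
  "dl i N = (if i = 1 \<and> N = 0 then const (1/2) * time 0 else 0)"

lemma d_EE: "d i (EE N a) = EE N (d i a) + hh i N a"
proof (cases i)
  case 0
  have "EE N 0 = 0" by (rule lin_0[OF sder_lin[OF sder_EE]])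
  then show ?thesis by (simp add: 0 hh_def d_0)
next
  case (Suc m)
  have "e j (d i a) = d i (e j a)" for j by (cases j) (simp_all add: dtau_d lin_0[OF lin_d])
  then show ?thesis
    by (simp add: EE_def Suc LL_d hh_def) (simp add: d_d[of "Suc m"])
qed

lemma d_hh: "d j (hh i N a) = hh i N (d j a)"
  by (cases i) (simp_all add: hh_def lin_0[OF lin_d] lin_const_mult[OF lin_d] d_d[of j])

text \<open>With p = k + N in the first sum, and the second reversed by the symmetry of f, both
  become one sum over p < M + N with weight p - N + 1/2. The reflection of p gives it the weight M -
  p - 1/2; the two weights add up to M - N.\<close>

lemma symmetric_sum:
  fixes f :: "nat \<Rightarrow> nat \<Rightarrow> salg"
  assumes F: "\<And>p q. f p q = f q p" and MN: "M + N > 0"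
  shows "2 * ((\<Sum>k<M. const (of_nat k + 1/2) * f (k + N) (M - 1 - k)) - (\<Sum>k<N. const (of_nat k + 1/2) * f (k + M) (N - 1 - k)))
    = const (of_nat M - of_nat N) * (\<Sum>p<M + N. f p (M + N - 1 - p))"
proof -
  let ?T = "M + N - 1"
  let ?G = "\<lambda>p. f p (?T - p)"
  have 1: "(\<Sum>k<M. const (of_nat k + 1/2) * f (k + N) (M - 1 - k)) = (\<Sum>p\<in>{N..<M + N}. const (of_nat p - of_nat N + 1/2) * ?G p)"
    by (rule sum.reindex_bij_witness[where i = "\<lambda>p. p - N" and j = "\<lambda>k. k + N"])
      (auto simp: of_nat_diff algebra_simps)
  have 2: "(\<Sum>k<N. const (of_nat k + 1/2) * f (k + M) (N - 1 - k)) = (\<Sum>p\<in>{..<N}. const (of_nat N - of_nat p - 1/2) * ?G p)"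
  proof (rule sum.reindex_bij_witness[where i = "\<lambda>p. N - 1 - p" and j = "\<lambda>k. N - 1 - k"])
    fix k assume "k \<in> {..<N}"
    then have k: "k < N" by simp
    then have "?T - (N - 1 - k) = k + M" by auto
    moreover have "of_nat N - of_nat (N - 1 - k) - 1/2 = (of_nat k + 1/2 :: complex)"
      using k by (simp add: of_nat_diff)
    ultimately show "const (of_nat N - of_nat (N - 1 - k) - 1/2) * ?G (N - 1 - k) = const (of_nat k + 1/2) * f (k + M) (N - 1 - k)"
      using F[of "k + M" "N - 1 - k"] by (simp only:)
  qed auto
  have neg: "- (\<Sum>p\<in>{..<N}. const (of_nat N - of_nat p - 1/2) * ?G p) = (\<Sum>p\<in>{..<N}. const (of_nat p - of_nat N + 1/2) * ?G p)"
    unfolding sum_negf[symmetric]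
    by (rule sum.cong) (simp_all flip: const_uminus mult_minus_left add: algebra_simps)
  have split: "{..<M + N} = {..<N} \<union> {N..<M + N}" by auto
  have B: "(\<Sum>k<M. const (of_nat k + 1/2) * f (k + N) (M - 1 - k)) - (\<Sum>k<N. const (of_nat k + 1/2) * f (k + M) (N - 1 - k))
      = (\<Sum>p<M + N. const (of_nat p - of_nat N + 1/2) * ?G p)" (is "?B = ?R")
    unfolding 1 2 split by (subst sum.union_disjoint) (use neg in auto)
  have "?R = (\<Sum>p<M + N. const (of_nat M - of_nat p - 1/2) * ?G p)"
  proof (rule sum.reindex_bij_witness[where i = "\<lambda>p. ?T - p" and j = "\<lambda>p. ?T - p"])
    fix p assume "p \<in> {..<M + N}"
    then have p: "p < M + N" by simp
    have "of_nat M - of_nat (?T - p) - 1/2 = (of_nat p - of_nat N + 1/2 :: complex)"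
      using p by (simp add: of_nat_diff)
    moreover have "?T - (?T - p) = p" using p by auto
    ultimately show "const (of_nat M - of_nat (?T - p) - 1/2) * ?G (?T - p) = const (of_nat p - of_nat N + 1/2) * ?G p"
      using F[of p "?T - p"] by (simp only:)
  qed auto
  then have "2 * ?R = (\<Sum>p<M + N. const (of_nat p - of_nat N + 1/2) * ?G p + const (of_nat M - of_nat p - 1/2) * ?G p)"
    unfolding sum.distrib mult_2 by simp
  also have "\<dots> = (\<Sum>p<M + N. const (of_nat M - of_nat N) * ?G p)"
    by (simp flip: distrib_right const_add)
  finally show ?thesis unfolding B by (simp add: sum_distrib_left)
qed

lemma sum_hh: "(\<Sum>k\<le>M. hh k N (f k)) = (\<Sum>k<M. const (of_nat k + 1/2) * d (k + N) (f (Suc k)))"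
  by (subst sum.atMost_shift) (simp add: hh_def)

section \<open>Commutators of the constituents of L_M\<close>

lemma Qop_EE:
  assumes "M + N > 0"
  shows "(Qop M (EE N a) - EE N (Qop M a)) - (Qop N (EE M a) - EE M (Qop N a)) = const (of_nat M - of_nat N) * Qop (M + N - 1) a"
proof -
  have c: "EE N (K * b) = K * EE N b" for N b by (rule lin_const_mult[OF sder_lin[OF sder_EE]])
  have 1: "Qop M (EE N a) - EE N (Qop M a) = K * (2 * (\<Sum>k<M. const (of_nat k + 1/2) * d (k + N) (d (M - 1 - k) a)))" for M N
  proof -
    have r: "(\<Sum>k\<le>M. hh (M - k) N (d k a)) = (\<Sum>k\<le>M. hh k N (d (M - k) a))"
      by (rule sum.reindex_bij_witness[where i = "\<lambda>k. M - k" and j = "\<lambda>k. M - k"]) auto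
    have "Qop M (EE N a) - EE N (Qop M a) = K * (\<Sum>k\<le>M. hh (M - k) N (d k a) + hh k N (d (M - k) a))"
      unfolding Qop_def c right_diff_distrib[symmetric] lin_sum[OF sder_lin[OF sder_EE]] sum_subtractf[symmetric]
      by (simp add: d_EE lin_add[OF lin_d] d_hh add.commute)
    also have "\<dots> = K * (2 * (\<Sum>k\<le>M. hh k N (d (M - k) a)))"
      by (simp only: sum.distrib r mult_2)
    finally show ?thesis by (simp add: sum_hh)
  qed
  let ?F = "\<lambda>p q. d p (d q a)"
  have "(Qop M (EE N a) - EE N (Qop M a)) - (Qop N (EE M a) - EE M (Qop N a)) =
      K * (2 * ((\<Sum>k<M. const (of_nat k + 1/2) * ?F (k + N) (M - 1 - k)) - (\<Sum>k<N. const (of_nat k + 1/2) * ?F (k + M) (N - 1 - k))))"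
    unfolding 1 by (simp only: right_diff_distrib)
  also have "\<dots> = K * (const (of_nat M - of_nat N) * (\<Sum>p<M + N. ?F p (M + N - 1 - p)))"
    by (subst symmetric_sum[OF d_d assms]) simp
  also have "\<dots> = const (of_nat M - of_nat N) * Qop (M + N - 1) a"
  proof -
    have "{..<M + N} = {..M + N - 1}" using assms by auto
    then show ?thesis unfolding Qop_def by (simp only: const_left_commute[of K])
  qed
  finally show ?thesis .
qed

lemma gcomm: "a * g n * b = a * b * g n"
  using central_even[OF par_g, of n] by (simp add: central_def mult.assoc)

text \<open>The cross terms, in which one derivative falls on \<open>a\<close> and one on g, are
  symmetric in M and N because d_j g_n is, and cancel.\<close>

lemma Qop_Nop:
  "(Qop M (Nop N a) - Nop N (Qop M a)) - (Qop N (Nop M a) - Nop M (Qop N a))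
    = (\<Sum>k\<le>N. d k a * Qop M (g (N - k))) - (\<Sum>k\<le>M. d k a * Qop N (g (M - k)))"
proof -
  define W where "W M N = (\<Sum>x\<le>M. \<Sum>k\<le>N. d x (d k a) * d (M - x) (g (N - k)))" for M N
  have K: "b * (K * c) = K * (b * c)" for b c by (rule const_left_commute)
  have dd: "d k (d x (d y a)) = d x (d y (d k a))" for k x y
    by (simp only: d_d[of k x] d_d[of k y])
  have 1: "Qop M (Nop N a) - Nop N (Qop M a) = (\<Sum>k\<le>N. d k a * Qop M (g (N - k))) + K * (2 * W M N)" for M N
  proof -
    have r: "(\<Sum>x\<le>M. \<Sum>k\<le>N. d (M - x) (d k a) * d x (g (N - k))) = W M N"
      unfolding W_def by (rule sum.reindex_bij_witness[where i = "\<lambda>k. M - k" and j = "\<lambda>k. M - k"]) auto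
    have "Qop M (Nop N a) = K * (\<Sum>x\<le>M. \<Sum>k\<le>N. d x (d (M - x) (d k a)) * g (N - k) + d (M - x) (d k a) * d x (g (N - k))
        + d x (d k a) * d (M - x) (g (N - k)) + d k a * d x (d (M - x) (g (N - k))))"
      unfolding Qop_def Nop_def by (simp add: lin_sum[OF lin_d] sder_mult[OF sder_d] lin_add[OF lin_d] add_ac)
    also have "\<dots> = K * (\<Sum>x\<le>M. \<Sum>k\<le>N. d x (d (M - x) (d k a)) * g (N - k)) + K * (2 * W M N) + K * (\<Sum>x\<le>M. \<Sum>k\<le>N. d k a * d x (d (M - x) (g (N - k))))"
      unfolding sum.distrib r W_def[symmetric] by (simp add: distrib_left mult_2)
    also have "K * (\<Sum>x\<le>M. \<Sum>k\<le>N. d x (d (M - x) (d k a)) * g (N - k)) = Nop N (Qop M a)"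
    proof -
      have "Nop N (Qop M a) = (\<Sum>k\<le>N. K * (\<Sum>x\<le>M. d k (d x (d (M - x) a)) * g (N - k)))"
        unfolding Nop_def Qop_def lin_const_mult[OF lin_d] lin_sum[OF lin_d] mult.assoc sum_distrib_right ..
      also have "\<dots> = K * (\<Sum>k\<le>N. \<Sum>x\<le>M. d k (d x (d (M - x) a)) * g (N - k))"
        by (rule sum_distrib_left[symmetric])
      also have "\<dots> = K * (\<Sum>k\<le>N. \<Sum>x\<le>M. d x (d (M - x) (d k a)) * g (N - k))"
        by (intro arg_cong[of _ _ "\<lambda>b. K * b"] sum.cong refl arg_cong[of _ _ "\<lambda>b. b * g _"] dd)
      finally show ?thesis by (subst sum.swap) (rule sym)
    qed
    also have "K * (\<Sum>x\<le>M. \<Sum>k\<le>N. d k a * d x (d (M - x) (g (N - k)))) = (\<Sum>k\<le>N. d k a * Qop M (g (N - k)))"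
    proof -
      have "(\<Sum>k\<le>N. d k a * Qop M (g (N - k))) = K * (\<Sum>k\<le>N. d k a * (\<Sum>x\<le>M. d x (d (M - x) (g (N - k)))))"
        unfolding Qop_def K sum_distrib_left[symmetric] ..
      also have "\<dots> = K * (\<Sum>k\<le>N. \<Sum>x\<le>M. d k a * d x (d (M - x) (g (N - k))))"
        by (intro arg_cong[of _ _ "\<lambda>b. K * b"] sum.cong refl sum_distrib_left)
      finally show ?thesis by (subst sum.swap) (rule sym)
    qed
    finally show ?thesis by simp
  qed
  have "W M N = W N M"
    unfolding W_def by (subst sum.swap) (intro sum.cong refl arg_cong2[of _ _ _ _ times] d_d d_g_sym)
  then show ?thesis unfolding 1 by simp
qed

lemma Nop_Nop:
  "Nop M (Nop N a) - Nop N (Nop M a) = (\<Sum>k\<le>N. d k a * Nop M (g (N - k))) - (\<Sum>k\<le>M. d k a * Nop N (g (M - k)))"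
proof -
  have 1: "Nop M (Nop N a) = (\<Sum>x\<le>M. \<Sum>k\<le>N. d x (d k a) * g (N - k) * g (M - x)) + (\<Sum>k\<le>N. d k a * Nop M (g (N - k)))" for M N
  proof -
    have "Nop M (Nop N a) = (\<Sum>x\<le>M. \<Sum>k\<le>N. d x (d k a) * g (N - k) * g (M - x) + d k a * (d x (g (N - k)) * g (M - x)))"
      unfolding Nop_def by (simp add: lin_sum[OF lin_d] sder_mult[OF sder_d] sum_distrib_right distrib_right mult.assoc)
    also have "(\<Sum>x\<le>M. \<Sum>k\<le>N. d x (d k a) * g (N - k) * g (M - x) + d k a * (d x (g (N - k)) * g (M - x)))
        = (\<Sum>x\<le>M. \<Sum>k\<le>N. d x (d k a) * g (N - k) * g (M - x)) + (\<Sum>x\<le>M. \<Sum>k\<le>N. d k a * (d x (g (N - k)) * g (M - x)))"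
      by (simp add: sum.distrib)
    also have "(\<Sum>x\<le>M. \<Sum>k\<le>N. d k a * (d x (g (N - k)) * g (M - x))) = (\<Sum>k\<le>N. d k a * Nop M (g (N - k)))"
      unfolding Nop_def sum_distrib_left by (rule sum.swap)
    finally show ?thesis .
  qed
  have "(\<Sum>x\<le>M. \<Sum>k\<le>N. d x (d k a) * g (N - k) * g (M - x)) = (\<Sum>x\<le>N. \<Sum>k\<le>M. d x (d k a) * g (M - k) * g (N - x))"
    by (subst sum.swap) (intro sum.cong refl, metis d_d gcomm)
  then show ?thesis unfolding 1 by simp
qed

lemma Nop_EE: "Nop M (EE N a) - EE N (Nop M a) = (\<Sum>k\<le>M. hh k N a * g (M - k)) - (\<Sum>k\<le>M. d k a * EE N (g (M - k)))"
  unfolding Nop_def lin_sum[OF sder_lin[OF sder_EE]] sum_subtractf[symmetric]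
  by (rule sum.cong) (simp_all add: d_EE sder_mult[OF sder_EE] distrib_right)

text \<open>Pairing the index shifts of the flows with those of the g's makes the summand symmetric
  in its two indices, so that \<open>symmetric_sum\<close> applies.\<close>

lemma hh_gg_sum:
  assumes "M + N > 0"
  shows "(\<Sum>k\<le>M. hh k N a * g (M - k)) + (\<Sum>k\<le>M. d k a * gg (M - k) N) - (\<Sum>k\<le>N. hh k M a * g (N - k)) - (\<Sum>k\<le>N. d k a * gg (N - k) M)
    = const (of_nat M - of_nat N) * Nop (M + N - 1) a"
proof (rule two_cancel)
  let ?F = "\<lambda>p q. d p a * g q + d q a * g p"
  have 1: "(\<Sum>k\<le>M. hh k N a * g (M - k)) + (\<Sum>k\<le>M. d k a * gg (M - k) N) = (\<Sum>k<M. const (of_nat k + 1/2) * ?F (k + N) (M - 1 - k))" for M N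
  proof -
    have "(\<Sum>k\<le>M. hh k N a * g (M - k)) = (\<Sum>k<M. const (of_nat k + 1/2) * (d (k + N) a * g (M - 1 - k)))"
      by (subst sum.atMost_shift) (simp add: hh_def mult.assoc)
    moreover have "(\<Sum>k\<le>M. d k a * gg (M - k) N) = (\<Sum>k\<le>M. d (M - k) a * gg k N)"
      by (rule sum.reindex_bij_witness[where i = "\<lambda>k. M - k" and j = "\<lambda>k. M - k"]) auto
    moreover have "\<dots> = (\<Sum>k<M. const (of_nat k + 1/2) * (d (M - 1 - k) a * g (k + N)))"
      by (subst sum.atMost_shift) (simp add: gg_def const_left_commute)
    ultimately show ?thesis by (simp add: distrib_left sum.distrib)
  qed
  have "2 * ((\<Sum>k<M. const (of_nat k + 1/2) * ?F (k + N) (M - 1 - k)) - (\<Sum>k<N. const (of_nat k + 1/2) * ?F (k + M) (N - 1 - k)))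
     = const (of_nat M - of_nat N) * (\<Sum>p<M + N. ?F p (M + N - 1 - p))"
    by (rule symmetric_sum[OF _ assms]) (simp add: add.commute)
  also have "(\<Sum>p<M + N. ?F p (M + N - 1 - p)) = 2 * Nop (M + N - 1) a"
  proof -
    have s: "{..<M + N} = {..M + N - 1}" using assms by auto
    have "(\<Sum>p\<le>M + N - 1. d (M + N - 1 - p) a * g p) = Nop (M + N - 1) a"
    proof -
      define P where "P = M + N - 1"
      have "(\<Sum>p\<le>P. d (P - p) a * g p) = (\<Sum>k\<le>P. d k a * g (P - k))"
        by (rule sum.reindex_bij_witness[where i = "\<lambda>k. P - k" and j = "\<lambda>k. P - k"]) auto
      then show ?thesis by (simp only: P_def Nop_def)
    qed
    then show ?thesis unfolding s sum.distrib by (simp add: Nop_def mult_2)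
  qed
  finally show "2 * ((\<Sum>k\<le>M. hh k N a * g (M - k)) + (\<Sum>k\<le>M. d k a * gg (M - k) N) - (\<Sum>k\<le>N. hh k M a * g (N - k)) - (\<Sum>k\<le>N. d k a * gg (N - k) M))
    = 2 * (const (of_nat M - of_nat N) * Nop (M + N - 1) a)"
    unfolding 1 1[symmetric] diff_diff_eq
    by (metis (no_types, lifting) 1 const_left_commute const_numeral)
qed

lemma tc_time_mult: "scont D \<Longrightarrow> time_continuous (\<lambda>a. b * D a)"
  by (rule scont_comp_tc[OF scont_tc[OF scont_mult_left]])

lemma scont_e: "scont (e n)"
  by (cases n) (simp_all add: e_def[abs_def] scont_zero scont_dtau)

lemma tc_EE: "time_continuous (EE M)"
proof -
  have "time_continuous (\<lambda>a. lsum (\<lambda>k. const (1 / cf k) * time k * d (k + M) a))"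
    by (rule time_continuous_lsum[where K = "\<lambda>P. T -` set_mset (fst P)", OF tc_time_mult[OF scont_d] ssum_time finite_time_vimage coeff_time_mult_nonzero])
  moreover have "time_continuous (\<lambda>a. lsum (\<lambda>k. const (of_nat k + c0) * tau k * e (k + M) a))"
    by (rule time_continuous_lsum[where K = "\<lambda>P. Tau -` fset (snd P)", OF tc_time_mult[OF scont_e] ssum_tau finite_tau_vimage coeff_tau_mult_nonzero])
  ultimately show ?thesis
    unfolding EE_def[abs_def] LL_def by (rule time_continuous_add)
qed

lemma EE_time: "EE M (time k) = (if M \<le> Suc k then const (cf (Suc k) / cf (Suc k - M)) * time (Suc k - M) else 0)"
proof -
  have d: "d (j + M) (time k) = (if M \<le> Suc k \<and> j = Suc k - M then const (cf (Suc k)) else 0)" for j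
  proof (cases "j + M")
    case (Suc n)
    then show ?thesis by (auto simp: d_Suc dt_time)
  qed (auto simp: d_0)
  have e: "e j (time k) = 0" for j by (cases j) (simp_all add: dtau_time)
  show ?thesis
  proof (cases "M \<le> Suc k")
    case True
    have "EE M (time k) = lsum (\<lambda>j. if j = Suc k - M then const (1 / cf j) * time j * const (cf (Suc k)) else 0)"
      unfolding EE_def LL_def d e using True by (simp add: lsum_zero if_distrib cong: if_cong)
    also have "\<dots> = const (1 / cf (Suc k - M)) * const (cf (Suc k)) * time (Suc k - M)"
      unfolding lsum_delta by (metis const_commute mult.assoc)
    finally show ?thesis using True by (simp flip: const_mult add: mult.commute)
  qed (simp add: EE_def LL_def d e lsum_zero)
qed

lemma EE_tau: "EE M (tau k) = (if M \<le> Suc k then const (of_nat (Suc k - M) + c0) * tau (Suc k - M) else 0)"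
proof -
  have e: "e (j + M) (tau k) = (if M \<le> Suc k \<and> j = Suc k - M then 1 else 0)" for j
  proof (cases "j + M")
    case (Suc n)
    then show ?thesis by (auto simp: dtau_tau)
  qed auto
  have d: "d j (tau k) = 0" for j by (cases j) (simp_all add: d_0 d_Suc dt_tau)
  show ?thesis
  proof (cases "M \<le> Suc k")
    case True
    have "EE M (tau k) = lsum (\<lambda>j. if j = Suc k - M then const (of_nat j + c0) * tau j else 0)"
      unfolding EE_def LL_def d e using True by (simp add: lsum_zero if_distrib cong: if_cong)
    then show ?thesis unfolding lsum_delta using True by simp
  qed (simp add: EE_def LL_def d e lsum_zero)
qed

text \<open>\<open>EE\<close> differentiates the explicit times as well and shifts their index by M
  - 1. For M = 0 the shifted sums lack index 0: for t_0 this leaves the term with 1/2, while for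
  tau_0 the weight is c_0 = 0.\<close>

lemma EE_LL:
  assumes "ok M"
  shows "EE M (LL (\<lambda>k. p (Suc k)) (\<lambda>k. q (Suc k))) = LL (\<lambda>k. EE M (p (Suc k))) (\<lambda>k. EE M (q (Suc k)))
    + LL (\<lambda>k. const (of_nat (k + M) - 1/2) * p (k + M)) (\<lambda>k. const (of_nat (k + M) - 1 + c0) * q (k + M))
    + (if M = 0 then const (1/2) * time 0 * p 0 else 0)"
proof -
  let ?f = "\<lambda>k. const (1 / cf k) * time k * (const (of_nat (k + M) - 1/2) * p (k + M))"
  let ?h = "\<lambda>k. const (of_nat k + c0) * tau k * (const (of_nat (k + M) - 1 + c0) * q (k + M))"
  have 1: "EE M (const (1 / cf k) * time k * p (Suc k)) = const (1 / cf k) * time k * EE M (p (Suc k))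
      + (if M \<le> Suc k then ?f (Suc k - M) else 0)" for k
  proof -
    have "const (1 / cf k) * (const (cf (Suc k) / cf (Suc k - M)) * time (Suc k - M)) * p (Suc k)
        = const (1 / cf (Suc k - M)) * time (Suc k - M) * (const (of_nat (Suc k) - 1/2) * p (Suc k))"
    proof -
      have c: "cf (Suc k) = (of_nat (Suc k) - 1/2) * cf k" by (simp add: cf_Suc algebra_simps)
      have "const (1 / cf (Suc k - M)) * time (Suc k - M) * (const (of_nat (Suc k) - 1/2) * p (Suc k))
        = const (1 / cf (Suc k - M)) * const (of_nat (Suc k) - 1/2) * time (Suc k - M) * p (Suc k)"
        by (metis const_commute mult.assoc)
      moreover have "1 / cf k * (cf (Suc k) / cf (Suc k - M)) = 1 / cf (Suc k - M) * (of_nat (Suc k) - 1/2)"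
        unfolding c using cf_nz[of k] by (simp add: field_simps)
      ultimately show ?thesis by (simp only: mult.assoc[symmetric] const_mult[symmetric])
    qed
    then show ?thesis
      by (simp add: sder_mult[OF sder_EE] sder_const[OF sder_EE] EE_time)
  qed
  have 2: "EE M (const (of_nat k + c0) * tau k * q (Suc k)) = const (of_nat k + c0) * tau k * EE M (q (Suc k))
      + (if M \<le> Suc k then ?h (Suc k - M) else 0)" for k
  proof -
    have "const (of_nat k + c0) * (const (of_nat (Suc k - M) + c0) * tau (Suc k - M)) * q (Suc k)
        = const (of_nat (Suc k - M) + c0) * tau (Suc k - M) * (const (of_nat (Suc k) - 1 + c0) * q (Suc k))"
      by (simp add: mult.assoc) (metis const_commute mult.assoc)
    then show ?thesis
      by (simp add: sder_mult[OF sder_EE] sder_const[OF sder_EE] EE_tau del: of_nat_diff)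
  qed
  have z: "(if M = 0 then ?h 0 else 0) = 0" using assms by auto
  have t: "- (if M = 0 then ?f 0 else 0) = (if M = 0 then const (1/2) * time 0 * p 0 else 0)"
  proof -
    have "time 0 * (const (- (1/2)) * p 0) = - (const (1/2) * time 0 * p 0)"
      by (metis const_commute const_uminus mult.assoc mult_minus_left)
    then show ?thesis by (simp add: cf_0)
  qed
  have f: "ssum ?f" by (rule ssum_time)
  have h: "ssum ?h" by (rule ssum_tau)
  have "EE M (LL (\<lambda>k. p (Suc k)) (\<lambda>k. q (Suc k))) =
      lsum (\<lambda>k. const (1 / cf k) * time k * EE M (p (Suc k))) + (lsum ?f - (if M = 0 then ?f 0 else 0)) +
      (lsum (\<lambda>k. const (of_nat k + c0) * tau k * EE M (q (Suc k))) + (lsum ?h - (if M = 0 then ?h 0 else 0)))"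
    unfolding LL_apply[OF sder_lin[OF sder_EE] tc_EE] 1 2
    unfolding lsum_add[OF ssum_time ssum_shifted[OF f]] lsum_add[OF ssum_tau ssum_shifted[OF h]]
      lsum_shifted[OF f] lsum_shifted[OF h] ..
  then show ?thesis unfolding z using t unfolding LL_def by simp
qed

lemma EE_EE:
  assumes ok: "ok M" and N: "N > 0"
  shows "EE M (EE N a) - EE N (EE M a) = const (of_nat M - of_nat N) * EE (M + N - 1) a
    + (if M = 0 then const (1/2) * time 0 * d (N - 1) a else 0)"
proof -
  obtain n where n: "N = Suc n" using N by (cases N) auto
  have e: "EE M (e (Suc i) a) = e (Suc i) (EE M a) - const (of_nat i + c0) * e (i + M) a" for i
  proof -
    have "- dtau i (e j a) = e j (dtau i a)" for j
      using dtau_dtau[of _ i a] by (cases j) (simp_all add: lin_0[OF lin_dtau])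
    then show ?thesis by (simp add: EE_def LL_dtau dtau_d)
  qed
  have d: "EE M (d (Suc i) a) = d (Suc i) (EE M a) - const (of_nat i + 1/2) * d (i + M) a" for i
    by (simp add: d_EE hh_def)
  let ?A = "\<lambda>k. d (k + M + n) a" and ?B = "\<lambda>k. e (k + M + n) a"
  have X: "EE N b = LL (\<lambda>k. d (Suc k + n) b) (\<lambda>k. e (Suc k + n) b)" for b by (simp add: EE_def n)
  have "EE M (EE N a) = LL (\<lambda>k. EE M (d (Suc (k + n)) a)) (\<lambda>k. EE M (e (Suc (k + n)) a))
      + LL (\<lambda>k. const (of_nat (k + M) - 1/2) * ?A k) (\<lambda>k. const (of_nat (k + M) - 1 + c0) * ?B k)
      + (if M = 0 then const (1/2) * time 0 * d n a else 0)"
    using EE_LL[OF ok, of "\<lambda>k. d (k + n) a" "\<lambda>k. e (k + n) a"] unfolding X add_Suc add_0 .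
  also have "LL (\<lambda>k. EE M (d (Suc (k + n)) a)) (\<lambda>k. EE M (e (Suc (k + n)) a)) =
      EE N (EE M a) - LL (\<lambda>k. const (of_nat (k + n) + 1/2) * ?A k) (\<lambda>k. const (of_nat (k + n) + c0) * ?B k)"
    unfolding d e LL_diff X by (simp add: add_ac)
  finally have "EE M (EE N a) - EE N (EE M a) =
      LL (\<lambda>k. const (of_nat (k + M) - 1/2) * ?A k - const (of_nat (k + n) + 1/2) * ?A k)
         (\<lambda>k. const (of_nat (k + M) - 1 + c0) * ?B k - const (of_nat (k + n) + c0) * ?B k)
      + (if M = 0 then const (1/2) * time 0 * d n a else 0)"
    unfolding LL_diff by simp
  also have "\<dots> = LL (\<lambda>k. const (of_nat M - of_nat N) * ?A k) (\<lambda>k. const (of_nat M - of_nat N) * ?B k)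
      + (if M = 0 then const (1/2) * time 0 * d n a else 0)"
  proof -
    have "of_nat (k + M) - 1/2 - (of_nat (k + n) + 1/2) = (of_nat M - of_nat N :: complex)"
      "of_nat (k + M) - 1 + c0 - (of_nat (k + n) + c0) = of_nat M - of_nat N" for k
      by (simp_all add: n)
    then show ?thesis unfolding const_sub_mult by (simp only:)
  qed
  also have "\<dots> = const (of_nat M - of_nat N) * EE (M + N - 1) a + (if M = 0 then const (1/2) * time 0 * d (N - 1) a else 0)"
    unfolding LL_central_mult[OF central_const, symmetric] by (simp add: EE_def n add.assoc)
  finally show ?thesis .
qed

lemma lin_sum_fun: "(\<And>k. lin (f k)) \<Longrightarrow> lin (\<lambda>a. \<Sum>k\<in>A. f k a)"
  by (simp add: lin_def sum.distrib sum_distrib_left)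

lemma lin_Qop: "lin (Qop M)"
  unfolding Qop_def[abs_def] by (rule lin_comp[OF lin_mult_left lin_sum_fun[OF lin_comp[OF lin_d lin_d]]])

lemma lin_Nop: "lin (Nop M)"
  unfolding Nop_def[abs_def] by (rule lin_sum_fun) (rule lin_comp[OF lin_mult_right lin_d])

lemma lin_Lop: "lin (Lop M)"
  using lin_Qop[of M] lin_Nop[of M] sder_lin[OF sder_EE[of M]] by (simp add: Lop_def[abs_def] lin_def distrib_left)

lemma Qop_Qop: "Qop M (Qop N a) = Qop N (Qop M a)"
proof -
  have 1: "Qop M (Qop N a) = K * (K * (\<Sum>x\<le>M. \<Sum>k\<le>N. d x (d (M - x) (d k (d (N - k) a)))))" for M N
    unfolding Qop_def lin_const_mult[OF lin_d] lin_sum[OF lin_d] sum_distrib_left[symmetric] ..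
  have 2: "d x (d y (d k (d l a))) = d k (d l (d x (d y a)))" for x y k l
    by (simp only: d_d[of y k] d_d[of y l] d_d[of x k] d_d[of x l])
  show ?thesis
    unfolding 1 by (subst sum.swap) (intro arg_cong[of _ _ "\<lambda>b. K * b"] sum.cong refl 2)
qed

text \<open>\<open>SG M l\<close> is the value of the flow on \<open>g l\<close>, including \<open>g 0 = 0\<close>; it differs from
  \<open>Lop M (g l)\<close> by an inhomogeneous term.\<close>

definition SG :: "nat \<Rightarrow> nat \<Rightarrow> salg" where "SG M l = Lop M (g l) + gg l M + dl l M"

lemma SG_Sg: "l > 0 \<Longrightarrow> Sg M l = SG M l" and SG_0: "SG M 0 = 0"
proof -
  show "SG M 0 = 0" by (simp add: SG_def g_0 gg_def dl_def lin_0[OF lin_Lop])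
  assume "l > 0"
  then show "Sg M l = SG M l"
    by (cases l) (simp_all add: SG_def Sg_def Lop_def Qop_def Nop_def gg_def dl_def add.commute)
qed

text \<open>Moving L_M past the coefficients g of L_N produces L_M g_{N-k}; the inhomogeneous terms
  that complete it to \<open>SG\<close> are supplied by \<open>hh_gg_sum\<close> and, for M = 0, by
  the t_0 term of \<open>EE_EE\<close>.\<close>

lemma Lop_Lop:
  assumes ok: "ok M" and N: "N > 0"
  shows "Lop M (Lop N a) - Lop N (Lop M a) = const (of_nat M - of_nat N) * Lop (M + N - 1) a
    + (\<Sum>k\<le>N. d k a * SG M (N - k)) - (\<Sum>k\<le>M. d k a * SG N (M - k))"
proof -
  let ?c = "const (of_nat M - of_nat N)"
  have MN: "M + N > 0" using N by simp
  have S: "(\<Sum>k\<le>n. d k a * SG m (n - k)) = (\<Sum>k\<le>n. d k a * Qop m (g (n - k))) + (\<Sum>k\<le>n. d k a * Nop m (g (n - k)))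
      + (\<Sum>k\<le>n. d k a * EE m (g (n - k))) + (\<Sum>k\<le>n. d k a * gg (n - k) m) + (\<Sum>k\<le>n. d k a * dl (n - k) m)" for m n
    by (simp add: SG_def Lop_def distrib_left sum.distrib)
  have D1: "(\<Sum>k\<le>M. d k a * dl (M - k) N) = 0" using N by (simp add: dl_def)
  have D2: "(\<Sum>k\<le>N. d k a * dl (N - k) M) = (if M = 0 then const (1/2) * time 0 * d (N - 1) a else 0)"
  proof -
    have "(\<Sum>k\<le>N. d k a * dl (N - k) M) = (\<Sum>k\<le>N. if k = N - 1 then d (N - 1) a * dl 1 M else 0)"
      by (rule sum.cong) (use N in \<open>auto simp: dl_def\<close>)
    also have "\<dots> = d (N - 1) a * dl 1 M" by simp
    finally have 1: "(\<Sum>k\<le>N. d k a * dl (N - k) M) = d (N - 1) a * dl 1 M" .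
    have "d (N - 1) a * (const (1/2) * time 0) = const (1/2) * time 0 * d (N - 1) a"
      by (metis central_def central_mult central_const central_even par_even_gen)
    then show ?thesis unfolding 1 by (simp add: dl_def)
  qed
  have "Lop M (Lop N a) - Lop N (Lop M a) =
      ((Qop M (Nop N a) - Nop N (Qop M a)) - (Qop N (Nop M a) - Nop M (Qop N a)))
    + ((Qop M (EE N a) - EE N (Qop M a)) - (Qop N (EE M a) - EE M (Qop N a)))
    + (Nop M (Nop N a) - Nop N (Nop M a))
    + (Nop M (EE N a) - EE N (Nop M a)) - (Nop N (EE M a) - EE M (Nop N a))
    + (EE M (EE N a) - EE N (EE M a))"
    unfolding Lop_def lin_add[OF lin_Qop] lin_add[OF lin_Nop] lin_add[OF sder_lin[OF sder_EE]] Qop_Qop[of M N]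
    by (simp add: algebra_simps)
  then show ?thesis
    unfolding Qop_Nop Qop_EE[OF MN] Nop_Nop Nop_EE EE_EE[OF ok N] S D1 D2 Lop_def[of "M + N - 1"] distrib_left[of ?c]
      hh_gg_sum[OF MN, of a, symmetric]
    by (simp add: algebra_simps)
qed

lemma Lop_dl: "N > 0 \<Longrightarrow> Lop N (dl l M) = (if l = 1 \<and> M = 0 then const (1/4) * g (N - 1) + (if N = 1 then const (1/4) * time 0 else 0) else 0)"
proof -
  assume N: "N > 0"
  have "d k (d j (time 0)) = 0" for k j by (simp add: d_time0 sder_const[OF sder_d] lin_0[OF lin_d])
  then have "Qop N (time 0) = 0" by (simp add: Qop_def)
  moreover have "Nop N (time 0) = const (1/2) * g (N - 1)"
  proof -
    have "Nop N (time 0) = (\<Sum>k\<le>N. if k = 1 then const (1/2) * g (N - 1) else 0)"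
      unfolding Nop_def d_time0 by (rule sum.cong) auto
    then show ?thesis using N by simp
  qed
  moreover have "EE N (time 0) = (if N = 1 then const (1/2) * time 0 else 0)"
    using N by (auto simp: EE_time cf_Suc cf_0)
  ultimately have "Lop N (time 0) = const (1/2) * g (N - 1) + (if N = 1 then const (1/2) * time 0 else 0)"
    by (simp add: Lop_def)
  then show ?thesis
    by (simp add: dl_def lin_0[OF lin_Lop] lin_const_mult[OF lin_Lop] distrib_left const_mult_assoc)
qed

section \<open>From the operators L_M to the flows\<close>

context
  fixes M S assumes S: "sfl M S"
begin

lemma S_gg: "S (g l) = SG M l"
  by (cases l) (simp_all add: S_g[OF S] SG_Sg SG_0 g_0 lin_0[OF lin_S[OF S]])

lemma S_K: "S (K * a) = K * S a"
  by (rule lin_const_mult[OF lin_S[OF S]])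

text \<open>The flow commutes with the d_k and with \<open>EE\<close>, so it sees L_N only through
  the coefficients g.\<close>

lemma S_Lop:
  assumes ok: "ok M"
  shows "S (Lop N a) = Lop N (S a) + (\<Sum>k\<le>N. d k a * SG M (N - k))"
proof -
  note sum = lin_sum[OF lin_S[OF S]]
  have "S (Qop N a) = Qop N (S a)"
    unfolding Qop_def S_K sum d_S[OF S ok] ..
  moreover have "S (Nop N a) = Nop N (S a) + (\<Sum>k\<le>N. d k a * SG M (N - k))"
    unfolding Nop_def sum sder_mult[OF sder_S[OF S]] d_S[OF S ok] S_gg sum.distrib by simp
  ultimately show ?thesis
    unfolding Lop_def lin_add[OF lin_S[OF S]] S_EE[OF S ok] by simp
qed

end

text \<open>Moving S' through S (g l) gives L_M L_N, in this order, plus corrections from the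
  coefficients. These corrections are exactly the two sums in \<open>Lop_Lop\<close> and cancel
  them, so only the inhomogeneous terms remain to be compared.\<close>

lemma virasoro_g:
  assumes S: "sfl M S" "sfl N S'" and ok: "ok M" "N > 0" and l: "l > 0"
  shows "S' (S (g l)) - S (S' (g l)) = const (of_nat M - of_nat N) * SG (M + N - 1) l"
proof -
  obtain m where m: "l = Suc m" using l by (cases l) auto
  have okN: "ok N" using ok by simp
  have d0: "dl j N = 0" for j using ok(2) by (simp add: dl_def)
  have z: "S' (dl l M) = 0"
    using S_time[OF S(2)] by (simp add: dl_def lin_const_mult[OF lin_S[OF S(2)]] lin_0[OF lin_S[OF S(2)]])
  let ?h = "const (of_nat m + 1/2)"
  have 1: "S' (gg l M) = ?h * SG N (m + M)" "S (gg l N) = ?h * SG M (m + N)"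
    by (simp_all add: m gg_def lin_const_mult[OF lin_S[OF S(1)]] lin_const_mult[OF lin_S[OF S(2)]] S_gg[OF S(1)] S_gg[OF S(2)])
  have 2: "Lop j (gg l i) = ?h * Lop j (g (m + i))" for i j
    by (simp add: m gg_def lin_const_mult[OF lin_Lop])
  have A: "S' (S (g l)) = Lop M (Lop N (g l)) + ?h * Lop M (g (m + N)) + (\<Sum>k\<le>M. d k (g l) * SG N (M - k)) + ?h * SG N (m + M)"
    unfolding S_gg[OF S(1)] unfolding SG_def[of M l] lin_add[OF lin_S[OF S(2)]] S_Lop[OF S(2) okN] z 1 S_gg[OF S(2)]
    unfolding SG_def[of N l] d0 lin_add[OF lin_Lop] 2 by (simp add: lin_0[OF lin_Lop])
  have B: "S (S' (g l)) = Lop N (Lop M (g l)) + ?h * Lop N (g (m + M)) + Lop N (dl l M) + (\<Sum>k\<le>N. d k (g l) * SG M (N - k)) + ?h * SG M (m + N)"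
    unfolding S_gg[OF S(2)] unfolding SG_def[of N l] d0 lin_add[OF lin_S[OF S(1)]] S_Lop[OF S(1) ok(1)] 1 S_gg[OF S(1)]
    unfolding SG_def[of M l] lin_add[OF lin_Lop] 2 by (simp add: lin_0[OF lin_S[OF S(1)]])
  have "S' (S (g l)) - S (S' (g l)) = (Lop M (Lop N (g l)) - Lop N (Lop M (g l))) + (\<Sum>k\<le>M. d k (g l) * SG N (M - k)) - (\<Sum>k\<le>N. d k (g l) * SG M (N - k))
    + ?h * (gg (m + M) N - gg (m + N) M - dl (m + N) M) - Lop N (dl l M)"
    unfolding A B SG_def[of N "m + M"] SG_def[of M "m + N"] d0 by (simp add: algebra_simps)
  then have C: "S' (S (g l)) - S (S' (g l)) = const (of_nat M - of_nat N) * Lop (M + N - 1) (g l)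
    + (?h * (gg (m + M) N - gg (m + N) M - dl (m + N) M) - Lop N (dl l M))"
    unfolding Lop_Lop[OF ok] by simp
  obtain n where n: "N = Suc n" using ok by (cases N) auto
  have "?h * (gg (m + M) N - gg (m + N) M - dl (m + N) M) - Lop N (dl l M) = const (of_nat M - of_nat N) * (gg l (M + N - 1) + dl l (M + N - 1))"
  \<comment> \<open>For m + M > 0 all \<open>dl\<close> terms vanish and coefficients of g are
    compared. The case 0 is g_1 together with s_{-1}, where \<open>Lop_dl\<close> provides what is
    missing.\<close>
  proof (cases "m + M")
    case 0
    then have "m = 0" "M = 0" by auto
    then show ?thesis
      unfolding Lop_dl[OF ok(2)] by (cases n) (auto intro!: salg_eqI simp: n m gg_def dl_def g_0 coeff_const_mult coeff_diff coeff_add coeff_zero coeff_uminus field_simps)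
  next
    case (Suc p)
    have mN: "m + N = Suc (m + n)" by (simp add: n)
    have e: "p + N = m + (M + N - 1)" "m + n + M = m + (M + N - 1)" using Suc n by auto
    have c: "of_nat p = (of_nat m + of_nat M - 1 :: complex)" using arg_cong[OF Suc, of "of_nat :: nat \<Rightarrow> complex"] by simp
    have dls: "dl (m + N) M = 0" "dl l (M + N - 1) = 0" "dl l M = 0"
      using Suc ok(2) by (auto simp: dl_def m)
    have gg: "gg (Suc p) N = const (of_nat p + 1/2) * g (m + (M + N - 1))"
        "gg (Suc (m + n)) M = const (of_nat (m + n) + 1/2) * g (m + (M + N - 1))" "gg l (M + N - 1) = ?h * g (m + (M + N - 1))"
      by (simp_all only: gg_def m nat.case e)
    have "?h * (const (of_nat p + 1/2) * x - const (of_nat (m + n) + 1/2) * x) = const (of_nat M - of_nat N) * (?h * x)" for x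
      unfolding const_sub_mult const_mult_assoc by (simp add: c n algebra_simps)
    then show ?thesis
      unfolding dls unfolding Suc mN gg unfolding lin_0[OF lin_Lop] by simp
  qed
  then show ?thesis unfolding C SG_def[of "M + N - 1"] by (simp add: distrib_left)
qed

lemma two_r1: "2 * r 1 = ufield"
proof -
  have "2 * r 1 - ufield = 0"
  proof (rule u_poly_kernel)
    show "dx (2 * r 1 - ufield) = 0"
      using two_d1[of ufield] d_u[of 1] by (simp add: lin_diff[OF lin_dt] lin_numeral_mult[OF lin_dt])
    show "u_poly (2 * r 1 - ufield)" unfolding mult_2 by (intro u_poly_closed u_poly_r)
    show "aug (2 * r 1 - ufield) = 0" by (simp add: mult_2 aug_r)
  qed
  then show ?thesis by simp
qed

text \<open>Because u = 2 g_1'' and sigma_n is twice the tau_n-flow of g_1, a derivation that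
  commutes with \<open>dx\<close> and with the odd flows and kills all g_l also kills u and the
  sigma_n.\<close>

theorem virasoro:
  assumes S: "sfl M S" "sfl N S'" "sfl (M + N - 1) S''" and ok: "ok M" "ok (M + N - 1)" "N > 0"
  shows "S' (S a) - S (S' a) = const (of_nat M - of_nat N) * S'' a"
proof -
  let ?c = "const (of_nat M - of_nat N)"
  let ?Z = "\<lambda>a. (S' (S a) - S (S' a)) - ?c * S'' a"
  have okN: "ok N" using ok by simp
  note dx = S_dx[OF S(1) ok(1)] S_dx[OF S(2) okN] S_dx[OF S(3) ok(2)]
  note dtau = dtau_S[OF S(1) ok(1), symmetric] dtau_S[OF S(2) okN, symmetric] dtau_S[OF S(3) ok(2), symmetric]
  have "sder id (\<lambda>a. S' (S a) - S (S' a))" by (rule sder_commutator[OF sder_S[OF S(2)] sder_S[OF S(1)]]) simp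
  moreover have "sder id (\<lambda>a. ?c * S'' a)"
    using sder_S[OF S(3)] unfolding sder_def lin_def
    by (simp add: distrib_left mult.assoc) (metis const_commute const_left_commute mult.assoc)
  ultimately have Z: "sder id ?Z" by (rule sder_diff)
  have tc: "time_continuous ?Z"
    by (rule scont_tc[OF scont_diff[OF scont_diff[OF scont_comp[OF scont_S[OF S(2)] scont_S[OF S(1)]] scont_comp[OF scont_S[OF S(1)] scont_S[OF S(2)]]]
      scont_comp[OF scont_mult_left scont_S[OF S(3)]]]])
  have Zdx: "?Z (dx a) = dx (?Z a)" for a
    unfolding dx lin_diff[OF lin_dt] lin_const_mult[OF lin_dt] ..
  have Zdtau: "?Z (dtau n a) = dtau n (?Z a)" for n a
    unfolding dtau lin_diff[OF lin_dtau] lin_const_mult[OF lin_dtau] ..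
  have Zg: "?Z (g l) = 0" if "l > 0" for l
    unfolding virasoro_g[OF S(1,2) ok(1,3) that] S_gg[OF S(3)] by simp
  have Zf: "?Z (fone k) = 0" for k by (rule fone_zero[OF sder_lin[OF Z] Zg])
  have Zu: "?Z ufield = 0"
    unfolding two_r1[symmetric] dx_g_pos[OF zero_less_one, symmetric] lin_numeral_mult[OF sder_lin[OF Z]] Zdx Zg[OF zero_less_one]
    by (simp add: lin_0[OF lin_dt])
  have Zs: "?Z (sigma n) = 0" for n
    unfolding two_dtau_g1[symmetric] lin_numeral_mult[OF sder_lin[OF Z]] Zdtau Zg[OF zero_less_one]
    by (simp add: lin_0[OF lin_dtau])
  have z: "S 0 = 0" "S' 0 = 0" by (rule lin_0[OF lin_S[OF S(1)]] lin_0[OF lin_S[OF S(2)]])+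
  have "?Z a = 0"
    by (rule der_ext[OF Z _ tc Zdx _ _ Zf Zu Zs]) (simp_all add: S_time[OF S(1)] S_time[OF S(2)] S_time[OF S(3)] S_tau[OF S(1)] S_tau[OF S(2)] S_tau[OF S(3)] z)
  then show ?thesis by simp
qed

subsection \<open>Existence of the Virasoro flows\<close>

lemma dtau_sigma_0: "dtau 0 (sigma 0) = 0"
  using dtau_jet_sigma[of 0 0 0] by (simp add: sigma_tau_def)

text \<open>This is the relation sigma_{k+1}' = P_1 sigma_k linearised along the flow: u varies by
  rho' and sigma_k by the tau_k-derivative of rho. The last summand is the defect inherited from
  \<open>rho_Suc\<close>; it decides for which c_0 the flow exists.\<close>

lemma dtau_Suc_rho:
  assumes "ok M \<or> k = 0"
  shows "2 * dx (dtau (Suc k) (rho M)) = ds.Q (dtau k (rho M)) + 2 * dx (rho M) * dx (sigma k) + dx (dx (rho M)) * sigma k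
    + 2 * dtau k (if M = 0 then const c0 * tau 0 * dx (sigma 0) else 0)"
proof -
  have comm: "a * b = b * a" if "par b = b" for a b using central_even[OF that] by (simp add: central_def)
  have c: "sigma k * dx (rho M) = dx (rho M) * sigma k" "sigma k * rho M = rho M * sigma k"
    "dx (sigma k) * dx (rho M) = dx (rho M) * dx (sigma k)" "dx (dx (sigma k)) * rho M = rho M * dx (dx (sigma k))"
    by (rule comm; simp add: par_rho flip: par_dt)+
  have cond: "c0 = 0 \<or> M > 0 \<or> k = 0" using assms by auto
  have "2 * dx (dtau (Suc k) (rho M)) = dx (2 * dtau k (rho (Suc M)) - ds.br (rho M) (sigma k))"
    unfolding rho_dtau_Suc[OF cond, symmetric] lin_numeral_mult[OF lin_dt] ..
  also have "\<dots> = dtau k (2 * dx (rho (Suc M))) - (rho M * dx (dx (sigma k)) - dx (dx (rho M)) * sigma k)"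
  proof -
    have "dx (ds.br (rho M) (sigma k)) = rho M * dx (dx (sigma k)) - dx (dx (rho M)) * sigma k"
      by (simp add: ds.br_def lin_diff[OF lin_dt] sder_mult[OF sder_dt])
    then show ?thesis
      by (simp only: lin_diff[OF lin_dt] lin_numeral_mult[OF lin_dt] lin_numeral_mult[OF lin_dtau] dtau_dx)
  qed
  also have "2 * dx (rho (Suc M)) = ds.Q (rho M) + 2 * (if M = 0 then const c0 * tau 0 * dx (sigma 0) else 0)"
    unfolding rho_Suc distrib_left PP_Q ..
  also have "dtau k \<dots> = dtau k (ds.Q (rho M)) + 2 * dtau k (if M = 0 then const c0 * tau 0 * dx (sigma 0) else 0)"
    by (simp only: lin_add[OF lin_dtau] lin_numeral_mult[OF lin_dtau])
  also have "dtau k (ds.Q (rho M)) = ds.Q (dtau k (rho M)) + 2 * dx (rho M) * dx (sigma k) + dx (dx (sigma k)) * rho M"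
  proof -
    have "par ufield = ufield" "par (dx ufield) = dx ufield" "par 2 = 2" "dtau k 2 = 0" "dtau k kap = 0"
      using par_const[of 2] sder_const[OF sder_dtau, of k] const_numeral[of "num.Bit0 num.One"] by (simp_all flip: par_dt) metis
    then have "dtau k (ds.Q (rho M)) = ds.Q (dtau k (rho M)) + 2 * (dx (sigma k) * dx (rho M)) + dx (dx (sigma k)) * rho M"
      unfolding ds.Q_def by (simp add: lin_add[OF lin_dtau] lin_numeral_mult[OF lin_dtau] lin_const_mult[OF lin_dtau]
          sder_mult[OF sder_dtau] dtau_dx dtau_u mult.assoc distrib_left)
    then show ?thesis by (simp add: c mult.assoc)
  qed
  finally show ?thesis by (simp add: c algebra_simps)
qed

lemma derivation_PP:
  assumes S: "sder id S" "S ufield = dx h" "S (dx ufield) = dx (dx h)"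
    and a: "S a = b" "S (dx a) = dx b" "S (dx (dx (dx a))) = dx (dx (dx b))"
  shows "2 * S (PP a) = ds.Q b + 2 * dx h * dx a + dx (dx h) * a"
proof -
  have "2 * S (PP a) = S (ds.Q a)" unfolding PP_Q[symmetric] lin_numeral_mult[OF sder_lin[OF S(1)]] ..
  also have "\<dots> = ds.Q b + 2 * dx h * dx a + dx (dx h) * a"
    using sder_const[OF S(1), of 2] unfolding ds.Q_def
    by (simp add: sder_const[OF S(1)] const_numeral lin_add[OF sder_lin[OF S(1)]] lin_numeral_mult[OF sder_lin[OF S(1)]] lin_const_mult[OF sder_lin[OF S(1)]]
      sder_mult[OF S(1)] S(2,3) a mult.assoc distrib_left)
  finally show ?thesis .
qed

text \<open>The values on the free generators can be prescribed at will. What needs proof is that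
  the flow respects the value of \<open>dx\<close> on each \<open>Sig k\<close>, which is
  \<open>dtau_Suc_rho\<close>; induction on k first provides all jets of sigma_k.\<close>

theorem sfl_exists:
  assumes ok: "ok M"
  shows "\<exists>S. sfl M S"
proof -
  let ?v = "\<lambda>x. case x of T k \<Rightarrow> 0 | U j \<Rightarrow> (dx ^^ j) (dx (rho M)) | F n \<Rightarrow> const (1 / (eps * cf (Suc n))) * Sg M (Suc n)"
  let ?w = "\<lambda>y. case y of Tau k \<Rightarrow> 0 | Th j \<Rightarrow> (dx ^^ j) (dtau 0 (rho M)) | Sig k \<Rightarrow> dtau (Suc k) (rho M)"
  let ?S = "derv ?v ?w"
  have pdx: "par ((dx ^^ j) a) = (dx ^^ j) (par a)" for j a by (induction j) (simp_all add: par_dt[symmetric])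
  have pw: "par (dtau k (rho M)) = - dtau k (rho M)" for k
    using par_dtau[of k "rho M"] unfolding par_rho by (metis minus_minus)
  have Sg: "par (Sg M n) = Sg M n" for n by (rule par_Sg)
  have S: "even_derivation ?S"
    by (rule even_derivation_derv)
      (auto simp: lin_0[OF lin_par] lin_const_mult[OF lin_par] pdx pw Sg lin_uminus[OF lin_funpow[OF lin_dt]] par_dt[symmetric] par_rho split: evar.split ovar.split)
  then have sder: "sder id ?S" by (auto simp: even_derivation_iff)
  note lin = sder_lin[OF sder]
  have u: "?S ((dx ^^ j) ufield) = (dx ^^ j) (dx (rho M))" for j
    unfolding dx_pow_u by (simp add: derv_gen)
  have u': "?S ufield = dx (rho M)" "?S (dx ufield) = dx (dx (rho M))" using u[of 0] u[of 1] by simp_all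
  have s0: "?S (sigma k) = dtau k (rho M)" for k
    by (cases k) (simp_all add: sigma.simps derv_gen)
  let ?C = "\<lambda>a. ?S (dx a) - dx (?S a)"
  let ?V = "\<lambda>a. ?C a = 0"
  have C: "sder id ?C" by (rule sder_commutator[OF sder sder_dt]) simp
  have V: "subalg ?V" by (rule subalg_ker[OF C]) simp
  have VU: "?V (even_gen (U j))" for j
    using u[of j] u[of "Suc j"] unfolding funpow.simps o_apply dx_pow_u by simp
  have VTh: "?V (odd_gen (Th j))" for j
  proof -
    have "?S ((dx ^^ j) (sigma 0)) = (dx ^^ j) (dtau 0 (rho M))" for j
      unfolding dx_pow_sigma0 by (simp add: derv_gen)
    from this[of j] this[of "Suc j"] show ?thesis unfolding funpow.simps o_apply dx_pow_sigma0 by simp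
  qed
  have step: "?S ((dx ^^ j) (sigma k)) = (dx ^^ j) (dtau k (rho M))" if "\<And>i. i < k \<Longrightarrow> ?V (odd_gen (Sig i))" for j k
  proof (induction j)
    case (Suc j)
    have "?V ((dx ^^ j) (sigma k))" using jets_sigma[OF V VU VTh that] unfolding jets_def by blast
    then show ?case using Suc by simp
  qed (simp add: s0)
  have VSig: "?V (odd_gen (Sig k))" for k
  proof (induction k rule: less_induct)
    case (less k)
    have st: "?S ((dx ^^ j) (sigma k)) = (dx ^^ j) (dtau k (rho M))" for j by (rule step) (rule less)
    have "2 * ?S (PP (sigma k)) = ds.Q (dtau k (rho M)) + 2 * dx (rho M) * dx (sigma k) + dx (dx (rho M)) * sigma k"
      by (rule derivation_PP[OF sder u' s0]) (use st[of 1] st[of 3] in \<open>simp_all add: numeral_3_eq_3\<close>)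
    also have "\<dots> = 2 * dx (dtau (Suc k) (rho M))"
      using dtau_Suc_rho[of M k] ok by (auto simp: lin_0[OF lin_dtau])
    finally have "?S (dx (sigma (Suc k))) = dx (?S (sigma (Suc k)))"
      unfolding dx_sigma s0 by (rule two_cancel)
    then show ?case by (simp add: sigma.simps)
  qed
  have "sfl M ?S"
    unfolding sfl_def
  proof (intro conjI allI impI S u)
    show "?S ((dx ^^ j) (sigma n)) = (dx ^^ j) (dtau n (rho M))" for j n by (rule step[OF VSig])
    show "?S (g n) = Sg M n" if "n > 0" for n
      using that eps by (cases n) (simp_all add: g_Suc lin_const_mult[OF lin] derv_gen const_mult_assoc)
  qed (simp_all add: derv_gen)
  then show ?thesis by blast
qed

text \<open>For M = 0 the flow applied to sigma_1' = P_1 sigma_0 can be compared with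
  \<open>dtau_Suc_rho\<close> at k = 0. The difference is the tau_0-derivative of c_0 tau_0
  sigma_0', that is c_0 sigma_0', since the tau_0-flow of sigma_0 is zero.\<close>

lemma sfl_ok:
  assumes S: "sfl M S"
  shows "ok M"
proof (cases M)
  case 0
  have s: "S ((dx ^^ j) (sigma n)) = (dx ^^ j) (dtau n (rho 0))" for j n
    using S_jet_sigma[OF S] 0 by simp
  have "2 * S (PP (sigma 0)) = ds.Q (dtau 0 (rho 0)) + 2 * dx (rho 0) * dx (sigma 0) + dx (dx (rho 0)) * sigma 0"
    by (rule derivation_PP[OF sder_S[OF S]])
      (use S_jet_u[OF S, of 0] S_jet_u[OF S, of 1] s[of 0 0] s[of 1 0] s[of 3 0] 0 in \<open>simp_all add: numeral_3_eq_3\<close>)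
  moreover have "S (PP (sigma 0)) = dx (dtau (Suc 0) (rho 0))" using s[of 1 "Suc 0"] by (simp add: dx_sigma)
  ultimately have "2 * dtau 0 (const c0 * tau 0 * dx (sigma 0)) = 2 * 0"
    using dtau_Suc_rho[of 0 0] by simp
  then have "dtau 0 (const c0 * tau 0 * dx (sigma 0)) = 0" by (rule two_cancel)
  then have "const c0 * odd_gen (Th 1) = 0"
    using dx_pow_sigma0[of 1]
    by (simp add: sder_mult[OF sder_dtau] sder_const[OF sder_dtau] dtau_tau dtau_dx dtau_sigma_0 lin_0[OF lin_dt])
  then have "coeff (const c0 * odd_gen (Th 1)) ({#}, {|Th 1|}) = 0" by (simp add: coeff_zero)
  then have "c0 = 0" unfolding coeff_const_mult odd_gen_mon coeff_mon by simp
  then show ?thesis by simp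
qed simp

section \<open>Translation to the flows in the original variables\<close>

lemma sum_pairs:
  fixes h :: "nat \<Rightarrow> nat \<Rightarrow> salg"
  assumes "\<And>j. h 0 j = 0" "\<And>i. h i 0 = 0"
  shows "(\<Sum>k\<le>Suc m. h k (Suc m - k)) = (\<Sum>(k, l) | k + l + 1 = m. h (Suc k) (Suc l))"
proof -
  have "(\<Sum>(k, l) | k + l + 1 = m. h (Suc k) (Suc l)) = (\<Sum>k<m. h (Suc k) (Suc m - Suc k))"
    by (rule sum.reindex_bij_witness[where i = "\<lambda>k. (k, m - 1 - k)" and j = fst]) (auto simp: Suc_diff_le)
  then show ?thesis
    by (subst sum.atMost_shift) (simp add: assms lessThan_Suc)
qed

lemma const_mult_terms: "const a * b * (const c * x) = const (a * c) * (b * x)"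
  by (metis const_commute const_mult mult.assoc)

lemma Sg_f_s: "Sg (Suc m) (Suc n) = const (eps * cf (Suc n)) * f_s eps c0 dt dtau m n"
proof -
  let ?c = "const (eps * cf (Suc n))"
  let ?G = "\<lambda>k l. const (Gamma (of_nat k + 3/2) * Gamma (of_nat l + 3/2) / (Gamma (1/2) * Gamma (1/2)))"
  have G: "?G k l = const (cf (Suc k) * cf (Suc l))" for k l
    unfolding Gamma_cf_Suc using Gamma_half_nz[of 0] by simp
  note lins = lin_const_mult[OF lin_d]
  have 1: "(\<Sum>k\<le>Suc m. d k (d (Suc m - k) (g (Suc n)))) = ?c * (\<Sum>(k, l) | k + l + 1 = m. ?G k l * dt k (dt l (fone n)))"
  proof -
    have "(\<Sum>k\<le>Suc m. d k (d (Suc m - k) (fone n))) = (\<Sum>(k, l) | k + l + 1 = m. d (Suc k) (d (Suc l) (fone n)))"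
      by (rule sum_pairs) (simp_all add: d_0 lin_0[OF lin_d])
    also have "\<dots> = (\<Sum>(k, l) | k + l + 1 = m. ?G k l * dt k (dt l (fone n)))"
      unfolding G by (simp add: d_Suc lin_const_mult[OF lin_dt] const_mult_assoc)
    finally show ?thesis by (simp only: g_Suc lins sum_distrib_left[symmetric])
  qed
  have 2: "(\<Sum>k\<le>Suc m. d k (g (Suc n)) * g (Suc m - k)) = ?c * (const eps * (\<Sum>(k, l) | k + l + 1 = m. ?G k l * dt k (fone n) * fone l))"
  proof -
    have "(\<Sum>k\<le>Suc m. d k (fone n) * g (Suc m - k)) = (\<Sum>(k, l) | k + l + 1 = m. d (Suc k) (fone n) * g (Suc l))"
      by (rule sum_pairs) (simp_all add: d_0 g_0)
    also have "\<dots> = (\<Sum>(k, l) | k + l + 1 = m. const eps * (?G k l * dt k (fone n) * fone l))"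
    proof -
      have "d (Suc k) (fone n) * g (Suc l) = const eps * (const (cf (Suc k) * cf (Suc l)) * dt k (fone n) * fone l)" for k l
        unfolding d_Suc g_Suc const_mult_terms by (simp add: const_mult_assoc mult.assoc mult.left_commute)
      then show ?thesis unfolding G by simp
    qed
    also have "\<dots> = const eps * (\<Sum>(k, l) | k + l + 1 = m. ?G k l * dt k (fone n) * fone l)"
      by (simp add: sum_distrib_left case_prod_unfold)
    finally show ?thesis by (simp only: g_Suc lins mult.assoc sum_distrib_left[symmetric])
  qed
  have 3: "const (of_nat (Suc n) - 1/2) * g (Suc n + Suc m - 1) = ?c * (const (Gamma (of_nat (n + m) + 3/2) / Gamma (of_nat n + 1/2)) * fone (n + m))"
  proof -
    have "Gamma (of_nat (n + m) + 3/2) / Gamma (of_nat n + 1/2) = cf (Suc (n + m)) / cf n"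
      unfolding Gamma_cf_Suc Gamma_cf using Gamma_half_nz[of 0] by simp
    moreover have "(of_nat (Suc n) - 1/2) * (eps * cf (Suc (n + m))) = eps * cf (Suc n) * (cf (Suc (n + m)) / cf n)"
      using cf_nz[of n] by (simp add: cf_Suc[of n] field_simps)
    ultimately show ?thesis by (simp add: g_Suc const_mult_assoc)
  qed
  have 4: "EE (Suc m) (g (Suc n)) = ?c * (lsum (\<lambda>k. const (Gamma (of_nat (k + m) + 3/2) / Gamma (of_nat k + 1/2)) * time k * dt (k + m) (fone n))
      + lsum (\<lambda>k. const (of_nat k + c0) * tau k * dtau (k + m) (fone n)))"
  proof -
    have "const (1 / cf k) * time k * d (k + Suc m) (fone n) = const (Gamma (of_nat (k + m) + 3/2) / Gamma (of_nat k + 1/2)) * time k * dt (k + m) (fone n)" for k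
    proof -
      have "Gamma (of_nat (k + m) + 3/2) / Gamma (of_nat k + 1/2) = 1 / cf k * cf (Suc (k + m))"
        unfolding Gamma_cf_Suc Gamma_cf using Gamma_half_nz[of 0] by simp
      then show ?thesis unfolding add_Suc_right d_Suc const_mult_terms by (simp only: mult.assoc)
    qed
    then have "EE (Suc m) (fone n) = lsum (\<lambda>k. const (Gamma (of_nat (k + m) + 3/2) / Gamma (of_nat k + 1/2)) * time k * dt (k + m) (fone n))
      + lsum (\<lambda>k. const (of_nat k + c0) * tau k * dtau (k + m) (fone n))"
      by (simp only: EE_def LL_def add_Suc_right e_simps)
    then show ?thesis by (simp only: g_Suc lin_const_mult[OF sder_lin[OF sder_EE]])
  qed
  show ?thesis
    unfolding Sg_def f_s_def 1 2 3 4 distrib_left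
    by (simp add: const_mult_assoc mult.commute add.assoc)
qed

lemma Sg_f_s_minus1: "Sg 0 (Suc n) = const (eps * cf (Suc n)) * f_s_minus1 eps c0 dt dtau n"
proof -
  let ?c = "const (eps * cf (Suc n))"
  have 1: "const (of_nat (Suc n) - 1/2) * g n + (if n = 0 then const (1/2) * time 0 else 0)
    = ?c * (if n = 0 then const (1 / eps) * time 0 else fone (n - 1))"
    using eps by (cases n) (simp_all add: g_0 g_Suc const_mult_assoc cf_Suc[of 0] cf_Suc[of "Suc _"] algebra_simps)
  have 2: "EE 0 (fone n) = lsum (\<lambda>k. time (k + 1) * dt k (fone n)) + lsum (\<lambda>k. const (of_nat k + 1 + c0) * tau (k + 1) * dtau k (fone n))"
  proof -
    have "const (1 / cf (Suc k)) * time (Suc k) * d (Suc k) (fone n) = time (k + 1) * dt k (fone n)" for k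
      by (simp add: d_Suc const_mult_terms)
    then show ?thesis
      unfolding EE_def LL_def lsum_Suc[OF ssum_time] lsum_Suc[OF ssum_tau] by (simp add: d_0 add.commute)
  qed
  show ?thesis
    unfolding f_s_minus1_def distrib_left 1[symmetric] add.assoc 2[symmetric] using 2
    by (simp add: Sg_def d_0 g_0 g_Suc lin_const_mult[OF sder_lin[OF sder_EE]] add_ac distrib_left)
qed

lemma s_flow_iff:
  assumes m: "m \<ge> -1"
  shows "s_flow eps c0 dt dtau m S \<longleftrightarrow> sfl (nat (m + 1)) S"
proof -
  let ?M = "nat (m + 1)"
  let ?f = "\<lambda>n. if m = -1 then f_s_minus1 eps c0 dt dtau n else f_s eps c0 dt dtau (nat m) n"
  have f: "Sg ?M (Suc n) = const (eps * cf (Suc n)) * ?f n" for n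
  proof (cases "m = -1")
    case False
    then have "?M = Suc (nat m)" using m by simp
    then show ?thesis using False by (simp add: Sg_f_s)
  qed (simp add: Sg_f_s_minus1)
  have rho: "const eps * ?f 0 = rho ?M"
  proof -
    have "rho ?M = const 2 * (const (eps * cf 1) * ?f 0)"
      unfolding rho_Sg[symmetric] const_numeral using f[of 0] by simp
    then show ?thesis by (simp only: const_mult_assoc) (simp add: cf_Suc[of 0] field_simps)
  qed
  have gens: "(\<forall>n. S (fone n) = ?f n) \<longleftrightarrow> (\<forall>n>0. S (g n) = Sg ?M n)" if "even_derivation S"
  proof -
    have lin: "lin S" using that by (auto simp: even_derivation_iff sder_lin)
    have "eps * cf (Suc n) \<noteq> 0" for n using eps by simp
    then have "S (fone n) = ?f n \<longleftrightarrow> S (g (Suc n)) = Sg ?M (Suc n)" for n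
      unfolding f g_Suc lin_const_mult[OF lin] by (auto dest: const_cancel[rotated])
    then show ?thesis by (metis gr0_implies_Suc zero_less_Suc)
  qed
  have "const eps * dx (?f 0) = dx (rho ?M)" "const eps * dtau n (?f 0) = dtau n (rho ?M)" for n
    unfolding rho[symmetric] lin_const_mult[OF lin_dt] lin_const_mult[OF lin_dtau] by simp_all
  then show ?thesis
    unfolding s_flow_def sfl_def Let_def using gens by (smt (verit))
qed

end

theorem theorem5p11:
  fixes eps c0 :: complex
    and R :: "nat \<Rightarrow> salg" and Om Ph :: "nat \<Rightarrow> nat \<Rightarrow> salg"
    and dt dtau :: "nat \<Rightarrow> salg \<Rightarrow> salg"
  assumes "eps \<noteq> 0" and "super_tau_cover eps R Om Ph dt dtau"
  shows
    "(\<forall>m. -1 \<le> m \<and> (0 \<le> m \<or> c0 = 0) \<longrightarrow> (\<exists>S. s_flow eps c0 dt dtau m S)) \<and>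
     (\<forall>m k S a. -1 \<le> m \<and> s_flow eps c0 dt dtau m S \<longrightarrow>
        commutator (dt k) S a = 0 \<and> commutator (dtau k) S a = 0) \<and>
     (\<forall>m n S a. -1 \<le> m \<and> -1 \<le> n \<and>
        (\<forall>j\<in>{m, n, n + m}. -1 \<le> j \<longrightarrow> s_flow eps c0 dt dtau j (S j)) \<longrightarrow>
        commutator (S n) (S m) a = const (of_int (m - n)) * S (n + m) a)"
proof -
  interpret tau_cover eps c0 R Om Ph dt dtau using assms by unfold_locales
  show ?thesis
  proof (intro conjI allI impI; (elim conjE)?)
    fix m :: int
    assume m: "-1 \<le> m" "0 \<le> m \<or> c0 = 0"
    then have "c0 = 0 \<or> nat (m + 1) > 0" by auto
    then show "\<exists>S. s_flow eps c0 dt dtau m S" unfolding s_flow_iff[OF m(1)] by (rule sfl_exists)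
  next
    fix m :: int and k S a
    assume m: "-1 \<le> m" and "s_flow eps c0 dt dtau m S"
    then have S: "sfl (nat (m + 1)) S" by (simp add: s_flow_iff)
    have "const (cf (Suc k)) * dt k (S a) = const (cf (Suc k)) * S (dt k a)"
      using d_S[OF S sfl_ok[OF S], of "Suc k" a] by (simp add: d_Suc lin_const_mult[OF lin_S[OF S]])
    then show "commutator (dt k) S a = 0" unfolding commutator_def using const_cancel[OF cf_nz] by simp
    show "commutator (dtau k) S a = 0" unfolding commutator_def using dtau_S[OF S sfl_ok[OF S]] by simp
  next
    fix m n :: int and S a
    assume mn: "-1 \<le> m" "-1 \<le> n" and flow: "\<forall>j\<in>{m, n, n + m}. -1 \<le> j \<longrightarrow> s_flow eps c0 dt dtau j (S j)"
    then have S: "sfl (nat (m + 1)) (S m)" "sfl (nat (n + 1)) (S n)" "-1 \<le> n + m \<Longrightarrow> sfl (nat (n + m + 1)) (S (n + m))"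
      by (simp_all flip: s_flow_iff)
    \<comment> \<open>\<open>virasoro\<close> asks that one of the two flows be different from
      s_{-1}; for q >= 0 this is the second one, and the sum of the indices is at least -1.\<close>
    have V: "S q (S p a) - S p (S q a) = const (of_int (p - q)) * S (q + p) a"
      if p: "-1 \<le> p" and q: "0 \<le> q" and S: "sfl (nat (p + 1)) (S p)" "sfl (nat (q + 1)) (S q)" "sfl (nat (q + p + 1)) (S (q + p))" for p q
    proof -
      have "nat (q + p + 1) = nat (p + 1) + nat (q + 1) - 1" using p q by (simp add: nat_eq_iff nat_diff_distrib' flip: nat_add_distrib)
      then have "S q (S p a) - S p (S q a) = const (of_nat (nat (p + 1)) - of_nat (nat (q + 1))) * S (q + p) a"
        using S q by (intro virasoro sfl_ok) simp_all
      moreover have "of_nat (nat (p + 1)) - of_nat (nat (q + 1)) = (of_int (p - q) :: complex)" using p q by simp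
      ultimately show ?thesis by (simp only:)
    qed
    consider "0 \<le> n" | "0 \<le> m" | "m = -1" "n = -1" using mn by linarith
    then show "commutator (S n) (S m) a = const (of_int (m - n)) * S (n + m) a"
    proof cases
      case 1
      then show ?thesis unfolding commutator_def using V[OF mn(1) _ S(1,2)] S(3) mn by simp
    next
      case 2
      have "S m (S n a) - S n (S m a) = const (of_int (n - m)) * S (m + n) a"
        by (rule V[OF mn(2) 2 S(2,1)]) (use S(3) mn 2 in \<open>simp add: add.commute\<close>)
      moreover have "const (of_int (m - n)) = - const (of_int (n - m))" by (simp flip: const_uminus)
      ultimately show ?thesis unfolding commutator_def by (simp add: add.commute algebra_simps)
    next
      \<comment> \<open>Both flows are s_{-1}, so the factor m - n is 0 and the value of S at -2,
        about which nothing is assumed, drops out.\<close>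
      case 3
      then show ?thesis by (simp add: commutator_def)
    qed
  qed
qed

end
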